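(* As a representation of $\mathfrak{sl}(4,\mathbb C)$ (via $\pi_l^0$), $\mathcal D^0_{\mathbb M}$ is the minimal representation of $SO(3,3)\simeq SL(2,\mathbb H_{\mathbb R})/\{\pm1\}$ (i.e. it is isomorphic to the underlying Harish-Chandra module, as a module over $\mathfrak{so}(6,\mathbb C)\simeq\mathfrak{sl}(4,\mathbb C)$, of that representation). In particular, $\mathcal D^0_{\mathbb M}$ is irreducible.
   Context: $\mathbb H_{\mathbb C}$ is the algebra of complex $2\times2$ matrices, $N(Z)=\det Z$. Minkowski space is $$\mathbb M=\left\{Y=\begin{pmatrix}-it-ix^3&-ix^1-x^2\\-ix^1+x^2&-it+ix^3\end{pmatrix}: t,x^1,x^2,x^3\in\mathbb R\right\}\subset\mathbb H_{\mathbb C},$$ so $N(Y)=r^2-t^2$ with $r=\sqrt{(x^1)^2+(x^2)^2+(x^3)^2}$; $\mathbb M^+=\{Y\in\mathbb M:N(Y)>0\}$. Spherical coordinates: $x^1=r\sin\theta\cos\varphi$, $x^2=r\sin\theta\sin\varphi$, $x^3=r\cos\theta$. For integers $l\ge0$, $-l\le m\le l$: $P_l^{(m)}(x)=\frac{(-1)^{l+m}}{2^ll!}(1-x^2)^{m/2}\frac{d^{l+m}}{dx^{l+m}}(1-x^2)^l$ and $Y_l^m(\theta,\varphi)=(-i)^m\sqrt{\frac{(l-m)!}{(l+m)!}}\,P_l^{(m)}(\cos\theta)e^{-im\varphi}$. $\mathcal D^0_{\mathbb M}$ is the $\mathbb C$-linear span of the functions on $\mathbb M^+$ $$f^\pm_{l,m,n}(Y)=\sqrt{\tfrac{(2l+1)(l-n)!}{(l+n)!}}\;r^{-1}(r^2-t^2)^{\pm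 n/2}P_l^{(n)}(t/r)\,Y_l^m(\theta,\varphi),\quad l\ge0,\ -l\le m\le l,\ 0\le n\le l.$$ $GL(2,\mathbb H_{\mathbb C})=GL(4,\mathbb C)$ acts on functions of $Z\in\mathbb H_{\mathbb C}$ by $(\pi_l^0(h)\phi)(Z)=\frac1{N(cZ+d)}\phi\bigl((aZ+b)(cZ+d)^{-1}\bigr)$, $h^{-1}=\begin{pmatrix}a&b\\c&d\end{pmatrix}$. Differentiating yields first-order holomorphic differential operators, hence an action of $\mathfrak{gl}(4,\mathbb C)\supset\mathfrak{sl}(4,\mathbb C)$ on real-analytic functions on $\mathbb M^+$ (by holomorphic extension to a neighborhood in $\mathbb H_{\mathbb C}$); $\mathcal D^0_{\mathbb M}$ is stable under $\mathfrak{sl}(4,\mathbb C)$. The minimal representation meant here is the representation $(\varpi^{3,3},V^{3,3})$ of $O(3,3)$ of Kobayashi and Ørsted, also denoted $(\varpi^{\min}_{\mathbb R^{2,2}},\mathcal H)$ in its flat model on $\mathbb R^{2,2}$: let $\Xi=\{(x,y)\in\mathbb R^3\times\mathbb R^3:|x|=|y|\ne0\}$; $V^{3,3}$ is the space of smooth functions on $\Xi$, homogeneous of degree $-1$ under positive dilations, whose restriction $F$ to $S^2\times S^2$ satisfies $(\Delta_{S^2}\otimes1-1\otimes\Delta_{S^2})F=0$, with $O(3,3)$ acting by $(gF)(\xi)=F(g^{-1}\xi)$. Equivalently, in the flat model it is the representation on solutions of the ultrahyperbolic equation on $\mathbb H_{\mathbb R}=\{X: x_{22}=\overline{x_{11}},x_{21}=\overline{x_{12}}\}\cong\mathbb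 R^{2,2}$ generated by $\phi_0(X)=\bigl((1+N(X))^2+4x_{12}x_{21}\bigr)^{-1/2}$ under $\pi_l^0$ of $SL(2,\mathbb H_{\mathbb R})\simeq SL(4,\mathbb R)$. Its Harish-Chandra module is the space of $SO(3)\times SO(3)$-finite vectors with the action of the complexified Lie algebra. *)

theory Defs
  imports "HOL-Analysis.Analysis" "HOL-Library.Function_Algebras"
begin

section \<open>Spaces of complex-valued functions\<close>

definition fscale :: "complex \<Rightarrow> ('a \<Rightarrow> complex) \<Rightarrow> 'a \<Rightarrow> complex" where
  "fscale c f = (\<lambda>x. c * f x)"

global_interpretation fn: vector_space fscale
  by unfold_locales (auto simp: fscale_def algebra_simps)

section \<open>Matrix Lie algebras and their modules\<close>

definition mscale :: "'a::times \<Rightarrow> 'a ^ 'n ^ 'm \<Rightarrow> 'a ^ 'n ^ 'm" where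
  "mscale c X = (\<chi> i j. c * X $ i $ j)"

definition bracket :: "'a::ring_1 ^ 'n ^ 'n \<Rightarrow> 'a ^ 'n ^ 'n \<Rightarrow> 'a ^ 'n ^ 'n" where
  "bracket X Y = X ** Y - Y ** X"

definition mexp :: "'a::real_normed_algebra_1 ^ 'n ^ 'n \<Rightarrow> 'a ^ 'n ^ 'n" where
  "mexp A = (\<Sum>k. (1 / fact k) *\<^sub>R (((**) A) ^^ k) (mat 1))"

definition lie_iso ::
  "(complex ^ 'n ^ 'n) set \<Rightarrow> (complex ^ 'm ^ 'm) set \<Rightarrow> (complex ^ 'n ^ 'n \<Rightarrow> complex ^ 'm ^ 'm) \<Rightarrow> bool" where
  "lie_iso g h \<sigma> \<longleftrightarrow>
     bij_betw \<sigma> g h \<and>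
     (\<forall>X\<in>g. \<forall>Y\<in>g. \<sigma> (X + Y) = \<sigma> X + \<sigma> Y) \<and>
     (\<forall>c. \<forall>X\<in>g. \<sigma> (mscale c X) = mscale c (\<sigma> X)) \<and>
     (\<forall>X\<in>g. \<forall>Y\<in>g. \<sigma> (bracket X Y) = bracket (\<sigma> X) (\<sigma> Y))"

text \<open>The action \<open>\<rho>\<close> is only required to be well behaved on the space \<open>V\<close>.\<close>

definition lie_module ::
  "(complex ^ 'n ^ 'n) set \<Rightarrow> ('x \<Rightarrow> complex) set \<Rightarrow>
   (complex ^ 'n ^ 'n \<Rightarrow> ('x \<Rightarrow> complex) \<Rightarrow> ('x \<Rightarrow> complex)) \<Rightarrow> bool" where
  "lie_module g V \<rho> \<longleftrightarrow>
     fn.subspace V \<and>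
     (\<forall>X\<in>g. \<forall>v\<in>V. \<rho> X v \<in> V) \<and>
     (\<forall>X\<in>g. \<forall>u\<in>V. \<forall>v\<in>V. \<rho> X (u + v) = \<rho> X u + \<rho> X v) \<and>
     (\<forall>X\<in>g. \<forall>c. \<forall>v\<in>V. \<rho> X (fscale c v) = fscale c (\<rho> X v)) \<and>
     (\<forall>X\<in>g. \<forall>Y\<in>g. \<forall>v\<in>V. \<rho> (X + Y) v = \<rho> X v + \<rho> Y v) \<and>
     (\<forall>X\<in>g. \<forall>c. \<forall>v\<in>V. \<rho> (mscale c X) v = fscale c (\<rho> X v)) \<and>
     (\<forall>X\<in>g. \<forall>Y\<in>g. \<forall>v\<in>V. \<rho> (bracket X Y) v = \<rho> X (\<rho> Y v) - \<rho> Y (\<rho> X v))"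

definition irreducible_module ::
  "(complex ^ 'n ^ 'n) set \<Rightarrow> ('x \<Rightarrow> complex) set \<Rightarrow>
   (complex ^ 'n ^ 'n \<Rightarrow> ('x \<Rightarrow> complex) \<Rightarrow> ('x \<Rightarrow> complex)) \<Rightarrow> bool" where
  "irreducible_module g V \<rho> \<longleftrightarrow>
     V \<noteq> {0} \<and>
     (\<forall>W. fn.subspace W \<and> W \<subseteq> V \<and> (\<forall>X\<in>g. \<forall>w\<in>W. \<rho> X w \<in> W) \<longrightarrow> W = {0} \<or> W = V)"

text \<open>\<open>\<Phi>\<close> is an isomorphism from the \<open>g\<close>-module \<open>V\<close> to the \<open>h\<close>-module \<open>W\<close>,
  the latter being regarded as a \<open>g\<close>-module through \<open>\<sigma>\<close>.\<close>

definition module_iso ::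
  "(complex ^ 'n ^ 'n) set \<Rightarrow> (complex ^ 'n ^ 'n \<Rightarrow> complex ^ 'm ^ 'm) \<Rightarrow>
   ('x \<Rightarrow> complex) set \<Rightarrow> (complex ^ 'n ^ 'n \<Rightarrow> ('x \<Rightarrow> complex) \<Rightarrow> ('x \<Rightarrow> complex)) \<Rightarrow>
   ('y \<Rightarrow> complex) set \<Rightarrow> (complex ^ 'm ^ 'm \<Rightarrow> ('y \<Rightarrow> complex) \<Rightarrow> ('y \<Rightarrow> complex)) \<Rightarrow>
   (('x \<Rightarrow> complex) \<Rightarrow> ('y \<Rightarrow> complex)) \<Rightarrow> bool" where
  "module_iso g \<sigma> V \<rho> W \<rho>' \<Phi> \<longleftrightarrow>
     bij_betw \<Phi> V W \<and>
     (\<forall>u\<in>V. \<forall>v\<in>V. \<Phi> (u + v) = \<Phi> u + \<Phi> v) \<and>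
     (\<forall>c. \<forall>v\<in>V. \<Phi> (fscale c v) = fscale c (\<Phi> v)) \<and>
     (\<forall>X\<in>g. \<forall>v\<in>V. \<Phi> (\<rho> X v) = \<rho>' (\<sigma> X) (\<Phi> v))"

section \<open>Minkowski space and the space \<open>D\<^sup>0\<close>\<close>

text \<open>A point is given by its coordinates \<open>(t, (x\<^sup>1, x\<^sup>2, x\<^sup>3))\<close>.\<close>

definition mink :: "real \<times> (real ^ 3) \<Rightarrow> complex ^ 2 ^ 2" where
  "mink p = (let t = complex_of_real (fst p); x1 = complex_of_real (snd p $ 1);
                 x2 = complex_of_real (snd p $ 2); x3 = complex_of_real (snd p $ 3)
             in vector [vector [- \<i> * t - \<i> * x3, - \<i> * x1 - x2],
                        vector [- \<i> * x1 + x2, - \<i> * t + \<i> * x3]])"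

definition minkowski :: "(complex ^ 2 ^ 2) set" where
  "minkowski = range mink"

text \<open>The determinant is real on Minkowski space.\<close>

definition mink_plus :: "(complex ^ 2 ^ 2) set" where
  "mink_plus = {Y \<in> minkowski. 0 < Re (det Y)}"

text \<open>The integer power of the square root stands for \<open>(1 - x\<^sup>2)\<^sup>m\<^sup>/\<^sup>2\<close>; unlike \<open>powr\<close> it
  gives \<open>1\<close> for \<open>m = 0\<close> also at \<open>x = \<plusminus>1\<close>. For \<open>m < 0\<close> and \<open>x = \<plusminus>1\<close> it gives \<open>0\<close>, so that
  the product is \<open>0\<close>, which is the limit value.\<close>

definition legendreP :: "nat \<Rightarrow> int \<Rightarrow> real \<Rightarrow> real" where
  "legendreP l m x =
     (- 1) ^ nat (int l + m) / (2 ^ l * fact l) * (sqrt (1 - x\<^sup>2) powi m)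
     * (deriv ^^ nat (int l + m)) (\<lambda>u. (1 - u\<^sup>2) ^ l) x"

definition sph_harm :: "nat \<Rightarrow> int \<Rightarrow> real \<Rightarrow> real \<Rightarrow> complex" where
  "sph_harm l m \<theta> \<phi> =
     (- \<i>) powi m * of_real (sqrt (fact (nat (int l - m)) / fact (nat (int l + m))))
     * of_real (legendreP l m (cos \<theta>)) * exp (- \<i> * of_int m * of_real \<phi>)"

text \<open>The functions \<open>f\<^sup>\<plusminus>\<close> (with \<open>s = \<plusminus>1\<close>), extended by \<open>0\<close> outside \<open>mink_plus\<close>. The spherical
  coordinates of \<open>x \<noteq> 0\<close> are taken to be \<open>\<theta> = arccos (x\<^sup>3 / r)\<close> and \<open>\<phi> = Arg (x\<^sup>1 + i x\<^sup>2)\<close>.\<close>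

definition mink_fn :: "real \<Rightarrow> nat \<Rightarrow> int \<Rightarrow> nat \<Rightarrow> complex ^ 2 ^ 2 \<Rightarrow> complex" where
  "mink_fn s l m n Y =
     (if Y \<in> mink_plus then
        (let (t, x) = inv mink Y; r = norm x in
         of_real (sqrt ((2 * real l + 1) * fact (l - n) / fact (l + n))
                  * (1 / r) * (r\<^sup>2 - t\<^sup>2) powr (s * real n / 2) * legendreP l (int n) (t / r))
         * sph_harm l m (arccos (x $ 3 / r)) (Arg (Complex (x $ 1) (x $ 2))))
      else 0)"

definition D0M :: "(complex ^ 2 ^ 2 \<Rightarrow> complex) set" where
  "D0M = fn.span {mink_fn s l m n | s l m n.
                    (s = 1 \<or> s = - 1) \<and> - int l \<le> m \<and> m \<le> int l \<and> n \<le> l}"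

section \<open>The action of \<open>gl(4,\<complex>)\<close>\<close>

text \<open>Elements of \<open>GL(2,\<bbbH>) = GL(4,\<complex>)\<close> are matrices over the index type \<open>2 + 2\<close>, with the
  four \<open>2 \<times> 2\<close> blocks selected by \<open>Inl\<close> and \<open>Inr\<close>.\<close>

definition blkA :: "'a ^ (2 + 2) ^ (2 + 2) \<Rightarrow> 'a ^ 2 ^ 2" where
  "blkA h = (\<chi> i j. h $ Inl i $ Inl j)"
definition blkB :: "'a ^ (2 + 2) ^ (2 + 2) \<Rightarrow> 'a ^ 2 ^ 2" where
  "blkB h = (\<chi> i j. h $ Inl i $ Inr j)"
definition blkC :: "'a ^ (2 + 2) ^ (2 + 2) \<Rightarrow> 'a ^ 2 ^ 2" where
  "blkC h = (\<chi> i j. h $ Inr i $ Inl j)"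
definition blkD :: "'a ^ (2 + 2) ^ (2 + 2) \<Rightarrow> 'a ^ 2 ^ 2" where
  "blkD h = (\<chi> i j. h $ Inr i $ Inr j)"

definition pi_l :: "complex ^ (2 + 2) ^ (2 + 2) \<Rightarrow> (complex ^ 2 ^ 2 \<Rightarrow> complex) \<Rightarrow> complex ^ 2 ^ 2 \<Rightarrow> complex" where
  "pi_l h \<phi> Z =
     (let k = matrix_inv h; den = blkC k ** Z + blkD k
      in 1 / det den * \<phi> ((blkA k ** Z + blkB k) ** matrix_inv den))"

definition holo_on :: "(complex ^ 2 ^ 2) set \<Rightarrow> (complex ^ 2 ^ 2 \<Rightarrow> complex) \<Rightarrow> bool" where
  "holo_on U \<phi> \<longleftrightarrow>
     open U \<and>
     (\<forall>Z\<in>U. \<exists>D. (\<phi> has_derivative D) (at Z) \<and> (\<forall>c V. D (mscale c V) = c * D V))"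

definition holo_ext :: "(complex ^ 2 ^ 2 \<Rightarrow> complex) \<Rightarrow> complex ^ 2 ^ 2 \<Rightarrow> complex" where
  "holo_ext \<phi> = (SOME \<psi>. \<exists>U. mink_plus \<subseteq> U \<and> holo_on U \<psi> \<and> (\<forall>Y\<in>mink_plus. \<psi> Y = \<phi> Y))"

text \<open>All holomorphic extensions of \<open>\<phi>\<close> have the same germ along \<open>mink_plus\<close>, since
  \<open>mink_plus\<close> is open in the totally real subspace \<open>minkowski\<close> of maximal dimension; hence
  the choice made in \<open>holo_ext\<close> does not matter here.\<close>

definition dpi_l :: "complex ^ (2 + 2) ^ (2 + 2) \<Rightarrow> (complex ^ 2 ^ 2 \<Rightarrow> complex) \<Rightarrow> complex ^ 2 ^ 2 \<Rightarrow> complex" where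
  "dpi_l X \<phi> Y =
     (if Y \<in> mink_plus
      then vector_derivative (\<lambda>s::real. pi_l (mexp (s *\<^sub>R X)) (holo_ext \<phi>) Y) (at 0)
      else 0)"

definition sl4 :: "(complex ^ (2 + 2) ^ (2 + 2)) set" where
  "sl4 = {X. trace X = 0}"

definition HR :: "(complex ^ 2 ^ 2) set" where
  "HR = {X. X $ 2 $ 2 = cnj (X $ 1 $ 1) \<and> X $ 2 $ 1 = cnj (X $ 1 $ 2)}"

text \<open>The Lie algebra of \<open>SL(2,\<bbbH>\<^sub>\<real>)\<close>, a real form of \<open>sl4\<close>.\<close>

definition sl2_HR :: "(complex ^ (2 + 2) ^ (2 + 2)) set" where
  "sl2_HR = {X \<in> sl4. blkA X \<in> HR \<and> blkB X \<in> HR \<and> blkC X \<in> HR \<and> blkD X \<in> HR}"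

section \<open>The minimal representation of \<open>O(3,3)\<close>\<close>

definition join :: "real ^ 3 \<Rightarrow> real ^ 3 \<Rightarrow> real ^ (3 + 3)" where
  "join x y = (\<chi> i. case i of Inl a \<Rightarrow> x $ a | Inr b \<Rightarrow> y $ b)"

definition Xi :: "(real ^ (3 + 3)) set" where
  "Xi = {join x y | x y. norm x = norm y \<and> norm x \<noteq> 0}"

definition J33 :: "'a::ring_1 ^ (3 + 3) ^ (3 + 3)" where
  "J33 = (\<chi> i j. if i = j then (case i of Inl _ \<Rightarrow> 1 | Inr _ \<Rightarrow> - 1) else 0)"

definition so33 :: "(real ^ (3 + 3) ^ (3 + 3)) set" where
  "so33 = {X. transpose X ** J33 + J33 ** X = 0}"

text \<open>The complexification of \<open>so33\<close>, a form of \<open>so(6,\<complex>)\<close>.\<close>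

definition so33C :: "(complex ^ (3 + 3) ^ (3 + 3)) set" where
  "so33C = {X. transpose X ** J33 + J33 ** X = 0}"

definition cmat :: "real ^ 'n ^ 'm \<Rightarrow> complex ^ 'n ^ 'm" where
  "cmat X = (\<chi> i j. complex_of_real (X $ i $ j))"
definition Re_mat :: "complex ^ 'n ^ 'm \<Rightarrow> real ^ 'n ^ 'm" where
  "Re_mat X = (\<chi> i j. Re (X $ i $ j))"
definition Im_mat :: "complex ^ 'n ^ 'm \<Rightarrow> real ^ 'n ^ 'm" where
  "Im_mat X = (\<chi> i j. Im (X $ i $ j))"

text \<open>The block diagonal subgroup \<open>SO(3) \<times> SO(3)\<close> of \<open>O(3,3)\<close>.\<close>

definition SO3xSO3 :: "(real ^ (3 + 3) ^ (3 + 3)) set" where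
  "SO3xSO3 = {(\<chi> i j. case (i, j) of (Inl a, Inl b) \<Rightarrow> A $ a $ b
                                   | (Inr a, Inr b) \<Rightarrow> B $ a $ b | _ \<Rightarrow> 0)
              | A B :: real ^ 3 ^ 3.
                orthogonal_matrix A \<and> det A = 1 \<and> orthogonal_matrix B \<and> det B = 1}"

primrec Ck_on :: "nat \<Rightarrow> ('a::euclidean_space \<Rightarrow> complex) \<Rightarrow> 'a set \<Rightarrow> bool" where
  "Ck_on 0 f U \<longleftrightarrow> continuous_on U f"
| "Ck_on (Suc k) f U \<longleftrightarrow>
     f differentiable_on U \<and> (\<forall>b\<in>Basis. Ck_on k (\<lambda>x. frechet_derivative f (at x) b) U)"

text \<open>Smoothness on the embedded submanifold \<open>Xi\<close>: local extendability to smooth functions.\<close>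

definition smooth_on_Xi :: "(real ^ (3 + 3) \<Rightarrow> complex) \<Rightarrow> bool" where
  "smooth_on_Xi F \<longleftrightarrow>
     (\<forall>p\<in>Xi. \<exists>U G. open U \<and> p \<in> U \<and> (\<forall>k. Ck_on k G U) \<and> (\<forall>q\<in>U \<inter> Xi. G q = F q))"

definition laplacian :: "('a::euclidean_space \<Rightarrow> complex) \<Rightarrow> 'a \<Rightarrow> complex" where
  "laplacian f p =
     (\<Sum>b\<in>Basis. vector_derivative
        (\<lambda>s::real. vector_derivative (\<lambda>u::real. f (p + u *\<^sub>R b)) (at s)) (at 0))"

text \<open>The Laplace--Beltrami operator of the unit sphere is the Euclidean Laplacian of the
  extension that is homogeneous of degree \<open>0\<close>.\<close>

definition laplacian_S2 :: "(real ^ 3 \<Rightarrow> complex) \<Rightarrow> real ^ 3 \<Rightarrow> complex" where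
  "laplacian_S2 f p = laplacian (\<lambda>x. f (x /\<^sub>R norm x)) p"

text \<open>Functions on \<open>Xi\<close> are extended by \<open>0\<close>.\<close>

definition V33 :: "(real ^ (3 + 3) \<Rightarrow> complex) set" where
  "V33 = {F. (\<forall>\<xi>. \<xi> \<notin> Xi \<longrightarrow> F \<xi> = 0) \<and>
             smooth_on_Xi F \<and>
             (\<forall>a>0. \<forall>\<xi>\<in>Xi. F (a *\<^sub>R \<xi>) = of_real (1 / a) * F \<xi>) \<and>
             (\<forall>x y. norm x = 1 \<and> norm y = 1 \<longrightarrow>
                laplacian_S2 (\<lambda>x. F (join x y)) x - laplacian_S2 (\<lambda>y. F (join x y)) y = 0)}"

definition o33_act :: "real ^ (3 + 3) ^ (3 + 3) \<Rightarrow> (real ^ (3 + 3) \<Rightarrow> complex) \<Rightarrow> real ^ (3 + 3) \<Rightarrow> complex" where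
  "o33_act g F \<xi> = F (matrix_inv g *v \<xi>)"

definition V33_HC :: "(real ^ (3 + 3) \<Rightarrow> complex) set" where
  "V33_HC = {F \<in> V33. \<exists>S. finite S \<and> (\<lambda>k. o33_act k F) ` SO3xSO3 \<subseteq> fn.span S}"

definition do33 :: "real ^ (3 + 3) ^ (3 + 3) \<Rightarrow> (real ^ (3 + 3) \<Rightarrow> complex) \<Rightarrow> real ^ (3 + 3) \<Rightarrow> complex" where
  "do33 X F \<xi> = vector_derivative (\<lambda>s::real. o33_act (mexp (s *\<^sub>R X)) F \<xi>) (at 0)"

definition do33C :: "complex ^ (3 + 3) ^ (3 + 3) \<Rightarrow> (real ^ (3 + 3) \<Rightarrow> complex) \<Rightarrow> real ^ (3 + 3) \<Rightarrow> complex" where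
  "do33C X F \<xi> = do33 (Re_mat X) F \<xi> + \<i> * do33 (Im_mat X) F \<xi>"

end

theory Submission
  imports Defs "HOL-Computational_Algebra.Fundamental_Theorem_Algebra"
begin

text \<open>Both modules are spaces of functions of a point \<open>(x, y)\<close> of the complex null cone
  \<open>x \<cdot> x = y \<cdot> y\<close> in six dimensions together with a square root \<open>\<rho>\<close> of \<open>x \<cdot> x\<close>, spanned by
  \<open>h\<^sub>l\<^sub>j(x) h\<^sub>l\<^sub>k(y) / \<rho>\<^sup>2\<^sup>l\<^sup>+\<^sup>1\<close>, where the \<open>h\<^sub>l\<^sub>j\<close> are the coefficients of the \<open>l\<close>-th power of a quadratic
  polynomial attached to the point and form a basis of the harmonic polynomials of degree \<open>l\<close>. The Lie
  algebra acts through linear vector fields; raising and lowering operators, and one operator that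
  changes \<open>l\<close>, show that such a module is irreducible.

  On \<open>Xi\<close> the two-sided Laplace equation forces the degrees of the two spherical harmonics in a
  \<open>K\<close>-finite function to agree. On Minkowski space the Pluecker coordinates of the columns of
  \<open>(Y, 1)\<close> lie on the cone and linearize the action of \<open>GL(4, \<complex>)\<close>, the factor \<open>1 / N(cZ + d)\<close> being
  absorbed by homogeneity of degree \<open>-1\<close>; the \<open>y\<close>-part is \<open>((N + 1) / 2, \<i> (N - 1) / 2, t)\<close>, whose
  \<open>h\<^sub>l\<^sub>k\<close> is a power of \<open>N\<close> times a Legendre function of \<open>t / r\<close>.

  The two modules are compared by realizing both at once on the disjoint union of the two domains:
  restriction to either part is equivariant and onto, and injective by irreducibility.\<close>

text \<open>Sending each spanning function on one domain to its namesake on the other is well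
  defined only if both families satisfy the same linear relations, and none are known in advance. A
  relation valid on just one domain would put a nonzero submodule into the kernel of a restriction
  from the disjoint union; irreducibility excludes this, and its own proof works with arbitrary,
  possibly redundant, expansions. The operators are derivatives of group actions, one of them taken
  through an arbitrarily chosen holomorphic extension, so their algebra is hidden. Functions are
  therefore represented by syntactic expressions in the cone coordinates and 1/\<rho>, on which the
  action is a formal derivation, and linearity and brackets are checked there once. \<rho> is a
  coordinate of its own because it occurs in odd powers. For the K-finite functions on
  \<open>Xi\<close>, a finite-dimensional rotation-invariant space of functions on the sphere is
  split into weights, and a nilpotent raising operator turns each weight function into a polynomial
  along a meridian, up to a power of sqrt (1 - z^2).\<close>

section \<open>Finite-dimensional spaces of functions\<close>

lemma sum_fun_apply: "(\<Sum>i\<in>I. f i) x = (\<Sum>i\<in>I. f i x)"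
  by (induction I rule: infinite_finite_induct) auto

lemma fscale_apply: "fscale c f x = c * f x"
  by (simp add: fscale_def)

lemma fn_span_sum_apply:
  assumes "finite I" "\<And>i. i \<in> I \<Longrightarrow> w i \<in> fn.span S" "\<And>x. f x = (\<Sum>i\<in>I. c i * w i x)"
  shows "f \<in> fn.span S"
proof -
  have "f = (\<Sum>i\<in>I. fscale (c i) (w i))"
    using assms(3) by (auto simp: sum_fun_apply fscale_apply)
  then show ?thesis
    by (auto intro!: fn.span_sum fn.span_scale assms)
qed

lemma fn_subspace_sum_apply:
  assumes "fn.subspace S" "finite I" "\<And>i. i \<in> I \<Longrightarrow> w i \<in> S" "\<And>x. f x = (\<Sum>i\<in>I. c i * w i x)"
  shows "f \<in> S"
  using fn_span_sum_apply[of I w S f c] assms by (simp add: fn.span_base fn.span_eq_iff[THEN iffD2])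

text \<open>A finite-dimensional function space is determined by its values at finitely many points,
  and \<open>w\<close> is the resulting interpolation formula. It makes such spaces closed under
  pointwise limits and separates the variables of a function all of whose slices lie in one such
  space. Points are added one at a time, as in Gaussian elimination.\<close>

lemma fn_span_dual_points:
  assumes "finite S"
  shows "\<exists>I w. finite I \<and> (\<forall>i\<in>I. w i \<in> fn.span S) \<and>
    (\<forall>f\<in>fn.span S. \<forall>x. f x = (\<Sum>i\<in>I. f i * w i x))"
  using assms
proof (induction S)
  case empty
  show ?case by (rule exI[of _ "{}"]) auto
next
  case (insert g S)
  then obtain I w where I: "finite I" "\<And>i. i \<in> I \<Longrightarrow> w i \<in> fn.span S"
    and w: "\<And>f x. f \<in> fn.span S \<Longrightarrow> f x = (\<Sum>i\<in>I. f i * w i x)" by blast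
  \<comment> \<open>The interpolation error of \<open>g\<close> at the old points. The error of
    every member of the larger span is a multiple of it, so one point where \<open>g'\<close> does
    not vanish suffices.\<close>
  define g' where "g' x = g x - (\<Sum>i\<in>I. g i * w i x)" for x
  have split: "\<exists>c. \<forall>x. f x - (\<Sum>i\<in>I. f i * w i x) = c * g' x" if "f \<in> fn.span (insert g S)" for f
  proof -
    from that obtain c where c: "f - fscale c g \<in> fn.span S"
      by (auto simp: fn.span_insert)
    have "f x - (\<Sum>i\<in>I. f i * w i x) = c * g' x" for x
      using w[OF c, of x]
      by (simp add: g'_def fscale_apply algebra_simps sum_subtractf sum_distrib_left)
    then show ?thesis by blast
  qed
  show ?case
  proof (cases "\<forall>x. g' x = 0")
    case True
    have "f x = (\<Sum>i\<in>I. f i * w i x)" if "f \<in> fn.span (insert g S)" for f x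
    proof -
      from split[OF that] obtain c where "f x - (\<Sum>i\<in>I. f i * w i x) = c * g' x" by blast
      then show ?thesis by (simp only: True[rule_format]) simp
    qed
    moreover have "w i \<in> fn.span (insert g S)" if "i \<in> I" for i
      using I(2)[OF that] fn.span_mono[of S "insert g S"] by auto
    ultimately show ?thesis using I(1) by blast
  next
    case False
    then obtain x0 where x0: "g' x0 \<noteq> 0" by blast
    define w0 where "w0 i = (if i \<in> I then w i else 0)" for i
    define g'' where "g'' = fscale (1 / g' x0) g'"
    have g'': "g'' \<in> fn.span (insert g S)"
    proof -
      have "g' = g - (\<Sum>i\<in>I. fscale (g i) (w i))"
        by (auto simp: g'_def sum_fun_apply fscale_apply)
      moreover have "w i \<in> fn.span (insert g S)" if "i \<in> I" for i
        using I(2)[OF that] fn.span_mono[of S "insert g S"] by auto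
      ultimately show ?thesis unfolding g''_def
        by (auto intro!: fn.span_scale fn.span_diff fn.span_sum intro: fn.span_base)
    qed
    \<comment> \<open>Newton's correction: \<open>g''\<close> has the value 1 at \<open>x0\<close>,
      and subtracting a multiple of it makes each old function vanish there. Extending
      \<open>w\<close> by zero to \<open>w0\<close> makes the formula valid whether or not
      \<open>x0\<close> is already among the points.\<close>
    define w' where "w' i = w0 i - fscale (w0 i x0) g'' + (if i = x0 then g'' else 0)" for i
    have "w' i \<in> fn.span (insert g S)" for i
    proof -
      have "w0 i \<in> fn.span (insert g S)"
        using I(2)[of i] fn.span_mono[of S "insert g S"] by (auto simp: w0_def fn.span_zero)
      with g'' show ?thesis unfolding w'_def
        by (auto intro!: fn.span_add fn.span_diff fn.span_scale fn.span_zero)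
    qed
    moreover have "f x = (\<Sum>i\<in>insert x0 I. f i * w' i x)" if f: "f \<in> fn.span (insert g S)" for f x
    proof -
      from split[OF f] obtain c where c: "\<And>x. f x - (\<Sum>i\<in>I. f i * w i x) = c * g' x" by blast
      have w0: "(\<Sum>i\<in>insert x0 I. f i * w0 i y) = (\<Sum>i\<in>I. f i * w i y)" for y
        by (rule sum.mono_neutral_cong_right) (auto simp: w0_def I(1))
      have "(\<Sum>i\<in>insert x0 I. f i * w' i x)
          = (\<Sum>i\<in>insert x0 I. f i * w0 i x) - (\<Sum>i\<in>insert x0 I. f i * w0 i x0) * g'' x
            + (\<Sum>i\<in>insert x0 I. if i = x0 then f i * g'' x else 0)"
        unfolding sum_distrib_right sum_subtractf[symmetric] sum.distrib[symmetric]
        by (rule sum.cong) (auto simp: w'_def fscale_apply algebra_simps)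
      also have "\<dots> = (\<Sum>i\<in>I. f i * w i x) + (f x0 - (\<Sum>i\<in>I. f i * w i x0)) * g'' x"
        using I(1) by (simp only: w0) (simp add: algebra_simps)
      also have "\<dots> = f x"
        unfolding c using c[of x] x0 by (simp add: g''_def fscale_apply algebra_simps)
      finally show ?thesis by simp
    qed
    ultimately show ?thesis using I(1)
      by (intro exI[of _ "insert x0 I"] exI[of _ w']) auto
  qed
qed

text \<open>There are more vectors than the dimension allows. Dependence is a property of sets and
  cannot see a vector that occurs twice in the sequence, which is why injectivity is split
  off.\<close>

lemma fn_span_iterates_dependent:
  fixes v :: "nat \<Rightarrow> 'a \<Rightarrow> complex"
  assumes "finite S" "\<And>k. v k \<in> fn.span S"
  shows "\<exists>c n. (\<exists>k\<le>n. c k \<noteq> 0) \<and> (\<forall>x. (\<Sum>k\<le>n. c k * v k x) = 0)"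
proof (cases "inj_on v {..card S}")
  case True
  then have card: "card (v ` {..card S}) = card S + 1"
    by (simp add: card_image)
  have "fn.dependent (v ` {..card S})"
  proof (rule ccontr)
    assume "\<not> fn.dependent (v ` {..card S})"
    from fn.independent_span_bound[OF assms(1) this] assms(2) card show False by auto
  qed
  then obtain u where u: "\<exists>w\<in>v ` {..card S}. u w \<noteq> 0" "(\<Sum>w\<in>v ` {..card S}. fscale (u w) w) = 0"
    by (auto simp: fn.dependent_finite)
  then have s: "(\<Sum>k\<le>card S. fscale (u (v k)) (v k)) = 0"
    using True by (simp add: sum.reindex)
  have "(\<Sum>k\<le>card S. u (v k) * v k x) = 0" for x
    using fun_cong[OF s, of x] by (simp add: sum_fun_apply fscale_apply)
  with u(1) show ?thesis
    by (intro exI[of _ "\<lambda>k. u (v k)"] exI[of _ "card S"]) auto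
next
  case False
  then obtain i j where ij: "i \<le> card S" "j \<le> card S" "i \<noteq> j" "v i = v j"
    by (auto simp: inj_on_def)
  let ?c = "\<lambda>k. (if k = i then 1 else 0) - (if k = j then 1 else 0) :: complex"
  have "(\<Sum>k\<le>card S. ?c k * v k x) = 0" for x
  proof -
    have "(\<Sum>k\<le>card S. ?c k * v k x)
        = (\<Sum>k\<le>card S. if k = i then v k x else 0) - (\<Sum>k\<le>card S. if k = j then v k x else 0)"
      unfolding sum_subtractf[symmetric] by (rule sum.cong) auto
    with ij show ?thesis by simp
  qed
  with ij show ?thesis
    by (intro exI[of _ ?c] exI[of _ "card S"]) auto
qed

section \<open>The exponential of a matrix\<close>

abbreviation mpow :: "'a::semiring_1 ^ 'n ^ 'n \<Rightarrow> nat \<Rightarrow> 'a ^ 'n ^ 'n" where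
  "mpow A k \<equiv> (((**) A) ^^ k) (mat 1)"

lemma mpow_Suc_right: "mpow A (Suc k) = mpow A k ** A"
  by (induction k) (auto simp: matrix_mul_assoc)

lemma mpow_scale:
  fixes A :: "'a::real_normed_field ^ 'n ^ 'n"
  shows "mpow (s *\<^sub>R A) k = (s ^ k) *\<^sub>R mpow A k"
proof (induction k)
  case (Suc k)
  have "(s *\<^sub>R A) ** (s ^ k *\<^sub>R mpow A k) = s ^ Suc k *\<^sub>R (A ** mpow A k)"
    by (simp add: vec_eq_iff matrix_matrix_mult_def scaleR_sum_right mult_ac)
  with Suc show ?case by simp
qed simp

lemma norm_mpow_entry_le:
  fixes A :: "'a::real_normed_field ^ 'n ^ 'n"
  shows "norm (mpow A k $ i $ j) \<le> (\<Sum>i\<in>UNIV. \<Sum>l\<in>UNIV. norm (A $ i $ l)) ^ k"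
proof (induction k arbitrary: i)
  case 0
  show ?case by (simp add: mat_def)
next
  case (Suc k)
  let ?C = "\<Sum>i\<in>UNIV. \<Sum>l\<in>UNIV. norm (A $ i $ l)"
  have "norm (mpow A (Suc k) $ i $ j) = norm (\<Sum>l\<in>UNIV. A $ i $ l * mpow A k $ l $ j)"
    by (simp add: matrix_matrix_mult_def)
  also have "\<dots> \<le> (\<Sum>l\<in>UNIV. norm (A $ i $ l) * ?C ^ k)"
    by (rule order_trans[OF norm_sum]) (auto intro!: sum_mono mult_left_mono Suc simp: norm_mult)
  also have "\<dots> = (\<Sum>l\<in>UNIV. norm (A $ i $ l)) * ?C ^ k"
    by (simp add: sum_distrib_right)
  also have "\<dots> \<le> ?C * ?C ^ k"
  proof (rule mult_right_mono)
    show "(\<Sum>l\<in>UNIV. norm (A $ i $ l)) \<le> ?C"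
      by (rule member_le_sum[of i UNIV "\<lambda>i. \<Sum>l\<in>UNIV. norm (A $ i $ l)"]) (auto intro: sum_nonneg)
    show "0 \<le> ?C ^ k" by (intro zero_le_power sum_nonneg) auto
  qed
  finally show ?case by simp
qed

lemma summable_mpow_entry:
  fixes A :: "'a::{real_normed_field,banach} ^ 'n ^ 'n"
  shows "summable (\<lambda>k. (mpow A k $ i $ j / fact k) * y ^ k)"
proof -
  let ?C = "\<Sum>i\<in>UNIV. \<Sum>l\<in>UNIV. norm (A $ i $ l)"
  have "summable (\<lambda>k. inverse (fact k) * (?C * norm y) ^ k)"
    using summable_exp[of "?C * norm y"] .
  then show ?thesis
  proof (rule summable_comparison_test')
    show "norm ((mpow A k $ i $ j / fact k) * y ^ k) \<le> inverse (fact k) * (?C * norm y) ^ k" for k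
      using norm_mpow_entry_le[of k A i j]
      by (auto simp: norm_mult norm_divide norm_power power_mult_distrib divide_simps mult_right_mono)
  qed
qed

lemma mexp_entry:
  fixes A :: "'a::{real_normed_field,banach} ^ 'n ^ 'n"
  shows "mexp (s *\<^sub>R A) $ i $ j = (\<Sum>k. (mpow A k $ i $ j / fact k) * of_real s ^ k)"
proof -
  let ?f = "\<lambda>k. (1 / fact k) *\<^sub>R mpow (s *\<^sub>R A) k"
  have f: "?f k $ i $ j = (mpow A k $ i $ j / fact k) * of_real s ^ k" for k i j
    by (simp add: mpow_scale) (simp add: scaleR_conv_of_real field_simps)
  have "(\<lambda>k. ?f k $ i $ j) sums (\<Sum>k. (mpow A k $ i $ j / fact k) * of_real s ^ k)" for i j
    unfolding f by (rule summable_sums summable_mpow_entry)+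
  then have "?f sums (\<chi> i j. \<Sum>k. (mpow A k $ i $ j / fact k) * of_real s ^ k)"
    unfolding sums_def
    by (intro vec_tendstoI) (auto simp: sum_component)
  then show ?thesis
    unfolding mexp_def by (simp add: sums_unique[symmetric])
qed

lemma has_vector_derivative_vec:
  fixes f :: "real \<Rightarrow> 'a::real_normed_vector ^ 'n"
  assumes "\<And>i. ((\<lambda>s. f s $ i) has_vector_derivative f' $ i) F"
  shows "(f has_vector_derivative f') F"
  using assms unfolding has_vector_derivative_def has_derivative_def
  by (auto intro!: vec_tendstoI bounded_linear_scaleR_left)

lemma has_vector_derivative_vec_nth:
  assumes "(f has_vector_derivative f') F"
  shows "((\<lambda>s. f s $ i) has_vector_derivative f' $ i) F"
  using bounded_linear.has_vector_derivative[OF bounded_linear_vec_nth assms] .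

text \<open>Entrywise the exponential is an everywhere convergent power series; its differentiated
  series is resummed by splitting a factor A off on the left or on the right. Both orders are given
  because their combination makes the two terms of the product rule cancel in
  \<open>mexp_minus\<close>.\<close>

lemma has_vector_derivative_mexp:
  fixes A :: "'a::{real_normed_field,banach} ^ 'n ^ 'n"
  shows "((\<lambda>s. mexp (s *\<^sub>R A)) has_vector_derivative A ** mexp (s *\<^sub>R A)) (at s)"
    and "((\<lambda>s. mexp (s *\<^sub>R A)) has_vector_derivative mexp (s *\<^sub>R A) ** A) (at s)"
proof -
  define c where "c i j k = mpow A k $ i $ j / fact k" for i j k
  define e where "e i j = (\<lambda>s. \<Sum>k. c i j k * s ^ k)" for i j
  have entry: "mexp (s *\<^sub>R A) $ i $ j = e i j (of_real s)" for s i j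
    by (simp add: e_def c_def mexp_entry)
  have sm: "summable (\<lambda>k. c i j k * y ^ k)" for i j y
    unfolding c_def by (rule summable_mpow_entry)
  have D: "(e i j has_field_derivative (\<Sum>k. diffs (c i j) k * y ^ k)) (at y)" for i j y
    unfolding e_def by (rule termdiffs_strong_converges_everywhere[OF sm])
  have D': "((\<lambda>s. e i j (of_real s)) has_vector_derivative (\<Sum>k. diffs (c i j) k * of_real s ^ k)) (at s)"
    for i j s
    using field_vector_diff_chain_at[OF has_vector_derivative_of_real[OF DERIV_ident] D, of i j s]
    by (simp add: o_def)
  have c_Suc: "diffs (c i j) k = (\<Sum>l\<in>UNIV. A $ i $ l * c l j k)"
    "diffs (c i j) k = (\<Sum>l\<in>UNIV. c i l k * A $ l $ j)" for i j k
  proof -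
    have d: "diffs (c i j) k = mpow A (Suc k) $ i $ j / fact k"
      by (simp add: diffs_def c_def divide_simps del: funpow.simps of_nat_Suc)
    show "diffs (c i j) k = (\<Sum>l\<in>UNIV. A $ i $ l * c l j k)"
      unfolding d by (simp add: matrix_matrix_mult_def c_def sum_divide_distrib)
    show "diffs (c i j) k = (\<Sum>l\<in>UNIV. c i l k * A $ l $ j)"
      unfolding d mpow_Suc_right by (simp add: matrix_matrix_mult_def c_def sum_divide_distrib)
  qed
  have e: "(\<lambda>k. c i j k * y ^ k) sums e i j y" for i j y
    unfolding e_def by (rule summable_sums[OF sm])
  have L: "(\<Sum>k. diffs (c i j) k * y ^ k) = (\<Sum>l\<in>UNIV. A $ i $ l * e l j y)" for i j y
  proof -
    have "(\<lambda>k. \<Sum>l\<in>UNIV. A $ i $ l * (c l j k * y ^ k)) sums (\<Sum>l\<in>UNIV. A $ i $ l * e l j y)"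
      by (intro sums_sum sums_mult e)
    then show ?thesis
      by (simp add: c_Suc(1) sum_distrib_right mult.assoc sums_iff)
  qed
  have R: "(\<Sum>k. diffs (c i j) k * y ^ k) = (\<Sum>l\<in>UNIV. e i l y * A $ l $ j)" for i j y
  proof -
    have "(\<lambda>k. \<Sum>l\<in>UNIV. (c i l k * y ^ k) * A $ l $ j) sums (\<Sum>l\<in>UNIV. e i l y * A $ l $ j)"
      by (intro sums_sum sums_mult2 e)
    moreover have "(\<lambda>k. diffs (c i j) k * y ^ k) = (\<lambda>k. \<Sum>l\<in>UNIV. (c i l k * y ^ k) * A $ l $ j)"
      unfolding c_Suc(2) sum_distrib_right by (intro ext sum.cong refl) (simp add: mult.assoc mult.commute[of "A $ _ $ _"])
    ultimately show ?thesis
      by (simp only: sums_unique[symmetric])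
  qed
  show "((\<lambda>s. mexp (s *\<^sub>R A)) has_vector_derivative A ** mexp (s *\<^sub>R A)) (at s)"
    by (intro has_vector_derivative_vec)
       (use D'[unfolded L] in \<open>simp add: entry matrix_matrix_mult_def\<close>)
  show "((\<lambda>s. mexp (s *\<^sub>R A)) has_vector_derivative mexp (s *\<^sub>R A) ** A) (at s)"
    by (intro has_vector_derivative_vec)
       (use D'[unfolded R] in \<open>simp add: entry matrix_matrix_mult_def\<close>)
qed

lemma mexp_0 [simp]: "mexp (0 :: 'a::{real_normed_field,banach} ^ 'n ^ 'n) = mat 1"
proof -
  have "mexp ((0::real) *\<^sub>R (0 :: 'a ^ 'n ^ 'n)) $ i $ j = mat 1 $ i $ j" for i j
    unfolding mexp_entry by (subst suminf_finite[of "{0}"]) auto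
  then show ?thesis by (simp add: vec_eq_iff)
qed

lemma has_vector_derivative_matrix_mult:
  fixes f :: "real \<Rightarrow> 'a::real_normed_field ^ 'k ^ 'm" and g :: "real \<Rightarrow> 'a ^ 'n ^ 'k"
  assumes "(f has_vector_derivative f') (at s)" "(g has_vector_derivative g') (at s)"
  shows "((\<lambda>s. f s ** g s) has_vector_derivative (f s ** g' + f' ** g s)) (at s)"
proof (intro has_vector_derivative_vec)
  fix i j
  have "((\<lambda>s. \<Sum>k\<in>UNIV. f s $ i $ k * g s $ k $ j) has_vector_derivative
      (\<Sum>k\<in>UNIV. f s $ i $ k * g' $ k $ j + f' $ i $ k * g s $ k $ j)) (at s)"
    by (intro has_vector_derivative_sum has_vector_derivative_mult has_vector_derivative_vec_nth assms)
  then show "((\<lambda>s. (f s ** g s) $ i $ j) has_vector_derivative (f s ** g' + f' ** g s) $ i $ j) (at s)"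
    by (simp add: matrix_matrix_mult_def sum.distrib)
qed

lemma has_vector_derivative_matrix_vector_mult:
  fixes f :: "real \<Rightarrow> 'a::real_normed_field ^ 'n ^ 'm" and g :: "real \<Rightarrow> 'a ^ 'n"
  assumes "(f has_vector_derivative f') (at s)" "(g has_vector_derivative g') (at s)"
  shows "((\<lambda>s. f s *v g s) has_vector_derivative (f s *v g' + f' *v g s)) (at s)"
proof (intro has_vector_derivative_vec)
  fix i
  have "((\<lambda>s. \<Sum>k\<in>UNIV. f s $ i $ k * g s $ k) has_vector_derivative
      (\<Sum>k\<in>UNIV. f s $ i $ k * g' $ k + f' $ i $ k * g s $ k)) (at s)"
    by (intro has_vector_derivative_sum has_vector_derivative_mult has_vector_derivative_vec_nth assms)
  then show "((\<lambda>s. (f s *v g s) $ i) has_vector_derivative (f s *v g' + f' *v g s) $ i) (at s)"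
    by (simp add: matrix_vector_mult_def sum.distrib)
qed

lemma matrix_mul_minus:
  fixes A :: "'a::ring_1 ^ 'k ^ 'm"
  shows "A ** (- B) = - (A ** B)" "(- A) ** B = - (A ** B)"
  by (auto simp: vec_eq_iff matrix_matrix_mult_def sum_negf)

lemma mexp_minus:
  fixes A :: "'a::{real_normed_field,banach} ^ 'n ^ 'n"
  shows "mexp (s *\<^sub>R (- A)) ** mexp (s *\<^sub>R A) = mat 1"
proof -
  let ?f = "\<lambda>s. mexp (s *\<^sub>R (- A)) ** mexp (s *\<^sub>R A)"
  have "(?f has_vector_derivative 0) (at s)" for s
    by (rule has_vector_derivative_eq_rhs[OF has_vector_derivative_matrix_mult
          [OF has_vector_derivative_mexp(2)[of "-A"] has_vector_derivative_mexp(1)[of A]]])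
       (simp add: matrix_mul_assoc matrix_mul_minus)
  then obtain c where "\<And>s. ?f s = c"
    using has_vector_derivative_zero_constant[of UNIV ?f] by (metis UNIV_I convex_UNIV)
  then have "?f s = ?f 0" by metis
  then show ?thesis by simp
qed

lemma matrix_inv_eqI:
  fixes A :: "'a::field ^ 'n ^ 'n"
  assumes "B ** A = mat 1"
  shows "matrix_inv A = B"
proof -
  have "A ** B = mat 1"
    using assms matrix_left_right_inverse by blast
  with assms have "A ** matrix_inv A = mat 1"
    unfolding matrix_inv_def by (rule_tac someI2[of _ B]) auto
  then have "B ** (A ** matrix_inv A) = B" by simp
  then show ?thesis by (simp add: matrix_mul_assoc assms)
qed

lemma matrix_inv_mexp:
  fixes A :: "'a::{real_normed_field,banach} ^ 'n ^ 'n"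
  shows "matrix_inv (mexp (s *\<^sub>R A)) = mexp (s *\<^sub>R (- A))"
  by (rule matrix_inv_eqI[OF mexp_minus])

section \<open>Harmonic polynomials in three variables\<close>

definition bl :: "complex ^ 3 \<Rightarrow> complex ^ 3 \<Rightarrow> complex" where
  "bl x y = (\<Sum>i\<in>UNIV. x $ i * y $ i)"

lemma bl_3: "bl x y = x $ 1 * y $ 1 + x $ 2 * y $ 2 + x $ 3 * y $ 3"
  by (simp add: bl_def sum_3)

text \<open>At the parameter u the polynomial takes the value x . (1 - u^2, i (1 + u^2), 2 u), the
  pairing of x with the general isotropic vector. Powers of a linear form given by an isotropic
  vector are harmonic, so the coefficients of the powers are solid harmonics.\<close>

definition sq :: "complex ^ 3 \<Rightarrow> complex poly" where
  "sq x = [:x $ 1 + \<i> * x $ 2, 2 * x $ 3, - (x $ 1 - \<i> * x $ 2):]"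

definition he :: "nat \<Rightarrow> nat \<Rightarrow> complex ^ 3 \<Rightarrow> complex" where
  "he l j x = coeff (sq x ^ l) j"

text \<open>The derivative of \<open>he l j\<close> at \<open>x\<close> in the direction
  \<open>v\<close>, given as a formula and confirmed by \<open>he_path\<close>. For l = 0 the factor
  \<open>of_nat l\<close> neutralizes the truncated exponent.\<close>

definition dhe :: "nat \<Rightarrow> nat \<Rightarrow> complex ^ 3 \<Rightarrow> complex ^ 3 \<Rightarrow> complex" where
  "dhe l j x v = coeff (smult (of_nat l) (sq x ^ (l - 1) * sq v)) j"

lemma sq_add: "sq (x + y) = sq x + sq y"
  and sq_scale: "sq (c *s x) = smult c (sq x)"
  and sq_zero: "sq 0 = 0"
  by (simp_all add: sq_def algebra_simps)

lemma dhe_add: "dhe l j x (u + v) = dhe l j x u + dhe l j x v"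
  and dhe_scale: "dhe l j x (c *s v) = c * dhe l j x v"
  by (simp_all add: dhe_def sq_add sq_scale algebra_simps)

lemma dhe_sum: "dhe l j x (\<Sum>i\<in>I. v i) = (\<Sum>i\<in>I. dhe l j x (v i))"
  by (induction I rule: infinite_finite_induct) (simp_all add: dhe_add, simp_all add: dhe_def sq_zero)

lemma coeff_pCons3_mult:
  "coeff ([:a, b, c:] * P) j =
    a * coeff P j + (if 1 \<le> j then b * coeff P (j - 1) else 0) + (if 2 \<le> j then c * coeff P (j - 2) else 0)"
  by (cases j rule: nat.exhaust; cases "j - 1") (auto simp: coeff_pCons add.assoc split: nat.split)

lemma degree_sq_power: "degree (sq x ^ l) \<le> 2 * l"
proof -
  have "degree (sq x) \<le> 2" by (auto simp: sq_def)
  then show ?thesis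
    by (meson degree_power_le le_trans mult_le_mono1)
qed

lemma he_eq_0: "2 * l < j \<Longrightarrow> he l j x = 0"
  using degree_sq_power[of x l] by (auto simp: he_def intro!: coeff_eq_0)

lemma he_scale: "he l j (c *s x) = c ^ l * he l j x"
  by (simp add: he_def sq_scale smult_power)

definition LH :: "nat \<Rightarrow> (complex ^ 3 \<Rightarrow> complex) set" where
  "LH l = fn.span (range (he l))"

lemma he_in_LH: "he l j \<in> LH l"
  by (auto simp: LH_def intro: fn.span_base)

lemma LH_sum:
  assumes "\<And>i. i \<in> I \<Longrightarrow> w i \<in> LH l" "finite I" "\<And>x. f x = (\<Sum>i\<in>I. c i * w i x)"
  shows "f \<in> LH l"
  using assms unfolding LH_def by (intro fn_span_sum_apply[of I w _ f c]) auto

lemma LH_coeff_mult: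
  assumes "\<And>i. (\<lambda>x. coeff (P x) i) \<in> LH l"
  shows "(\<lambda>x. coeff (A * P x) j) \<in> LH l"
  by (rule LH_sum[of "{..j}" "\<lambda>i x. coeff (P x) (j - i)" _ _ "\<lambda>i. coeff A i"])
     (auto simp: coeff_mult assms)

lemma LH_coeff_pderiv:
  assumes "\<And>i. (\<lambda>x. coeff (P x) i) \<in> LH l"
  shows "(\<lambda>x. coeff (pderiv (P x)) j) \<in> LH l"
  by (rule LH_sum[of "{()}" "\<lambda>_ x. coeff (P x) (Suc j)" _ _ "\<lambda>i. of_nat (Suc j)"])
     (auto simp: coeff_pderiv assms)

lemma LH_add: "f \<in> LH l \<Longrightarrow> g \<in> LH l \<Longrightarrow> (\<lambda>x. f x + g x) \<in> LH l"
  using fn.span_add[of f _ g] by (auto simp: LH_def plus_fun_def)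

lemma LH_scale: "f \<in> LH l \<Longrightarrow> (\<lambda>x. c * f x) \<in> LH l"
  using fn.span_scale[of f _ c] by (auto simp: LH_def fscale_def)

lemma LH_sq_power: "(\<lambda>x. coeff (sq x ^ l) j) \<in> LH l"
  using he_in_LH[of l j] by (simp add: he_def[abs_def])

definition crs :: "complex ^ 3 \<Rightarrow> complex ^ 3 \<Rightarrow> complex ^ 3" where
  "crs w x = vector [w $ 2 * x $ 3 - w $ 3 * x $ 2, w $ 3 * x $ 1 - w $ 1 * x $ 3, w $ 1 * x $ 2 - w $ 2 * x $ 1]"

text \<open>This is \<open>sq w\<close> times - i / 2: infinitesimal rotations are identified with
  quadratic vector fields on the projective line in the same way as vectors with quadratic
  polynomials.\<close>

definition alp :: "complex ^ 3 \<Rightarrow> complex poly" where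
  "alp w = [:(w $ 2 - \<i> * w $ 1) / 2, - \<i> * w $ 3, (w $ 2 + \<i> * w $ 1) / 2:]"

text \<open>Rotations act on the parameter of the isotropic vectors by vector fields on the projective line.\<close>

lemma sq_crs: "sq (crs w x) = alp w * pderiv (sq x) - pderiv (alp w) * sq x"
  by (simp add: sq_def crs_def alp_def pderiv_pCons field_simps complex_eq_iff)

lemma dhe_crs:
  "dhe l j x (crs w x) = coeff (alp w * pderiv (sq x ^ l) - smult (of_nat l) (pderiv (alp w) * sq x ^ l)) j"
proof -
  have "smult (of_nat l) (sq x ^ (l - 1) * sq (crs w x))
      = alp w * pderiv (sq x ^ l) - smult (of_nat l) (pderiv (alp w) * sq x ^ l)"
    by (cases l) (simp_all add: sq_crs pderiv_power_Suc algebra_simps smult_diff_right smult_add_right del: power_Suc, simp_all add: mult_ac)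
  then show ?thesis by (simp add: dhe_def)
qed

lemma dhe_crs_LH: "(\<lambda>x. dhe l j x (crs w x)) \<in> LH l"
proof -
  have "(\<lambda>x. coeff (alp w * pderiv (sq x ^ l)) j + (- of_nat l) * coeff (pderiv (alp w) * sq x ^ l) j) \<in> LH l"
    by (intro LH_add LH_scale LH_coeff_mult LH_coeff_pderiv LH_sq_power)
  then show ?thesis by (simp add: dhe_crs)
qed

text \<open>For a quadratic q the combination q'^2 - 2 q q'' is its discriminant, here 4 x . x.
  Through this identity the quadratic form of the cone enters a calculus that otherwise sees only
  polynomials in the parameter; \<open>sq_polarization\<close> is its bilinear version.\<close>

lemma sq_discriminant: "pderiv (sq x) ^ 2 = [:4 * bl x x:] + smult 2 (sq x * pderiv (pderiv (sq x)))"
  by (simp add: sq_def bl_3 pderiv_pCons power2_eq_square algebra_simps)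

lemma sq_polarization:
  "[:4 * bl w x:] = - (sq w * pderiv (pderiv (sq x)) - pderiv (sq w) * pderiv (sq x) + pderiv (pderiv (sq w)) * sq x)"
  by (simp add: sq_def bl_3 pderiv_pCons algebra_simps)

text \<open>The harmonic part of the product of a linear form with a harmonic polynomial is a
  transvectant in the parameter.\<close>

definition she :: "nat \<Rightarrow> nat \<Rightarrow> complex ^ 3 \<Rightarrow> complex ^ 3 \<Rightarrow> complex" where
  "she l j w x = - 1 / (4 * (of_nat l + 1) * (2 * of_nat l + 1)) *
     coeff (sq w * pderiv (pderiv (sq x ^ (l + 1)))
       - smult (2 * of_nat l + 1) (pderiv (sq w) * pderiv (sq x ^ (l + 1)))
       + smult ((of_nat l + 1) * (2 * of_nat l + 1)) (pderiv (pderiv (sq w)) * sq x ^ (l + 1))) j"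

lemma she_LH: "she l j w \<in> LH (l + 1)"
proof -
  have "(\<lambda>x. - 1 / (4 * (of_nat l + 1) * (2 * of_nat l + 1)) *
     ((coeff (sq w * pderiv (pderiv (sq x ^ (l + 1)))) j
       + (- (2 * of_nat l + 1)) * coeff (pderiv (sq w) * pderiv (sq x ^ (l + 1))) j)
       + ((of_nat l + 1) * (2 * of_nat l + 1)) * coeff (pderiv (pderiv (sq w)) * sq x ^ (l + 1)) j)) \<in> LH (l + 1)"
    by (intro LH_add LH_scale LH_coeff_mult LH_coeff_pderiv LH_sq_power)
  moreover have "she l j w = (\<lambda>x. - 1 / (4 * (of_nat l + 1) * (2 * of_nat l + 1)) *
     ((coeff (sq w * pderiv (pderiv (sq x ^ (l + 1)))) j
       + (- (2 * of_nat l + 1)) * coeff (pderiv (sq w) * pderiv (sq x ^ (l + 1))) j)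
       + ((of_nat l + 1) * (2 * of_nat l + 1)) * coeff (pderiv (pderiv (sq w)) * sq x ^ (l + 1)) j))"
    by (rule ext) (simp add: she_def algebra_simps del: power_Suc)
  ultimately show ?thesis by simp
qed

lemma dhe_LH: "(\<lambda>x. dhe l j x w) \<in> LH (l - 1)"
proof -
  have "(\<lambda>x. of_nat l * coeff (sq w * sq x ^ (l - 1)) j) \<in> LH (l - 1)"
    by (intro LH_scale LH_coeff_mult LH_sq_power)
  then show ?thesis by (simp add: dhe_def mult.commute)
qed

text \<open>A harmonic part of degree l + 1 plus x . x times a harmonic of degree l - 1. Expanding
  (q^(l+1))'' produces q'^2, which the discriminant identity replaces; the coefficients in
  \<open>she\<close> are the ones for which the rest combines, by polarization, to a multiple of (w
  . x) q^l.\<close>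

lemma bl_mult_he: "bl w x * he l j x = she l j w x + bl x x / (2 * of_nat l + 1) * dhe l j x w"
proof -
  define Q where "Q = sq x"
  define c :: complex where "c = of_nat l"
  have c1: "c + 1 \<noteq> 0" "2 * c + 1 \<noteq> 0"
  proof -
    have "c + 1 = of_nat (l + 1)" "2 * c + 1 = of_nat (2 * l + 1)" by (simp_all add: c_def)
    then show "c + 1 \<noteq> 0" "2 * c + 1 \<noteq> 0" by (metis of_nat_eq_0_iff add_is_0 one_neq_zero)+
  qed
  define T where "T = sq w * pderiv (pderiv (Q ^ (l + 1))) - smult (2 * c + 1) (pderiv (sq w) * pderiv (Q ^ (l + 1)))
       + smult ((c + 1) * (2 * c + 1)) (pderiv (pderiv (sq w)) * Q ^ (l + 1))"
  have G1: "pderiv (Q ^ (l + 1)) = smult (c + 1) (Q ^ l * pderiv Q)"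
    using pderiv_power_Suc[of Q l] by (simp add: c_def add.commute)
  have G2: "pderiv (pderiv (Q ^ (l + 1))) = smult (c + 1) (Q ^ l * pderiv (pderiv Q) + smult c (Q ^ (l - 1) * pderiv Q ^ 2))"
    unfolding G1 by (simp add: pderiv_mult pderiv_smult pderiv_power c_def power2_eq_square mult_ac add.commute)
  \<comment> \<open>For l = 0 the exponents on the two sides differ because of truncation, but the
    factor c is then 0.\<close>
  have QQ: "smult c (Q ^ (l - 1) * Q) = smult c (Q ^ l)"
    by (cases l) (simp_all add: c_def mult.commute)
  have "pderiv Q ^ 2 = [:4 * bl x x:] + smult 2 (Q * pderiv (pderiv Q))"
    unfolding Q_def by (rule sq_discriminant)
  then have "smult c (Q ^ (l - 1) * pderiv Q ^ 2)
      = smult (4 * bl x x * c) (Q ^ (l - 1)) + smult 2 (smult c (Q ^ (l - 1) * Q) * pderiv (pderiv Q))"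
    by (simp add: algebra_simps smult_add_right)
  then have G2': "pderiv (pderiv (Q ^ (l + 1))) = smult (c + 1) (smult (2 * c + 1) (Q ^ l * pderiv (pderiv Q)) + smult (4 * bl x x * c) (Q ^ (l - 1)))"
    unfolding G2 QQ by (simp add: smult_add_left smult_add_right algebra_simps)
  have "T = smult ((c + 1) * (2 * c + 1)) (Q ^ l * (sq w * pderiv (pderiv Q) - pderiv (sq w) * pderiv Q + pderiv (pderiv (sq w)) * Q))
     + smult (4 * bl x x * (c + 1)) (smult c (Q ^ (l - 1) * sq w))"
    unfolding T_def unfolding G2' unfolding G1
    by (subst poly_eq_poly_eq_iff[symmetric], rule ext) (simp add: algebra_simps del: power_Suc, simp add: algebra_simps)
  also have "sq w * pderiv (pderiv Q) - pderiv (sq w) * pderiv Q + pderiv (pderiv (sq w)) * Q = - [:4 * bl w x:]"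
    unfolding Q_def sq_polarization by simp
  finally have T: "T = smult (4 * bl x x * (c + 1)) (smult c (Q ^ (l - 1) * sq w)) - smult (4 * (c + 1) * (2 * c + 1) * bl w x) (Q ^ l)"
    by (simp add: algebra_simps)
  have "she l j w x = - 1 / (4 * (c + 1) * (2 * c + 1)) * coeff T j"
    by (simp add: she_def T_def Q_def c_def)
  also have "coeff T j = 4 * (c + 1) * (bl x x * dhe l j x w - (2 * c + 1) * (bl w x * he l j x))"
    unfolding T by (simp add: he_def dhe_def Q_def c_def[symmetric] algebra_simps)
  also have "- 1 / (4 * (c + 1) * (2 * c + 1)) * (4 * (c + 1) * (bl x x * dhe l j x w - (2 * c + 1) * (bl w x * he l j x)))
      = bl w x * he l j x - bl x x / (2 * c + 1) * dhe l j x w"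
  proof -
    have "- 1 / (4 * a * b) * (4 * a * (u - b * v)) = v - u / b" if "a \<noteq> 0" "b \<noteq> 0" for a b u v :: complex
      using that by (simp add: field_simps)
    from this[OF c1] show ?thesis by simp
  qed
  finally show ?thesis by (simp add: c_def)
qed

section \<open>Expressions in the coordinates of the cone\<close>

text \<open>The symbols stand for functions of a point \<open>\<xi>\<close> of the cone and a square root \<open>\<rho>\<close> of the
  common value of its two quadratic forms; \<open>Ri\<close> is \<open>1 / \<rho>\<close>.\<close>

datatype ex = Cst complex | Ln "complex ^ (3 + 3)" | Ri | Ad ex ex | Mu ex ex

primrec ev :: "ex \<Rightarrow> complex ^ (3 + 3) \<Rightarrow> complex \<Rightarrow> complex" where
  "ev (Cst c) \<xi> \<rho> = c"
| "ev (Ln a) \<xi> \<rho> = (\<Sum>i\<in>UNIV. a $ i * \<xi> $ i)"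
| "ev Ri \<xi> \<rho> = 1 / \<rho>"
| "ev (Ad e f) \<xi> \<rho> = ev e \<xi> \<rho> + ev f \<xi> \<rho>"
| "ev (Mu e f) \<xi> \<rho> = ev e \<xi> \<rho> * ev f \<xi> \<rho>"

text \<open>The formal differential with \<xi>' and \<rho>' as independent increments; that \<rho>
  is tied to \<xi> is put in only when \<open>der\<close> is evaluated.\<close>

primrec dv :: "ex \<Rightarrow> complex ^ (3 + 3) \<Rightarrow> complex \<Rightarrow> complex ^ (3 + 3) \<Rightarrow> complex \<Rightarrow> complex" where
  "dv (Cst c) \<xi> \<rho> \<xi>' \<rho>' = 0"
| "dv (Ln a) \<xi> \<rho> \<xi>' \<rho>' = (\<Sum>i\<in>UNIV. a $ i * \<xi>' $ i)"
| "dv Ri \<xi> \<rho> \<xi>' \<rho>' = - \<rho>' / \<rho>\<^sup>2"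
| "dv (Ad e f) \<xi> \<rho> \<xi>' \<rho>' = dv e \<xi> \<rho> \<xi>' \<rho>' + dv f \<xi> \<rho> \<xi>' \<rho>'"
| "dv (Mu e f) \<xi> \<rho> \<xi>' \<rho>' = dv e \<xi> \<rho> \<xi>' \<rho>' * ev f \<xi> \<rho> + ev e \<xi> \<rho> * dv f \<xi> \<rho> \<xi>' \<rho>'"

text \<open>The derivation given by \<open>dl\<close> on linear forms and by \<open>q\<close> on half the square of \<open>\<rho>\<close>.\<close>

primrec dgen :: "(complex ^ (3 + 3) \<Rightarrow> ex) \<Rightarrow> ex \<Rightarrow> ex \<Rightarrow> ex" where
  "dgen dl q (Cst c) = Cst 0"
| "dgen dl q (Ln a) = dl a"
| "dgen dl q Ri = Mu (Cst (- 1)) (Mu (Mu Ri (Mu Ri Ri)) q)"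
| "dgen dl q (Ad e f) = Ad (dgen dl q e) (dgen dl q f)"
| "dgen dl q (Mu e f) = Ad (Mu (dgen dl q e) f) (Mu e (dgen dl q f))"

lemma dv_add: "dv e \<xi> \<rho> (u + v) (r + s) = dv e \<xi> \<rho> u r + dv e \<xi> \<rho> v s"
  by (induction e) (auto simp: algebra_simps sum.distrib add_divide_distrib diff_divide_distrib)

lemma dv_scale: "dv e \<xi> \<rho> (c *s u) (c * r) = c * dv e \<xi> \<rho> u r"
  by (induction e) (auto simp: algebra_simps sum_distrib_left)

lemma ev_dgen:
  assumes "\<And>a. ev (dl a) \<xi> \<rho> = (\<Sum>i\<in>UNIV. a $ i * v $ i)" "\<rho> \<noteq> 0"
  shows "ev (dgen dl q e) \<xi> \<rho> = dv e \<xi> \<rho> v (ev q \<xi> \<rho> / \<rho>)"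
  using assms(2) by (induction e) (auto simp: assms(1) power2_eq_square)

lemma ev_has_derivative:
  assumes "(\<xi> has_derivative \<xi>') (at x within S)" "(\<rho> has_derivative \<rho>') (at x within S)" "\<rho> x \<noteq> 0"
  shows "((\<lambda>x. ev e (\<xi> x) (\<rho> x)) has_derivative (\<lambda>h. dv e (\<xi> x) (\<rho> x) (\<xi>' h) (\<rho>' h))) (at x within S)"
proof (induction e)
  case (Ln a)
  have "((\<lambda>x. \<Sum>i\<in>UNIV. a $ i * \<xi> x $ i) has_derivative (\<lambda>h. \<Sum>i\<in>UNIV. a $ i * \<xi>' h $ i)) (at x within S)"
    by (intro has_derivative_sum has_derivative_mult_right
        bounded_linear.has_derivative[OF bounded_linear_vec_nth] assms)
  then show ?case by simp
next
  case Ri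
  show ?case
    using has_derivative_divide[OF has_derivative_const[of 1] assms(2,3)] assms(3)
    by (simp add: power2_eq_square divide_inverse mult_ac)
next
  case (Ad e f)
  then show ?case by (auto intro: has_derivative_add)
next
  case (Mu e f)
  then show ?case
    using has_derivative_mult[OF Mu] by (simp add: add.commute)
qed (simp add: has_derivative_const)

lemma ev_has_vector_derivative:
  assumes "(\<xi> has_vector_derivative \<xi>') (at s)" "(\<rho> has_vector_derivative \<rho>') (at s)" "\<rho> s \<noteq> 0"
  shows "((\<lambda>s. ev e (\<xi> s) (\<rho> s)) has_vector_derivative dv e (\<xi> s) (\<rho> s) \<xi>' \<rho>') (at s)"
proof -
  have "dv e (\<xi> s) (\<rho> s) (h *\<^sub>R \<xi>') (h *\<^sub>R \<rho>') = h *\<^sub>R dv e (\<xi> s) (\<rho> s) \<xi>' \<rho>'" for h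
    using dv_scale[of e "\<xi> s" "\<rho> s" "of_real h" \<xi>' \<rho>']
    by (simp add: scaleR_conv_of_real vector_scalar_mult_def scaleR_vec_def)
  then show ?thesis
    using ev_has_derivative[of \<xi> _ s UNIV \<rho> _ e] assms unfolding has_vector_derivative_def by fastforce
qed

definition vx :: "complex ^ (3 + 3) \<Rightarrow> complex ^ 3" where "vx \<xi> = (\<chi> a. \<xi> $ Inl a)"
definition vy :: "complex ^ (3 + 3) \<Rightarrow> complex ^ 3" where "vy \<xi> = (\<chi> a. \<xi> $ Inr a)"

lemma sum_UNIV_plus:
  "(\<Sum>i\<in>(UNIV :: ('a::finite + 'b::finite) set). f i) = (\<Sum>a\<in>UNIV. f (Inl a)) + (\<Sum>b\<in>UNIV. f (Inr b))"
  unfolding UNIV_Plus_UNIV[symmetric] by (subst sum.Plus) (auto simp: o_def)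

definition axl :: "3 \<Rightarrow> complex ^ (3 + 3)" where "axl a = axis (Inl a) 1"

text \<open>The derivation along the vector field \<xi> \<mapsto> - X \<xi>; the sign is there
  because group elements act on functions through their inverses. The second argument of
  \<open>dgen\<close> is x . x' for this field, half the derivative of \<rho>^2.\<close>

definition der :: "complex ^ (3 + 3) ^ (3 + 3) \<Rightarrow> ex \<Rightarrow> ex" where
  "der X = dgen (\<lambda>a. Ln (- (a v* X)))
     (Ad (Mu (Ln (axl 1)) (Ln (- (axl 1 v* X)))) (Ad (Mu (Ln (axl 2)) (Ln (- (axl 2 v* X)))) (Mu (Ln (axl 3)) (Ln (- (axl 3 v* X))))))"

lemma ev_Ln_axl: "(\<Sum>i\<in>UNIV. axl a $ i * \<xi> $ i) = vx \<xi> $ a"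
  by (simp add: axl_def axis_def vx_def if_distrib[of "\<lambda>c. c * _"] cong: if_cong)

lemma sum_vector_matrix:
  fixes X :: "'a::comm_ring_1 ^ 'n ^ 'm"
  shows "(\<Sum>i\<in>UNIV. (a v* X) $ i * \<xi> $ i) = (\<Sum>i\<in>UNIV. a $ i * (X *v \<xi>) $ i)"
  unfolding vector_matrix_mult_def matrix_vector_mult_def
  by (simp add: sum_distrib_left sum_distrib_right, subst sum.swap) (simp add: mult_ac)

lemma sum_minus_vector_matrix:
  fixes X :: "'a::comm_ring_1 ^ 'n ^ 'm"
  shows "(\<Sum>i\<in>UNIV. (- (a v* X)) $ i * \<xi> $ i) = - (\<Sum>i\<in>UNIV. a $ i * (X *v \<xi>) $ i)"
  by (simp add: sum_vector_matrix[symmetric] sum_negf)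

lemma ev_der:
  assumes "\<rho> \<noteq> 0"
  shows "ev (der X e) \<xi> \<rho> = dv e \<xi> \<rho> (- (X *v \<xi>)) (- bl (vx \<xi>) (vx (X *v \<xi>)) / \<rho>)"
proof -
  define q where "q = Ad (Mu (Ln (axl 1)) (Ln (- (axl 1 v* X))))
    (Ad (Mu (Ln (axl 2)) (Ln (- (axl 2 v* X)))) (Mu (Ln (axl 3)) (Ln (- (axl 3 v* X)))))"
  have "ev q \<xi> \<rho> = - bl (vx \<xi>) (vx (X *v \<xi>))"
    by (simp add: q_def sum_vector_matrix ev_Ln_axl bl_3 sum_negf)
  then show ?thesis
    unfolding der_def q_def[symmetric]
    by (subst ev_dgen[where v = "- (X *v \<xi>)"]) (auto simp: sum_vector_matrix sum_negf assms)
qed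

lemma ev_der_add:
  assumes "\<rho> \<noteq> 0"
  shows "ev (der (X + Y) e) \<xi> \<rho> = ev (der X e) \<xi> \<rho> + ev (der Y e) \<xi> \<rho>"
  using assms by (simp add: ev_der dv_add[symmetric] matrix_vector_mult_add_rdistrib bl_3 vx_def algebra_simps
      diff_divide_distrib add_divide_distrib)

lemma ev_der_scale:
  assumes "\<rho> \<noteq> 0"
  shows "ev (der (mscale c X) e) \<xi> \<rho> = c * ev (der X e) \<xi> \<rho>"
proof -
  have "mscale c X *v \<xi> = c *s (X *v \<xi>)"
    by (simp add: vec_eq_iff mscale_def matrix_vector_mult_def sum_distrib_left mult_ac)
  then show ?thesis
    using assms by (simp add: ev_der dv_scale[symmetric] bl_3 vx_def algebra_simps)
qed

lemma matrix_vector_mult_minus: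
  fixes A :: "'a::ring_1 ^ 'n ^ 'm"
  shows "A *v (- x) = - (A *v x)"
  by (simp add: vec_eq_iff matrix_vector_mult_def sum_negf)

lemma bracket_mult: "bracket X Y *v \<xi> = X *v (Y *v \<xi>) - Y *v (X *v \<xi>)"
  by (simp add: bracket_def matrix_vector_mult_diff_rdistrib matrix_vector_mul_assoc)

text \<open>Both sides are derivations in \<open>e\<close>, so the generators decide. On linear
  forms the sign in \<open>der\<close> makes X \<mapsto> der X a homomorphism rather than an
  antihomomorphism; on \<open>Ri\<close> the quadratic terms are symmetric in X and Y and
  cancel.\<close>

lemma ev_der_bracket:
  assumes "\<rho> \<noteq> 0"
  shows "ev (der (bracket X Y) e) \<xi> \<rho> = ev (der X (der Y e)) \<xi> \<rho> - ev (der Y (der X e)) \<xi> \<rho>"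
proof (induction e)
  case (Cst c)
  then show ?case by (simp add: der_def)
next
  case (Ln a)
  have *: "der Y (Ln a) = Ln (- (a v* Y))" for Y a by (simp add: der_def)
  have **: "ev (Ln (- (- (a v* X) v* Y))) \<xi> \<rho> = (\<Sum>i\<in>UNIV. a $ i * (X *v (Y *v \<xi>)) $ i)" for X Y
    by (simp only: ev.simps sum_minus_vector_matrix) (simp add: sum_negf[symmetric] sum_vector_matrix)
  show ?case unfolding * ** by (simp add: sum_vector_matrix bracket_mult right_diff_distrib sum_subtractf sum_negf)
next
  case Ri
  define q where "q X = Ad (Mu (Ln (axl 1)) (Ln (- (axl 1 v* X))))
    (Ad (Mu (Ln (axl 2)) (Ln (- (axl 2 v* X)))) (Mu (Ln (axl 3)) (Ln (- (axl 3 v* X)))))" for X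
  have ev_q: "ev (q X) \<xi> \<rho> = - bl (vx \<xi>) (vx (X *v \<xi>))" for X
    by (simp add: q_def sum_vector_matrix ev_Ln_axl bl_3 sum_negf)
  have vx_minus: "vx (- v) = - vx v" for v by (simp add: vx_def vec_eq_iff)
  have dv_q: "dv (q Y) \<xi> \<rho> (- v) r = bl (vx v) (vx (Y *v \<xi>)) + bl (vx \<xi>) (vx (Y *v v))" for Y v r
    unfolding q_def by (simp only: dv.simps ev.simps sum_minus_vector_matrix ev_Ln_axl vx_minus matrix_vector_mult_minus)
      (simp add: bl_3 ev_Ln_axl vx_minus algebra_simps)
  have der_Ri: "der X Ri = Mu (Cst (- 1)) (Mu (Mu Ri (Mu Ri Ri)) (q X))" for X
    by (simp add: der_def q_def)
  have *: "ev (der X (der Y Ri)) \<xi> \<rho> = 3 * bl (vx \<xi>) (vx (X *v \<xi>)) * bl (vx \<xi>) (vx (Y *v \<xi>)) / \<rho> ^ 5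
      - (bl (vx (X *v \<xi>)) (vx (Y *v \<xi>)) + bl (vx \<xi>) (vx (Y *v (X *v \<xi>)))) / \<rho> ^ 3" for X Y
    unfolding ev_der[OF assms] der_Ri using assms
    by (simp add: dv_q ev_q) (simp add: field_simps power_def numeral_eq_Suc)
  have **: "bl (vx \<xi>) (vx (bracket X Y *v \<xi>)) = bl (vx \<xi>) (vx (X *v (Y *v \<xi>))) - bl (vx \<xi>) (vx (Y *v (X *v \<xi>)))"
    by (simp add: bracket_mult bl_3 vx_def algebra_simps)
  show ?case
    unfolding * unfolding der_Ri using assms
    by (simp add: ev_q ** power3_eq_cube) (simp add: bl_3 field_simps)
next
  case (Ad e f)
  then show ?case by (simp add: der_def)
next
  case (Mu e f)
  have "der X (Mu e f) = Ad (Mu (der X e) f) (Mu e (der X f))" "der X (Ad e f) = Ad (der X e) (der X f)" for X e f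
    by (simp_all add: der_def)
  then show ?case by (simp add: Mu) (simp add: algebra_simps)
qed

text \<open>The degree is a syntactic certificate. A sum requires summands of equal degree, and a
  constant counts as degree 0 even if it is zero.\<close>

inductive homog :: "int \<Rightarrow> ex \<Rightarrow> bool" where
  "homog 0 (Cst c)"
| "homog 1 (Ln a)"
| "homog (- 1) Ri"
| "homog d e \<Longrightarrow> homog d f \<Longrightarrow> homog d (Ad e f)"
| "homog d e \<Longrightarrow> homog d' f \<Longrightarrow> homog (d + d') (Mu e f)"

lemma homog_Mu: "homog d e \<Longrightarrow> homog d' f \<Longrightarrow> d + d' = d'' \<Longrightarrow> homog d'' (Mu e f)"
  using homog.intros(5) by blast

lemma homog_scale: "homog d e \<Longrightarrow> homog d (Mu (Cst c) e)"
  by (rule homog_Mu[OF homog.intros(1)]) auto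

lemma ev_homog:
  assumes "homog d e" "c \<noteq> 0"
  shows "ev e (c *s \<xi>) (c * \<rho>) = c powi d * ev e \<xi> \<rho>"
  using assms
  by (induction) (auto simp: sum_distrib_left mult_ac algebra_simps power_int_add power_int_minus divide_simps)

lemma homog_der: "homog d e \<Longrightarrow> homog d (der X e)"
proof (induction rule: homog.induct)
  case 3
  show ?case unfolding der_def dgen.simps
    by (rule homog_Mu[OF homog.intros(1) homog_Mu[OF homog_Mu[OF homog.intros(3) homog_Mu[OF homog.intros(3,3) refl] refl]
          homog.intros(4)[OF homog_Mu[OF homog.intros(2,2)] homog.intros(4)[OF homog_Mu[OF homog.intros(2,2)] homog_Mu[OF homog.intros(2,2)]]] refl]])
       auto
qed (auto simp: der_def intro: homog.intros)

text \<open>\<open>emb\<close> selects the x- or the y-block. The case distinctions are kept in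
  constant factors, possibly zero, so that all summands have degree l as \<open>homog\<close>
  demands; a zero factor also disarms the truncated j - 1 and j - 2.\<close>

primrec eh :: "(3 \<Rightarrow> 3 + 3) \<Rightarrow> nat \<Rightarrow> nat \<Rightarrow> ex" where
  "eh emb 0 j = Cst (if j = 0 then 1 else 0)"
| "eh emb (Suc l) j =
     Ad (Mu (Ln (axis (emb 1) 1 + \<i> *s axis (emb 2) 1)) (eh emb l j))
    (Ad (Mu (Cst (if 1 \<le> j then 2 else 0)) (Mu (Ln (axis (emb 3) 1)) (eh emb l (j - 1))))
        (Mu (Cst (if 2 \<le> j then - 1 else 0)) (Mu (Ln (axis (emb 1) 1 - \<i> *s axis (emb 2) 1)) (eh emb l (j - 2)))))"

lemma sum_axis: "(\<Sum>i\<in>UNIV. axis k (1::complex) $ i * \<xi> $ i) = \<xi> $ k"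
  by (simp add: axis_def if_distrib[of "\<lambda>c. c * _"] cong: if_cong)

lemma sum_axis2:
  "(\<Sum>i\<in>UNIV. (axis k (1::complex) + \<i> *s axis k' 1) $ i * \<xi> $ i) = \<xi> $ k + \<i> * \<xi> $ k'"
  "(\<Sum>i\<in>UNIV. (axis k (1::complex) - \<i> *s axis k' 1) $ i * \<xi> $ i) = \<xi> $ k - \<i> * \<xi> $ k'"
  by (simp_all add: distrib_right left_diff_distrib sum.distrib sum_subtractf mult.assoc sum_axis
      flip: sum_distrib_left)

lemma he_0: "he 0 j x = (if j = 0 then 1 else 0)"
  by (simp add: he_def)

lemma he_Suc:
  "he (Suc l) j x = (x $ 1 + \<i> * x $ 2) * he l j x + (if 1 \<le> j then 2 * x $ 3 * he l (j - 1) x else 0)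
     + (if 2 \<le> j then - (x $ 1 - \<i> * x $ 2) * he l (j - 2) x else 0)"
  by (simp only: he_def power_Suc sq_def coeff_pCons3_mult)

lemma dhe_Suc:
  "dhe (Suc l) j x v = (v $ 1 + \<i> * v $ 2) * he l j x + (if 1 \<le> j then 2 * v $ 3 * he l (j - 1) x else 0)
     + (if 2 \<le> j then - (v $ 1 - \<i> * v $ 2) * he l (j - 2) x else 0)
     + (x $ 1 + \<i> * x $ 2) * dhe l j x v + (if 1 \<le> j then 2 * x $ 3 * dhe l (j - 1) x v else 0)
     + (if 2 \<le> j then - (x $ 1 - \<i> * x $ 2) * dhe l (j - 2) x v else 0)"
proof -
  have "smult (of_nat (Suc l)) (sq x ^ (Suc l - 1) * sq v)
      = sq v * sq x ^ l + sq x * smult (of_nat l) (sq x ^ (l - 1) * sq v)"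
    by (subst poly_eq_poly_eq_iff[symmetric], rule ext) (cases l; simp add: algebra_simps)
  then have "dhe (Suc l) j x v = coeff (sq v * sq x ^ l) j + coeff (sq x * smult (of_nat l) (sq x ^ (l - 1) * sq v)) j"
    by (simp add: dhe_def)
  also have "\<dots> = ((v $ 1 + \<i> * v $ 2) * he l j x + (if 1 \<le> j then 2 * v $ 3 * he l (j - 1) x else 0)
     + (if 2 \<le> j then - (v $ 1 - \<i> * v $ 2) * he l (j - 2) x else 0))
     + ((x $ 1 + \<i> * x $ 2) * dhe l j x v + (if 1 \<le> j then 2 * x $ 3 * dhe l (j - 1) x v else 0)
     + (if 2 \<le> j then - (x $ 1 - \<i> * x $ 2) * dhe l (j - 2) x v else 0))"
    unfolding he_def dhe_def sq_def[of v] sq_def[of x, THEN arg_cong[where f = "\<lambda>q. q * _"]] coeff_pCons3_mult ..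
  finally show ?thesis by (simp only: add.assoc)
qed

lemma ev_eh: "ev (eh emb l j) \<xi> \<rho> = he l j (\<chi> a. \<xi> $ emb a)"
proof (induction l arbitrary: j)
  case 0
  then show ?case by (simp add: he_0)
next
  case (Suc l)
  show ?case
    unfolding eh.simps ev.simps Suc he_Suc sum_axis sum_axis2
    by (cases "1 \<le> j"; cases "2 \<le> j") (simp_all add: algebra_simps)
qed

lemma dv_eh: "dv (eh emb l j) \<xi> \<rho> \<xi>' \<rho>' = dhe l j (\<chi> a. \<xi> $ emb a) (\<chi> a. \<xi>' $ emb a)"
proof (induction l arbitrary: j)
  case 0
  then show ?case by (simp add: dhe_def)
next
  case (Suc l)
  show ?case
    unfolding eh.simps dv.simps Suc dhe_Suc ev.simps ev_eh sum_axis sum_axis2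
    by (cases "1 \<le> j"; cases "2 \<le> j") (simp_all add: algebra_simps)
qed

lemma homog_eh: "homog (int l) (eh emb l j)"
proof (induction l arbitrary: j)
  case 0
  then show ?case by (simp add: homog.intros)
next
  case (Suc l)
  show ?case unfolding eh.simps
    by (intro homog.intros(4) homog_scale homog_Mu[OF homog.intros(2) Suc]) auto
qed

primrec rp :: "nat \<Rightarrow> ex" where
  "rp 0 = Cst 1"
| "rp (Suc n) = Mu Ri (rp n)"

lemma ev_rp: "ev (rp n) \<xi> \<rho> = 1 / \<rho> ^ n"
  by (induction n) auto

lemma dv_rp: "\<rho> \<noteq> 0 \<Longrightarrow> dv (rp n) \<xi> \<rho> \<xi>' \<rho>' = - of_nat n * \<rho>' / \<rho> ^ (n + 1)"
  by (induction n) (auto simp: ev_rp field_simps power2_eq_square)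

lemma homog_rp: "homog (- int n) (rp n)"
proof (induction n)
  case (Suc n)
  show ?case unfolding rp.simps by (rule homog_Mu[OF homog.intros(3) Suc]) auto
qed (simp add: homog.intros)

definition bx :: "nat \<Rightarrow> nat \<Rightarrow> nat \<Rightarrow> ex" where
  "bx l j k = Mu (Mu (eh Inl l j) (eh Inr l k)) (rp (2 * l + 1))"

lemma ev_bx: "ev (bx l j k) \<xi> \<rho> = he l j (vx \<xi>) * he l k (vy \<xi>) / \<rho> ^ (2 * l + 1)"
  by (simp add: bx_def ev_eh ev_rp vx_def vy_def)

lemma dv_bx:
  assumes "\<rho> \<noteq> 0"
  shows "dv (bx l j k) \<xi> \<rho> \<xi>' \<rho>' =
     (dhe l j (vx \<xi>) (vx \<xi>') * he l k (vy \<xi>) + he l j (vx \<xi>) * dhe l k (vy \<xi>) (vy \<xi>')) / \<rho> ^ (2 * l + 1)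
     - (2 * of_nat l + 1) * he l j (vx \<xi>) * he l k (vy \<xi>) * \<rho>' / \<rho> ^ (2 * l + 2)"
  using assms unfolding bx_def dv.simps ev.simps dv_eh ev_eh dv_rp[OF assms] ev_rp
  by (simp add: vx_def[symmetric] vy_def[symmetric] algebra_simps diff_divide_distrib add_divide_distrib)

lemma homog_bx: "homog (- 1) (bx l j k)"
  unfolding bx_def by (rule homog_Mu[OF homog_Mu[OF homog_eh homog_eh refl] homog_rp]) auto

section \<open>The Lie algebra \<open>so33C\<close>\<close>

primrec sgn33 :: "3 + 3 \<Rightarrow> 'a::ring_1" where
  "sgn33 (Inl a) = 1"
| "sgn33 (Inr a) = - 1"

lemma J33_entry: "J33 $ i $ j = (if i = j then sgn33 i else 0)"
  by (cases i) (auto simp: J33_def)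

lemma so_form_entry:
  fixes X :: "'a::comm_ring_1 ^ (3 + 3) ^ (3 + 3)"
  shows "(transpose X ** J33 + J33 ** X) $ i $ j = sgn33 j * X $ j $ i + sgn33 i * X $ i $ j"
  by (simp add: matrix_matrix_mult_def J33_entry transpose_def if_distrib if_distribR mult.commute cong: if_cong)

lemma so33C_iff: "X \<in> so33C \<longleftrightarrow> (\<forall>i j. sgn33 j * X $ j $ i + sgn33 i * X $ i $ j = 0)"
  unfolding so33C_def by (simp add: vec_eq_iff so_form_entry[unfolded vector_add_component])

lemma so33_iff: "X \<in> so33 \<longleftrightarrow> (\<forall>i j. sgn33 j * X $ j $ i + sgn33 i * X $ i $ j = 0)"
  unfolding so33_def by (simp add: vec_eq_iff so_form_entry[unfolded vector_add_component])

lemma so33C_add: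
  assumes "X \<in> so33C" "Y \<in> so33C"
  shows "X + Y \<in> so33C"
  unfolding so33C_iff
proof (intro allI)
  fix i j
  have "sgn33 j * (X + Y) $ j $ i + sgn33 i * (X + Y) $ i $ j
      = (sgn33 j * X $ j $ i + sgn33 i * X $ i $ j) + (sgn33 j * Y $ j $ i + sgn33 i * Y $ i $ j)"
    by (simp add: algebra_simps)
  then show "sgn33 j * (X + Y) $ j $ i + sgn33 i * (X + Y) $ i $ j = 0"
    using assms by (simp add: so33C_iff)
qed

lemma so33C_scale:
  assumes "X \<in> so33C"
  shows "mscale c X \<in> so33C"
  unfolding so33C_iff
proof (intro allI)
  fix i j
  have "sgn33 j * mscale c X $ j $ i + sgn33 i * mscale c X $ i $ j
      = c * (sgn33 j * X $ j $ i + sgn33 i * X $ i $ j)"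
    by (simp add: mscale_def algebra_simps)
  then show "sgn33 j * mscale c X $ j $ i + sgn33 i * mscale c X $ i $ j = 0"
    using assms by (simp add: so33C_iff)
qed

lemma so33C_bracket:
  assumes "X \<in> so33C" "Y \<in> so33C"
  shows "bracket X Y \<in> so33C"
proof -
  have s: "sgn33 i * sgn33 i = (1 :: complex)" for i by (cases i) auto
  have X: "X $ j $ i = - sgn33 i * sgn33 j * X $ i $ j" if "X \<in> so33C" for X :: "complex ^ (3 + 3) ^ (3 + 3)" and i j
  proof -
    have "sgn33 j * (sgn33 j * X $ j $ i + sgn33 i * X $ i $ j) = 0"
      using that by (simp add: so33C_iff)
    then show ?thesis
      by (simp add: distrib_left mult.assoc[symmetric] s add_eq_0_iff2)
  qed
  have *: "sgn33 j * (X ** Y) $ j $ i = sgn33 i * (Y ** X) $ i $ j" if X': "X \<in> so33C" "Y \<in> so33C"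
    for X Y :: "complex ^ (3 + 3) ^ (3 + 3)" and i j
  proof -
    have "sgn33 j * (X $ j $ k * Y $ k $ i) = sgn33 i * (Y $ i $ k * X $ k $ j)" for k
    proof -
      have "sgn33 j * (X $ j $ k * Y $ k $ i)
          = (sgn33 j * sgn33 j) * (sgn33 k * sgn33 k) * sgn33 i * (X $ k $ j * Y $ i $ k)"
        unfolding X[OF X'(1), of j k] X[OF X'(2), of k i] by (simp add: mult_ac)
      then show ?thesis by (simp add: s mult_ac)
    qed
    then show ?thesis by (simp add: matrix_matrix_mult_def sum_distrib_left)
  qed
  show ?thesis
    unfolding so33C_iff
  proof (intro allI)
    fix i j
    show "sgn33 j * bracket X Y $ j $ i + sgn33 i * bracket X Y $ i $ j = 0"
      using *[OF assms, of j i] *[OF assms(2,1), of j i]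
      by (simp add: bracket_def right_diff_distrib)
  qed
qed

text \<open>The Lie algebra splits into two copies of so(3), acting by the cross products with
  \<open>w\<close> and \<open>w'\<close>, and the boosts \<open>B\<close>, which mix the two blocks
  symmetrically.\<close>

definition gX :: "complex ^ 3 \<Rightarrow> complex ^ 3 \<Rightarrow> complex ^ 3 ^ 3 \<Rightarrow> complex ^ (3 + 3) ^ (3 + 3)" where
  "gX w w' B = (\<chi> i j. case i of
      Inl a \<Rightarrow> (case j of Inl b \<Rightarrow> crs w (axis b 1) $ a | Inr b \<Rightarrow> B $ a $ b)
    | Inr a \<Rightarrow> (case j of Inl b \<Rightarrow> B $ b $ a | Inr b \<Rightarrow> crs w' (axis b 1) $ a))"

lemma crs_entries:
  "crs w x $ 1 = w $ 2 * x $ 3 - w $ 3 * x $ 2"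
  "crs w x $ 2 = w $ 3 * x $ 1 - w $ 1 * x $ 3"
  "crs w x $ 3 = w $ 1 * x $ 2 - w $ 2 * x $ 1"
  by (simp_all add: crs_def)

lemma gX_mult:
  "vx (gX w w' B *v \<xi>) = crs w (vx \<xi>) + B *v vy \<xi>"
  "vy (gX w w' B *v \<xi>) = crs w' (vy \<xi>) + transpose B *v vx \<xi>"
  by (simp_all add: vec_eq_iff vx_def vy_def gX_def matrix_vector_mult_def sum_UNIV_plus transpose_def
      forall_3 sum_3 crs_entries axis_def)

lemma all_plus: "(\<forall>i. P i) \<longleftrightarrow> (\<forall>a. P (Inl a)) \<and> (\<forall>b. P (Inr b))"
  by (metis sum.exhaust)

lemma gX_in_so33C: "gX w w' B \<in> so33C"
  unfolding so33C_iff
by (simp add: all_plus forall_3 gX_def crs_entries axis_def)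

lemma so33C_gX:
  assumes "X \<in> so33C"
  obtains w w' B where "X = gX w w' B"
proof -
  let ?w = "vector [X $ Inl 3 $ Inl 2, X $ Inl 1 $ Inl 3, X $ Inl 2 $ Inl 1] :: complex ^ 3"
  let ?w' = "vector [X $ Inr 3 $ Inr 2, X $ Inr 1 $ Inr 3, X $ Inr 2 $ Inr 1] :: complex ^ 3"
  note X = assms[unfolded so33C_iff, rule_format]
  have l: "X $ Inl b $ Inl a + X $ Inl a $ Inl b = 0" and m: "- X $ Inr b $ Inl a + X $ Inl a $ Inr b = 0" for a b
    using X[of "Inl b" "Inl a"] X[of "Inl a" "Inr b"] by simp_all
  have r: "X $ Inr b $ Inr a + X $ Inr a $ Inr b = 0" for a b
  proof -
    have "- (X $ Inr b $ Inr a + X $ Inr a $ Inr b) = 0"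
      using X[of "Inr a" "Inr b"] by simp
    then show ?thesis by (simp only: neg_equal_0_iff_equal)
  qed
  have m': "X $ Inr b $ Inl a = X $ Inl a $ Inr b" for a b
    using m[of b a] by (simp add: add_eq_0_iff)
  have d: "X $ Inl a $ Inl a = 0" "X $ Inr a $ Inr a = 0" for a
    using l[of a a] r[of a a] by (simp_all flip: mult_2)
  have o: "X $ Inl 1 $ Inl 2 = - X $ Inl 2 $ Inl 1" "X $ Inl 3 $ Inl 1 = - X $ Inl 1 $ Inl 3"
    "X $ Inl 2 $ Inl 3 = - X $ Inl 3 $ Inl 2" "X $ Inr 1 $ Inr 2 = - X $ Inr 2 $ Inr 1"
    "X $ Inr 3 $ Inr 1 = - X $ Inr 1 $ Inr 3" "X $ Inr 2 $ Inr 3 = - X $ Inr 3 $ Inr 2"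
    by (rule eq_neg_iff_add_eq_0[THEN iffD2], use l r in \<open>simp add: add.commute\<close>)+
  have "X = gX ?w ?w' (\<chi> a b. X $ Inl a $ Inr b)"
    by (simp add: vec_eq_iff all_plus forall_3 gX_def crs_entries axis_def m' d o)
  then show ?thesis by (rule that)
qed

section \<open>Realizations of the cone\<close>

text \<open>By \<open>bl_mult_he\<close> both products have the form S + \<rho>^2 u / c and T +
  \<rho>^2 v / c with c = 2 l + 1. The mixed terms S v and u T cancel precisely because the exponent
  of 1/\<rho> is 2 l + 1. Only the levels l - 1 and l + 1 remain, which is why the functions
  \<open>bx\<close> span an invariant space.\<close>

lemma boost_bx:
  assumes "\<rho> \<noteq> 0" "bl x x = \<rho>\<^sup>2" "bl y y = \<rho>\<^sup>2"
  shows "(bl w' y * dhe l j x w * he l k y + bl w x * he l j x * dhe l k y w') / \<rho> ^ (2 * l + 1)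
      - (2 * of_nat l + 1) * he l j x * he l k y * (bl w x * bl w' y / \<rho>) / \<rho> ^ (2 * l + 2)
    = dhe l j x w * dhe l k y w' / ((2 * of_nat l + 1) * \<rho> ^ (2 * (l - 1) + 1))
      - (2 * of_nat l + 1) * (she l j w x * she l k w' y) / \<rho> ^ (2 * (l + 1) + 1)"
proof -
  define c :: complex where "c = 2 * of_nat l + 1"
  have c: "c \<noteq> 0" by (simp add: c_def) (metis of_nat_1 of_nat_add of_nat_eq_0_iff of_nat_mult of_nat_numeral add_is_0 one_neq_zero)
  define a b u v where "a = he l j x" "b = he l k y" "u = dhe l j x w" "v = dhe l k y w'"
  have A: "bl w x * a = she l j w x + \<rho>\<^sup>2 / c * u" and B: "bl w' y * b = she l k w' y + \<rho>\<^sup>2 / c * v"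
    using bl_mult_he[of w x l j] bl_mult_he[of w' y l k] assms(2,3)
    by (simp_all add: a_b_u_v_def c_def)
  \<comment> \<open>For l = 0 the truncated exponent on the left is harmless, since u and v
    vanish.\<close>
  have uv: "u * v / (c * \<rho> ^ (2 * (l - 1) + 1)) = u * v * \<rho>\<^sup>2 / (c * \<rho> ^ (2 * l + 1))"
    using assms(1) by (cases l) (simp_all add: a_b_u_v_def dhe_def power2_eq_square)
  have "(bl w' y * u * b + bl w x * a * v) / \<rho> ^ (2 * l + 1) - c * a * b * (bl w x * bl w' y / \<rho>) / \<rho> ^ (2 * l + 2)
     = (u * (bl w' y * b) + (bl w x * a) * v) / \<rho> ^ (2 * l + 1) - c * (bl w x * a) * (bl w' y * b) / \<rho> ^ (2 * l + 3)"
    by (simp add: mult_ac power_add numeral_3_eq_3)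
  also have "\<dots> = u * v * \<rho>\<^sup>2 / (c * \<rho> ^ (2 * l + 1)) - c * (she l j w x * she l k w' y) / \<rho> ^ (2 * l + 3)"
  proof -
    have "(u * (T + r / c * v) + (S + r / c * u) * v) / P - c * (S + r / c * u) * (T + r / c * v) / (P * r)
      = u * v * r / (c * P) - c * (S * T) / (P * r)" if "P \<noteq> 0" "r \<noteq> 0" for P r S T :: complex
      using that c by (simp add: field_simps)
    moreover have "\<rho> ^ (2 * l + 3) = \<rho> ^ (2 * l + 1) * \<rho>\<^sup>2"
      by (simp add: power_add power2_eq_square power3_eq_cube)
    ultimately show ?thesis using assms(1) unfolding A B by simp
  qed
  finally show ?thesis
    unfolding a_b_u_v_def[symmetric] c_def[symmetric] uv by (simp add: numeral_3_eq_3)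
qed

text \<open>\<open>opr\<close> is constrained only on functions that come from expressions of degree
  -1; nothing is said about its values elsewhere. Its linearity on \<open>U\<close> therefore has to
  be derived by lifting functions to expressions.\<close>

locale cone_realization =
  fixes D :: "'x set" and tau :: "'x \<Rightarrow> (complex ^ (3 + 3)) \<times> complex"
    and opr :: "complex ^ (3 + 3) ^ (3 + 3) \<Rightarrow> ('x \<Rightarrow> complex) \<Rightarrow> 'x \<Rightarrow> complex"
  assumes D_ne: "D \<noteq> {}"
    and cone: "\<And>p. p \<in> D \<Longrightarrow> snd (tau p) \<noteq> 0 \<and> bl (vx (fst (tau p))) (vx (fst (tau p))) = (snd (tau p))\<^sup>2
        \<and> bl (vy (fst (tau p))) (vy (fst (tau p))) = (snd (tau p))\<^sup>2"
    and opr: "\<And>X e. X \<in> so33C \<Longrightarrow> homog (- 1) e \<Longrightarrow>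
        opr X (\<lambda>p. if p \<in> D then ev e (fst (tau p)) (snd (tau p)) else 0)
        = (\<lambda>p. if p \<in> D then ev (der X e) (fst (tau p)) (snd (tau p)) else 0)"
begin

definition evx :: "ex \<Rightarrow> 'x \<Rightarrow> complex" where
  "evx e = (\<lambda>p. if p \<in> D then ev e (fst (tau p)) (snd (tau p)) else 0)"

definition b :: "nat \<Rightarrow> nat \<Rightarrow> nat \<Rightarrow> 'x \<Rightarrow> complex" where
  "b l j k = evx (bx l j k)"

definition U :: "('x \<Rightarrow> complex) set" where
  "U = fn.span (range (\<lambda>(l, j, k). b l j k))"

lemma opr_evx: "X \<in> so33C \<Longrightarrow> homog (- 1) e \<Longrightarrow> opr X (evx e) = evx (der X e)"
  unfolding evx_def by (rule opr)

lemma subspace_U: "fn.subspace U"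
  by (simp add: U_def)

lemma b_in_U: "b l j k \<in> U"
  unfolding U_def by (rule fn.span_base) (auto intro: image_eqI[of _ _ "(l, j, k)"])

lemma b_apply: "p \<in> D \<Longrightarrow> b l j k p =
    he l j (vx (fst (tau p))) * he l k (vy (fst (tau p))) / snd (tau p) ^ (2 * l + 1)"
  and b_outside: "p \<notin> D \<Longrightarrow> b l j k p = 0"
  by (simp_all add: b_def evx_def ev_bx)

lemma b_eq_0: "2 * l < j \<or> 2 * l < k \<Longrightarrow> b l j k = 0"
  by (auto simp: b_def evx_def ev_bx he_eq_0)

lemma U_prod:
  assumes "f \<in> LH l" "g \<in> LH l"
  shows "(\<lambda>p. if p \<in> D then f (vx (fst (tau p))) * g (vy (fst (tau p))) / snd (tau p) ^ (2 * l + 1) else 0) \<in> U"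
    (is "?F f g \<in> U")
proof -
  have 1: "?F (he l j) g \<in> U" for j
    using assms(2) unfolding LH_def
  proof (induction rule: fn.span_induct_alt)
    case base
    have "?F (he l j) 0 = 0" by auto
    then show ?case using fn.subspace_0[OF subspace_U] by simp
  next
    case (step c h g)
    then obtain k where k: "h = he l k" by auto
    have "?F (he l j) (fscale c h + g) = fscale c (b l j k) + ?F (he l j) g"
      by (rule ext) (simp add: k b_apply b_outside fscale_apply algebra_simps add_divide_distrib)
    then show ?case using step b_in_U
      by (auto intro!: fn.subspace_add[OF subspace_U] fn.subspace_scale[OF subspace_U])
  qed
  show ?thesis
    using assms(1) unfolding LH_def
  proof (induction rule: fn.span_induct_alt)
    case base
    have "?F 0 g = 0" by auto
    then show ?case using fn.subspace_0[OF subspace_U] by simp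
  next
    case (step c h f)
    then obtain j where j: "h = he l j" by auto
    have "?F (fscale c h + f) g = fscale c (?F (he l j) g) + ?F f g"
      by (rule ext) (simp add: j fscale_apply algebra_simps add_divide_distrib)
    then show ?case using step 1[of j]
      by (auto intro!: fn.subspace_add[OF subspace_U] fn.subspace_scale[OF subspace_U])
  qed
qed

text \<open>The rotations keep the level l. Decomposing \<open>B\<close> into matrix units reduces
  the boost part to \<open>boost_bx\<close> for coordinate vectors.\<close>

lemma ev_der_gX:
  assumes "p \<in> D"
  defines "x \<equiv> vx (fst (tau p))" and "y \<equiv> vy (fst (tau p))" and "\<rho> \<equiv> snd (tau p)"
  shows "evx (der (gX w w' B) (bx l j k)) p =
    - (dhe l j x (crs w x) * he l k y + he l j x * dhe l k y (crs w' y)) / \<rho> ^ (2 * l + 1)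
    - (\<Sum>a\<in>UNIV. \<Sum>c\<in>UNIV. B $ a $ c *
        (dhe l j x (axis a 1) * dhe l k y (axis c 1) / ((2 * of_nat l + 1) * \<rho> ^ (2 * (l - 1) + 1))
      - (2 * of_nat l + 1) * (she l j (axis a 1) x * she l k (axis c 1) y) / \<rho> ^ (2 * (l + 1) + 1)))"
proof -
  have c: "\<rho> \<noteq> 0" "bl x x = \<rho>\<^sup>2" "bl y y = \<rho>\<^sup>2"
    using cone[OF assms(1)] by (auto simp: x_def y_def \<rho>_def)
  have bl_axis: "bl (axis a 1) z = z $ a" for a z
    by (simp add: bl_def sum_axis)
  have vec: "z = (\<Sum>a\<in>UNIV. z $ a *s axis a 1)" for z :: "complex ^ 3"
    by (simp add: basis_expansion)
  have By: "B *v y = (\<Sum>a\<in>UNIV. \<Sum>c\<in>UNIV. (B $ a $ c * y $ c) *s axis a 1)"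
    by (subst vec) (simp add: matrix_vector_mult_def vector_scalar_mult_def sum_distrib_right vec_eq_iff sum_component)
  have Bx: "transpose B *v x = (\<Sum>a\<in>UNIV. \<Sum>c\<in>UNIV. (B $ a $ c * x $ a) *s axis c 1)"
    by (subst sum.swap, subst vec) (simp add: matrix_vector_mult_def transpose_def sum_distrib_right vec_eq_iff sum_component)
  have blB: "bl x (crs w x + B *v y) = (\<Sum>a\<in>UNIV. \<Sum>c\<in>UNIV. B $ a $ c * (x $ a * y $ c))"
    by (simp add: bl_3 crs_entries matrix_vector_mult_def sum_3 algebra_simps)
  have d1: "dhe l j x (crs w x + B *v y) = dhe l j x (crs w x) + (\<Sum>a\<in>UNIV. \<Sum>c\<in>UNIV. B $ a $ c * (y $ c * dhe l j x (axis a 1)))"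
    unfolding dhe_add By dhe_sum dhe_scale by (simp add: mult.assoc)
  have d2: "dhe l k y (crs w' y + transpose B *v x) = dhe l k y (crs w' y) + (\<Sum>a\<in>UNIV. \<Sum>c\<in>UNIV. B $ a $ c * (x $ a * dhe l k y (axis c 1)))"
    unfolding dhe_add Bx dhe_sum dhe_scale by (simp add: mult.assoc)
  have dm: "dhe l j x (- v) = - dhe l j x v" for l j x v
    using dhe_scale[of l j x "- 1" v] by simp
  have vm: "vx (- v) = - vx v" "vy (- v) = - vy v" for v
    by (simp_all add: vx_def vy_def vec_eq_iff)
  have "evx (der (gX w w' B) (bx l j k)) p =
     - (dhe l j x (crs w x + B *v y) * he l k y + he l j x * dhe l k y (crs w' y + transpose B *v x)) / \<rho> ^ (2 * l + 1)
     + (2 * of_nat l + 1) * he l j x * he l k y * (bl x (crs w x + B *v y) / \<rho>) / \<rho> ^ (2 * l + 2)"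
  proof -
    have "evx (der (gX w w' B) (bx l j k)) p
        = dv (bx l j k) (fst (tau p)) \<rho> (- (gX w w' B *v fst (tau p))) (- bl x (crs w x + B *v y) / \<rho>)"
      using c(1) assms(1) by (simp add: evx_def ev_der gX_mult flip: x_def y_def \<rho>_def)
    also have "\<dots> = (- dhe l j x (crs w x + B *v y) * he l k y + he l j x * - dhe l k y (crs w' y + transpose B *v x)) / \<rho> ^ (2 * l + 1)
        - (2 * of_nat l + 1) * he l j x * he l k y * (- bl x (crs w x + B *v y) / \<rho>) / \<rho> ^ (2 * l + 2)"
      unfolding dv_bx[OF c(1)] vm gX_mult dm x_def[symmetric] y_def[symmetric] ..
    finally show ?thesis
      by (simp add: add_divide_distrib diff_divide_distrib)
  qed
  also have "\<dots> = - (dhe l j x (crs w x) * he l k y + he l j x * dhe l k y (crs w' y)) / \<rho> ^ (2 * l + 1)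
    - (\<Sum>a\<in>UNIV. \<Sum>c\<in>UNIV. B $ a $ c * (
       (bl (axis c 1) y * dhe l j x (axis a 1) * he l k y + bl (axis a 1) x * he l j x * dhe l k y (axis c 1)) / \<rho> ^ (2 * l + 1)
      - (2 * of_nat l + 1) * he l j x * he l k y * (bl (axis a 1) x * bl (axis c 1) y / \<rho>) / \<rho> ^ (2 * l + 2)))"
    unfolding d1 d2 blB bl_axis
    by (simp add: sum_3) (simp add: algebra_simps add_divide_distrib diff_divide_distrib)
  also have "\<dots> = - (dhe l j x (crs w x) * he l k y + he l j x * dhe l k y (crs w' y)) / \<rho> ^ (2 * l + 1)
    - (\<Sum>a\<in>UNIV. \<Sum>c\<in>UNIV. B $ a $ c *
        (dhe l j x (axis a 1) * dhe l k y (axis c 1) / ((2 * of_nat l + 1) * \<rho> ^ (2 * (l - 1) + 1))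
      - (2 * of_nat l + 1) * (she l j (axis a 1) x * she l k (axis c 1) y) / \<rho> ^ (2 * (l + 1) + 1)))"
    unfolding boost_bx[OF c] ..
  finally show ?thesis .
qed

lemma evx_der_bx_in_U:
  assumes "X \<in> so33C"
  shows "evx (der X (bx l j k)) \<in> U"
proof -
  obtain w w' B where X: "X = gX w w' B"
    using so33C_gX[OF assms] .
  let ?P = "\<lambda>n f g p. if p \<in> D then f (vx (fst (tau p))) * g (vy (fst (tau p))) / snd (tau p) ^ (2 * n + 1) else 0"
  have eq: "evx (der X (bx l j k)) =
     fscale (- 1) (?P l (\<lambda>x. dhe l j x (crs w x)) (he l k)) + fscale (- 1) (?P l (he l j) (\<lambda>y. dhe l k y (crs w' y)))
     + (\<Sum>a\<in>UNIV. \<Sum>c\<in>UNIV.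
         fscale (- B $ a $ c / (2 * of_nat l + 1)) (?P (l - 1) (\<lambda>x. dhe l j x (axis a 1)) (\<lambda>y. dhe l k y (axis c 1)))
       + fscale (B $ a $ c * (2 * of_nat l + 1)) (?P (l + 1) (she l j (axis a 1)) (she l k (axis c 1))))"
    (is "_ = ?R")
  proof
    fix p
    show "evx (der X (bx l j k)) p = ?R p"
    proof (cases "p \<in> D")
      case True
      let ?x = "vx (fst (tau p))" and ?y = "vy (fst (tau p))" and ?r = "snd (tau p)"
      have t: "(fscale (- B $ a $ c / (2 * of_nat l + 1)) (?P (l - 1) (\<lambda>x. dhe l j x (axis a 1)) (\<lambda>y. dhe l k y (axis c 1)))
          + fscale (B $ a $ c * (2 * of_nat l + 1)) (?P (l + 1) (she l j (axis a 1)) (she l k (axis c 1)))) p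
        = - (B $ a $ c * (dhe l j ?x (axis a 1) * dhe l k ?y (axis c 1) / ((2 * of_nat l + 1) * ?r ^ (2 * (l - 1) + 1))
          - (2 * of_nat l + 1) * (she l j (axis a 1) ?x * she l k (axis c 1) ?y) / ?r ^ (2 * (l + 1) + 1)))" for a c
      proof -
        have "- B $ a $ c / n * (u / P) + B $ a $ c * n * (v / Q) = - (B $ a $ c * (u / (n * P) - n * v / Q))"
          for n u v P Q :: complex by (simp add: right_diff_distrib)
        then show ?thesis by (simp only: plus_fun_apply fscale_apply True if_True)
      qed
      have "?R p = fscale (- 1) (?P l (\<lambda>x. dhe l j x (crs w x)) (he l k)) p + fscale (- 1) (?P l (he l j) (\<lambda>y. dhe l k y (crs w' y))) p
        + (\<Sum>a\<in>UNIV. \<Sum>c\<in>UNIV.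
          (fscale (- B $ a $ c / (2 * of_nat l + 1)) (?P (l - 1) (\<lambda>x. dhe l j x (axis a 1)) (\<lambda>y. dhe l k y (axis c 1)))
          + fscale (B $ a $ c * (2 * of_nat l + 1)) (?P (l + 1) (she l j (axis a 1)) (she l k (axis c 1)))) p)"
        by (simp only: plus_fun_apply sum_fun_apply)
      also have "\<dots> = evx (der X (bx l j k)) p"
        unfolding X ev_der_gX[OF True] t sum_negf
        by (simp only: fscale_apply True if_True) (simp add: add_divide_distrib diff_divide_distrib)
      finally show ?thesis ..
    next
      case False
      then show ?thesis by (simp add: evx_def sum_fun_apply fscale_apply)
    qed
  qed
  show ?thesis unfolding eq
    by (intro fn.subspace_add[OF subspace_U] fn.subspace_sum[OF subspace_U] fn.subspace_scale[OF subspace_U]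
        U_prod dhe_crs_LH he_in_LH dhe_LH she_LH)
qed

text \<open>An element of \<open>U\<close> has many expressions, but \<open>opr\<close> depends only
  on the function, so any representative may be used. Identities proved for \<open>der\<close>
  thereby descend to operators on \<open>U\<close>.\<close>

lemma U_rep:
  assumes "f \<in> U"
  obtains e where "homog (- 1) e" "f = evx e" "\<And>X. X \<in> so33C \<Longrightarrow> evx (der X e) \<in> U"
proof -
  have "\<exists>e. homog (- 1) e \<and> f = evx e \<and> (\<forall>X\<in>so33C. evx (der X e) \<in> U)"
    using assms unfolding U_def
  proof (induction rule: fn.span_induct_alt)
    case base
    have "homog (- 1) (Mu (Cst 0) (bx 0 0 0))" by (intro homog_scale homog_bx)
    moreover have "0 = evx (Mu (Cst 0) (bx 0 0 0))" by (auto simp: evx_def)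
    moreover have "evx (der X (Mu (Cst 0) (bx 0 0 0))) = 0" for X by (auto simp: evx_def der_def)
    ultimately show ?case using fn.subspace_0[OF subspace_U] by (metis U_def)
  next
    case (step c h f)
    then obtain l j k where h: "h = b l j k" by auto
    from step obtain e where e: "homog (- 1) e" "f = evx e" "\<And>X. X \<in> so33C \<Longrightarrow> evx (der X e) \<in> U"
      by (auto simp: U_def)
    let ?e = "Ad (Mu (Cst c) (bx l j k)) e"
    have "homog (- 1) ?e" using e(1) by (intro homog.intros(4) homog_scale homog_bx)
    moreover have "fscale c h + f = evx ?e" by (auto simp: h b_def e(2) evx_def fscale_apply)
    moreover have "evx (der X ?e) \<in> U" if "X \<in> so33C" for X
    proof -
      have "evx (der X ?e) = fscale c (evx (der X (bx l j k))) + evx (der X e)"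
        by (auto simp: evx_def fscale_apply der_def)
      then show ?thesis
        by (simp only: fn.subspace_add[OF subspace_U] fn.subspace_scale[OF subspace_U]
            e(3)[OF that] evx_der_bx_in_U[OF that])
    qed
    ultimately show ?case by (auto simp: U_def)
  qed
  then show ?thesis using that by blast
qed

lemma opr_in_U: "X \<in> so33C \<Longrightarrow> f \<in> U \<Longrightarrow> opr X f \<in> U"
  by (metis U_rep opr_evx)

lemma opr_add:
  assumes "X \<in> so33C" "f \<in> U" "g \<in> U"
  shows "opr X (f + g) = opr X f + opr X g"
proof -
  obtain e e' where e: "homog (- 1) e" "f = evx e" and e': "homog (- 1) e'" "g = evx e'"
    using U_rep assms(2,3) by metis
  have "f + g = evx (Ad e e')" by (auto simp: e e' evx_def)
  then show ?thesis
    using e e' assms(1) by (auto simp: opr_evx homog.intros) (auto simp: evx_def der_def)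
qed

lemma opr_scale:
  assumes "X \<in> so33C" "f \<in> U"
  shows "opr X (fscale c f) = fscale c (opr X f)"
proof -
  obtain e where e: "homog (- 1) e" "f = evx e"
    using U_rep assms(2) by metis
  have "fscale c f = evx (Mu (Cst c) e)" by (auto simp: e evx_def fscale_apply)
  then show ?thesis
    using e assms(1) by (auto simp: opr_evx homog_scale) (auto simp: evx_def der_def fscale_apply)
qed

theorem lie_module_U: "lie_module so33C U opr"
  unfolding lie_module_def
proof (intro conjI ballI allI)
  fix X Y v assume X: "X \<in> so33C" and Y: "Y \<in> so33C" and v: "v \<in> U"
  obtain e where e: "homog (- 1) e" "v = evx e" using U_rep[OF v] by metis
  note n = opr_evx[OF X] opr_evx[OF Y] opr_evx[OF so33C_add[OF X Y]] opr_evx[OF so33C_bracket[OF X Y]]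
    homog_der e(1)
  show "opr (X + Y) v = opr X v + opr Y v"
    using cone by (auto simp: e(2) n) (auto simp: evx_def ev_der_add)
  show "opr (bracket X Y) v = opr X (opr Y v) - opr Y (opr X v)"
    using cone by (auto simp: e(2) n) (auto simp: evx_def ev_der_bracket)
next
  fix X c v assume X: "X \<in> so33C" and v: "v \<in> U"
  obtain e where e: "homog (- 1) e" "v = evx e" using U_rep[OF v] by metis
  show "opr (mscale c X) v = fscale c (opr X v)"
    using cone by (auto simp: e opr_evx[OF X] opr_evx[OF so33C_scale[OF X]])
      (auto simp: evx_def ev_der_scale fscale_apply)
qed (auto simp: subspace_U opr_in_U opr_add opr_scale)

section \<open>Raising, lowering and level-changing operators\<close>

text \<open>All vectors used are isotropic. (i, 1, 0) makes \<open>alp\<close> equal to 1 and (-i,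
  1, 0) makes it u^2, so up to sign the operators F and E act on the generating polynomial as d/du
  and u^2 d/du - 2 l u. For \<open>opM\<close> the vector (1, -i, 0) has constant \<open>sq\<close>,
  so differentiation and harmonic multiplication along it merely shift indices.\<close>

definition "opF1 = opr (gX (vector [\<i>, 1, 0]) 0 0)"
definition "opE1 = opr (gX (vector [- \<i>, 1, 0]) 0 0)"
definition "opF2 = opr (gX 0 (vector [\<i>, 1, 0]) 0)"
definition "opE2 = opr (gX 0 (vector [- \<i>, 1, 0]) 0)"
definition "opM = opr (gX 0 0 (\<chi> a c. (vector [1, - \<i>, 0] :: complex ^ 3) $ a * (vector [1, - \<i>, 0] :: complex ^ 3) $ c))"

lemma alp_F: "alp (vector [\<i>, 1, 0]) = 1"
  and alp_E: "alp (vector [- \<i>, 1, 0]) = [:0, 0, 1:]"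
  by (simp_all add: alp_def one_pCons)

lemma crs_0: "crs 0 x = 0"
  by (simp add: vec_eq_iff forall_3 crs_entries)

lemma dhe_0: "dhe l j x 0 = 0"
  using dhe_scale[of l j x 0 0] by simp

lemma dhe_F: "dhe l j x (crs (vector [\<i>, 1, 0]) x) = of_nat (Suc j) * he l (Suc j) x"
  by (simp add: dhe_crs alp_F coeff_pderiv he_def del: of_nat_Suc)

lemma dhe_E: "dhe l j x (crs (vector [- \<i>, 1, 0]) x)
    = (if j = 0 then 0 else (of_nat (j - 1) - 2 * of_nat l) * he l (j - 1) x)"
proof -
  have "pderiv [:0, 0, 1::complex:] = [:0, 2, 0:]" by (simp add: pderiv_pCons)
  then have "dhe l j x (crs (vector [- \<i>, 1, 0]) x)
      = coeff ([:0, 0, 1:] * pderiv (sq x ^ l)) j - of_nat l * coeff ([:0, 2, 0:] * sq x ^ l) j"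
    unfolding dhe_crs alp_E by (simp only: coeff_diff coeff_smult)
  also have "\<dots> = (if 2 \<le> j then coeff (pderiv (sq x ^ l)) (j - 2) else 0) - of_nat l * (if 1 \<le> j then 2 * he l (j - 1) x else 0)"
    unfolding coeff_pCons3_mult he_def by simp
  also have "\<dots> = (if j = 0 then 0 else (of_nat (j - 1) - 2 * of_nat l) * he l (j - 1) x)"
    by (cases j; cases "j - 1") (auto simp: coeff_pderiv he_def algebra_simps)
  finally show ?thesis .
qed

lemma opF1_b: "opF1 (b l j k) = fscale (- of_nat (Suc j)) (b l (Suc j) k)"
  and opF2_b: "opF2 (b l j k) = fscale (- of_nat (Suc k)) (b l j (Suc k))"
  and opE1_b: "opE1 (b l j k) = fscale (if j = 0 then 0 else 2 * of_nat l - of_nat (j - 1)) (b l (j - 1) k)"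
  and opE2_b: "opE2 (b l j k) = fscale (if k = 0 then 0 else 2 * of_nat l - of_nat (k - 1)) (b l j (k - 1))"
proof -
  have e: "opr (gX w w' B) (b l j k) p = (if p \<in> D then evx (der (gX w w' B) (bx l j k)) p else 0)" for w w' B p
    unfolding b_def opr_evx[OF gX_in_so33C homog_bx] by (simp add: evx_def)
  show "opF1 (b l j k) = fscale (- of_nat (Suc j)) (b l (Suc j) k)"
    by (rule ext) (auto simp: opF1_def e ev_der_gX dhe_F crs_0 dhe_0 fscale_apply b_apply b_outside simp del: of_nat_Suc)
  show "opF2 (b l j k) = fscale (- of_nat (Suc k)) (b l j (Suc k))"
    by (rule ext) (auto simp: opF2_def e ev_der_gX dhe_F crs_0 dhe_0 fscale_apply b_apply b_outside simp del: of_nat_Suc)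
  show "opE1 (b l j k) = fscale (if j = 0 then 0 else 2 * of_nat l - of_nat (j - 1)) (b l (j - 1) k)"
    by (rule ext) (auto simp: opE1_def e ev_der_gX dhe_E crs_0 dhe_0 fscale_apply b_apply b_outside diff_divide_distrib algebra_simps)
  show "opE2 (b l j k) = fscale (if k = 0 then 0 else 2 * of_nat l - of_nat (k - 1)) (b l j (k - 1))"
    by (rule ext) (auto simp: opE2_def e ev_der_gX dhe_E crs_0 dhe_0 fscale_apply b_apply b_outside diff_divide_distrib algebra_simps)
qed

text \<open>Both terms have the same weights j - l + 1 and k - l + 1, so \<open>opM\<close>
  separates the levels l + 1 and l - 1 only where one of the terms vanishes or is already available.
  For l = 0 the truncated l - 1 is covered by c' = 0.\<close>

lemma opM_b:
  obtains c c' where "c \<noteq> 0" "1 \<le> l \<Longrightarrow> c' \<noteq> 0"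
    "opM (b l j k) = fscale c (b (l + 1) (j + 2) (k + 2)) + fscale c' (b (l - 1) j k)" "l = 0 \<Longrightarrow> c' = 0"
proof -
  let ?w = "vector [1, - \<i>, 0] :: complex ^ 3"
  define d :: complex where "d = 2 * of_nat l + 1"
  define s where "s j = - (of_nat (j + 1) * of_nat (j + 2)) / (2 * (of_nat l + 1) * d)" for j :: nat
  have d: "d \<noteq> 0" "of_nat l + 1 \<noteq> (0::complex)"
  proof -
    have "d = of_nat (2 * l + 1)" "of_nat l + 1 = (of_nat (l + 1) :: complex)" by (simp_all add: d_def)
    then show "d \<noteq> 0" "of_nat l + 1 \<noteq> (0::complex)" by (metis of_nat_eq_0_iff add_is_0 one_neq_zero)+
  qed
  have s0: "s j \<noteq> 0" for j
    unfolding s_def using d by (auto simp del: of_nat_Suc of_nat_add distrib_left_numeral)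
  have sqw: "sq ?w = [:2:]" by (simp add: sq_def)
  have dw: "dhe l j x ?w = 2 * of_nat l * he (l - 1) j x" for j x
    by (simp add: dhe_def sqw he_def)
  have sw: "she l j ?w x = s j * he (l + 1) (j + 2) x" for j x
  proof -
    have "she l j ?w x = - 1 / (4 * (of_nat l + 1) * d) * (2 * (of_nat (j + 1) * (of_nat (j + 2) * coeff (sq x ^ (l + 1)) (j + 2))))"
      unfolding she_def sqw d_def by (simp add: coeff_pderiv pderiv_pCons del: power_Suc of_nat_Suc of_nat_add)
    moreover have "- 1 / (4 * a * d) * (2 * (u * (v * G))) = - (u * v) / (2 * a * d) * G"
      if "a \<noteq> 0" "d \<noteq> 0" for a d u v G :: complex
      using that by (simp add: field_simps)
    ultimately show ?thesis unfolding s_def he_def using d by (simp only: not_False_eq_True)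
  qed
  have w3: "?w $ 3 = 0" by simp
  have add: "dhe l j x ?w = dhe l j x (axis 1 1) - \<i> * dhe l j x (axis 2 1)" for j x
  proof -
    have w: "?w = axis 1 1 + (- \<i>) *s axis 2 1"
      by (simp add: vec_eq_iff forall_3 axis_def)
    show ?thesis unfolding w dhe_add dhe_scale by simp
  qed
  have sadd: "she l j ?w x = she l j (axis 1 1) x - \<i> * she l j (axis 2 1) x" for j x
  proof -
    have w: "sq ?w = sq (axis 1 1) + smult (- \<i>) (sq (axis 2 1))"
      by (simp add: sq_def axis_def)
    have k: "k * ((a + - \<i> * b) - c * (a' + - \<i> * b') + e * (a'' + - \<i> * b''))
        = k * (a - c * a' + e * a'') - \<i> * (k * (b - c * b' + e * b''))" for k a b c a' b' e a'' b'' :: complex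
      by (simp add: algebra_simps)
    show ?thesis
      unfolding she_def w pderiv_add pderiv_smult distrib_right[where 'a = "complex poly"] mult_smult_left coeff_add coeff_diff coeff_smult k ..
  qed
  have "opM (b l j k) = fscale (d * s j * s k) (b (l + 1) (j + 2) (k + 2)) + fscale (- (4 * of_nat l ^ 2) / d) (b (l - 1) j k)"
  proof
    fix p
    have e: "opM (b l j k) p = (if p \<in> D then evx (der (gX 0 0 (\<chi> a c. ?w $ a * ?w $ c)) (bx l j k)) p else 0)"
      unfolding opM_def b_def opr_evx[OF gX_in_so33C homog_bx] by (simp add: evx_def)
    show "opM (b l j k) p = (fscale (d * s j * s k) (b (l + 1) (j + 2) (k + 2)) + fscale (- (4 * of_nat l ^ 2) / d) (b (l - 1) j k)) p"
    proof (cases "p \<in> D")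
      case True
      define x y \<rho> where xy: "x = vx (fst (tau p))" "y = vy (fst (tau p))" "\<rho> = snd (tau p)"
      have "opM (b l j k) p = - (dhe l j x ?w * dhe l k y ?w / (d * \<rho> ^ (2 * (l - 1) + 1))
          - d * (she l j ?w x * she l k ?w y) / \<rho> ^ (2 * (l + 1) + 1))"
        unfolding e add sadd using True
        by (simp add: ev_der_gX crs_0 dhe_0 sum_3 flip: xy d_def)
          (simp add: algebra_simps add_divide_distrib diff_divide_distrib)
      also have "\<dots> = d * s j * s k * b (l + 1) (j + 2) (k + 2) p - 4 * of_nat l ^ 2 / d * b (l - 1) j k p"
        unfolding dw sw b_apply[OF True] xy by (simp add: power2_eq_square mult_ac)
      finally show ?thesis by (simp add: fscale_apply)
    qed (simp add: e b_outside fscale_apply)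
  qed
  moreover have "d * s j * s k \<noteq> 0" using d s0 by auto
  moreover have "- (4 * of_nat l ^ 2) / d \<noteq> 0" if "1 \<le> l" using d that by simp
  ultimately show ?thesis
    by (intro that[of "d * s j * s k" "- (4 * of_nat l ^ 2) / d"]) simp_all
qed

lemma opM_ex:
  "\<exists>c c'. c \<noteq> 0 \<and> (1 \<le> l \<longrightarrow> c' \<noteq> 0) \<and> (l = 0 \<longrightarrow> c' = 0) \<and>
    opM (b l j k) = fscale c (b (l + 1) (j + 2) (k + 2)) + fscale c' (b (l - 1) j k)"
  by (rule opM_b[of l j k]) blast

text \<open>\<open>opF1\<close>, \<open>opF2\<close>, \<open>opE1\<close>, \<open>opE2\<close> move the two weights, \<open>opM\<close> the level \<open>l\<close>.\<close>

lemma op_linear: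
  assumes "T \<in> {opF1, opE1, opF2, opE2, opM}"
  shows "f \<in> U \<Longrightarrow> T f \<in> U" "f \<in> U \<Longrightarrow> T (fscale c f) = fscale c (T f)"
    "f \<in> U \<Longrightarrow> g \<in> U \<Longrightarrow> T (f + g) = T f + T g"
  using assms
  by (auto simp: opF1_def opE1_def opF2_def opE2_def opM_def gX_in_so33C opr_in_U opr_scale opr_add)

lemma op_pow_linear:
  assumes "T \<in> {opF1, opE1, opF2, opE2, opM}"
  shows "f \<in> U \<Longrightarrow> (T ^^ n) f \<in> U" "f \<in> U \<Longrightarrow> (T ^^ n) (fscale c f) = fscale c ((T ^^ n) f)"
    "f \<in> U \<Longrightarrow> g \<in> U \<Longrightarrow> (T ^^ n) (f + g) = (T ^^ n) f + (T ^^ n) g"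
proof -
  show U: "f \<in> U \<Longrightarrow> (T ^^ n) f \<in> U" for f n
    by (induction n) (auto simp: op_linear[OF assms])
  show "f \<in> U \<Longrightarrow> (T ^^ n) (fscale c f) = fscale c ((T ^^ n) f)"
    "f \<in> U \<Longrightarrow> g \<in> U \<Longrightarrow> (T ^^ n) (f + g) = (T ^^ n) f + (T ^^ n) g"
    by (induction n) (auto simp: op_linear[OF assms] U)
qed

lemma fscale_0: "fscale 0 f = 0" "fscale c 0 = 0"
  by (auto simp: fscale_def)

lemma fscale_fscale: "fscale c (fscale d f) = fscale (c * d) f"
  by (auto simp: fscale_def mult_ac)

lemma opF1_pow: "\<exists>c. c \<noteq> 0 \<and> (opF1 ^^ n) (b l j k) = fscale c (b l (j + n) k)"
proof (induction n)
  case (Suc n)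
  then obtain c where "c \<noteq> 0" "(opF1 ^^ n) (b l j k) = fscale c (b l (j + n) k)" by blast
  then show ?case
    by (intro exI[of _ "c * (- of_nat (Suc (j + n)))"])
       (auto simp: op_linear b_in_U opF1_b fscale_fscale simp del: of_nat_Suc)
qed (auto intro!: exI[of _ 1] simp: fscale_def)

lemma opF2_pow: "\<exists>c. c \<noteq> 0 \<and> (opF2 ^^ n) (b l j k) = fscale c (b l j (k + n))"
proof (induction n)
  case (Suc n)
  then obtain c where "c \<noteq> 0" "(opF2 ^^ n) (b l j k) = fscale c (b l j (k + n))" by blast
  then show ?case
    by (intro exI[of _ "c * (- of_nat (Suc (k + n)))"])
       (auto simp: op_linear b_in_U opF2_b fscale_fscale simp del: of_nat_Suc)
qed (auto intro!: exI[of _ 1] simp: fscale_def)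

lemma E_factor: "n < m \<Longrightarrow> m \<le> 2 * l \<Longrightarrow> 2 * of_nat l - of_nat (m - n - 1) \<noteq> (0 :: complex)"
proof -
  assume "n < m" "m \<le> 2 * l"
  then have "2 * of_nat l - of_nat (m - n - 1) = (of_nat (2 * l - (m - n - 1)) :: complex)"
    by (subst of_nat_diff) auto
  with \<open>n < m\<close> \<open>m \<le> 2 * l\<close> show ?thesis by (simp del: of_nat_diff)
qed

lemma opE1_pow: "n \<le> j \<Longrightarrow> j \<le> 2 * l \<Longrightarrow> \<exists>c. c \<noteq> 0 \<and> (opE1 ^^ n) (b l j k) = fscale c (b l (j - n) k)"
proof (induction n)
  case (Suc n)
  then obtain c where "c \<noteq> 0" "(opE1 ^^ n) (b l j k) = fscale c (b l (j - n) k)" by auto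
  with Suc E_factor[of n j l] show ?case
    by (intro exI[of _ "c * (2 * of_nat l - of_nat (j - n - 1))"])
       (auto simp: op_linear b_in_U opE1_b fscale_fscale)
qed (auto intro!: exI[of _ 1] simp: fscale_def)

lemma opE2_pow: "n \<le> k \<Longrightarrow> k \<le> 2 * l \<Longrightarrow> \<exists>c. c \<noteq> 0 \<and> (opE2 ^^ n) (b l j k) = fscale c (b l j (k - n))"
proof (induction n)
  case (Suc n)
  then obtain c where "c \<noteq> 0" "(opE2 ^^ n) (b l j k) = fscale c (b l j (k - n))" by auto
  with Suc E_factor[of n k l] show ?case
    by (intro exI[of _ "c * (2 * of_nat l - of_nat (k - n - 1))"])
       (auto simp: op_linear b_in_U opE2_b fscale_fscale)
qed (auto intro!: exI[of _ 1] simp: fscale_def)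

lemma opE1_pow_0: "j < n \<Longrightarrow> (opE1 ^^ n) (b l j k) = 0"
proof (induction n arbitrary: j)
  case (Suc n)
  note IH = Suc.IH and prems = Suc.prems
  have "(opE1 ^^ Suc n) (b l j k) = fscale (if j = 0 then 0 else 2 * of_nat l - of_nat (j - 1)) ((opE1 ^^ n) (b l (j - 1) k))"
    unfolding funpow_Suc_right comp_def opE1_b by (rule op_pow_linear) (simp_all add: b_in_U)
  also have "\<dots> = 0"
  proof (cases j)
    case 0
    then show ?thesis by (simp only: simp_thms if_True fscale_0)
  next
    case (Suc i)
    then have "(opE1 ^^ n) (b l (j - 1) k) = 0" using IH[of "j - 1"] prems by auto
    then show ?thesis by (simp only: fscale_0)
  qed
  finally show ?case .
qed simp

section \<open>Irreducibility\<close>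

lemma U_expansion:
  assumes "f \<in> U"
  shows "\<exists>T c. finite T \<and> (\<forall>l j k. (l, j, k) \<in> T \<longrightarrow> j \<le> 2 * l \<and> k \<le> 2 * l) \<and>
    (\<forall>i\<in>T. c i \<noteq> 0) \<and> f = (\<Sum>(l, j, k)\<in>T. fscale (c (l, j, k)) (b l j k))"
proof -
  have "\<exists>T c. finite T \<and> (\<forall>(l, j, k)\<in>T. j \<le> 2 * l \<and> k \<le> 2 * l) \<and> f = (\<Sum>(l, j, k)\<in>T. fscale (c (l, j, k)) (b l j k))"
    using assms unfolding U_def
  proof (induction rule: fn.span_induct_alt)
    case base
    show ?case by (intro exI[of _ "{}"]) auto
  next
    case (step x h f)
    then obtain T c l j k where T: "finite T" "\<forall>(l, j, k)\<in>T. j \<le> 2 * l \<and> k \<le> 2 * l"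
      "f = (\<Sum>(l, j, k)\<in>T. fscale (c (l, j, k)) (b l j k))" and h: "h = b l j k" by auto
    show ?case
    proof (cases "j \<le> 2 * l \<and> k \<le> 2 * l")
      case False
      then have "h = 0" using h b_eq_0[of l j k] by (auto simp: not_le)
      then have eq: "fscale x h + f = f" by (simp only: fscale_0 add_0)
      show ?thesis unfolding eq using T by blast
    next
      case True
      let ?T = "insert (l, j, k) T"
      let ?c = "\<lambda>i. (if i \<in> T then c i else 0) + (if i = (l, j, k) then x else 0)"
      have "(\<Sum>(l, j, k)\<in>?T. fscale (?c (l, j, k)) (b l j k))
          = (\<Sum>i\<in>?T. fscale (if i \<in> T then c i else 0) (case i of (l, j, k) \<Rightarrow> b l j k))
          + (\<Sum>i\<in>?T. if i = (l, j, k) then fscale x (b l j k) else 0)"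
        unfolding sum.distrib[symmetric]
        by (rule sum.cong) (auto simp: fscale_def algebra_simps)
      also have "(\<Sum>i\<in>?T. fscale (if i \<in> T then c i else 0) (case i of (l, j, k) \<Rightarrow> b l j k)) = f"
        unfolding T(3) by (rule sum.mono_neutral_cong_right) (auto simp: T(1) fscale_def)
      also have "(\<Sum>i\<in>?T. if i = (l, j, k) then fscale x (b l j k) else 0) = fscale x h"
        using T(1) h by simp
      finally show ?thesis using T True
        by (intro exI[of _ ?T] exI[of _ ?c]) (auto simp: add.commute)
    qed
  qed
  then obtain T c where T: "finite T" "\<forall>(l, j, k)\<in>T. j \<le> 2 * l \<and> k \<le> 2 * l" "f = (\<Sum>(l, j, k)\<in>T. fscale (c (l, j, k)) (b l j k))"
    by blast
  have "f = (\<Sum>(l, j, k)\<in>{i \<in> T. c i \<noteq> 0}. fscale (c (l, j, k)) (b l j k))"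
    unfolding T(3) by (rule sum.mono_neutral_right) (auto simp: T(1) fscale_def)
  then show ?thesis
    using T(1,2) by (intro exI[of _ "{i \<in> T. c i \<noteq> 0}"] exI[of _ c] conjI) auto
qed

text \<open>A nonzero vector is reduced to one spanning function \<open>b l 0 (2 * l)\<close>; from
  there raising reaches the top corner of level l, lowering fills the level, and \<open>opM\<close>
  at the corners reaches the neighbouring levels. The argument applies to any expansion of the
  vector, unique or not.\<close>

theorem irreducible_U: "irreducible_module so33C U opr"
  unfolding irreducible_module_def
proof (intro conjI allI impI)
  obtain p where p: "p \<in> D" using D_ne by blast
  have "b 0 0 0 p \<noteq> 0" using cone[OF p] by (simp add: b_apply[OF p] he_0)
  then have "b 0 0 0 \<noteq> 0" by auto
  with b_in_U[of 0 0 0] show "U \<noteq> {0}" by blast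
next
  fix W assume "fn.subspace W \<and> W \<subseteq> U \<and> (\<forall>X\<in>so33C. \<forall>w\<in>W. opr X w \<in> W)"
  then have W: "fn.subspace W" "W \<subseteq> U" and stab: "\<And>X w. X \<in> so33C \<Longrightarrow> w \<in> W \<Longrightarrow> opr X w \<in> W"
    by auto
  have WT: "T w \<in> W" if "T \<in> {opF1, opE1, opF2, opE2, opM}" "w \<in> W" for T w
    using that by (auto simp: opF1_def opE1_def opF2_def opE2_def opM_def gX_in_so33C intro!: stab)
  have WTn: "(T ^^ n) w \<in> W" if "T \<in> {opF1, opE1, opF2, opE2, opM}" "w \<in> W" for T w n
    by (induction n) (auto simp: that WT[OF that(1)])
  have unscale: "f \<in> W" if "fscale c f \<in> W" "c \<noteq> 0" for c f
  proof -
    have "fscale (1 / c) (fscale c f) \<in> W"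
      using that(1) by (rule fn.subspace_scale[OF W(1)])
    then show ?thesis using that(2) by (simp add: fscale_def)
  qed
  have top_level: "b l j k \<in> W" if "b l (2 * l) (2 * l) \<in> W" for l j k
  proof (cases "j \<le> 2 * l \<and> k \<le> 2 * l")
    case True
    obtain c where c: "c \<noteq> 0" "(opE1 ^^ (2 * l - j)) (b l (2 * l) (2 * l)) = fscale c (b l j (2 * l))"
      using opE1_pow[of "2 * l - j" "2 * l" l "2 * l"] True by auto
    then have "b l j (2 * l) \<in> W"
      using WTn[OF _ that, of opE1 "2 * l - j"] unscale by auto
    moreover obtain c where "c \<noteq> 0" "(opE2 ^^ (2 * l - k)) (b l j (2 * l)) = fscale c (b l j k)"
      using opE2_pow[of "2 * l - k" "2 * l" l j] True by auto
    ultimately show ?thesis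
      using WTn[of opE2 "b l j (2 * l)" "2 * l - k"] unscale by auto
  next
    case False
    then show ?thesis using fn.subspace_0[OF W(1)] by (simp add: b_eq_0 not_le)
  qed
  have bottom_level: "b l (2 * l) (2 * l) \<in> W" if "b l 0 (2 * l) \<in> W" for l
    using opF1_pow[of "2 * l" l 0 "2 * l"] WTn[OF _ that, of opF1 "2 * l"] unscale by auto
  \<comment> \<open>At the top weights, 2 l exceeds 2 (l - 1), so the lower term of
    \<open>opM\<close> vanishes and level l + 1 is isolated; for l = 0 the lower term vanishes
    through its coefficient.\<close>
  have up: "b (l + 1) (2 * (l + 1)) (2 * (l + 1)) \<in> W" if "b l (2 * l) (2 * l) \<in> W" for l
  proof -
    obtain c c' where c: "c \<noteq> 0" "l = 0 \<Longrightarrow> c' = 0"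
      "opM (b l (2 * l) (2 * l)) = fscale c (b (l + 1) (2 * l + 2) (2 * l + 2)) + fscale c' (b (l - 1) (2 * l) (2 * l))"
      using opM_ex[of l "2 * l" "2 * l"] by blast
    have z: "fscale c' (b (l - 1) (2 * l) (2 * l)) = 0"
      by (cases l) (use c(2) b_eq_0[of "l - 1" "2 * l" "2 * l"] in \<open>auto simp: fscale_0\<close>)
    have "opM (b l (2 * l) (2 * l)) \<in> W" by (rule WT[OF _ that]) simp
    then have "fscale c (b (l + 1) (2 * l + 2) (2 * l + 2)) \<in> W" unfolding c(3) z by (simp only: add_0_right)
    then have "b (l + 1) (2 * l + 2) (2 * l + 2) \<in> W" using c(1) by (rule unscale)
    then show ?thesis by simp
  qed
  \<comment> \<open>From the bottom corner \<open>opM\<close> reaches the levels l + 1 and l - 1;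
    the former lies in \<open>W\<close> by \<open>up\<close> and is subtracted.\<close>
  have down: "b (l - 1) (2 * (l - 1)) (2 * (l - 1)) \<in> W" if l1: "b l (2 * l) (2 * l) \<in> W" and l2: "1 \<le> l" for l
  proof -
    obtain c c' where c: "c' \<noteq> 0"
      "opM (b l 0 0) = fscale c (b (l + 1) (0 + 2) (0 + 2)) + fscale c' (b (l - 1) 0 0)"
      using opM_ex[of l 0 0] l2 by blast
    have "opM (b l 0 0) - fscale c (b (l + 1) (0 + 2) (0 + 2)) \<in> W"
      by (rule fn.subspace_diff[OF W(1) WT[OF _ top_level[OF l1]] fn.subspace_scale[OF W(1) top_level[OF up[OF l1]]]]) simp
    then have "fscale c' (b (l - 1) 0 0) \<in> W" unfolding c(2) add_diff_cancel_left' .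
    then have 1: "b (l - 1) 0 0 \<in> W" using c(1) by (rule unscale)
    obtain d where d: "d \<noteq> 0" "(opF1 ^^ (2 * (l - 1))) (b (l - 1) 0 0) = fscale d (b (l - 1) (0 + 2 * (l - 1)) 0)"
      using opF1_pow by blast
    have "(opF1 ^^ (2 * (l - 1))) (b (l - 1) 0 0) \<in> W" by (rule WTn[OF _ 1]) simp
    then have 2: "b (l - 1) (2 * (l - 1)) 0 \<in> W" unfolding d(2) using d(1) unscale by (metis add_0)
    obtain d' where d': "d' \<noteq> 0"
      "(opF2 ^^ (2 * (l - 1))) (b (l - 1) (2 * (l - 1)) 0) = fscale d' (b (l - 1) (2 * (l - 1)) (0 + 2 * (l - 1)))"
      using opF2_pow by blast
    have "(opF2 ^^ (2 * (l - 1))) (b (l - 1) (2 * (l - 1)) 0) \<in> W" by (rule WTn[OF _ 2]) simp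
    then show ?thesis unfolding d'(2) using d'(1) unscale by (metis add_0)
  qed
  have all: "W = U" if l: "b l (2 * l) (2 * l) \<in> W" for l
  proof -
    have "b n (2 * n) (2 * n) \<in> W" for n
    proof (cases "l \<le> n")
      case True
      then show ?thesis
      proof (induction n rule: dec_induct)
        case base
        show ?case using l .
      next
        case (step m)
        then show ?case using up[of m] by simp
      qed
    next
      case False
      then have "n \<le> l" by simp
      then show ?thesis
      proof (induction n rule: inc_induct)
        case base
        show ?case using l .
      next
        case (step m)
        then show ?case using down[of "Suc m"] by simp
      qed
    qed
    then have "range (\<lambda>(l, j, k). b l j k) \<subseteq> W" using top_level by auto
    then have "U \<subseteq> W" unfolding U_def using W(1) by (rule fn.span_minimal)
    with W(2) show ?thesis by auto
  qed
  show "W = {0} \<or> W = U"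
  proof (cases "W \<subseteq> {0}")
    case True
    then show ?thesis using fn.subspace_0[OF W(1)] by auto
  next
    case False
    then obtain w where w: "w \<in> W" "w \<noteq> 0" by blast
    then have "w \<in> U" using W(2) by blast
    obtain T c where T: "finite T" "\<And>l j k. (l, j, k) \<in> T \<Longrightarrow> j \<le> 2 * l \<and> k \<le> 2 * l"
      "\<And>i. i \<in> T \<Longrightarrow> c i \<noteq> 0" "w = (\<Sum>(l, j, k)\<in>T. fscale (c (l, j, k)) (b l j k))"
      using U_expansion[OF \<open>w \<in> U\<close>] by blast
    have "T \<noteq> {}" using T(4) w(2) by auto
    have mx: "\<exists>i\<in>S. \<forall>i'\<in>S. f i' \<le> f i" if "finite S" "S \<noteq> {}" for S :: "(nat \<times> nat \<times> nat) set" and f :: "_ \<Rightarrow> nat"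
    proof -
      have "Max (f ` S) \<in> f ` S" using that by auto
      then show ?thesis using that by (metis Max_ge finite_imageI image_iff imageI)
    qed
    \<comment> \<open>\<open>f1\<close> and \<open>f2\<close> measure how far the two indices are
      from the top of their level. The chosen term is lexicographically maximal for (f1, f2, f3),
      and these three numbers determine the term.\<close>
    define f1 f2 f3 :: "nat \<times> nat \<times> nat \<Rightarrow> nat" where
      "f1 = (\<lambda>(l, j, k). 2 * l - j)" and "f2 = (\<lambda>(l, j, k). 2 * l - k)" and "f3 = (\<lambda>(l, j, k). l)"
    obtain i1 where i1: "i1 \<in> T" "\<And>i. i \<in> T \<Longrightarrow> f1 i \<le> f1 i1" using mx[OF T(1) \<open>T \<noteq> {}\<close>] by blast
    obtain i2 where i2: "i2 \<in> T" "f1 i2 = f1 i1" "\<And>i. i \<in> T \<Longrightarrow> f1 i = f1 i1 \<Longrightarrow> f2 i \<le> f2 i2"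
    proof -
      have "finite {i \<in> T. f1 i = f1 i1}" "{i \<in> T. f1 i = f1 i1} \<noteq> {}" using T(1) i1(1) by (simp, blast)
      from mx[OF this, of f2] show ?thesis by (elim bexE) (rule that, blast+)
    qed
    obtain i3 where i3: "i3 \<in> T" "f1 i3 = f1 i1" "f2 i3 = f2 i2"
      "\<And>i. i \<in> T \<Longrightarrow> f1 i = f1 i1 \<Longrightarrow> f2 i = f2 i2 \<Longrightarrow> f3 i \<le> f3 i3"
    proof -
      have "finite {i \<in> T. f1 i = f1 i1 \<and> f2 i = f2 i2}" "{i \<in> T. f1 i = f1 i1 \<and> f2 i = f2 i2} \<noteq> {}"
        using T(1) i2(1,2) by (simp, blast)
      from mx[OF this, of f3] show ?thesis by (elim bexE) (rule that, blast+)
    qed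
    obtain l j k where ljk: "i3 = (l, j, k)" by (cases i3)
    have jk: "j \<le> 2 * l" "k \<le> 2 * l" using T(2) i3(1) ljk by auto
    \<comment> \<open>Climbing by exactly 2 l - j and 2 l - k pushes every term with a smaller
      distance past its top, where it is zero. Terms with equal distances and a lower level l' land
      on the top of level l', and 2 l descents, more than 2 l', annihilate them.\<close>
    define A where "A g = (opE1 ^^ (2 * l)) ((opF2 ^^ (2 * l - k)) ((opF1 ^^ (2 * l - j)) g))" for g
    have A_U: "g \<in> U \<Longrightarrow> A g \<in> U" and A_scale: "g \<in> U \<Longrightarrow> A (fscale x g) = fscale x (A g)"
      and A_add: "g \<in> U \<Longrightarrow> h \<in> U \<Longrightarrow> A (g + h) = A g + A h" for x g h
      by (simp_all add: A_def op_pow_linear)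
    have A_0: "A 0 = 0"
      using A_scale[of 0 0] fn.subspace_0[OF subspace_U] by (simp add: fscale_0)
    have A_b: "A (b l' j' k') = (if (l', j', k') = i3 then A (b l j k) else 0)" if i: "(l', j', k') \<in> T" for l' j' k'
    proof (cases "(l', j', k') = i3")
      case False
      have le: "j' \<le> 2 * l'" "k' \<le> 2 * l'" using T(2)[OF i] by auto
      obtain c1 where c1: "(opF1 ^^ (2 * l - j)) (b l' j' k') = fscale c1 (b l' (j' + (2 * l - j)) k')"
        using opF1_pow by metis
      obtain c2 where c2: "(opF2 ^^ (2 * l - k)) (b l' (j' + (2 * l - j)) k') = fscale c2 (b l' (j' + (2 * l - j)) (k' + (2 * l - k)))"
        using opF2_pow by metis
      have Ab: "A (b l' j' k') = fscale (c1 * c2) ((opE1 ^^ (2 * l)) (b l' (j' + (2 * l - j)) (k' + (2 * l - k))))"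
        by (simp add: A_def c1 c2 op_pow_linear b_in_U fscale_fscale)
      have m1: "2 * l' - j' \<le> 2 * l - j" using i1(2)[OF i] i3(2) by (simp add: f1_def f2_def f3_def ljk)
      have m2: "2 * l' - k' \<le> 2 * l - k" if "2 * l' - j' = 2 * l - j"
        using i2(3)[OF i] i3(2,3) that by (simp add: f1_def f2_def f3_def ljk)
      have m3: "l' \<le> l" if "2 * l' - j' = 2 * l - j" "2 * l' - k' = 2 * l - k"
        using i3(4)[OF i] i3(2,3) that by (simp add: f1_def f2_def f3_def ljk)
      have z: "(opE1 ^^ (2 * l)) 0 = 0"
        using op_pow_linear(2)[of opE1 0 "2 * l" 0] fn.subspace_0[OF subspace_U] by (simp add: fscale_0)
      have "(opE1 ^^ (2 * l)) (b l' (j' + (2 * l - j)) (k' + (2 * l - k))) = 0"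
      proof (cases "2 * l' - j' = 2 * l - j \<and> 2 * l' - k' = 2 * l - k")
        case True
        with m3 False ljk le jk have "l' < l" by (cases "l' = l") auto
        with True le show ?thesis by (intro opE1_pow_0) auto
      next
        case False
        have "2 * l' < j' + (2 * l - j) \<or> 2 * l' < k' + (2 * l - k)"
        proof (cases "2 * l' - j' = 2 * l - j")
          case True
          then show ?thesis using m2[OF True] False le by linarith
        next
          case False
          then show ?thesis using m1 le by linarith
        qed
        then show ?thesis by (simp add: b_eq_0 z)
      qed
      with False Ab show ?thesis by (simp add: fscale_0)
    qed (simp add: ljk)
    have A_sum: "A (\<Sum>i\<in>S. h i) = (\<Sum>i\<in>S. A (h i))" if "finite S" "\<And>i. i \<in> S \<Longrightarrow> h i \<in> U" for S and h :: "nat \<times> nat \<times> nat \<Rightarrow> _"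
      using that by (induction S) (auto simp: A_0 A_add fn.subspace_sum[OF subspace_U])
    have "A w = (\<Sum>i\<in>T. A (case i of (l, j, k) \<Rightarrow> fscale (c (l, j, k)) (b l j k)))"
      unfolding T(4) by (rule A_sum) (auto simp: T(1) intro: fn.subspace_scale[OF subspace_U] b_in_U)
    also have "\<dots> = (\<Sum>i\<in>T. if i = i3 then fscale (c i3) (A (b l j k)) else 0)"
      by (rule sum.cong) (auto simp: A_scale b_in_U A_b fscale_0)
    finally have Aw: "A w = fscale (c i3) (A (b l j k))" using T(1) i3(1) by simp
    obtain c1 where c1: "c1 \<noteq> 0" "(opF1 ^^ (2 * l - j)) (b l j k) = fscale c1 (b l (2 * l) k)"
      using opF1_pow[of "2 * l - j" l j k] jk by auto
    obtain c2 where c2: "c2 \<noteq> 0" "(opF2 ^^ (2 * l - k)) (b l (2 * l) k) = fscale c2 (b l (2 * l) (2 * l))"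
      using opF2_pow[of "2 * l - k" l "2 * l" k] jk by auto
    obtain c3 where c3: "c3 \<noteq> 0" "(opE1 ^^ (2 * l)) (b l (2 * l) (2 * l)) = fscale c3 (b l 0 (2 * l))"
      using opE1_pow[of "2 * l" "2 * l" l "2 * l"] by auto
    have "A (b l j k) = fscale (c1 * (c2 * c3)) (b l 0 (2 * l))"
      by (simp add: A_def c1 c2 c3 op_pow_linear b_in_U fscale_fscale)
    with Aw have "A w = fscale (c i3 * (c1 * (c2 * c3))) (b l 0 (2 * l))" by (simp add: fscale_fscale)
    moreover have "A w \<in> W" unfolding A_def
      by (rule WTn[of opE1, OF _ WTn[of opF2, OF _ WTn[of opF1, OF _ w(1)]]]) simp_all
    ultimately have "b l 0 (2 * l) \<in> W"
      using c1 c2 c3 T(3)[OF i3(1)] unscale by auto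
    then show ?thesis using all bottom_level by blast
  qed
qed

end

section \<open>Rotation-finite functions on the sphere\<close>

definition cv :: "real ^ 3 \<Rightarrow> complex ^ 3" where
  "cv x = (\<chi> i. of_real (x $ i))"

definition rs :: "(real ^ 3 \<Rightarrow> complex) \<Rightarrow> real ^ 3 \<Rightarrow> complex" where
  "rs f = (\<lambda>x. if norm x = 1 then f x else 0)"

definition ST :: "(real ^ 3 \<Rightarrow> complex) set" where
  "ST = fn.span (range (\<lambda>(l, j). rs (\<lambda>x. he l j (cv x))))"

lemma norm_3: "(norm (x :: real ^ 3))\<^sup>2 = (x $ 1)\<^sup>2 + (x $ 2)\<^sup>2 + (x $ 3)\<^sup>2"
  by (simp add: norm_vec_def L2_set_def sum_3)

lemma bl_cv: "bl (cv x) (cv x) = of_real ((norm x)\<^sup>2)"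
  unfolding norm_3 by (simp add: bl_3 cv_def power2_eq_square)

lemma subspace_ST: "fn.subspace ST"
  by (simp add: ST_def)

lemma LH_ST:
  assumes "f \<in> LH l"
  shows "rs (\<lambda>x. f (cv x)) \<in> ST"
  using assms unfolding LH_def
proof (induction rule: fn.span_induct_alt)
  case base
  have "rs (\<lambda>x. 0) = 0" by (auto simp: rs_def)
  then show ?case using fn.subspace_0[OF subspace_ST] by (simp add: rs_def zero_fun_def)
next
  case (step c h f)
  then obtain j where h: "h = he l j" by auto
  have "rs (\<lambda>x. (fscale c h + f) (cv x)) = fscale c (rs (\<lambda>x. he l j (cv x))) + rs (\<lambda>x. f (cv x))"
    by (auto simp: rs_def h fscale_def)
  moreover have "rs (\<lambda>x. he l j (cv x)) \<in> ST"
    unfolding ST_def by (rule fn.span_base) (auto intro: image_eqI[of _ _ "(l, j)"])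
  ultimately show ?case
    using step by (simp only: fn.subspace_add[OF subspace_ST] fn.subspace_scale[OF subspace_ST])
qed

text \<open>On the sphere x . x = 1, so \<open>bl_mult_he\<close> writes the product as a sum of
  restricted harmonics of degrees l + 1 and l - 1. By iteration products of linear forms restrict
  into \<open>ST\<close>.\<close>

lemma ST_mult_bl:
  assumes "f \<in> ST"
  shows "(\<lambda>x. bl w (cv x) * f x) \<in> ST"
  using assms unfolding ST_def
proof (induction rule: fn.span_induct_alt)
  case base
  have "(\<lambda>x. bl w (cv x) * (0 :: real ^ 3 \<Rightarrow> complex) x) = 0" by auto
  then show ?case by (simp only: fn.span_zero)
next
  case (step c h f)
  then obtain l j where h: "h = rs (\<lambda>x. he l j (cv x))" by auto
  have "(\<lambda>x. bl w (cv x) * (fscale c h + f) x)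
      = fscale c (rs (\<lambda>x. she l j w (cv x))) + fscale (c / (2 * of_nat l + 1)) (rs (\<lambda>x. dhe l j (cv x) w))
        + (\<lambda>x. bl w (cv x) * f x)"
    by (auto simp: h rs_def fscale_def algebra_simps bl_mult_he bl_cv)
  then show ?case
    using step fn.subspace_add[OF subspace_ST] fn.subspace_scale[OF subspace_ST] LH_ST[OF she_LH] LH_ST[OF dhe_LH]
    unfolding ST_def by simp
qed

lemma ST_monomial: "rs (\<lambda>x. bl w (cv x) ^ m * bl w' (cv x) ^ n) \<in> ST"
proof (induction m)
  case 0
  show ?case
  proof (induction n)
    case 0
    have "rs (\<lambda>x. he 0 0 (cv x)) \<in> ST" by (rule LH_ST[OF he_in_LH])
    then show ?case by (simp add: he_0)
  next
    case (Suc n)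
    from ST_mult_bl[OF this, of w'] show ?case
      by (simp add: rs_def if_distrib mult_ac cong: if_cong)
  qed
next
  case (Suc m)
  from ST_mult_bl[OF this, of w] show ?case
    by (simp add: rs_def if_distrib mult_ac cong: if_cong)
qed

text \<open>With w = (1, i, 0) or (1, -i, 0) this is the form that functions of nonnegative or
  negative weight turn out to have.\<close>

lemma ST_poly: "rs (\<lambda>x. bl w (cv x) ^ m * poly q (of_real (x $ 3))) \<in> ST"
proof -
  have b: "bl (axis 3 1) (cv x) = of_real (x $ 3)" for x
    by (simp add: bl_3 cv_def axis_def)
  show ?thesis
    by (rule fn_subspace_sum_apply[OF subspace_ST, of "{..degree q}" "\<lambda>i. rs (\<lambda>x. bl w (cv x) ^ m * bl (axis 3 1) (cv x) ^ i)" _ "coeff q"])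
       (auto simp: ST_monomial, auto simp: rs_def b poly_altdef sum_distrib_left mult_ac)
qed

section \<open>Rotations about the coordinate axes and their generators\<close>

definition rm1 :: "real \<Rightarrow> real ^ 3 ^ 3" where
  "rm1 s = vector [vector [1, 0, 0], vector [0, cos s, - sin s], vector [0, sin s, cos s]]"
definition rm2 :: "real \<Rightarrow> real ^ 3 ^ 3" where
  "rm2 s = vector [vector [cos s, 0, sin s], vector [0, 1, 0], vector [- sin s, 0, cos s]]"
definition rm3 :: "real \<Rightarrow> real ^ 3 ^ 3" where
  "rm3 s = vector [vector [cos s, - sin s, 0], vector [sin s, cos s, 0], vector [0, 0, 1]]"

definition rotation3 :: "real ^ 3 ^ 3 \<Rightarrow> bool" where
  "rotation3 R \<longleftrightarrow> orthogonal_matrix R \<and> det R = 1"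

lemma sin_cos_sq: "cos s * cos s + sin s * sin s = (1::real)" "sin s * sin s + cos s * cos s = (1::real)"
  using sin_cos_squared_add[of s] by (simp_all add: power2_eq_square)

lemma rotation3_rm: "rotation3 (rm1 s)" "rotation3 (rm2 s)" "rotation3 (rm3 s)"
  unfolding rotation3_def
  by (auto simp: rm1_def rm2_def rm3_def orthogonal_matrix vec_eq_iff forall_3 matrix_matrix_mult_def
      transpose_def sum_3 mat_def det_3 sin_cos_sq)

definition J1 :: "real ^ 3 \<Rightarrow> real ^ 3" where "J1 x = vector [0, - x $ 3, x $ 2]"
definition J2 :: "real ^ 3 \<Rightarrow> real ^ 3" where "J2 x = vector [x $ 3, 0, - x $ 1]"
definition J3 :: "real ^ 3 \<Rightarrow> real ^ 3" where "J3 x = vector [- x $ 2, x $ 1, 0]"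

definition rotpath :: "(real \<Rightarrow> real ^ 3 ^ 3) \<Rightarrow> (real ^ 3 \<Rightarrow> real ^ 3) \<Rightarrow> bool" where
  "rotpath R J \<longleftrightarrow> (\<forall>s. rotation3 (R s)) \<and> R 0 = mat 1 \<and>
     (\<forall>x. ((\<lambda>s. R s *v x) has_vector_derivative J x) (at 0))"

lemma rm_mult:
  "rm1 s *v x = vector [x $ 1, cos s * x $ 2 - sin s * x $ 3, sin s * x $ 2 + cos s * x $ 3]"
  "rm2 s *v x = vector [cos s * x $ 1 + sin s * x $ 3, x $ 2, cos s * x $ 3 - sin s * x $ 1]"
  "rm3 s *v x = vector [cos s * x $ 1 - sin s * x $ 2, sin s * x $ 1 + cos s * x $ 2, x $ 3]"
  by (simp_all add: rm1_def rm2_def rm3_def vec_eq_iff forall_3 matrix_vector_mult_def sum_3)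

lemma has_vector_derivative_vec3:
  fixes f :: "real \<Rightarrow> 'a::real_normed_vector ^ 3"
  assumes "((\<lambda>s. f s $ 1) has_vector_derivative f' $ 1) F" "((\<lambda>s. f s $ 2) has_vector_derivative f' $ 2) F"
    "((\<lambda>s. f s $ 3) has_vector_derivative f' $ 3) F"
  shows "(f has_vector_derivative f') F"
proof (rule has_vector_derivative_vec)
  show "((\<lambda>s. f s $ i) has_vector_derivative f' $ i) F" for i
    using exhaust_3[of i] assms by auto
qed

lemma rotpath_rm: "rotpath rm1 J1" "rotpath rm2 J2" "rotpath rm3 J3"
  unfolding rotpath_def
  by (auto simp: rotation3_rm intro!: has_vector_derivative_vec3)
     (auto simp: rm1_def rm2_def rm3_def vec_eq_iff forall_3 mat_def J1_def J2_def J3_def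
       matrix_vector_mult_def sum_3 has_real_derivative_iff_has_vector_derivative[symmetric]
       intro!: derivative_eq_intros)

definition LR :: "(real \<Rightarrow> real ^ 3 ^ 3) \<Rightarrow> (real ^ 3 \<Rightarrow> complex) \<Rightarrow> real ^ 3 \<Rightarrow> complex" where
  "LR R f x = vector_derivative (\<lambda>s. f (R s *v x)) (at 0)"

lemma difference_quotient_tendsto:
  fixes g :: "real \<Rightarrow> complex"
  assumes "(g has_vector_derivative D) (at 0)"
  shows "((\<lambda>s. 1 / of_real s * (g s - g 0)) \<longlongrightarrow> D) (at 0)"
proof -
  have "((\<lambda>h. norm (g (0 + h) - g 0 - h *\<^sub>R D) / norm h) \<longlongrightarrow> 0) (at 0)"
    using assms unfolding has_vector_derivative_def has_derivative_at by blast
  moreover have "\<forall>\<^sub>F h in at 0. norm (g (0 + h) - g 0 - h *\<^sub>R D) / norm h = norm (1 / of_real h * (g h - g 0) - D)"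
  proof (rule eventually_at_topological[THEN iffD2], intro exI[of _ UNIV] conjI ballI impI)
    fix h :: real assume "h \<noteq> 0"
    then have "1 / of_real h * (g h - g 0) - D = (g h - g 0 - h *\<^sub>R D) / of_real h"
      by (simp add: field_simps scaleR_conv_of_real)
    then show "norm (g (0 + h) - g 0 - h *\<^sub>R D) / norm h = norm (1 / of_real h * (g h - g 0) - D)"
      by (simp add: norm_divide)
  qed auto
  ultimately have "((\<lambda>h. norm (1 / of_real h * (g h - g 0) - D)) \<longlongrightarrow> 0) (at 0)"
    by (rule Lim_transform_eventually)
  then have "((\<lambda>h. 1 / of_real h * (g h - g 0) - D) \<longlongrightarrow> 0) (at 0)"
    by (rule tendsto_norm_zero_cancel)
  then show ?thesis by (rule LIM_zero_cancel)
qed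

lemma poly_zero_on_circle:
  assumes "\<And>t::real. poly p (cis t) = 0"
  shows "p = 0"
proof (rule ccontr)
  assume "p \<noteq> 0"
  then have "finite {z. poly p z = 0}" by (rule poly_roots_finite)
  moreover have "cis ` {0..pi} \<subseteq> {z. poly p z = 0}" using assms by auto
  ultimately have "finite (Re ` cis ` {0..pi})" by (intro finite_imageI[of "cis ` {0..pi}"]) (rule finite_subset)
  then have "finite (cos ` {0..pi})" by (simp add: image_image)
  then have "finite {0..pi}"
    by (rule finite_imageD) (auto simp: inj_on_def intro: cos_inj_pi)
  then show False using infinite_Icc[OF pi_gt_zero] by blast
qed

lemma pderiv_sum: "pderiv (\<Sum>i\<in>I. f i) = (\<Sum>i\<in>I. pderiv (f i))"
  by (induction I rule: infinite_finite_induct) (auto simp: pderiv_add)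

lemma poly_antiderivative: "\<exists>Q. pderiv Q = (q :: complex poly)"
proof -
  define Q where "Q = (\<Sum>i\<le>degree q. monom (coeff q i / of_nat (Suc i)) (Suc i))"
  have "pderiv Q = (\<Sum>i\<le>degree q. monom (coeff q i) i)"
    unfolding Q_def pderiv_sum
    by (rule sum.cong) (simp_all add: pderiv_monom del: of_nat_Suc)
  then show ?thesis by (metis poly_as_sum_of_monoms)
qed

lemma rm3_add: "rm3 (s + t) *v x = rm3 s *v (rm3 t *v x)"
  by (simp add: rm_mult sin_add cos_add algebra_simps)

lemma rm3_2pi: "rm3 (2 * pi) *v x = x"
  by (simp add: rm_mult vec_eq_iff forall_3)

lemma rm3_0: "rm3 0 = mat 1"
  using rotpath_rm(3) by (simp add: rotpath_def)

section \<open>Rotation-invariant finite-dimensional spaces\<close>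

text \<open>The members will be functions of \<open>sgn x\<close>, constant along rays, hence
  differentiable only away from the origin. \<open>S\<close> need not lie in \<open>A\<close>; it
  bounds the dimension.\<close>

locale sphere_space =
  fixes A S :: "(real ^ 3 \<Rightarrow> complex) set"
  assumes sub: "fn.subspace A" and fin: "finite S" and A_S: "A \<subseteq> fn.span S"
    and diff: "\<And>f x. f \<in> A \<Longrightarrow> x \<noteq> 0 \<Longrightarrow> f differentiable (at x)"
    and rot: "\<And>f R. f \<in> A \<Longrightarrow> rotation3 R \<Longrightarrow> (\<lambda>x. f (R *v x)) \<in> A"
begin

text \<open>A basis inside \<open>A\<close> is chosen first, so that the interpolating functions
  themselves lie in \<open>A\<close>.\<close>

lemma dual_points:
  "\<exists>I w. finite I \<and> (\<forall>i\<in>I. w i \<in> A) \<and> (\<forall>f\<in>A. \<forall>x. f x = (\<Sum>i\<in>I. f i * w i x))"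
proof -
  obtain B where B: "B \<subseteq> A" "fn.independent B" "A \<subseteq> fn.span B"
    using fn.maximal_independent_subset[of A] by blast
  have "finite B"
    using fn.independent_span_bound[OF fin B(2) subset_trans[OF B(1) A_S]] by simp
  have "fn.span B = A"
    by (rule subset_antisym[OF fn.span_minimal[OF B(1) sub] B(3)])
  with fn_span_dual_points[OF \<open>finite B\<close>] show ?thesis by (simp only:)
qed

text \<open>Members are combinations of finitely many fixed functions with their own values as
  coefficients, so a pointwise limit inherits the formula. Derivatives along rotations are such
  limits, whence \<open>LR_in_A\<close>.\<close>

lemma A_limit:
  fixes g :: "real \<Rightarrow> real ^ 3 \<Rightarrow> complex"
  assumes "\<And>s. g s \<in> A" "\<And>x. ((\<lambda>s. g s x) \<longlongrightarrow> h x) (at 0)"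
  shows "h \<in> A"
proof -
  obtain I w where Iw: "finite I \<and> (\<forall>i\<in>I. w i \<in> A) \<and> (\<forall>f\<in>A. \<forall>x. f x = (\<Sum>i\<in>I. f i * w i x))"
    using dual_points by (elim exE)
  then have I: "finite I" "\<And>i. i \<in> I \<Longrightarrow> w i \<in> A"
    and w: "\<And>f x. f \<in> A \<Longrightarrow> f x = (\<Sum>i\<in>I. f i * w i x)"
    by blast+
  have "h x = (\<Sum>i\<in>I. h i * w i x)" for x
  proof (rule tendsto_unique)
    show "((\<lambda>s. g s x) \<longlongrightarrow> h x) (at 0)" by (rule assms)
    have "((\<lambda>s. \<Sum>i\<in>I. g s i * w i x) \<longlongrightarrow> (\<Sum>i\<in>I. h i * w i x)) (at 0)"
      by (intro tendsto_intros assms)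
    moreover have "(\<lambda>s. g s x) = (\<lambda>s. \<Sum>i\<in>I. g s i * w i x)"
      by (rule ext) (rule w[OF assms(1)])
    ultimately show "((\<lambda>s. g s x) \<longlongrightarrow> (\<Sum>i\<in>I. h i * w i x)) (at 0)"
      by (simp only:)
  qed auto
  with I show ?thesis
    by (intro fn_subspace_sum_apply[OF sub, of I w h h])
qed

lemma LR_deriv:
  assumes "f \<in> A" "rotpath R J" "x \<noteq> 0"
  shows "((\<lambda>s. f (R s *v x)) has_vector_derivative frechet_derivative f (at x) (J x)) (at 0)"
proof -
  have "(f has_derivative frechet_derivative f (at x)) (at x)"
    using diff[OF assms(1,3)] frechet_derivative_works by blast
  then have "(f has_derivative frechet_derivative f (at x)) (at (R 0 *v x))"
    using assms(2) by (simp add: rotpath_def)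
  moreover have "((\<lambda>s. R s *v x) has_vector_derivative J x) (at 0)"
    using assms(2) by (simp add: rotpath_def)
  ultimately have "((\<lambda>s. f (R s *v x)) has_derivative (\<lambda>h. frechet_derivative f (at x) (h *\<^sub>R J x))) (at 0)"
    unfolding has_vector_derivative_def using has_derivative_compose by blast
  moreover have "linear (frechet_derivative f (at x))"
    using \<open>(f has_derivative frechet_derivative f (at x)) (at x)\<close> has_derivative_linear by blast
  ultimately show ?thesis
    unfolding has_vector_derivative_def by (simp add: linear_scale)
qed

lemma LR_frechet:
  assumes "f \<in> A" "rotpath R J" "x \<noteq> 0"
  shows "LR R f x = frechet_derivative f (at x) (J x)"
  unfolding LR_def by (rule vector_derivative_at[OF LR_deriv[OF assms]])

lemma LR_0: "LR R f 0 = 0"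
  by (simp add: LR_def)

lemma LR_has_deriv:
  assumes "f \<in> A" "rotpath R J"
  shows "((\<lambda>s. f (R s *v x)) has_vector_derivative LR R f x) (at 0)"
  using LR_deriv[OF assms, of x] LR_frechet[OF assms, of x] by (cases "x = 0") (auto simp: LR_0)

lemma LR_in_A:
  assumes "f \<in> A" "rotpath R J"
  shows "LR R f \<in> A"
proof (rule A_limit)
  fix s
  have "(\<lambda>x. f (R s *v x)) \<in> A" using assms rot by (auto simp: rotpath_def)
  then have "fscale (1 / of_real s) ((\<lambda>x. f (R s *v x)) - f) \<in> A"
    using assms(1) by (intro fn.subspace_scale[OF sub] fn.subspace_diff[OF sub])
  then show "(\<lambda>x. 1 / of_real s * (f (R s *v x) - f x)) \<in> A"
    by (simp add: fscale_def fun_diff_def)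
next
  fix x
  have "((\<lambda>s. f (R s *v x)) has_vector_derivative LR R f x) (at 0)"
    by (rule LR_has_deriv[OF assms])
  from difference_quotient_tendsto[OF this] assms(2)
  show "((\<lambda>s. 1 / of_real s * (f (R s *v x) - f x)) \<longlongrightarrow> LR R f x) (at 0)"
    by (simp add: rotpath_def)
qed

lemma LR_linear:
  assumes "f \<in> A" "g \<in> A" "rotpath R J"
  shows "LR R (\<lambda>x. c * f x + d * g x) x = c * LR R f x + d * LR R g x"
  unfolding LR_def[of R "\<lambda>x. c * f x + d * g x"]
  by (intro vector_derivative_at has_vector_derivative_add has_vector_derivative_mult_right LR_has_deriv[OF _ assms(3)] assms)

lemma lin_in_A: "f \<in> A \<Longrightarrow> g \<in> A \<Longrightarrow> (\<lambda>x. c * f x + d * g x) \<in> A"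
  using fn.subspace_add[OF sub fn.subspace_scale[OF sub] fn.subspace_scale[OF sub], of f g c d]
  by (simp add: fscale_def plus_fun_def)

lemma LR3_has_deriv:
  assumes "f \<in> A"
  shows "((\<lambda>s. f (rm3 s *v x)) has_vector_derivative LR rm3 f (rm3 t *v x)) (at t)"
proof -
  have "((\<lambda>s. f (rm3 s *v (rm3 t *v x))) has_vector_derivative LR rm3 f (rm3 t *v x)) (at 0)"
    by (rule LR_has_deriv[OF assms rotpath_rm(3)])
  then have "((\<lambda>s. f (rm3 s *v (rm3 t *v x))) has_vector_derivative LR rm3 f (rm3 t *v x)) (at ((\<lambda>s. s - t) t))"
    by simp
  moreover have "((\<lambda>s. s - t) has_vector_derivative 1) (at t)"
    by (auto intro!: derivative_eq_intros)
  ultimately have "((\<lambda>s. f (rm3 s *v (rm3 t *v x))) \<circ> (\<lambda>s. s - t) has_vector_derivative 1 *\<^sub>R LR rm3 f (rm3 t *v x)) (at t)"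
    by (intro vector_diff_chain_at) auto
  then show ?thesis by (simp add: o_def rm3_add[symmetric])
qed

section \<open>Weights for rotation about the third axis\<close>

definition wt :: "complex \<Rightarrow> (real ^ 3 \<Rightarrow> complex) \<Rightarrow> bool" where
  "wt \<mu> f \<longleftrightarrow> f \<in> A \<and> (\<forall>x. LR rm3 f x = \<i> * \<mu> * f x)"

lemma exp_rm3_deriv:
  assumes "f \<in> A"
  shows "((\<lambda>s. exp (- \<i> * \<mu> * of_real s) * f (rm3 s *v x)) has_vector_derivative
    exp (- \<i> * \<mu> * of_real t) * (LR rm3 f (rm3 t *v x) - \<i> * \<mu> * f (rm3 t *v x))) (at t)"
proof -
  have "((\<lambda>z. exp (- \<i> * \<mu> * z)) has_field_derivative - \<i> * \<mu> * exp (- \<i> * \<mu> * of_real t)) (at (of_real t))"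
    by (auto intro!: derivative_eq_intros)
  then have "((\<lambda>s. exp (- \<i> * \<mu> * of_real s)) has_vector_derivative - \<i> * \<mu> * exp (- \<i> * \<mu> * of_real t)) (at t)"
    using field_vector_diff_chain_at[OF has_vector_derivative_of_real[OF DERIV_ident]] by (simp add: o_def)
  from has_vector_derivative_mult[OF this LR3_has_deriv[OF assms, of x t]]
  show ?thesis by (simp add: algebra_simps)
qed

lemma wt_rm3:
  assumes "wt \<mu> f"
  shows "f (rm3 s *v x) = exp (\<i> * \<mu> * of_real s) * f x"
proof -
  let ?u = "\<lambda>s. exp (- \<i> * \<mu> * of_real s) * f (rm3 s *v x)"
  have "(?u has_vector_derivative 0) (at t)" for t
    using exp_rm3_deriv[of f \<mu> x t] assms by (simp add: wt_def)
  then obtain c where "\<And>s. ?u s = c"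
    using has_vector_derivative_zero_constant[of UNIV ?u] by (metis UNIV_I convex_UNIV)
  then have "?u s = ?u 0" by metis
  then have "exp (\<i> * \<mu> * of_real s) * ?u s = exp (\<i> * \<mu> * of_real s) * f x" by (simp add: rm3_0)
  moreover have "exp (\<i> * \<mu> * of_real s) * exp (- \<i> * \<mu> * of_real s) = 1" by (simp add: exp_minus)
  ultimately show ?thesis by (metis mult.assoc mult_1)
qed

text \<open>A nontrivial Jordan block would make \<open>f (rm3 s *v x)\<close> grow linearly, which is impossible
  for a periodic function.\<close>

lemma wt_no_jordan:
  assumes f: "f \<in> A" and g: "wt \<mu> g" and eq: "\<And>x. LR rm3 f x - \<i> * \<mu> * f x = g x"
  shows "g x = 0"
proof (rule ccontr)
  assume "g x \<noteq> 0"
  let ?u = "\<lambda>s. exp (- \<i> * \<mu> * of_real s) * f (rm3 s *v x) - of_real s * g x"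
  have "((\<lambda>s. exp (- \<i> * \<mu> * of_real s) * f (rm3 s *v x)) has_vector_derivative g x) (at t)" for t
  proof -
    have "exp (- \<i> * \<mu> * of_real t) * exp (\<i> * \<mu> * of_real t) = 1" by (simp add: exp_minus)
    then have "exp (- \<i> * \<mu> * of_real t) * g (rm3 t *v x) = g x"
      unfolding wt_rm3[OF g] mult.assoc[symmetric] by simp
    then show ?thesis using exp_rm3_deriv[OF f, of \<mu> x t] by (simp only: eq)
  qed
  moreover have "((\<lambda>s. of_real s * g x) has_vector_derivative g x) (at t)" for t
    by (auto intro!: derivative_eq_intros simp: has_vector_derivative_mult_left[OF has_vector_derivative_of_real[OF DERIV_ident], simplified])
  ultimately have "(?u has_vector_derivative 0) (at t)" for t
    using has_vector_derivative_diff by fastforce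
  then obtain c where "\<And>s. ?u s = c"
    using has_vector_derivative_zero_constant[of UNIV ?u] by (metis UNIV_I convex_UNIV)
  then have "?u (2 * pi) = ?u 0" by metis
  moreover have "exp (- \<i> * \<mu> * of_real (2 * pi)) = 1"
    using wt_rm3[OF g, of "2 * pi" x] \<open>g x \<noteq> 0\<close> by (simp add: rm3_2pi exp_minus)
  ultimately show False using \<open>g x \<noteq> 0\<close> by (simp add: rm3_2pi rm3_0)
qed

definition WS :: "(real ^ 3 \<Rightarrow> complex) set" where
  "WS = fn.span {f. \<exists>\<mu>. wt \<mu> f}"

lemma WS_A: "WS \<subseteq> A"
  unfolding WS_def by (rule fn.span_minimal[OF _ sub]) (auto simp: wt_def)

lemma wt_lin: "wt \<mu> f \<Longrightarrow> wt \<mu> g \<Longrightarrow> wt \<mu> (\<lambda>x. c * f x + d * g x)"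
  unfolding wt_def using LR_linear[of f g rm3 J3 c d] rotpath_rm(3) lin_in_A by (auto simp: algebra_simps)

lemma wt_0: "wt \<mu> (\<lambda>x. 0)"
  using fn.subspace_0[OF sub] by (simp add: wt_def zero_fun_def LR_def)

text \<open>On a vector of weight \<nu> \<noteq> \<mu> the operator LR rm3 - i \<mu> is
  multiplication by i (\<nu> - \<mu>) and can be inverted; what is left over has weight
  \<mu>.\<close>

lemma WS_resolve:
  assumes "g \<in> WS"
  shows "\<exists>h\<in>WS. wt \<mu> (\<lambda>x. g x - (LR rm3 h x - \<i> * \<mu> * h x))"
  using assms unfolding WS_def
proof (induction rule: fn.span_induct_alt)
  case base
  show ?case
    by (rule bexI[of _ 0]) (use wt_0[of \<mu>] in \<open>auto simp: fn.span_zero LR_def\<close>)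
next
  case (step c f g)
  then obtain \<nu> where f: "wt \<nu> f" by auto
  from step obtain h where h: "h \<in> fn.span {f. \<exists>\<mu>. wt \<mu> f}" "wt \<mu> (\<lambda>x. g x - (LR rm3 h x - \<i> * \<mu> * h x))"
    by auto
  show ?case
  proof (cases "\<nu> = \<mu>")
    case True
    have "wt \<mu> (\<lambda>x. (fscale c f + g) x - (LR rm3 h x - \<i> * \<mu> * h x))"
      using wt_lin[OF f[unfolded True] h(2), of c 1] by (simp add: fscale_def algebra_simps)
    with h(1) show ?thesis by blast
  next
    case False
    let ?k = "c / (\<i> * (\<nu> - \<mu>))"
    let ?h = "\<lambda>x. ?k * f x + 1 * h x"
    have hA: "h \<in> A" "f \<in> A" using subsetD[OF WS_A[unfolded WS_def] h(1)] f by (auto simp: wt_def)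
    have h_eq: "?h = fscale ?k f + h" by (auto simp: fscale_def)
    have h_in: "?h \<in> fn.span {f. \<exists>\<mu>. wt \<mu> f}" unfolding h_eq
      by (rule fn.span_add[OF fn.span_scale[OF fn.span_base] h(1)]) (use f in auto)
    have "(fscale c f + g) x - (LR rm3 ?h x - \<i> * \<mu> * ?h x) = g x - (LR rm3 h x - \<i> * \<mu> * h x)" for x
    proof -
      have "k * (\<i> * \<nu> * F) - \<i> * \<mu> * (k * F) = k * (\<i> * (\<nu> - \<mu>)) * F" for k F
        by (simp add: algebra_simps)
      moreover have "?k * (\<i> * (\<nu> - \<mu>)) = c" using False by simp
      ultimately have "?k * (\<i> * \<nu> * f x) - \<i> * \<mu> * (?k * f x) = c * f x" by (simp only:)
      moreover have "LR rm3 f x = \<i> * \<nu> * f x" using f by (simp add: wt_def)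
      moreover have "C + G - ((u + 1 * L) - m * (K + 1 * H)) = G - (L - m * H)" if "u - m * K = C" for C G u L m K H :: complex
        unfolding that[symmetric] by (simp add: algebra_simps)
      ultimately show ?thesis
        unfolding LR_linear[OF hA(2,1) rotpath_rm(3)] plus_fun_apply fscale_apply by (simp only:)
    qed
    then have eq: "(\<lambda>x. (fscale c f + g) x - (LR rm3 ?h x - \<i> * \<mu> * ?h x)) = (\<lambda>x. g x - (LR rm3 h x - \<i> * \<mu> * h x))"
      by (rule ext)
    then have "\<exists>h. h \<in> fn.span {f. \<exists>\<mu>. wt \<mu> f} \<and> wt \<mu> (\<lambda>x. (fscale c f + g) x - (LR rm3 h x - \<i> * \<mu> * h x))"
      by (intro exI[where x = ?h] conjI h_in) (rule ssubst[where P = "wt \<mu>", OF _ h(2)])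
    then show ?thesis unfolding Bex_def .
  qed
qed

text \<open>Subtracting a suitable \<open>h\<close> from \<open>WS\<close> reduces the right-hand
  side to a vector of weight \<mu>, which is zero because there are no Jordan blocks; so f - h is
  itself a weight vector.\<close>

lemma WS_peel:
  assumes f: "f \<in> A" and g: "(\<lambda>x. LR rm3 f x - \<i> * \<mu> * f x) \<in> WS"
  shows "f \<in> WS"
proof -
  obtain h where h: "h \<in> WS" "wt \<mu> (\<lambda>x. (LR rm3 f x - \<i> * \<mu> * f x) - (LR rm3 h x - \<i> * \<mu> * h x))"
    using WS_resolve[OF g] by blast
  have hA: "h \<in> A" using h(1) WS_A by auto
  let ?f = "\<lambda>x. 1 * f x + (- 1) * h x"
  have fA: "?f \<in> A" by (rule lin_in_A[OF f hA])
  have L: "LR rm3 ?f x = LR rm3 f x - LR rm3 h x" for x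
    using LR_linear[OF f hA rotpath_rm(3), of 1 "- 1" x] by simp
  have eq: "LR rm3 ?f x - \<i> * \<mu> * ?f x = (LR rm3 f x - \<i> * \<mu> * f x) - (LR rm3 h x - \<i> * \<mu> * h x)" for x
    unfolding L by (simp add: algebra_simps)
  have "LR rm3 ?f x - \<i> * \<mu> * ?f x = 0" for x
    unfolding eq by (rule wt_no_jordan[OF fA h(2) eq])
  then have "LR rm3 ?f x = \<i> * \<mu> * ?f x" for x
    by (simp only: right_minus_eq)
  then have "wt \<mu> ?f" using fA unfolding wt_def by blast
  then have "?f \<in> WS" unfolding WS_def by (auto intro: fn.span_base)
  then have "?f + h \<in> WS" using h(1) unfolding WS_def by (rule fn.span_add)
  then show ?thesis by (simp add: plus_fun_def)
qed

lemma LR3_pow_in_A: "f \<in> A \<Longrightarrow> (LR rm3 ^^ k) f \<in> A"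
  by (induction k) (auto intro: LR_in_A rotpath_rm)

text \<open>Induction on the degree: a root r of \<open>p\<close> splits off the factor LR rm3 - r,
  the quotient is handled by induction applied to (LR rm3 - r) f, and \<open>WS_peel\<close> returns
  to f. The root r corresponds to the weight - i r.\<close>

lemma poly_LR_WS:
  assumes "p \<noteq> 0" "f \<in> A" "degree p = n" "(\<lambda>x. \<Sum>k\<le>n. coeff p k * (LR rm3 ^^ k) f x) \<in> WS"
  shows "f \<in> WS"
  using assms
proof (induction n arbitrary: p f)
  case 0
  then have "coeff p 0 \<noteq> 0" by (metis leading_coeff_0_iff)
  moreover have "fscale (1 / coeff p 0) (\<lambda>x. \<Sum>k\<le>0. coeff p k * (LR rm3 ^^ k) f x) \<in> WS"
    using 0(4) unfolding WS_def by (rule fn.span_scale)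
  ultimately show ?case by (simp add: fscale_def)
next
  case (Suc n)
  then obtain r where "poly p r = 0"
    using fundamental_theorem_of_algebra[of p] by (auto simp: constant_degree)
  then obtain q where q: "p = [:- r, 1:] * q" by (auto simp: poly_eq_0_iff_dvd elim: dvdE)
  have q0: "q \<noteq> 0" using Suc.prems(1) q by auto
  then have dq: "degree q = n" using Suc.prems(3) q by (simp add: degree_mult_eq del: mult_pCons_left)
  let ?g = "\<lambda>x. 1 * LR rm3 f x + (- r) * f x"
  have LA: "LR rm3 f \<in> A" by (rule LR_in_A[OF Suc.prems(2) rotpath_rm(3)])
  have gA: "?g \<in> A" by (rule lin_in_A[OF LA Suc.prems(2)])
  have pow: "(LR rm3 ^^ k) ?g x = (LR rm3 ^^ Suc k) f x - r * (LR rm3 ^^ k) f x" for k x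
  proof (induction k arbitrary: x)
    case (Suc k)
    have "(LR rm3 ^^ Suc k) ?g x = LR rm3 (\<lambda>x. 1 * (LR rm3 ^^ Suc k) f x + (- r) * (LR rm3 ^^ k) f x) x"
      unfolding funpow.simps(2)[of k] comp_apply by (intro arg_cong[of _ _ "\<lambda>g. LR rm3 g x"] ext) (simp only: Suc, simp)
    also have "\<dots> = (LR rm3 ^^ Suc (Suc k)) f x - r * (LR rm3 ^^ Suc k) f x"
      unfolding LR_linear[OF LR3_pow_in_A[OF \<open>f \<in> A\<close>] LR3_pow_in_A[OF \<open>f \<in> A\<close>] rotpath_rm(3)] by simp
    finally show ?case .
  qed simp
  have "(\<Sum>k\<le>Suc n. coeff p k * (LR rm3 ^^ k) f x) = (\<Sum>k\<le>n. coeff q k * (LR rm3 ^^ k) ?g x)" for x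
  proof -
    have qn: "coeff q (Suc n) = 0" using dq by (simp add: coeff_eq_0)
    have "(\<Sum>k\<le>Suc n. coeff p k * (LR rm3 ^^ k) f x)
       = (\<Sum>k\<le>Suc n. (case k of 0 \<Rightarrow> 0 | Suc j \<Rightarrow> coeff q j) * (LR rm3 ^^ k) f x) - (\<Sum>k\<le>Suc n. r * coeff q k * (LR rm3 ^^ k) f x)"
      unfolding sum_subtractf[symmetric] q
      by (rule sum.cong) (auto simp: coeff_pCons algebra_simps split: nat.split)
    also have "(\<Sum>k\<le>Suc n. (case k of 0 \<Rightarrow> 0 | Suc j \<Rightarrow> coeff q j) * (LR rm3 ^^ k) f x) = (\<Sum>k\<le>n. coeff q k * (LR rm3 ^^ Suc k) f x)"
      by (subst sum.atMost_Suc_shift) simp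
    also have "(\<Sum>k\<le>Suc n. r * coeff q k * (LR rm3 ^^ k) f x) = (\<Sum>k\<le>n. r * coeff q k * (LR rm3 ^^ k) f x)"
      by (simp add: qn)
    finally show ?thesis
      unfolding pow by (simp add: sum_subtractf[symmetric] algebra_simps)
  qed
  then have "?g \<in> WS" using Suc.IH[OF q0 gA dq] Suc.prems(4) by presburger
  then show ?case
    by (intro WS_peel[OF Suc.prems(2), of "- \<i> * r"]) (simp add: algebra_simps)
qed

text \<open>The iterates of \<open>f\<close> under \<open>LR rm3\<close> are dependent, so a nonzero
  polynomial in \<open>LR rm3\<close> annihilates \<open>f\<close>.\<close>

lemma in_WS:
  assumes "f \<in> A"
  shows "f \<in> WS"
proof -
  obtain c n where c: "\<exists>k\<le>n. c k \<noteq> 0" "\<And>x. (\<Sum>k\<le>n. c k * (LR rm3 ^^ k) f x) = 0"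
    using fn_span_iterates_dependent[OF fin, of "\<lambda>k. (LR rm3 ^^ k) f"] LR3_pow_in_A[OF assms] A_S by blast
  define p where "p = (\<Sum>k\<le>n. monom (c k) k)"
  have cp: "coeff p k = (if k \<le> n then c k else 0)" for k
    unfolding p_def by (simp add: coeff_sum)
  have "p \<noteq> 0" using c(1) cp by (metis coeff_0)
  have "degree p \<le> n" by (rule degree_le) (auto simp: cp)
  have "(\<lambda>x. \<Sum>k\<le>degree p. coeff p k * (LR rm3 ^^ k) f x) = 0"
  proof
    fix x
    have "(\<Sum>k\<le>degree p. coeff p k * (LR rm3 ^^ k) f x) = (\<Sum>k\<le>n. c k * (LR rm3 ^^ k) f x)"
    proof (intro sum.mono_neutral_cong_left ballI)
      fix i assume "i \<in> {..n} - {..degree p}"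
      then have "c i = 0" using cp[of i] coeff_eq_0[of p i] by auto
      then show "c i * (LR rm3 ^^ i) f x = 0" by simp
    qed (use \<open>degree p \<le> n\<close> in \<open>auto simp: cp\<close>)
    then show "(\<Sum>k\<le>degree p. coeff p k * (LR rm3 ^^ k) f x) = (0 :: real ^ 3 \<Rightarrow> complex) x" using c(2) by simp
  qed
  then have "(\<lambda>x. \<Sum>k\<le>degree p. coeff p k * (LR rm3 ^^ k) f x) \<in> WS"
    unfolding WS_def by (simp only: fn.span_zero)
  then show ?thesis using poly_LR_WS[OF \<open>p \<noteq> 0\<close> assms refl] by blast
qed

lemma wt_int:
  assumes "wt \<mu> f" "f x \<noteq> 0"
  obtains m :: int where "\<mu> = of_int m"
proof -
  have "exp (\<i> * \<mu> * of_real (2 * pi)) = 1"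
    using wt_rm3[OF assms(1), of "2 * pi" x] assms(2) by (simp add: rm3_2pi)
  then obtain n :: int where "Re (\<i> * \<mu> * of_real (2 * pi)) = 0" "Im (\<i> * \<mu> * of_real (2 * pi)) = of_int (2 * n) * pi"
    unfolding exp_eq_1 by blast
  then have "\<mu> = of_int n"
    by (simp add: complex_eq_iff)
  then show ?thesis by (rule that)
qed

section \<open>The raising operator and the restriction to a meridian\<close>

definition Eop :: "(real ^ 3 \<Rightarrow> complex) \<Rightarrow> real ^ 3 \<Rightarrow> complex" where
  "Eop f x = LR rm2 f x - \<i> * LR rm1 f x"

lemma Eop_in_A: "f \<in> A \<Longrightarrow> Eop f \<in> A"
  using lin_in_A[OF LR_in_A[OF _ rotpath_rm(2)] LR_in_A[OF _ rotpath_rm(1)], of f f 1 "- \<i>"]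
  by (simp add: Eop_def[abs_def])

definition wti :: "int \<Rightarrow> (real ^ 3 \<Rightarrow> complex) \<Rightarrow> bool" where
  "wti m f \<longleftrightarrow> f \<in> A \<and> (\<forall>s x. f (rm3 s *v x) = cis (of_int m * s) * f x)"

text \<open>The rotation \<open>rm3 t\<close> turns the pair \<open>J1\<close>, \<open>J2\<close> of
  vector fields, and J2 - i J1 is an eigenvector with eigenvalue e^(-it). Moved to the other side,
  this factor raises the weight by one.\<close>

lemma Eop_wti:
  assumes "wti m f"
  shows "wti (m + 1) (Eop f)"
  unfolding wti_def
proof (intro conjI allI)
  have f: "f \<in> A" using assms by (simp add: wti_def)
  then show "Eop f \<in> A" by (rule Eop_in_A)
  fix t x
  show "Eop f (rm3 t *v x) = cis (of_int (m + 1) * t) * Eop f x"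
  proof (cases "x = 0")
    case True
    then show ?thesis by (simp add: Eop_def LR_0)
  next
    case False
    let ?y = "rm3 t *v x"
    have y0: "?y \<noteq> 0"
    proof
      assume "?y = 0"
      then have "rm3 (- t + t) *v x = 0" unfolding rm3_add by simp
      then show False using False by (simp add: rm3_0)
    qed
    define Df where "Df = frechet_derivative f (at ?y)"
    have D: "(f has_derivative Df) (at ?y)"
      using diff[OF f y0] frechet_derivative_works by (auto simp: Df_def)
    then have lin: "linear Df" using has_derivative_linear by blast
    have *: "cis (of_int m * t) * LR R f x = Df (rm3 t *v J x)" if "rotpath R J" for R J
    proof -
      have 1: "((\<lambda>s. f (rm3 t *v (R s *v x))) has_vector_derivative cis (of_int m * t) * LR R f x) (at 0)"
        using has_vector_derivative_mult_right[OF LR_has_deriv[OF f that, of x], of "cis (of_int m * t)"] assms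
        by (simp add: wti_def)
      have "((\<lambda>s. rm3 t *v (R s *v x)) has_vector_derivative rm3 t *v J x) (at 0)"
        using has_vector_derivative_matrix_vector_mult[OF has_vector_derivative_const[of "rm3 t"], of "\<lambda>s. R s *v x" "J x" 0] that
        by (simp add: rotpath_def)
      moreover have "(f has_derivative Df) (at (rm3 t *v (R 0 *v x)))" using D that by (simp add: rotpath_def)
      ultimately have "((\<lambda>s. f (rm3 t *v (R s *v x))) has_derivative (\<lambda>h. Df (h *\<^sub>R (rm3 t *v J x)))) (at 0)"
        unfolding has_vector_derivative_def using has_derivative_compose by blast
      then have "((\<lambda>s. f (rm3 t *v (R s *v x))) has_vector_derivative Df (rm3 t *v J x)) (at 0)"
        unfolding has_vector_derivative_def by (simp add: linear_scale[OF lin])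
      from vector_derivative_unique_at[OF 1 this] show ?thesis .
    qed
    have y: "LR R f ?y = Df (J ?y)" if "rotpath R J" for R J
      unfolding Df_def by (rule LR_frechet[OF f that y0])
    have r: "rm3 t *v J1 x = cos t *\<^sub>R J1 ?y + sin t *\<^sub>R J2 ?y" "rm3 t *v J2 x = (- sin t) *\<^sub>R J1 ?y + cos t *\<^sub>R J2 ?y"
    proof -
      have 1: "cos t * (sin t * a + cos t * b) + sin t * (sin t * b - cos t * a) = b" for a b
        using sin_cos_squared_add[of t] by algebra
      have 2: "cos t * (sin t * b - cos t * a) - sin t * (sin t * a + cos t * b) = - a" for a b
        using sin_cos_squared_add[of t] by algebra
      show "rm3 t *v J1 x = cos t *\<^sub>R J1 ?y + sin t *\<^sub>R J2 ?y" "rm3 t *v J2 x = (- sin t) *\<^sub>R J1 ?y + cos t *\<^sub>R J2 ?y"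
        using 1[of "x $ 1" "x $ 2"] 2[of "x $ 2" "x $ 1"]
        by (simp_all add: rm_mult J1_def J2_def vec_eq_iff forall_3)
    qed
    have "cis (of_int m * t) * Eop f x = Df (rm3 t *v J2 x) - \<i> * Df (rm3 t *v J1 x)"
      unfolding Eop_def using *[OF rotpath_rm(1)] *[OF rotpath_rm(2)] by (simp add: algebra_simps)
    also have "\<dots> = cis (- t) * (Df (J2 ?y) - \<i> * Df (J1 ?y))"
      unfolding r linear_add[OF lin] linear_scale[OF lin]
      by (simp add: complex_eq_iff algebra_simps)
    also have "\<dots> = cis (- t) * Eop f ?y"
      unfolding Eop_def y[OF rotpath_rm(1)] y[OF rotpath_rm(2)] ..
    finally have "cis t * (cis (of_int m * t) * Eop f x) = cis t * (cis (- t) * Eop f ?y)" by simp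
    then have "cis (t + of_int m * t) * Eop f x = Eop f ?y"
      by (simp only: mult.assoc[symmetric] cis_mult) simp
    then show ?thesis by (simp add: algebra_simps)
  qed
qed

lemma Eop_pow_wti: "wti m f \<Longrightarrow> wti (m + int k) ((Eop ^^ k) f)"
proof (induction k)
  case (Suc k)
  then show ?case using Eop_wti[of "m + int k" "(Eop ^^ k) f"] by (simp add: ac_simps)
qed simp

text \<open>The iterates have distinct weights. A dependence relation evaluated along an orbit of
  \<open>rm3\<close> is, up to a phase, a polynomial in e^(it) that vanishes on the circle, so each
  of its terms vanishes separately, including one with a nonzero coefficient.\<close>

lemma Eop_nilpotent:
  assumes "wti m f"
  obtains k where "\<And>x. (Eop ^^ k) f x = 0"
proof -
  have "(Eop ^^ k) f \<in> A" for k using Eop_pow_wti[OF assms, of k] by (simp add: wti_def)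
  then obtain c n where c: "\<exists>k\<le>n. c k \<noteq> 0" "\<And>x. (\<Sum>k\<le>n. c k * (Eop ^^ k) f x) = 0"
    using fn_span_iterates_dependent[OF fin, of "\<lambda>k. (Eop ^^ k) f"] A_S by blast
  then obtain k where k: "k \<le> n" "c k \<noteq> 0" by blast
  have "(Eop ^^ k) f x = 0" for x
  proof -
    define p where "p = (\<Sum>k\<le>n. monom (c k * (Eop ^^ k) f x) k)"
    have "poly p (cis t) = 0" for t
    proof -
      have "(\<Sum>k\<le>n. c k * (Eop ^^ k) f (rm3 t *v x)) = cis (of_int m * t) * poly p (cis t)"
        using Eop_pow_wti[OF assms]
        by (simp add: wti_def p_def poly_sum poly_monom sum_distrib_left Complex.DeMoivre cis_mult[symmetric] algebra_simps)
      then show ?thesis using c(2) by simp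
    qed
    then have "p = 0" by (rule poly_zero_on_circle)
    then have "coeff p k = 0" by simp
    then show ?thesis using k by (simp add: p_def coeff_sum)
  qed
  then show ?thesis by (rule that)
qed

definition gamma :: "real \<Rightarrow> real ^ 3" where
  "gamma z = vector [sqrt (1 - z\<^sup>2), 0, z]"

text \<open>With w = sqrt (1 - z^2), a function f of weight m satisfies Eop f (gamma z) = - w^(m+1)
  d/dz (w^(-m) f (gamma z)). Hence w^(-m) f is obtained from zero by repeated integration and is a
  polynomial in z.\<close>

lemma meridian_poly:
  assumes "wti m f" "\<And>x. (Eop ^^ k) f x = 0"
  shows "\<exists>q. \<forall>z\<in>{-1<..<1}. f (gamma z) = of_real (sqrt (1 - z\<^sup>2)) powi m * poly q (of_real z)"
  using assms
proof (induction k arbitrary: f m)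
  case 0
  then show ?case by (intro exI[of _ 0]) simp
next
  case (Suc k)
  have f: "f \<in> A" using Suc.prems by (simp add: wti_def)
  have "(Eop ^^ k) (Eop f) x = 0" for x
    using Suc.prems(2) by (simp add: funpow_Suc_right del: funpow.simps)
  from Suc.IH[OF Eop_wti[OF Suc.prems(1)] this] obtain q where
    q: "\<And>z. z \<in> {-1<..<1} \<Longrightarrow> Eop f (gamma z) = of_real (sqrt (1 - z\<^sup>2)) powi (m + 1) * poly q (of_real z)" by blast
  obtain Q where Q: "pderiv Q = q" using poly_antiderivative by blast
  \<comment> \<open>The derivative of w^(-m) f is - q and that of \<open>Q\<close> is q, so their
    sum is constant on the open interval.\<close>
  define h where "h z = of_real (sqrt (1 - z\<^sup>2)) powi (- m) * f (gamma z) + poly Q (of_real z)" for z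
  have "(h has_vector_derivative 0) (at z)" if z: "z \<in> {-1<..<1}" for z
  proof -
    define w where "w = sqrt (1 - z\<^sup>2)"
    have w: "w > 0" using z by (simp add: w_def abs_square_less_1 abs_less_iff)
    have g0: "gamma z \<noteq> 0" using w by (auto simp: gamma_def vec_eq_iff forall_3 w_def)
    define Df where "Df = frechet_derivative f (at (gamma z))"
    have D: "(f has_derivative Df) (at (gamma z))"
      using diff[OF f g0] frechet_derivative_works by (auto simp: Df_def)
    then have lin: "linear Df" using has_derivative_linear by blast
    have dw: "((\<lambda>z. sqrt (1 - z\<^sup>2)) has_real_derivative - z / w) (at z)"
      using w unfolding w_def by (auto intro!: derivative_eq_intros simp: field_simps)
    define g' where "g' = (vector [- z / w, 0, 1] :: real ^ 3)"
    have dg: "(gamma has_vector_derivative g') (at z)"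
      using dw by (intro has_vector_derivative_vec3)
        (auto simp: gamma_def g'_def has_real_derivative_iff_has_vector_derivative intro!: derivative_eq_intros)
    have "((\<lambda>z. f (gamma z)) has_derivative (\<lambda>h. Df (h *\<^sub>R g'))) (at z)"
      using has_derivative_compose[OF dg[unfolded has_vector_derivative_def] D] .
    then have df: "((\<lambda>z. f (gamma z)) has_vector_derivative Df g') (at z)"
      unfolding has_vector_derivative_def by (simp add: linear_scale[OF lin])
    have L: "LR R f (gamma z) = Df (J (gamma z))" if "rotpath R J" for R J
      unfolding Df_def by (rule LR_frechet[OF f that g0])
    have L3: "LR rm3 f (gamma z) = \<i> * of_int m * f (gamma z)"
    proof -
      have "((\<lambda>s. cis (of_int m * s) * f (gamma z)) has_vector_derivative \<i> * of_int m * f (gamma z)) (at 0)"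
      proof -
        have "((\<lambda>u. exp (\<i> * of_int m * u) * f (gamma z)) has_field_derivative \<i> * of_int m * f (gamma z)) (at (of_real 0))"
          by (auto intro!: derivative_eq_intros)
        from field_vector_diff_chain_at[OF has_vector_derivative_of_real[OF DERIV_ident] this]
        show ?thesis by (simp add: o_def cis_conv_exp mult.assoc)
      qed
      moreover have "((\<lambda>s. cis (of_int m * s) * f (gamma z)) has_vector_derivative LR rm3 f (gamma z)) (at 0)"
        using LR_has_deriv[OF f rotpath_rm(3), of "gamma z"] Suc.prems(1) by (simp add: wti_def)
      ultimately show ?thesis by (metis vector_derivative_unique_at)
    qed
    have J: "J2 (gamma z) = (- w) *\<^sub>R g'" "J1 (gamma z) = (- z / w) *\<^sub>R J3 (gamma z)"
      using w by (simp_all add: J1_def J2_def J3_def gamma_def g'_def vec_eq_iff forall_3 w_def)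
    have ii: "\<i> * (of_real z * (\<i> * a * b)) = - (of_real z * a * b)" for a b
      by (simp add: mult.left_commute[of "\<i>" "of_real z"] mult.assoc)
    have E: "Eop f (gamma z) = - of_real w * Df g' - of_real (z / w) * of_int m * f (gamma z)"
      unfolding Eop_def L[OF rotpath_rm(1)] L[OF rotpath_rm(2)] J linear_scale[OF lin] L[OF rotpath_rm(3), symmetric] L3
      by (simp add: scaleR_conv_of_real ii)
    have "((\<lambda>z. (of_real (sqrt (1 - z\<^sup>2)) :: complex) powi (- m)) has_vector_derivative
        of_int (- m) * of_real w powi (- m - 1) * of_real (- z / w)) (at z)"
    proof -
      have "((\<lambda>y. y powi (- m)) has_field_derivative of_int (- m) * (of_real w :: complex) powi (- m - 1)) (at (of_real (sqrt (1 - z\<^sup>2))))"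
        using w by (auto intro!: derivative_eq_intros simp: w_def)
      from field_vector_diff_chain_at[OF has_vector_derivative_of_real[OF dw] this] show ?thesis
        by (simp add: o_def mult.commute)
    qed
    from has_vector_derivative_mult[OF this df]
    have 1: "((\<lambda>z. of_real (sqrt (1 - z\<^sup>2)) powi (- m) * f (gamma z)) has_vector_derivative
        of_real w powi (- m) * Df g' + of_int (- m) * of_real w powi (- m - 1) * of_real (- z / w) * f (gamma z)) (at z)"
      by (simp add: w_def)
    have 2: "((\<lambda>z. poly Q (of_real z)) has_vector_derivative poly q (of_real z)) (at z)"
      using field_vector_diff_chain_at[OF has_vector_derivative_of_real[OF DERIV_ident] poly_DERIV[of Q]] by (simp add: o_def Q)
    have "of_real w powi (- m) * Df g' + of_int (- m) * of_real w powi (- m - 1) * of_real (- z / w) * f (gamma z)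
        = - (of_real w powi (- m - 1) * Eop f (gamma z))"
      unfolding E using w by (simp add: power_int_diff field_simps)
    also have "\<dots> = - poly q (of_real z)"
      unfolding q[OF z] w_def[symmetric] using w
      by (simp add: mult.assoc[symmetric] power_int_add[symmetric])
    finally have "of_real w powi (- m) * Df g' + of_int (- m) * of_real w powi (- m - 1) * of_real (- z / w) * f (gamma z) + poly q (of_real z) = 0"
      by simp
    with has_vector_derivative_add[OF 1 2] show ?thesis unfolding h_def[abs_def] by simp
  qed
  then obtain c where c: "\<And>z. z \<in> {-1<..<1} \<Longrightarrow> h z = c"
    using has_vector_derivative_zero_constant[of "{-1<..<1}" h]
    by (metis convex_real_interval(8) has_vector_derivative_at_within)
  show ?case
  proof (intro exI[of _ "[:c:] - Q"] ballI)
    fix z :: real assume z: "z \<in> {-1<..<1}"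
    then have w: "sqrt (1 - z\<^sup>2) \<noteq> 0" by (simp add: abs_square_less_1 abs_less_iff power2_eq_1_iff) 
    have "of_real (sqrt (1 - z\<^sup>2)) powi m * (of_real (sqrt (1 - z\<^sup>2)) powi (- m) * f (gamma z)) = f (gamma z)"
      using w by (simp add: power_int_minus)
    moreover have "of_real (sqrt (1 - z\<^sup>2)) powi (- m) * f (gamma z) = c - poly Q (of_real z)"
      using c[OF z] by (simp add: h_def eq_diff_eq)
    ultimately have "f (gamma z) = of_real (sqrt (1 - z\<^sup>2)) powi m * (c - poly Q (of_real z))" by (simp only:)
    then show "f (gamma z) = of_real (sqrt (1 - z\<^sup>2)) powi m * poly ([:c:] - Q) (of_real z)" by simp
  qed
qed

text \<open>Every point of the sphere off the axis is a rotate of a point of the meridian, and the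
  weight supplies the phase that turns w^m into (x1 + i x2)^m.\<close>

lemma wti_poly:
  assumes "wti m f"
  obtains q where "\<And>x. norm x = 1 \<Longrightarrow> Complex (x $ 1) (x $ 2) \<noteq> 0 \<Longrightarrow> f x = Complex (x $ 1) (x $ 2) powi m * poly q (of_real (x $ 3))"
proof -
  obtain k where "\<And>x. (Eop ^^ k) f x = 0" using Eop_nilpotent[OF assms] by blast
  from meridian_poly[OF assms this] obtain q where
    q: "\<And>z. z \<in> {-1<..<1} \<Longrightarrow> f (gamma z) = of_real (sqrt (1 - z\<^sup>2)) powi m * poly q (of_real z)" by blast
  show ?thesis
  proof (rule that[of q])
    fix x :: "real ^ 3"
    assume x: "norm x = 1" and p0: "Complex (x $ 1) (x $ 2) \<noteq> 0"
    define p where "p = Complex (x $ 1) (x $ 2)"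
    define t where "t = Arg p"
    have n: "(cmod p)\<^sup>2 = 1 - (x $ 3)\<^sup>2"
      using norm_3[of x] x by (simp add: p_def cmod_def)
    then have cp: "cmod p = sqrt (1 - (x $ 3)\<^sup>2)" by (metis norm_ge_zero real_sqrt_unique)
    have "(x $ 3)\<^sup>2 < 1" using n p0 by (simp add: p_def[symmetric]) (metis less_add_same_cancel2 n norm_eq_zero zero_less_power2 diff_add_cancel)
    then have x3: "x $ 3 \<in> {-1<..<1}" by (simp add: abs_square_less_1 abs_less_iff)
    have pt: "p = rcis (cmod p) t" unfolding t_def by (simp add: rcis_cmod_Arg)
    have "x $ 1 = cmod p * cos t" "x $ 2 = cmod p * sin t"
      using arg_cong[OF pt, of Re] arg_cong[OF pt, of Im] by (simp_all add: p_def)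
    then have "rm3 t *v gamma (x $ 3) = x"
      by (simp add: rm_mult gamma_def vec_eq_iff forall_3 cp mult.commute)
    then have "f x = cis (of_int m * t) * (of_real (cmod p) powi m * poly q (of_real (x $ 3)))"
      using assms q[OF x3] unfolding cp wti_def by metis
    also have "cis (of_int m * t) = cis t powi m" by (simp add: cis_power_int)
    also have "cis t powi m * (of_real (cmod p) powi m * poly q (of_real (x $ 3))) = p powi m * poly q (of_real (x $ 3))"
    proof -
      have "p powi m = of_real (cmod p) powi m * cis t powi m"
        using arg_cong[OF pt, of "\<lambda>z. z powi m"] unfolding rcis_def power_int_mult_distrib .
      then show ?thesis by simp
    qed
    finally show "f x = Complex (x $ 1) (x $ 2) powi m * poly q (of_real (x $ 3))" by (simp add: p_def)
  qed
qed

text \<open>The poles are limits of other points of the sphere along \<open>rm2\<close>, and both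
  sides are continuous there.\<close>

lemma pole_limit:
  assumes f: "f \<in> A" and w: "continuous_on UNIV (\<lambda>x. bl w (cv x))"
    and eq: "\<And>x. norm x = 1 \<Longrightarrow> Complex (x $ 1) (x $ 2) \<noteq> 0 \<Longrightarrow> f x = bl w (cv x) ^ n * poly q (of_real (x $ 3))"
    and x: "norm x = 1" "Complex (x $ 1) (x $ 2) = 0"
  shows "f x = bl w (cv x) ^ n * poly q (of_real (x $ 3))"
proof -
  let ?y = "\<lambda>s. rm2 s *v x"
  have x12: "x $ 1 = 0" "x $ 2 = 0" using x(2) by (auto simp: complex_eq_iff)
  have x0: "x \<noteq> 0" using x(1) by auto
  have x3: "x $ 3 \<noteq> 0" using x0 x12 by (auto simp: vec_eq_iff forall_3)
  have n1: "norm (?y s) = 1" for s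
    using x(1) rotation3_rm(2)[of s] by (metis norm_eq orthogonal_transformation_matrix rotation3_def orthogonal_transformation_norm matrix_of_matrix_vector_mul matrix_vector_mul_linear)
  have cont_y: "isCont ?y 0"
    using rotpath_rm(2) has_vector_derivative_continuous[of ?y "J2 x" 0 UNIV] by (auto simp: rotpath_def)
  have y0: "?y 0 = x" using rotpath_rm(2) by (simp add: rotpath_def)
  have "(\<lambda>s. f (?y s)) \<midarrow>0\<rightarrow> f x"
  proof -
    have "isCont f (?y 0)" using diff[OF f x0] y0 by (simp add: differentiable_imp_continuous_within)
    then have "isCont (\<lambda>s. f (?y s)) 0" using isCont_o2[OF cont_y] by blast
    then show ?thesis by (simp add: isCont_def y0)
  qed
  moreover have "(\<lambda>s. f (?y s)) \<midarrow>0\<rightarrow> bl w (cv x) ^ n * poly q (of_real (x $ 3))"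
  proof -
    have c1: "isCont (\<lambda>s. bl w (cv (?y s))) 0"
      using isCont_o2[OF cont_y, of "\<lambda>x. bl w (cv x)"] w by (simp add: continuous_on_eq_continuous_at)
    have c2: "isCont (\<lambda>s. poly q (of_real (?y s $ 3))) 0"
      by (rule isCont_o2[OF cont_y, of "\<lambda>x. poly q (of_real (x $ 3))"]) (intro continuous_intros)
    have "isCont (\<lambda>s. bl w (cv (?y s)) ^ n * poly q (of_real (?y s $ 3))) 0"
      by (intro continuous_mult continuous_power c1 c2)
    then have "(\<lambda>s. bl w (cv (?y s)) ^ n * poly q (of_real (?y s $ 3))) \<midarrow>0\<rightarrow> bl w (cv x) ^ n * poly q (of_real (x $ 3))"
      by (simp add: isCont_def y0)
    moreover have "\<forall>\<^sub>F s in at 0. bl w (cv (?y s)) ^ n * poly q (of_real (?y s $ 3)) = f (?y s)"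
    proof -
      have "\<forall>\<^sub>F s in at (0::real). s \<in> {- pi<..<pi} - {0}"
        using eventually_at_in_open[of "{- pi<..<pi}" "0::real"] by simp
      then show ?thesis
      proof eventually_elim
        case (elim s)
        then have "sin s \<noteq> 0" using sin_gt_zero[of s] sin_gt_zero[of "- s"] by (cases "s > 0") auto
        then have "Complex (?y s $ 1) (?y s $ 2) \<noteq> 0"
          using x12 x3 by (simp add: rm_mult complex_eq_iff)
        then show ?case using eq[OF n1] by simp
      qed
    qed
    ultimately show ?thesis by (rule Lim_transform_eventually)
  qed
  ultimately show ?thesis by (rule LIM_unique)
qed

lemma bl_continuous: "continuous_on UNIV (\<lambda>x. bl w (cv x))"
  unfolding bl_3 cv_def by (auto intro!: continuous_intros)

lemma Complex_bl: "Complex (x $ 1) (x $ 2) = bl (vector [1, \<i>, 0]) (cv x)"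
  by (simp add: bl_3 cv_def complex_eq_iff)

lemma wti_nonneg_ST:
  assumes "wti m f" "0 \<le> m"
  shows "rs f \<in> ST"
proof -
  obtain q where q: "\<And>x. norm x = 1 \<Longrightarrow> Complex (x $ 1) (x $ 2) \<noteq> 0 \<Longrightarrow> f x = Complex (x $ 1) (x $ 2) powi m * poly q (of_real (x $ 3))"
    using wti_poly[OF assms(1)] by blast
  let ?w = "vector [1, \<i>, 0] :: complex ^ 3"
  have 1: "f x = bl ?w (cv x) ^ nat m * poly q (of_real (x $ 3))" if "norm x = 1" "Complex (x $ 1) (x $ 2) \<noteq> 0" for x
    using q[OF that] assms(2) by (simp add: Complex_bl[symmetric] power_int_def)
  have "f x = bl ?w (cv x) ^ nat m * poly q (of_real (x $ 3))" if "norm x = 1" for x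
  proof (cases "Complex (x $ 1) (x $ 2) = 0")
    case True
    then show ?thesis using pole_limit[OF _ bl_continuous 1 that] assms(1) by (simp add: wti_def)
  qed (use 1 that in auto)
  then have "rs f = rs (\<lambda>x. bl ?w (cv x) ^ nat m * poly q (of_real (x $ 3)))" by (auto simp: rs_def)
  then show ?thesis using ST_poly by simp
qed

lemma rs_in_ST:
  assumes wt: "\<And>f m. wti m f \<Longrightarrow> rs f \<in> ST" and f: "f \<in> A"
  shows "rs f \<in> ST"
  using in_WS[OF f] unfolding WS_def
proof (induction rule: fn.span_induct_alt)
  case base
  have "rs 0 = 0" by (auto simp: rs_def)
  then show ?case using fn.subspace_0[OF subspace_ST] by (simp only:)
next
  case (step c h f)
  then obtain \<mu> where h: "wt \<mu> h" by auto
  have "rs h \<in> ST"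
  proof (cases "\<exists>x. h x \<noteq> 0")
    case True
    then obtain x m where "\<mu> = of_int m" using wt_int[OF h] by metis
    then have "wti m h" using h wt_rm3[OF h] by (auto simp: wti_def wt_def cis_conv_exp mult.assoc)
    then show ?thesis by (rule wt)
  next
    case False
    then have "rs h = 0" by (auto simp: rs_def)
    then show ?thesis using fn.subspace_0[OF subspace_ST] by (simp only:)
  qed
  moreover have "rs (fscale c h + f) = fscale c (rs h) + rs f" by (auto simp: rs_def fscale_def)
  ultimately show ?case using step
    by (simp only: fn.subspace_add[OF subspace_ST] fn.subspace_scale[OF subspace_ST])
qed

end

text \<open>Negative weights become positive after the reflection \<open>x\<^sub>2 \<mapsto> - x\<^sub>2\<close>.\<close>

definition refl3 :: "real ^ 3 ^ 3" where
  "refl3 = vector [vector [1, 0, 0], vector [0, - 1, 0], vector [0, 0, 1]]"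

lemma refl3_mult: "refl3 *v x = vector [x $ 1, - x $ 2, x $ 3]"
  by (simp add: refl3_def vec_eq_iff forall_3 matrix_vector_mult_def sum_3)

lemma refl3_refl3: "refl3 *v (refl3 *v x) = x"
  by (simp add: refl3_mult vec_eq_iff forall_3)

lemma refl3_rotation:
  assumes "rotation3 R"
  shows "rotation3 (refl3 ** R ** refl3)"
proof -
  have o: "orthogonal_matrix refl3"
    by (simp add: orthogonal_matrix refl3_def vec_eq_iff forall_3 matrix_matrix_mult_def transpose_def sum_3 mat_def)
  have d: "det refl3 = - 1"
    by (simp add: refl3_def det_3)
  show ?thesis
    using assms o d by (simp add: rotation3_def det_mul orthogonal_matrix_mul)
qed

context sphere_space
begin

lemma sphere_space_refl: "sphere_space ((\<lambda>f x. f (refl3 *v x)) ` A) ((\<lambda>f x. f (refl3 *v x)) ` S)"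
proof
  let ?r = "\<lambda>f x. f (refl3 *v x) :: complex"
  have r_lin: "?r (f + g) = ?r f + ?r g" "?r (fscale c f) = fscale c (?r f)" for f g c
    by (auto simp: fscale_def)
  show "fn.subspace (?r ` A)"
    unfolding fn.subspace_def
  proof (intro conjI ballI allI)
    show "0 \<in> ?r ` A" using fn.subspace_0[OF sub] by (rule image_eqI[rotated]) auto
  next
    fix x y assume "x \<in> ?r ` A" "y \<in> ?r ` A"
    then obtain f g where "x = ?r f" "y = ?r g" "f \<in> A" "g \<in> A" by blast
    then show "x + y \<in> ?r ` A"
      by (intro image_eqI[of _ _ "f + g"] fn.subspace_add[OF sub]) auto
  next
    fix c x assume "x \<in> ?r ` A"
    then obtain f where "x = ?r f" "f \<in> A" by blast
    then show "fscale c x \<in> ?r ` A"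
      by (intro image_eqI[of _ _ "fscale c f"] fn.subspace_scale[OF sub]) (auto simp: fscale_def)
  qed
  show "finite (?r ` S)" using fin by simp
  show "?r ` A \<subseteq> fn.span (?r ` S)"
  proof safe
    fix f assume "f \<in> A"
    then have "f \<in> fn.span S" using A_S by blast
    then show "?r f \<in> fn.span (?r ` S)"
    proof (induction rule: fn.span_induct_alt)
      case base
      have "?r 0 = 0" by auto
      then show ?case by (simp only: fn.span_zero)
    next
      case (step c x y)
      then show ?case unfolding r_lin by (intro fn.span_add fn.span_scale) (auto intro: fn.span_base)
    qed
  qed
next
  fix g x assume "g \<in> (\<lambda>f x. f (refl3 *v x)) ` A" "x \<noteq> (0 :: real ^ 3)"
  then obtain f where f: "g = (\<lambda>x. f (refl3 *v x))" "f \<in> A" by blast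
  have "refl3 *v x \<noteq> 0" using \<open>x \<noteq> 0\<close> refl3_refl3[of x] by auto
  then have "f differentiable (at (refl3 *v x))" using diff f(2) by blast
  moreover have "(*v) refl3 differentiable (at x)" by (simp add: linear_imp_differentiable)
  ultimately show "g differentiable (at x)"
    unfolding f(1) using differentiable_chain_at[of "(*v) refl3" x f] by (simp add: o_def)
next
  fix g R assume "g \<in> (\<lambda>f x. f (refl3 *v x)) ` A" "rotation3 R"
  then obtain f where f: "g = (\<lambda>x. f (refl3 *v x))" "f \<in> A" by blast
  have "(\<lambda>x. f ((refl3 ** R ** refl3) *v x)) \<in> A" by (rule rot[OF f(2) refl3_rotation[OF \<open>rotation3 R\<close>]])
  moreover have "g (R *v x) = f ((refl3 ** R ** refl3) *v (refl3 *v x))" for x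
    unfolding f(1) matrix_vector_mul_assoc[symmetric] refl3_refl3 ..
  ultimately show "(\<lambda>x. g (R *v x)) \<in> (\<lambda>f x. f (refl3 *v x)) ` A" by auto
qed

end

context sphere_space
begin

lemma wti_neg_ST:
  assumes "wti m f" "m < 0"
  shows "rs f \<in> ST"
proof -
  interpret r: sphere_space "(\<lambda>f x. f (refl3 *v x)) ` A" "(\<lambda>f x. f (refl3 *v x)) ` S"
    by (rule sphere_space_refl)
  have f: "f \<in> A" using assms by (simp add: wti_def)
  have "refl3 *v (rm3 s *v x) = rm3 (- s) *v (refl3 *v x)" for s x
    by (simp add: refl3_mult rm_mult vec_eq_iff forall_3)
  then have "r.wti (- m) (\<lambda>x. f (refl3 *v x))"
    using assms(1) unfolding r.wti_def wti_def by auto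
  then obtain q where q: "\<And>x. norm x = 1 \<Longrightarrow> Complex (x $ 1) (x $ 2) \<noteq> 0 \<Longrightarrow>
      f (refl3 *v x) = Complex (x $ 1) (x $ 2) powi (- m) * poly q (of_real (x $ 3))"
    using r.wti_poly by blast
  let ?w = "vector [1, - \<i>, 0] :: complex ^ 3"
  have w: "Complex (x $ 1) (- x $ 2) = bl ?w (cv x)" for x
    by (simp add: bl_3 cv_def complex_eq_iff)
  have 1: "f x = bl ?w (cv x) ^ nat (- m) * poly q (of_real (x $ 3))"
    if "norm x = 1" "Complex (x $ 1) (x $ 2) \<noteq> 0" for x
  proof -
    have "norm (refl3 *v x) = 1" using that(1) norm_3[of x] norm_3[of "refl3 *v x"]
      by (simp add: refl3_mult) (metis norm_ge_zero one_power2 power2_eq_imp_eq zero_le_one)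
    moreover have "Complex ((refl3 *v x) $ 1) ((refl3 *v x) $ 2) \<noteq> 0"
      using that(2) by (simp add: refl3_mult complex_eq_iff)
    ultimately have "f (refl3 *v (refl3 *v x)) = Complex ((refl3 *v x) $ 1) ((refl3 *v x) $ 2) powi (- m) * poly q (of_real ((refl3 *v x) $ 3))"
      by (rule q)
    moreover have "Complex ((refl3 *v x) $ 1) ((refl3 *v x) $ 2) = bl ?w (cv x)" "(refl3 *v x) $ 3 = x $ 3"
      using w[of x] by (simp_all add: refl3_mult)
    ultimately show ?thesis
      using assms(2) by (simp add: refl3_refl3 power_int_def)
  qed
  have "f x = bl ?w (cv x) ^ nat (- m) * poly q (of_real (x $ 3))" if "norm x = 1" for x
  proof (cases "Complex (x $ 1) (x $ 2) = 0")
    case True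
    then show ?thesis using pole_limit[OF f bl_continuous 1 that] by blast
  qed (use 1 that in auto)
  then have "rs f = rs (\<lambda>x. bl ?w (cv x) ^ nat (- m) * poly q (of_real (x $ 3)))" by (auto simp: rs_def)
  then show ?thesis using ST_poly by simp
qed

theorem sphere_ST: "f \<in> A \<Longrightarrow> rs f \<in> ST"
  using rs_in_ST wti_nonneg_ST wti_neg_ST by (metis not_less)

end

section \<open>The cone \<open>Xi\<close> and the space \<open>V33_HC\<close>\<close>

definition cvec :: "real ^ (3 + 3) \<Rightarrow> complex ^ (3 + 3)" where
  "cvec \<xi> = (\<chi> i. of_real (\<xi> $ i))"

definition rx :: "real ^ (3 + 3) \<Rightarrow> real ^ 3" where "rx \<xi> = (\<chi> a. \<xi> $ Inl a)"
definition ry :: "real ^ (3 + 3) \<Rightarrow> real ^ 3" where "ry \<xi> = (\<chi> a. \<xi> $ Inr a)"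

lemma rx_join [simp]: "rx (join x y) = x" and ry_join [simp]: "ry (join x y) = y"
  by (simp_all add: rx_def ry_def join_def vec_eq_iff)

lemma join_rx_ry: "join (rx \<xi>) (ry \<xi>) = \<xi>"
  by (simp add: vec_eq_iff all_plus rx_def ry_def join_def)

lemma Xi_iff: "\<xi> \<in> Xi \<longleftrightarrow> norm (rx \<xi>) = norm (ry \<xi>) \<and> rx \<xi> \<noteq> 0"
proof
  assume A: "norm (rx \<xi>) = norm (ry \<xi>) \<and> rx \<xi> \<noteq> 0"
  then have "norm (rx \<xi>) \<noteq> 0" using norm_eq_zero by blast
  moreover have "\<xi> = join (rx \<xi>) (ry \<xi>)" by (simp add: join_rx_ry)
  ultimately show "\<xi> \<in> Xi" using A unfolding Xi_def by blast
qed (auto simp: Xi_def)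

lemma Xi_norm:
  assumes "\<xi> \<in> Xi"
  shows "norm (ry \<xi>) = norm (rx \<xi>)" "rx \<xi> \<noteq> 0"
  using assms by (simp_all add: Xi_iff)

lemma vx_cvec: "vx (cvec \<xi>) = cv (rx \<xi>)" and vy_cvec: "vy (cvec \<xi>) = cv (ry \<xi>)"
  by (simp_all add: vx_def vy_def cvec_def cv_def rx_def ry_def)

lemma cvec_cmat: "cvec (X *v \<xi>) = cmat X *v cvec \<xi>"
  by (simp add: vec_eq_iff cvec_def cmat_def matrix_vector_mult_def)

lemma linear_rx: "linear rx" and linear_ry: "linear ry" and linear_cvec: "linear cvec" and linear_cv: "linear cv"
  by (auto intro!: linearI simp: rx_def ry_def cvec_def cv_def vec_eq_iff scaleR_conv_of_real[where 'a = complex])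

definition tauX :: "real ^ (3 + 3) \<Rightarrow> (complex ^ (3 + 3)) \<times> complex" where
  "tauX \<xi> = (cvec \<xi>, of_real (norm (rx \<xi>)))"

definition evX :: "ex \<Rightarrow> real ^ (3 + 3) \<Rightarrow> complex" where
  "evX e = (\<lambda>\<xi>. if \<xi> \<in> Xi then ev e (fst (tauX \<xi>)) (snd (tauX \<xi>)) else 0)"

lemma zero_vector_derivative_constant:
  fixes f :: "real \<Rightarrow> 'a::real_normed_vector"
  assumes "\<And>s. (f has_vector_derivative 0) (at s)"
  shows "f s = f t"
proof -
  obtain c where "\<And>s. s \<in> UNIV \<Longrightarrow> f s = c"
    by (rule has_vector_derivative_zero_constant[of UNIV f]) (use assms in auto)
  then show ?thesis by simp
qed

lemma matrix_vector_mult_neg_left: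
  fixes X :: "'a::ring_1 ^ 'n ^ 'm"
  shows "(- X) *v v = - (X *v v)"
  by (simp add: vec_eq_iff matrix_vector_mult_def sum_negf)

lemma mexp_mult_deriv:
  fixes X :: "'a::{real_normed_field,banach} ^ 'n ^ 'n"
  shows "((\<lambda>s. mexp (s *\<^sub>R X) *v v) has_vector_derivative X *v (mexp (s *\<^sub>R X) *v v)) (at s)"
  using has_vector_derivative_matrix_vector_mult[OF has_vector_derivative_mexp(1) has_vector_derivative_const]
  by (simp add: matrix_vector_mul_assoc)

lemma norm_sq_split: "(norm (rx \<xi>))\<^sup>2 - (norm (ry \<xi>))\<^sup>2 = (\<Sum>i\<in>UNIV. sgn33 i * (\<xi> $ i * \<xi> $ i))"
  unfolding norm_3 by (simp add: sum_UNIV_plus sum_3 rx_def ry_def power2_eq_square)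

lemma so33_form:
  fixes X :: "real ^ (3 + 3) ^ (3 + 3)"
  assumes "X \<in> so33"
  shows "(\<Sum>i\<in>UNIV. sgn33 i * (v $ i * (X *v v) $ i)) = 0"
proof -
  have "(\<Sum>i\<in>UNIV. sgn33 i * (v $ i * (X *v v) $ i)) = (\<Sum>i\<in>UNIV. \<Sum>j\<in>UNIV. sgn33 i * X $ i $ j * (v $ i * v $ j))" (is "?S = _")
    by (simp add: matrix_vector_mult_def sum_distrib_left mult_ac)
  also have "\<dots> = (\<Sum>i\<in>UNIV. \<Sum>j\<in>UNIV. - (sgn33 j * X $ j $ i * (v $ j * v $ i)))"
  proof (intro sum.cong refl)
    fix i j
    have "sgn33 i * X $ i $ j = - (sgn33 j * X $ j $ i)"
      using assms by (simp add: so33_iff eq_neg_iff_add_eq_0 add.commute)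
    then show "sgn33 i * X $ i $ j * (v $ i * v $ j) = - (sgn33 j * X $ j $ i * (v $ j * v $ i))" by simp
  qed
  also have "\<dots> = - (\<Sum>i\<in>UNIV. \<Sum>j\<in>UNIV. sgn33 i * X $ i $ j * (v $ i * v $ j))"
    by (subst sum.swap) (simp add: sum_negf)
  also have "\<dots> = - ?S" by (simp add: matrix_vector_mult_def sum_distrib_left mult_ac)
  finally show ?thesis by simp
qed

text \<open>The quadratic form is constant along the flow by \<open>so33_form\<close>, and the point
  cannot reach 0 because the flow is invertible.\<close>

lemma mexp_Xi:
  assumes "X \<in> so33" "\<xi> \<in> Xi"
  shows "mexp (s *\<^sub>R X) *v \<xi> \<in> Xi"
proof -
  let ?p = "\<lambda>s. mexp (s *\<^sub>R X) *v \<xi>"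
  let ?q = "\<lambda>s. \<Sum>i\<in>UNIV. sgn33 i * (?p s $ i * ?p s $ i)"
  have "(?q has_vector_derivative 0) (at s)" for s
  proof -
    have "(?q has_vector_derivative (\<Sum>i\<in>UNIV. sgn33 i * (?p s $ i * (X *v ?p s) $ i + (X *v ?p s) $ i * ?p s $ i))) (at s)"
      by (intro has_vector_derivative_sum has_vector_derivative_mult_right has_vector_derivative_mult
          has_vector_derivative_vec_nth mexp_mult_deriv)
    moreover have "(\<Sum>i\<in>UNIV. sgn33 i * (?p s $ i * (X *v ?p s) $ i + (X *v ?p s) $ i * ?p s $ i)) = 2 * (\<Sum>i\<in>UNIV. sgn33 i * (?p s $ i * (X *v ?p s) $ i))"
      by (simp add: sum_distrib_left algebra_simps)
    ultimately show ?thesis using so33_form[OF assms(1)] by simp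
  qed
  then have "?q s = ?q 0" by (rule zero_vector_derivative_constant)
  then have "(norm (rx (?p s)))\<^sup>2 - (norm (ry (?p s)))\<^sup>2 = (norm (rx (?p 0)))\<^sup>2 - (norm (ry (?p 0)))\<^sup>2"
    by (simp only: norm_sq_split)
  then have "(norm (rx (?p s)))\<^sup>2 - (norm (ry (?p s)))\<^sup>2 = 0"
    using Xi_norm(1)[OF assms(2)] by simp
  then have eq: "norm (rx (?p s)) = norm (ry (?p s))"
    by (simp add: power2_eq_iff_nonneg)
  have "rx (?p s) \<noteq> 0"
  proof
    assume "rx (?p s) = 0"
    moreover from this have "norm (ry (?p s)) = 0" using eq by simp
    ultimately have "join (rx (?p s)) (ry (?p s)) = 0" by (simp add: join_def vec_eq_iff all_plus)
    then have "?p s = 0" by (simp only: join_rx_ry)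
    then have "mexp (s *\<^sub>R - X) *v ?p s = 0" by simp
    then have "\<xi> = 0" by (simp only: matrix_vector_mul_assoc mexp_minus matrix_vector_mul_lid)
    then show False using assms(2) linear_0[OF linear_rx] by (simp add: Xi_iff)
  qed
  with eq show ?thesis by (simp add: Xi_iff)
qed

lemma so33_minus: "X \<in> so33 \<Longrightarrow> - X \<in> so33"
  unfolding so33_iff by (intro allI) (drule spec, drule spec, drule arg_cong[of _ _ uminus], simp)

lemma mexp_Xi_iff:
  assumes "X \<in> so33"
  shows "mexp (s *\<^sub>R X) *v \<xi> \<in> Xi \<longleftrightarrow> \<xi> \<in> Xi"
proof
  assume "mexp (s *\<^sub>R X) *v \<xi> \<in> Xi"
  from mexp_Xi[OF so33_minus[OF assms] this, of s] show "\<xi> \<in> Xi"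
    by (simp only: matrix_vector_mul_assoc mexp_minus matrix_vector_mul_lid)
qed (rule mexp_Xi[OF assms])

lemma bl_cv_cv: "bl (cv x) (cv y) = of_real (x \<bullet> y)"
  by (simp add: bl_def cv_def inner_vec_def)

lemma norm_rx_deriv:
  assumes "(p has_vector_derivative p') (at s)" "rx (p s) \<noteq> 0"
  shows "((\<lambda>s. of_real (norm (rx (p s))) :: complex) has_vector_derivative of_real ((rx (p s) \<bullet> rx p') / norm (rx (p s)))) (at s)"
proof -
  have "((\<lambda>s. rx (p s)) has_derivative (\<lambda>h. h *\<^sub>R rx p')) (at s)"
    using bounded_linear.has_vector_derivative[OF linear_conv_bounded_linear[THEN iffD1, OF linear_rx] assms(1)]
    unfolding has_vector_derivative_def .
  from has_derivative_compose[OF this has_derivative_norm[OF assms(2)]]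
  have "((\<lambda>s. norm (rx (p s))) has_derivative (\<lambda>h. h *\<^sub>R ((rx (p s) \<bullet> rx p') / norm (rx (p s))))) (at s)"
    by (simp add: sgn_div_norm divide_inverse inner_commute mult_ac)
  then have "((\<lambda>s. norm (rx (p s))) has_vector_derivative ((rx (p s) \<bullet> rx p') / norm (rx (p s)))) (at s)"
    unfolding has_vector_derivative_def .
  then show ?thesis
    using has_vector_derivative_of_real has_real_derivative_iff_has_vector_derivative by blast
qed

lemma do33_evX:
  assumes "X \<in> so33"
  shows "do33 X (evX e) = evX (der (cmat X) e)"
proof
  fix \<xi>
  have act: "o33_act (mexp (s *\<^sub>R X)) (evX e) \<xi> = evX e (mexp (s *\<^sub>R - X) *v \<xi>)" for s
    unfolding o33_act_def matrix_inv_mexp ..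
  show "do33 X (evX e) \<xi> = evX (der (cmat X) e) \<xi>"
  proof (cases "\<xi> \<in> Xi")
    case False
    then have "evX e (mexp (s *\<^sub>R - X) *v \<xi>) = 0" for s
      using mexp_Xi_iff[OF so33_minus[OF assms], of s \<xi>] by (simp add: evX_def)
    then show ?thesis unfolding do33_def act using False by (simp add: evX_def)
  next
    case True
    let ?p = "\<lambda>s. mexp (s *\<^sub>R - X) *v \<xi>"
    have p0: "?p 0 = \<xi>" by simp
    have r0: "rx \<xi> \<noteq> 0" using True by (simp add: Xi_iff)
    have d: "(?p has_vector_derivative - (X *v \<xi>)) (at 0)"
      using mexp_mult_deriv[of "- X" \<xi> 0] by (simp add: matrix_vector_mult_neg_left)
    have dc: "((\<lambda>s. cvec (?p s)) has_vector_derivative - (cmat X *v cvec \<xi>)) (at 0)"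
      using bounded_linear.has_vector_derivative[OF linear_conv_bounded_linear[THEN iffD1, OF linear_cvec] d]
      by (simp add: cvec_cmat[symmetric] linear_neg[OF linear_cvec])
    have dr: "((\<lambda>s. of_real (norm (rx (?p s))) :: complex) has_vector_derivative of_real ((rx \<xi> \<bullet> rx (- (X *v \<xi>))) / norm (rx \<xi>))) (at 0)"
      using norm_rx_deriv[OF d] r0 p0 by simp
    have "((\<lambda>s. ev e (cvec (?p s)) (of_real (norm (rx (?p s))))) has_vector_derivative
        dv e (cvec \<xi>) (of_real (norm (rx \<xi>))) (- (cmat X *v cvec \<xi>)) (of_real ((rx \<xi> \<bullet> rx (- (X *v \<xi>))) / norm (rx \<xi>)))) (at 0)"
      using ev_has_vector_derivative[OF dc dr] r0 p0 by simp
    moreover have "(\<lambda>s. ev e (cvec (?p s)) (of_real (norm (rx (?p s))))) = (\<lambda>s. evX e (?p s))"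
      using mexp_Xi[OF so33_minus[OF assms] True] by (simp add: evX_def tauX_def)
    moreover have "of_real ((rx \<xi> \<bullet> rx (- (X *v \<xi>))) / norm (rx \<xi>)) = - bl (vx (cvec \<xi>)) (vx (cmat X *v cvec \<xi>)) / of_real (norm (rx \<xi>))"
      by (simp add: cvec_cmat[symmetric] vx_cvec bl_cv_cv linear_neg[OF linear_rx])
    ultimately have "((\<lambda>s. evX e (?p s)) has_vector_derivative ev (der (cmat X) e) (cvec \<xi>) (of_real (norm (rx \<xi>)))) (at 0)"
      using r0 by (simp add: ev_der)
    then show ?thesis
      unfolding do33_def act using True by (simp add: vector_derivative_at evX_def tauX_def)
  qed
qed

lemma so33C_Re_Im:
  assumes "X \<in> so33C"
  shows "Re_mat X \<in> so33" "Im_mat X \<in> so33"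
proof -
  have s: "(sgn33 i :: complex) = of_real (sgn33 i)" for i by (cases i) auto
  have *: "sgn33 j * X $ j $ i + sgn33 i * X $ i $ j = 0" for i j using assms by (simp add: so33C_iff)
  have "Re (sgn33 j * X $ j $ i + sgn33 i * X $ i $ j) = 0" "Im (sgn33 j * X $ j $ i + sgn33 i * X $ i $ j) = 0" for i j
    unfolding * by simp_all
  then show "Re_mat X \<in> so33" "Im_mat X \<in> so33"
    unfolding s by (simp_all add: so33_iff Re_mat_def Im_mat_def)
qed

lemma do33C_evX:
  assumes "X \<in> so33C"
  shows "do33C X (evX e) = evX (der X e)"
proof
  fix \<xi>
  have X: "X = cmat (Re_mat X) + mscale \<i> (cmat (Im_mat X))"
    by (simp add: vec_eq_iff cmat_def Re_mat_def Im_mat_def mscale_def complex_eq_iff)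
  have "evX (der X e) \<xi> = evX (der (cmat (Re_mat X)) e) \<xi> + \<i> * evX (der (cmat (Im_mat X)) e) \<xi>"
  proof (cases "\<xi> \<in> Xi")
    case True
    then have "of_real (norm (rx \<xi>)) \<noteq> (0 :: complex)" using Xi_norm(2) by simp
    then show ?thesis using True
      by (subst X) (simp add: evX_def tauX_def ev_der_add ev_der_scale)
  qed (simp add: evX_def)
  then show "do33C X (evX e) \<xi> = evX (der X e) \<xi>"
    unfolding do33C_def by (simp add: do33_evX so33C_Re_Im[OF assms])
qed

interpretation Xr: cone_realization Xi tauX do33C
proof
  have "join (axis 1 1) (axis 1 1) \<in> Xi" by (simp add: Xi_iff)
  then show "Xi \<noteq> {}" by blast
next
  fix p assume "p \<in> Xi"
  then show "snd (tauX p) \<noteq> 0 \<and> bl (vx (fst (tauX p))) (vx (fst (tauX p))) = (snd (tauX p))\<^sup>2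
        \<and> bl (vy (fst (tauX p))) (vy (fst (tauX p))) = (snd (tauX p))\<^sup>2"
    using Xi_norm[of p] by (simp add: tauX_def vx_cvec vy_cvec bl_cv)
next
  fix X e assume "X \<in> so33C"
  from do33C_evX[OF this, of e]
  show "do33C X (\<lambda>p. if p \<in> Xi then ev e (fst (tauX p)) (snd (tauX p)) else 0)
      = (\<lambda>p. if p \<in> Xi then ev (der X e) (fst (tauX p)) (snd (tauX p)) else 0)"
    by (simp add: evX_def[abs_def])
qed

lemma Xr_evx: "Xr.evx e = evX e"
  by (simp add: Xr.evx_def evX_def)

subsection \<open>Smoothness\<close>

text \<open>Partial derivatives in the ambient space lead from expressions to expressions, so
  smoothness follows by induction on the order. Off the cone \<rho> is read as |x|, on the open set
  where x \<noteq> 0.\<close>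

definition pd :: "real ^ (3 + 3) \<Rightarrow> ex \<Rightarrow> ex" where
  "pd b = dgen (\<lambda>a. Cst (\<Sum>i\<in>UNIV. a $ i * cvec b $ i))
     (Ad (Mu (Ln (axl 1)) (Cst (of_real (rx b $ 1)))) (Ad (Mu (Ln (axl 2)) (Cst (of_real (rx b $ 2)))) (Mu (Ln (axl 3)) (Cst (of_real (rx b $ 3))))))"

definition evR :: "ex \<Rightarrow> real ^ (3 + 3) \<Rightarrow> complex" where
  "evR e \<xi> = ev e (cvec \<xi>) (of_real (norm (rx \<xi>)))"

lemma evR_has_derivative:
  assumes "rx \<xi> \<noteq> 0"
  shows "(evR e has_derivative (\<lambda>h. dv e (cvec \<xi>) (of_real (norm (rx \<xi>))) (cvec h) (of_real ((rx \<xi> \<bullet> rx h) / norm (rx \<xi>))))) (at \<xi>)"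
  unfolding evR_def[abs_def]
proof (rule ev_has_derivative)
  show "(cvec has_derivative cvec) (at \<xi>)"
    by (rule linear_imp_has_derivative[OF linear_cvec])
  have "((\<lambda>\<xi>. norm (rx \<xi>)) has_derivative (\<lambda>h. (rx \<xi> \<bullet> rx h) / norm (rx \<xi>))) (at \<xi>)"
    using has_derivative_compose[OF linear_imp_has_derivative[OF linear_rx] has_derivative_norm[OF assms]]
    by (simp add: sgn_div_norm divide_inverse inner_commute mult_ac)
  then show "((\<lambda>\<xi>. of_real (norm (rx \<xi>)) :: complex) has_derivative (\<lambda>h. of_real ((rx \<xi> \<bullet> rx h) / norm (rx \<xi>)))) (at \<xi>)"
    by (rule has_derivative_of_real)
qed (use assms in simp)

lemma evR_frechet:
  assumes "rx \<xi> \<noteq> 0"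
  shows "frechet_derivative (evR e) (at \<xi>) b = evR (pd b e) \<xi>"
proof -
  define q where "q = Ad (Mu (Ln (axl 1)) (Cst (of_real (rx b $ 1))))
    (Ad (Mu (Ln (axl 2)) (Cst (of_real (rx b $ 2)))) (Mu (Ln (axl 3)) (Cst (of_real (rx b $ 3)))))"
  have q: "ev q (cvec \<xi>) (of_real (norm (rx \<xi>))) = of_real (rx \<xi> \<bullet> rx b)"
    by (simp add: q_def ev_Ln_axl vx_cvec inner_vec_def sum_3 cv_def add.assoc)
  have "evR (pd b e) \<xi> = dv e (cvec \<xi>) (of_real (norm (rx \<xi>))) (cvec b) (of_real ((rx \<xi> \<bullet> rx b) / norm (rx \<xi>)))"
    unfolding evR_def pd_def q_def[symmetric] using assms
    by (subst ev_dgen[where v = "cvec b"]) (auto simp: q)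
  with fun_cong[OF frechet_derivative_at[OF evR_has_derivative[OF assms, of e]], of b]
  show ?thesis by (simp only:)
qed

lemma Ck_on_cong:
  assumes "open U" "\<And>x. x \<in> U \<Longrightarrow> f x = g x" "Ck_on k f U"
  shows "Ck_on k g U"
  using assms(2,3)
proof (induction k arbitrary: f g)
  case 0
  then show ?case using continuous_on_cong[of U U f g] by simp
next
  case (Suc k)
  have d: "(g has_derivative D) (at x) \<longleftrightarrow> (f has_derivative D) (at x)" if "x \<in> U" for x D
    by (rule iffI; erule has_derivative_transform_within_open[OF _ assms(1) that]; simp add: Suc.prems(1))
  have fr: "frechet_derivative g (at x) = frechet_derivative f (at x)" if "x \<in> U" for x
    unfolding frechet_derivative_def using d[OF that] by simp
  have "g differentiable (at x)" if "x \<in> U" for x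
    using Suc.prems(2) that unfolding differentiable_def d[OF that]
    by (simp add: differentiable_on_eq_differentiable_at[OF assms(1)] differentiable_def)
  then have "g differentiable_on U"
    by (simp add: differentiable_on_eq_differentiable_at[OF assms(1)])
  moreover have "Ck_on k (\<lambda>x. frechet_derivative g (at x) b) U" if "b \<in> Basis" for b
    using Suc.IH[of "\<lambda>x. frechet_derivative f (at x) b" "\<lambda>x. frechet_derivative g (at x) b"] Suc.prems(2) fr that by simp
  ultimately show ?case by simp
qed

lemma open_rx: "open {\<xi>. rx \<xi> \<noteq> 0}"
proof -
  have "continuous_on UNIV rx" using linear_continuous_on[OF linear_conv_bounded_linear[THEN iffD1, OF linear_rx]] .
  then show ?thesis by (intro open_Collect_neq continuous_on_const)
qed

lemma evR_Ck: "Ck_on k (evR e) {\<xi>. rx \<xi> \<noteq> 0}"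
proof (induction k arbitrary: e)
  have diff: "evR e differentiable_on {\<xi>. rx \<xi> \<noteq> 0}" for e
    using evR_has_derivative by (auto simp: differentiable_on_def differentiable_def intro: has_derivative_at_withinI)
  case 0
  show ?case using differentiable_imp_continuous_on[OF diff] by simp
  case (Suc k)
  have "Ck_on k (\<lambda>x. frechet_derivative (evR e) (at x) b) {\<xi>. rx \<xi> \<noteq> 0}" for b
    by (rule Ck_on_cong[OF open_rx _ Suc.IH[of "pd b e"]]) (simp add: evR_frechet)
  with diff show ?case by simp
qed

lemma evX_smooth: "smooth_on_Xi (evX e)"
  unfolding smooth_on_Xi_def
proof
  fix p assume "p \<in> Xi"
  then show "\<exists>U G. open U \<and> p \<in> U \<and> (\<forall>k. Ck_on k G U) \<and> (\<forall>q\<in>U \<inter> Xi. G q = evX e q)"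
    by (intro exI[of _ "{\<xi>. rx \<xi> \<noteq> 0}"] exI[of _ "evR e"])
       (auto simp: open_rx evR_Ck evX_def evR_def tauX_def Xi_iff)
qed

lemma evX_homogeneous:
  assumes "homog (- 1) e" "a > 0" "\<xi> \<in> Xi"
  shows "evX e (a *\<^sub>R \<xi>) = of_real (1 / a) * evX e \<xi>"
proof -
  have "a *\<^sub>R \<xi> \<in> Xi" using assms(2,3) by (simp add: Xi_iff linear_scale[OF linear_rx] linear_scale[OF linear_ry])
  moreover have "cvec (a *\<^sub>R \<xi>) = of_real a *s cvec \<xi>" by (simp add: vec_eq_iff cvec_def)
  moreover have "of_real (norm (rx (a *\<^sub>R \<xi>))) = (of_real a * of_real (norm (rx \<xi>)) :: complex)"
    using assms(2) by (simp add: linear_scale[OF linear_rx])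
  ultimately show ?thesis
    using ev_homog[OF assms(1), of "of_real a" "cvec \<xi>" "of_real (norm (rx \<xi>))"] assms(2,3)
    by (simp add: evX_def tauX_def power_int_minus divide_inverse)
qed

subsection \<open>The Laplacian of the sphere\<close>

definition ddhe :: "nat \<Rightarrow> nat \<Rightarrow> complex ^ 3 \<Rightarrow> complex ^ 3 \<Rightarrow> complex" where
  "ddhe l j x v = coeff (smult (of_nat l * of_nat (l - 1)) (sq x ^ (l - 2) * (sq v * sq v))) j"

lemma he_path:
  assumes "(X has_vector_derivative X') (at s)"
  shows "((\<lambda>s. he l j (X s)) has_vector_derivative dhe l j (X s) X') (at s)"
proof -
  define E :: "complex ^ 3 \<Rightarrow> complex ^ (3 + 3)" where "E x = (\<chi> i. case i of Inl a \<Rightarrow> x $ a | Inr b \<Rightarrow> 0)" for x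
  have E: "(\<chi> a. E x $ Inl a) = x" for x by (simp add: E_def vec_eq_iff)
  have "((\<lambda>s. E (X s)) has_vector_derivative E X') (at s)"
  proof (rule has_vector_derivative_vec)
    fix i show "((\<lambda>s. E (X s) $ i) has_vector_derivative E X' $ i) (at s)"
      by (cases i) (simp_all add: E_def has_vector_derivative_vec_nth[OF assms])
  qed
  from ev_has_vector_derivative[OF this has_vector_derivative_const[of "1::complex"], of "eh Inl l j"]
  show ?thesis by (simp add: ev_eh dv_eh E)
qed

lemma dhe_path:
  assumes "(X has_vector_derivative v) (at s)"
  shows "((\<lambda>s. dhe l j (X s) v) has_vector_derivative ddhe l j (X s) v) (at s)"
proof -
  have "((\<lambda>s. of_nat l * (\<Sum>i\<le>j. he (l - 1) i (X s) * coeff (sq v) (j - i))) has_vector_derivative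
      of_nat l * (\<Sum>i\<le>j. dhe (l - 1) i (X s) v * coeff (sq v) (j - i))) (at s)"
    by (intro has_vector_derivative_mult_right has_vector_derivative_sum has_vector_derivative_mult_left he_path assms)
  moreover have "of_nat l * (\<Sum>i\<le>j. he (l - 1) i x * coeff (sq v) (j - i)) = dhe l j x v" for x
    by (simp add: dhe_def coeff_mult he_def)
  moreover have "of_nat l * (\<Sum>i\<le>j. dhe (l - 1) i x v * coeff (sq v) (j - i)) = ddhe l j x v" for x
  proof -
    have "of_nat l * (\<Sum>i\<le>j. dhe (l - 1) i x v * coeff (sq v) (j - i))
        = of_nat l * coeff (smult (of_nat (l - 1)) (sq x ^ (l - 1 - 1) * sq v) * sq v) j"
      by (simp only: coeff_mult dhe_def)
    then show ?thesis by (simp add: ddhe_def numeral_2_eq_2 mult.assoc)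
  qed
  ultimately show ?thesis by simp
qed

text \<open>The polynomials \<open>sq (axis i 1)\<close> are the components of the general isotropic
  vector, so their squares sum to zero.\<close>

lemma ddhe_harmonic: "(\<Sum>i\<in>UNIV. ddhe l j x (axis i 1)) = 0"
proof -
  have "sq (axis 1 1) * sq (axis 1 1) + sq (axis 2 1) * sq (axis 2 1) + sq (axis 3 1) * sq (axis 3 1) = 0"
    by (simp add: sq_def axis_def)
  then have "coeff (smult (of_nat l * of_nat (l - 1)) (sq x ^ (l - 2) *
      (sq (axis 1 1) * sq (axis 1 1) + sq (axis 2 1) * sq (axis 2 1) + sq (axis 3 1) * sq (axis 3 1)))) j = 0"
    by (simp only: mult_zero_right smult_0_right coeff_0)
  then show ?thesis by (simp add: ddhe_def sum_3 distrib_left)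
qed

lemma dhe_euler: "(\<Sum>i\<in>UNIV. x $ i * dhe l j x (axis i 1)) = of_nat l * he l j x"
proof -
  have "(\<Sum>i\<in>UNIV. x $ i * dhe l j x (axis i 1)) = dhe l j x (\<Sum>i\<in>UNIV. x $ i *s axis i 1)"
    by (simp add: dhe_sum dhe_scale)
  also have "\<dots> = dhe l j x x" by (simp add: basis_expansion)
  also have "\<dots> = of_nat l * he l j x"
    by (cases l) (simp_all add: dhe_def he_def mult.commute del: of_nat_Suc)
  finally show ?thesis .
qed

lemma he_cv_0: "he l j (cv x) = he l j (of_real (norm x) *s cv (sgn x))" if "x \<noteq> 0"
proof -
  have "norm x *\<^sub>R sgn x = x" using that by (simp add: sgn_div_norm)
  then have "cv x = cv (norm x *\<^sub>R sgn x)" by simp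
  also have "\<dots> = of_real (norm x) *s cv (sgn x)" by (simp add: cv_def vec_eq_iff)
  finally show ?thesis by simp
qed

text \<open>The extension of a spherical harmonic that is constant along rays, which is what
  \<open>laplacian_S2\<close> differentiates.\<close>

definition gl :: "nat \<Rightarrow> nat \<Rightarrow> real ^ 3 \<Rightarrow> complex" where
  "gl l j x = he l j (cv x) * of_real (inverse (norm x) ^ l)"

definition gl' :: "nat \<Rightarrow> nat \<Rightarrow> 3 \<Rightarrow> real ^ 3 \<Rightarrow> complex" where
  "gl' l j i x = he l j (cv x) * of_real (- of_nat l * (x $ i) * inverse (norm x) ^ (l + 2))
     + dhe l j (cv x) (axis i 1) * of_real (inverse (norm x) ^ l)"

lemma gl_sphere:
  assumes "x \<noteq> 0"
  shows "he l j (cv (sgn x)) = gl l j x"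
  using assms by (simp add: gl_def he_cv_0[OF assms] he_scale power_inverse)

lemma line_deriv: "((\<lambda>u. x + u *\<^sub>R axis i 1) has_vector_derivative (axis i 1 :: real ^ 3)) (at s)"
  by (auto intro!: derivative_eq_intros)

lemma cv_line_deriv: "((\<lambda>u. cv (x + u *\<^sub>R axis i 1)) has_vector_derivative axis i 1) (at s)"
proof -
  have "cv (axis i 1) = axis i 1" by (simp add: cv_def axis_def vec_eq_iff)
  then show ?thesis
    using bounded_linear.has_vector_derivative[OF linear_conv_bounded_linear[THEN iffD1, OF linear_cv] line_deriv] by metis
qed

lemma inverse_norm_deriv:
  assumes "x + s *\<^sub>R axis i 1 \<noteq> (0 :: real ^ 3)"
  shows "((\<lambda>u. inverse (norm (x + u *\<^sub>R axis i 1)) ^ l) has_real_derivative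
     - of_nat l * ((x + s *\<^sub>R axis i 1) $ i) * inverse (norm (x + s *\<^sub>R axis i 1)) ^ (l + 2)) (at s)"
proof -
  let ?y = "x + s *\<^sub>R axis i 1"
  have "((\<lambda>u. norm (x + u *\<^sub>R axis i 1)) has_derivative (\<lambda>h. (h *\<^sub>R axis i 1) \<bullet> sgn ?y)) (at s)"
    using has_derivative_compose[OF line_deriv[unfolded has_vector_derivative_def] has_derivative_norm[OF assms]] .
  moreover have "(\<lambda>h. (h *\<^sub>R axis i 1) \<bullet> sgn ?y) = (*) (?y $ i / norm ?y)"
    by (rule ext) (simp add: inner_axis' sgn_div_norm inner_commute divide_inverse mult_ac)
  ultimately have n: "((\<lambda>u. norm (x + u *\<^sub>R axis i 1)) has_real_derivative ?y $ i / norm ?y) (at s)"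
    unfolding has_field_derivative_def by (simp only:)
  show ?thesis
    using assms
    by (auto intro!: derivative_eq_intros n) (cases l; simp add: field_simps power2_eq_square)
qed

lemma gl_deriv:
  assumes "x + s *\<^sub>R axis i 1 \<noteq> 0"
  shows "((\<lambda>u. gl l j (x + u *\<^sub>R axis i 1)) has_vector_derivative gl' l j i (x + s *\<^sub>R axis i 1)) (at s)"
  unfolding gl_def gl'_def
  by (intro has_vector_derivative_mult he_path cv_line_deriv has_vector_derivative_of_real inverse_norm_deriv assms)

lemma gl'_deriv:
  assumes "norm x = 1"
  shows "((\<lambda>s. gl' l j i (x + s *\<^sub>R axis i 1)) has_vector_derivative
     he l j (cv x) * of_real (- of_nat l + of_nat l * (of_nat l + 2) * (x $ i)\<^sup>2)
     - 2 * of_nat l * of_real (x $ i) * dhe l j (cv x) (axis i 1) + ddhe l j (cv x) (axis i 1)) (at 0)"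
proof -
  have x0: "x + 0 *\<^sub>R axis i 1 \<noteq> 0" using assms by auto
  have r: "((\<lambda>s. - of_nat l * ((x + s *\<^sub>R axis i 1) $ i) * inverse (norm (x + s *\<^sub>R axis i 1)) ^ (l + 2)) has_real_derivative
      (- of_nat l + of_nat l * (of_nat l + 2) * (x $ i)\<^sup>2)) (at 0)"
  proof -
    have a: "((\<lambda>s. (x + s *\<^sub>R axis i 1) $ i) has_real_derivative 1) (at 0)"
      by (auto intro!: derivative_eq_intros simp: axis_def)
    show ?thesis
      using DERIV_mult[OF DERIV_cmult[OF a, of "- of_nat l"] inverse_norm_deriv[OF x0, of "l + 2"]] assms
      by (simp add: algebra_simps power2_eq_square)
  qed
  have 1: "((\<lambda>s. gl' l j i (x + s *\<^sub>R axis i 1)) has_vector_derivative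
     (he l j (cv (x + 0 *\<^sub>R axis i 1)) * of_real (- of_nat l + of_nat l * (of_nat l + 2) * (x $ i)\<^sup>2)
      + dhe l j (cv (x + 0 *\<^sub>R axis i 1)) (axis i 1) * of_real (- of_nat l * ((x + 0 *\<^sub>R axis i 1) $ i) * inverse (norm (x + 0 *\<^sub>R axis i 1)) ^ (l + 2)))
     + (dhe l j (cv (x + 0 *\<^sub>R axis i 1)) (axis i 1) * of_real (- of_nat l * ((x + 0 *\<^sub>R axis i 1) $ i) * inverse (norm (x + 0 *\<^sub>R axis i 1)) ^ (l + 2))
      + ddhe l j (cv (x + 0 *\<^sub>R axis i 1)) (axis i 1) * of_real (inverse (norm (x + 0 *\<^sub>R axis i 1)) ^ l))) (at 0)"
    unfolding gl'_def
    by (intro has_vector_derivative_add has_vector_derivative_mult he_path dhe_path cv_line_deriv has_vector_derivative_of_real inverse_norm_deriv x0 r)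
  show ?thesis
    by (rule has_vector_derivative_eq_rhs[OF 1]) (use assms in \<open>simp add: algebra_simps\<close>)
qed

text \<open>The degree 0 extension |x|^(-l) h is differentiated twice along the coordinate lines; on
  the unit sphere Euler's relation and harmonicity leave - 3 l + l (l + 2) - 2 l^2 = - l (l + 1).
  Sums of mixed degrees are allowed and only values on the sphere are assumed, since that is how
  slices of functions on \<open>Xi\<close> are known.\<close>

lemma laplacian_S2_harmonic:
  assumes T: "finite T" and f: "\<And>x. norm x = 1 \<Longrightarrow> f x = (\<Sum>t\<in>T. c t * he (a t) (j t) (cv x))" and x: "norm x = 1"
  shows "laplacian_S2 f x = (\<Sum>t\<in>T. - (of_nat (a t) * (of_nat (a t) + 1)) * c t * he (a t) (j t) (cv x))"
proof -
  define g where "g x = f (x /\<^sub>R norm x)" for x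
  have g: "g y = (\<Sum>t\<in>T. c t * gl (a t) (j t) y)" if "y \<noteq> 0" for y
  proof -
    have "norm (y /\<^sub>R norm y) = 1" using that by simp
    then show ?thesis unfolding g_def using f gl_sphere[OF that] by (simp add: sgn_div_norm)
  qed
  define g1 where "g1 i y = (\<Sum>t\<in>T. c t * gl' (a t) (j t) i y)" for i y
  \<comment> \<open>The nested derivative in \<open>laplacian\<close> sees the inner function only
    near s = 0, where the line avoids the origin.\<close>
  have opn: "open {s. x + s *\<^sub>R axis i 1 \<noteq> 0}" for i :: 3
    by (intro open_Collect_neq continuous_intros)
  have d1: "vector_derivative (\<lambda>u. g (x + u *\<^sub>R axis i 1)) (at s) = g1 i (x + s *\<^sub>R axis i 1)"
    if s: "x + s *\<^sub>R axis i 1 \<noteq> 0" for i s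
  proof (rule vector_derivative_at)
    have "((\<lambda>u. \<Sum>t\<in>T. c t * gl (a t) (j t) (x + u *\<^sub>R axis i 1)) has_vector_derivative g1 i (x + s *\<^sub>R axis i 1)) (at s)"
      unfolding g1_def by (intro has_vector_derivative_sum has_vector_derivative_mult_right gl_deriv s)
    then show "((\<lambda>u. g (x + u *\<^sub>R axis i 1)) has_vector_derivative g1 i (x + s *\<^sub>R axis i 1)) (at s)"
      by (rule has_vector_derivative_transform_within_open[OF _ opn[of i]]) (use s g in auto)
  qed
  have d2: "vector_derivative (\<lambda>s. vector_derivative (\<lambda>u. g (x + u *\<^sub>R axis i 1)) (at s)) (at 0)
      = (\<Sum>t\<in>T. c t * (he (a t) (j t) (cv x) * of_real (- of_nat (a t) + of_nat (a t) * (of_nat (a t) + 2) * (x $ i)\<^sup>2)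
     - 2 * of_nat (a t) * of_real (x $ i) * dhe (a t) (j t) (cv x) (axis i 1) + ddhe (a t) (j t) (cv x) (axis i 1)))" for i
  proof (rule vector_derivative_at)
    have "((\<lambda>s. g1 i (x + s *\<^sub>R axis i 1)) has_vector_derivative (\<Sum>t\<in>T. c t * (he (a t) (j t) (cv x) * of_real (- of_nat (a t) + of_nat (a t) * (of_nat (a t) + 2) * (x $ i)\<^sup>2)
     - 2 * of_nat (a t) * of_real (x $ i) * dhe (a t) (j t) (cv x) (axis i 1) + ddhe (a t) (j t) (cv x) (axis i 1)))) (at 0)"
      unfolding g1_def by (intro has_vector_derivative_sum has_vector_derivative_mult_right gl'_deriv x)
    then show "((\<lambda>s. vector_derivative (\<lambda>u. g (x + u *\<^sub>R axis i 1)) (at s)) has_vector_derivative (\<Sum>t\<in>T. c t * (he (a t) (j t) (cv x) * of_real (- of_nat (a t) + of_nat (a t) * (of_nat (a t) + 2) * (x $ i)\<^sup>2)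
     - 2 * of_nat (a t) * of_real (x $ i) * dhe (a t) (j t) (cv x) (axis i 1) + ddhe (a t) (j t) (cv x) (axis i 1)))) (at 0)"
      by (rule has_vector_derivative_transform_within_open[OF _ opn[of i]]) (use x d1 in auto)
  qed
  have B: "(\<Sum>b\<in>(Basis :: (real ^ 3) set). F b) = (\<Sum>i\<in>UNIV. F (axis i 1))" for F :: "real ^ 3 \<Rightarrow> complex"
  proof -
    have b: "(Basis :: (real ^ 3) set) = range (\<lambda>i. axis i 1)" by (auto simp: Basis_vec_def)
    have "inj (\<lambda>i :: 3. axis i (1 :: real))" by (auto simp: inj_on_def axis_eq_axis)
    then show ?thesis unfolding b by (subst sum.reindex) auto
  qed
  have "laplacian_S2 f x = (\<Sum>i\<in>UNIV. vector_derivative (\<lambda>s. vector_derivative (\<lambda>u. g (x + u *\<^sub>R axis i 1)) (at s)) (at 0))"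
    unfolding laplacian_S2_def laplacian_def B g_def ..
  also have "\<dots> = (\<Sum>t\<in>T. \<Sum>i\<in>UNIV. c t * (he (a t) (j t) (cv x) * of_real (- of_nat (a t) + of_nat (a t) * (of_nat (a t) + 2) * (x $ i)\<^sup>2)
     - 2 * of_nat (a t) * of_real (x $ i) * dhe (a t) (j t) (cv x) (axis i 1) + ddhe (a t) (j t) (cv x) (axis i 1)))"
    unfolding d2 by (rule sum.swap)
  also have "\<dots> = (\<Sum>t\<in>T. - (of_nat (a t) * (of_nat (a t) + 1)) * c t * he (a t) (j t) (cv x))"
  proof (rule sum.cong[OF refl])
    fix t
    let ?l = "of_nat (a t) :: complex" and ?h = "he (a t) (j t) (cv x)"
    have n: "(\<Sum>i\<in>UNIV. (of_real (x $ i))\<^sup>2) = (1 :: complex)"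
    proof -
      have "(x $ 1)\<^sup>2 + (x $ 2)\<^sup>2 + (x $ 3)\<^sup>2 = 1" using norm_3[of x] x by simp
      from arg_cong[OF this, of complex_of_real] show ?thesis
        by (simp only: sum_3 of_real_add of_real_power of_real_1)
    qed
    have e: "(\<Sum>i\<in>UNIV. of_real (x $ i) * dhe (a t) (j t) (cv x) (axis i 1)) = ?l * ?h"
      using dhe_euler[of "cv x"] by (simp add: cv_def)
    have "(\<Sum>i\<in>UNIV. c t * (?h * of_real (- of_nat (a t) + of_nat (a t) * (of_nat (a t) + 2) * (x $ i)\<^sup>2)
       - 2 * ?l * of_real (x $ i) * dhe (a t) (j t) (cv x) (axis i 1) + ddhe (a t) (j t) (cv x) (axis i 1)))
      = c t * (?h * (- 3 * ?l + ?l * (?l + 2) * (\<Sum>i\<in>UNIV. (of_real (x $ i))\<^sup>2))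
        - 2 * ?l * (\<Sum>i\<in>UNIV. of_real (x $ i) * dhe (a t) (j t) (cv x) (axis i 1))
        + (\<Sum>i\<in>UNIV. ddhe (a t) (j t) (cv x) (axis i 1)))"
      by (simp add: sum_3 algebra_simps)
    also have "\<dots> = - (?l * (?l + 1)) * c t * ?h"
      unfolding n e ddhe_harmonic by (simp add: algebra_simps)
    finally show "(\<Sum>i\<in>UNIV. c t * (?h * of_real (- of_nat (a t) + of_nat (a t) * (of_nat (a t) + 2) * (x $ i)\<^sup>2)
       - 2 * ?l * of_real (x $ i) * dhe (a t) (j t) (cv x) (axis i 1) + ddhe (a t) (j t) (cv x) (axis i 1)))
       = - (?l * (?l + 1)) * c t * ?h" .
  qed
  finally show ?thesis .
qed

lemma fn_span_range_expansion:
  assumes "f \<in> fn.span (range h)"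
  shows "\<exists>T c. finite T \<and> (\<forall>x. f x = (\<Sum>t\<in>T. c t * h t x))"
  using assms
proof (induction rule: fn.span_induct_alt)
  case base
  show ?case by (rule exI[of _ "{}"]) simp
next
  case (step r g f)
  then obtain T c t0 where T: "finite T" "\<And>x. f x = (\<Sum>t\<in>T. c t * h t x)" and g: "g = h t0" by blast
  define c' where "c' t = (if t \<in> T then c t else 0) + (if t = t0 then r else 0)" for t
  have "(fscale r g + f) x = (\<Sum>t\<in>insert t0 T. c' t * h t x)" for x
  proof -
    have "(\<Sum>t\<in>insert t0 T. c' t * h t x)
        = (\<Sum>t\<in>insert t0 T. (if t \<in> T then c t else 0) * h t x) + (\<Sum>t\<in>insert t0 T. if t = t0 then r * h t x else 0)"
      unfolding sum.distrib[symmetric] by (rule sum.cong) (auto simp: c'_def algebra_simps)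
    also have "(\<Sum>t\<in>insert t0 T. (if t \<in> T then c t else 0) * h t x) = f x"
      unfolding T(2) by (rule sum.mono_neutral_cong_right) (auto simp: T(1))
    also have "(\<Sum>t\<in>insert t0 T. if t = t0 then r * h t x else 0) = r * h t0 x"
      using T(1) by simp
    finally show ?thesis by (simp add: g fscale_apply)
  qed
  then show ?case using T(1) by (intro exI[of _ "insert t0 T"] exI[of _ c']) auto
qed

subsection \<open>The compact group\<close>

definition kb :: "real ^ 3 ^ 3 \<Rightarrow> real ^ 3 ^ 3 \<Rightarrow> real ^ (3 + 3) ^ (3 + 3)" where
  "kb A B = (\<chi> i j. case (i, j) of (Inl a, Inl b) \<Rightarrow> A $ a $ b | (Inr a, Inr b) \<Rightarrow> B $ a $ b | _ \<Rightarrow> 0)"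

lemma SO3xSO3_kb: "SO3xSO3 = {kb A B | A B. rotation3 A \<and> rotation3 B}"
  by (auto simp: SO3xSO3_def kb_def rotation3_def)

lemma kb_mult: "kb A B *v \<xi> = join (A *v rx \<xi>) (B *v ry \<xi>)"
  by (simp add: vec_eq_iff all_plus kb_def join_def matrix_vector_mult_def sum_UNIV_plus rx_def ry_def)

lemma rotation3_transpose: "rotation3 A \<Longrightarrow> rotation3 (transpose A)"
  by (simp add: rotation3_def orthogonal_matrix_transpose det_transpose)

lemma rotation3_inverse:
  assumes "rotation3 A"
  shows "transpose A *v (A *v x) = x"
  using assms by (simp add: rotation3_def orthogonal_matrix matrix_vector_mul_assoc)

lemma rotation3_mult: "rotation3 A \<Longrightarrow> rotation3 B \<Longrightarrow> rotation3 (A ** B)"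
  by (simp add: rotation3_def orthogonal_matrix_mul det_mul)

lemma rotation3_one: "rotation3 (mat 1)"
  by (simp add: rotation3_def orthogonal_matrix_id)

lemma rotation3_norm:
  assumes "rotation3 A"
  shows "norm (A *v x) = norm x"
proof -
  have "(A *v x) \<bullet> (A *v x) = x \<bullet> (transpose A *v (A *v x))"
    by (simp add: dot_lmul_matrix[symmetric] inner_commute)
  then show ?thesis using rotation3_inverse[OF assms, of x] by (simp add: norm_eq_sqrt_inner)
qed

lemma matrix_inv_kb:
  assumes "rotation3 A" "rotation3 B"
  shows "matrix_inv (kb A B) = kb (transpose A) (transpose B)"
proof (rule matrix_inv_eqI)
  have "(kb (transpose A) (transpose B) ** kb A B) *v \<xi> = mat 1 *v \<xi>" for \<xi>
    by (simp only: matrix_vector_mul_assoc[symmetric] kb_mult rx_join ry_join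
        rotation3_inverse[OF assms(1)] rotation3_inverse[OF assms(2)] join_rx_ry matrix_vector_mul_lid)
  then show "kb (transpose A) (transpose B) ** kb A B = mat 1"
    by (subst matrix_eq) blast
qed

definition act :: "real ^ 3 ^ 3 \<Rightarrow> real ^ 3 ^ 3 \<Rightarrow> (real ^ (3 + 3) \<Rightarrow> complex) \<Rightarrow> real ^ (3 + 3) \<Rightarrow> complex" where
  "act A B F \<xi> = F (join (A *v rx \<xi>) (B *v ry \<xi>))"

lemma o33_act_kb:
  assumes "rotation3 A" "rotation3 B"
  shows "o33_act (kb A B) F = act (transpose A) (transpose B) F"
  by (rule ext) (simp add: o33_act_def act_def matrix_inv_kb[OF assms] kb_mult)

lemma orbit_eq: "(\<lambda>k. o33_act k F) ` SO3xSO3 = {act A B F | A B. rotation3 A \<and> rotation3 B}"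
proof safe
  fix k assume "k \<in> SO3xSO3"
  then obtain A B where "k = kb A B" "rotation3 A" "rotation3 B" by (auto simp: SO3xSO3_kb)
  then show "\<exists>A B. o33_act k F = act A B F \<and> rotation3 A \<and> rotation3 B"
    using o33_act_kb rotation3_transpose by blast
next
  fix A B assume AB: "rotation3 A" "rotation3 B"
  have "act A B F = o33_act (kb (transpose A) (transpose B)) F"
    using AB by (simp add: o33_act_kb rotation3_transpose)
  moreover have "kb (transpose A) (transpose B) \<in> SO3xSO3"
    using AB rotation3_transpose by (auto simp: SO3xSO3_kb)
  ultimately show "act A B F \<in> (\<lambda>k. o33_act k F) ` SO3xSO3" by blast
qed

lemma act_Xi:
  assumes "rotation3 A" "rotation3 B"
  shows "join (A *v rx \<xi>) (B *v ry \<xi>) \<in> Xi \<longleftrightarrow> \<xi> \<in> Xi"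
proof -
  have "A *v x \<noteq> 0 \<longleftrightarrow> x \<noteq> 0" for x using rotation3_norm[OF assms(1), of x] by (metis norm_eq_zero)
  then show ?thesis by (simp add: Xi_iff rotation3_norm assms)
qed

text \<open>Ordered products of n coordinates: a finite set whose span contains every rotated
  \<open>he n j\<close>.\<close>

primrec Mn :: "nat \<Rightarrow> (real ^ 3 \<Rightarrow> complex) set" where
  "Mn 0 = {\<lambda>x. 1}"
| "Mn (Suc n) = (\<lambda>(a, f) x. of_real (x $ a) * f x) ` (UNIV \<times> Mn n)"

lemma finite_Mn: "finite (Mn n)"
  by (induction n) auto

lemma Mn_lin:
  assumes "f \<in> fn.span (Mn n)"
  shows "(\<lambda>x. (\<Sum>a\<in>UNIV. w a * of_real (x $ a)) * f x) \<in> fn.span (Mn (Suc n))"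
proof -
  have 1: "(\<lambda>x. of_real (x $ a) * f x) \<in> fn.span (Mn (Suc n))" for a
    using assms
  proof (induction rule: fn.span_induct_alt)
    case base
    have "(\<lambda>x. of_real (x $ a) * (0 :: real ^ 3 \<Rightarrow> complex) x) = 0" by auto
    then show ?case by (simp only: fn.span_zero)
  next
    case (step c h f)
    have "(\<lambda>x. of_real (x $ a) * (fscale c h + f) x) = fscale c (\<lambda>x. of_real (x $ a) * h x) + (\<lambda>x. of_real (x $ a) * f x)"
      by (auto simp: fscale_def algebra_simps)
    moreover have "(\<lambda>x. of_real (x $ a) * h x) \<in> Mn (Suc n)"
      using step(1) by (auto intro!: image_eqI[of _ _ "(a, h)"])
    ultimately show ?case using step(2) by (simp only: fn.span_add fn.span_scale fn.span_base)
  qed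
  show ?thesis
    by (rule fn_span_sum_apply[of UNIV "\<lambda>a x. of_real (x $ a) * f x" _ _ w]) (auto simp: 1 sum_distrib_right mult.assoc simp del: Mn.simps)
qed

lemma he_rotate: "(\<lambda>x. he l j (cv (A *v x))) \<in> fn.span (Mn l)"
proof (induction l arbitrary: j)
  case 0
  have "(\<lambda>x. he 0 j (cv (A *v x))) = fscale (if j = 0 then 1 else 0) (\<lambda>x. 1)"
    by (auto simp: he_0 fscale_def)
  then show ?case by (simp only: Mn.simps) (intro fn.span_scale fn.span_base, simp)
next
  case (Suc l)
  let ?p = "\<lambda>a. of_real (A $ 1 $ a) + \<i> * of_real (A $ 2 $ a)"
  let ?z = "\<lambda>a. of_real (A $ 3 $ a) :: complex"
  let ?m = "\<lambda>a. of_real (A $ 1 $ a) - \<i> * of_real (A $ 2 $ a)"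
  let ?L = "\<lambda>w x. \<Sum>a\<in>UNIV. w a * complex_of_real (x $ a)"
  have "(\<lambda>x. he (Suc l) j (cv (A *v x))) = (\<lambda>x. ?L ?p x * he l j (cv (A *v x)))
      + fscale (if 1 \<le> j then 2 else 0) (\<lambda>x. ?L ?z x * he l (j - 1) (cv (A *v x)))
      + fscale (if 2 \<le> j then - 1 else 0) (\<lambda>x. ?L ?m x * he l (j - 2) (cv (A *v x)))"
  proof
    fix x
    have c: "cv (A *v x) $ 1 + \<i> * cv (A *v x) $ 2 = ?L ?p x" "cv (A *v x) $ 3 = ?L ?z x"
      "cv (A *v x) $ 1 - \<i> * cv (A *v x) $ 2 = ?L ?m x"
      by (simp_all add: cv_def matrix_vector_mult_def sum_3 algebra_simps)
    show "he (Suc l) j (cv (A *v x)) = ((\<lambda>x. ?L ?p x * he l j (cv (A *v x)))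
      + fscale (if 1 \<le> j then 2 else 0) (\<lambda>x. ?L ?z x * he l (j - 1) (cv (A *v x)))
      + fscale (if 2 \<le> j then - 1 else 0) (\<lambda>x. ?L ?m x * he l (j - 2) (cv (A *v x)))) x"
      unfolding he_Suc c by (simp add: fscale_apply)
  qed
  then show ?case by (simp only: fn.span_add fn.span_scale Mn_lin[OF Suc.IH])
qed

definition MX :: "nat \<Rightarrow> (real ^ 3 \<Rightarrow> complex) \<Rightarrow> (real ^ 3 \<Rightarrow> complex) \<Rightarrow> real ^ (3 + 3) \<Rightarrow> complex" where
  "MX l f g \<xi> = (if \<xi> \<in> Xi then f (rx \<xi>) * g (ry \<xi>) / of_real (norm (rx \<xi>)) ^ (2 * l + 1) else 0)"

lemma MX_span:
  assumes "f \<in> fn.span M" "g \<in> fn.span N"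
  shows "MX l f g \<in> fn.span ((\<lambda>(f, g). MX l f g) ` (M \<times> N))"
proof -
  have 1: "MX l h g \<in> fn.span ((\<lambda>(f, g). MX l f g) ` (M \<times> N))" if "h \<in> M" for h
    using assms(2)
  proof (induction rule: fn.span_induct_alt)
    case base
    have "MX l h 0 = 0" by (auto simp: MX_def)
    then show ?case by (simp only: fn.span_zero)
  next
    case (step c k g)
    have "MX l h (fscale c k + g) = fscale c (MX l h k) + MX l h g"
      by (auto simp: MX_def fscale_def algebra_simps add_divide_distrib)
    moreover have "MX l h k \<in> (\<lambda>(f, g). MX l f g) ` (M \<times> N)"
      using step(1) that by (auto intro!: image_eqI[of _ _ "(h, k)"])
    ultimately show ?case using step(2) by (simp only: fn.span_add fn.span_scale fn.span_base)
  qed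
  show ?thesis
    using assms(1)
  proof (induction rule: fn.span_induct_alt)
    case base
    have "MX l 0 g = 0" by (auto simp: MX_def)
    then show ?case by (simp only: fn.span_zero)
  next
    case (step c h f)
    have "MX l (fscale c h + f) g = fscale c (MX l h g) + MX l f g"
      by (auto simp: MX_def fscale_def algebra_simps add_divide_distrib)
    then show ?case using step(2) 1[OF step(1)] by (simp only: fn.span_add fn.span_scale)
  qed
qed

lemma act_b:
  assumes "rotation3 A" "rotation3 B"
  shows "act A B (Xr.b l j k) = MX l (\<lambda>x. he l j (cv (A *v x))) (\<lambda>y. he l k (cv (B *v y)))"
proof
  fix \<xi>
  show "act A B (Xr.b l j k) \<xi> = MX l (\<lambda>x. he l j (cv (A *v x))) (\<lambda>y. he l k (cv (B *v y))) \<xi>"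
    using act_Xi[OF assms, of \<xi>]
    by (cases "\<xi> \<in> Xi") (simp_all add: act_def Xr.b_apply Xr.b_outside MX_def tauX_def vx_cvec vy_cvec rotation3_norm assms)
qed

text \<open>One finite set has to serve all rotations at once; monomials of degree l in each
  variable, divided by the rotation-invariant power of |x|, do so.\<close>

lemma U_K_finite:
  assumes "f \<in> Xr.U"
  shows "\<exists>S. finite S \<and> (\<forall>A B. rotation3 A \<and> rotation3 B \<longrightarrow> act A B f \<in> fn.span S)"
  using assms unfolding Xr.U_def
proof (induction rule: fn.span_induct_alt)
  case base
  have "act A B 0 = 0" for A B by (auto simp: act_def)
  then have "\<forall>A B. rotation3 A \<and> rotation3 B \<longrightarrow> act A B 0 \<in> fn.span {}" by (simp only: fn.span_zero simp_thms)
  then show ?case by (intro exI[of _ "{}"] conjI finite.emptyI)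
next
  case (step c h f)
  then obtain S l j k where S: "finite S" "\<And>A B. rotation3 A \<Longrightarrow> rotation3 B \<Longrightarrow> act A B f \<in> fn.span S"
    and h: "h = Xr.b l j k" by auto
  let ?S = "(\<lambda>(f, g). MX l f g) ` (Mn l \<times> Mn l) \<union> S"
  have "act A B (fscale c h + f) \<in> fn.span ?S" if AB: "rotation3 A" "rotation3 B" for A B
  proof -
    have "act A B (fscale c h + f) = fscale c (act A B h) + act A B f"
      by (auto simp: act_def fscale_def)
    moreover have "act A B h \<in> fn.span ?S"
      unfolding h act_b[OF AB] using MX_span[OF he_rotate he_rotate] fn.span_mono[of _ ?S] by blast
    moreover have "act A B f \<in> fn.span ?S" using S(2)[OF AB] fn.span_mono[of S ?S] by blast
    ultimately show ?thesis by (simp only: fn.span_add fn.span_scale)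
  qed
  moreover have "finite ?S" using S(1) finite_Mn by auto
  ultimately show ?case by blast
qed

lemma Xr_b_unit:
  assumes "norm x = 1" "norm y = 1"
  shows "Xr.b l j k (join x y) = he l j (cv x) * he l k (cv y)"
proof -
  have "join x y \<in> Xi" using assms by (auto simp: Xi_iff)
  then show ?thesis using assms by (simp add: Xr.b_apply tauX_def vx_cvec vy_cvec)
qed

abbreviation lam :: "nat \<Rightarrow> complex" where
  "lam l \<equiv> of_nat l * (of_nat l + 1)"

lemma U_sub_V33: "Xr.U \<subseteq> V33"
proof
  fix f assume f: "f \<in> Xr.U"
  obtain e where e: "homog (- 1) e" "f = evX e"
    using f by (rule Xr.U_rep) (simp add: Xr_evx)
  obtain T c where T: "finite T" "\<And>\<xi>. f \<xi> = (\<Sum>t\<in>T. c t * (case t of (l, j, k) \<Rightarrow> Xr.b l j k) \<xi>)"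
    using fn_span_range_expansion[OF f[unfolded Xr.U_def]] by blast
  have unit: "f (join x y) = (\<Sum>t\<in>T. c t * he (fst t) (fst (snd t)) (cv x) * he (fst t) (snd (snd t)) (cv y))"
    if "norm x = 1" "norm y = 1" for x y
    unfolding T(2) by (rule sum.cong) (auto simp: Xr_b_unit[OF that] split: prod.split)
  have "laplacian_S2 (\<lambda>x. f (join x y)) x - laplacian_S2 (\<lambda>y. f (join x y)) y = 0"
    if x: "norm x = 1" and y: "norm y = 1" for x y
  proof -
    have "laplacian_S2 (\<lambda>x. f (join x y)) x
        = (\<Sum>t\<in>T. - lam (fst t) * (c t * he (fst t) (snd (snd t)) (cv y)) * he (fst t) (fst (snd t)) (cv x))"
      by (rule laplacian_S2_harmonic[OF T(1) _ x]) (simp add: unit y mult_ac)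
    moreover have "laplacian_S2 (\<lambda>y. f (join x y)) y
        = (\<Sum>t\<in>T. - lam (fst t) * (c t * he (fst t) (fst (snd t)) (cv x)) * he (fst t) (snd (snd t)) (cv y))"
      by (rule laplacian_S2_harmonic[OF T(1) _ y]) (simp add: unit x mult_ac)
    ultimately show ?thesis by (simp add: mult_ac)
  qed
  then show "f \<in> V33"
    unfolding V33_def using evX_smooth[of e] evX_homogeneous[OF e(1)] by (simp add: e(2) evX_def)
qed

lemma U_sub_V33_HC: "Xr.U \<subseteq> V33_HC"
proof
  fix f assume f: "f \<in> Xr.U"
  obtain S where S: "finite S" "\<And>A B. rotation3 A \<Longrightarrow> rotation3 B \<Longrightarrow> act A B f \<in> fn.span S"
    using U_K_finite[OF f] by blast
  then have "(\<lambda>k. o33_act k f) ` SO3xSO3 \<subseteq> fn.span S" unfolding orbit_eq by auto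
  with S(1) U_sub_V33 f show "f \<in> V33_HC" unfolding V33_HC_def by blast
qed

subsection \<open>\<open>K\<close>-finite functions\<close>

lemma sgn_rotation: "rotation3 R \<Longrightarrow> sgn (R *v x) = R *v sgn x"
  by (simp add: sgn_div_norm rotation3_norm matrix_vector_mult_scaleR)

lemma sgn_differentiable:
  assumes "x \<noteq> (0 :: real ^ 3)"
  shows "sgn differentiable (at x)"
proof -
  have "(\<lambda>x :: real ^ 3. inverse (norm x) *\<^sub>R x) differentiable (at x)"
    using assms differentiable_norm_at[OF assms]
    by (intro differentiable_scaleR differentiable_inverse differentiable_ident) auto
  then show ?thesis by (simp add: sgn_div_norm[abs_def])
qed

text \<open>\<open>jj\<close> freezes one of the two arguments at a fixed unit vector, so that
  slices of the rotates of \<open>F\<close> become functions on one sphere. Composition with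
  \<open>sgn\<close> extends them to nonzero vectors, as \<open>sphere_space\<close>
  expects.\<close>

lemma V33_slot_sphere_space:
  assumes F: "smooth_on_Xi F" and S: "finite S" "{act A B F | A B. rotation3 A \<and> rotation3 B} \<subseteq> fn.span S"
    and slot_rot: "\<And>R. rotation3 R \<Longrightarrow> \<exists>A B. rotation3 A \<and> rotation3 B \<and> (\<forall>x. join (A *v rx (jj x)) (B *v ry (jj x)) = jj (R *v x))"
    and slot_diff: "\<And>x. jj differentiable (at x)" and slot_Xi: "\<And>x. norm x = 1 \<Longrightarrow> jj x \<in> Xi"
  defines "W \<equiv> fn.span {act A B F | A B. rotation3 A \<and> rotation3 B}"
  shows "sphere_space ((\<lambda>w x. w (jj (sgn x))) ` W) ((\<lambda>w x. w (jj (sgn x))) ` S)"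
proof
  let ?r = "\<lambda>w x. w (jj (sgn x)) :: complex"
  have r_lin: "?r (f + g) = ?r f + ?r g" "?r (fscale c f) = fscale c (?r f)" "?r 0 = 0" for f g c
    by (auto simp: fscale_def)
  have subW: "fn.subspace W" by (simp add: W_def)
  show "fn.subspace (?r ` W)"
    unfolding fn.subspace_def
  proof (intro conjI ballI allI)
    show "0 \<in> ?r ` W" using fn.subspace_0[OF subW] by (rule image_eqI[rotated]) (simp only: r_lin)
  next
    fix x y assume "x \<in> ?r ` W" "y \<in> ?r ` W"
    then obtain f g where "x = ?r f" "y = ?r g" "f \<in> W" "g \<in> W" by blast
    then show "x + y \<in> ?r ` W"
      by (intro image_eqI[of _ _ "f + g"] fn.subspace_add[OF subW]) (simp_all only: r_lin)
  next
    fix c x assume "x \<in> ?r ` W"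
    then obtain f where "x = ?r f" "f \<in> W" by blast
    then show "fscale c x \<in> ?r ` W"
      by (intro image_eqI[of _ _ "fscale c f"] fn.subspace_scale[OF subW]) (simp_all only: r_lin)
  qed
  show "finite (?r ` S)" using S(1) by simp
  have WS: "W \<subseteq> fn.span S" unfolding W_def by (rule fn.span_minimal[OF S(2)]) simp
  show "?r ` W \<subseteq> fn.span (?r ` S)"
  proof safe
    fix f assume "f \<in> W"
    then have "f \<in> fn.span S" using WS by blast
    then show "?r f \<in> fn.span (?r ` S)"
    proof (induction rule: fn.span_induct_alt)
      case base
      show ?case by (simp only: r_lin fn.span_zero)
    next
      case (step c x y)
      then show ?case unfolding r_lin
        by (intro fn.span_add fn.span_scale) (auto intro: fn.span_base)
    qed
  qed
next
  fix g x assume "g \<in> (\<lambda>w x. w (jj (sgn x))) ` W" and x: "x \<noteq> (0 :: real ^ 3)"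
  then obtain w where g: "g = (\<lambda>x. w (jj (sgn x)))" and w: "w \<in> W" by blast
  show "g differentiable (at x)"
    unfolding g using w unfolding W_def
  proof (induction rule: fn.span_induct_alt)
    case base
    then show ?case by simp
  next
    case (step c h f)
    then obtain A B where h: "h = act A B F" and AB: "rotation3 A" "rotation3 B" by blast
    define \<phi> where "\<phi> x = join (A *v rx (jj (sgn x))) (B *v ry (jj (sgn x)))" for x
    have "linear (\<lambda>\<xi>. join (A *v rx \<xi>) (B *v ry \<xi>))"
    proof -
      have "(\<lambda>\<xi>. join (A *v rx \<xi>) (B *v ry \<xi>)) = (*v) (kb A B)" by (simp add: kb_mult[symmetric] fun_eq_iff)
      then show ?thesis by simp
    qed
    then have "(\<lambda>\<xi>. join (A *v rx \<xi>) (B *v ry \<xi>)) differentiable (at z)" for z by (rule linear_imp_differentiable)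
    from differentiable_chain_at[OF differentiable_chain_at[OF sgn_differentiable[OF x] slot_diff] this]
    have d\<phi>: "\<phi> differentiable (at x)" by (simp add: \<phi>_def[abs_def] o_def)
    have \<phi>Xi: "\<phi> y \<in> Xi" if "y \<noteq> 0" for y
      unfolding \<phi>_def act_Xi[OF AB] using slot_Xi[of "sgn y"] that by (simp add: norm_sgn)
    \<comment> \<open>\<open>F\<close> is smooth only along the cone, so differentiability of F o
      \<phi> comes from a local smooth extension \<open>G\<close>; \<phi> stays in
      \<open>Xi\<close>, where both agree.\<close>
    obtain U G where UG: "open U \<and> \<phi> x \<in> U \<and> (\<forall>k. Ck_on k G U) \<and> (\<forall>q\<in>U \<inter> Xi. G q = F q)"
      using bspec[OF F[unfolded smooth_on_Xi_def] \<phi>Xi[OF x]] by (elim exE)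
    then have U: "open U" "\<phi> x \<in> U" "\<And>k. Ck_on k G U" "\<And>q. q \<in> U \<Longrightarrow> q \<in> Xi \<Longrightarrow> G q = F q"
      by simp_all
    have "G differentiable (at (\<phi> x))"
      using U(3)[of "Suc 0"] U(1,2) by (simp add: differentiable_on_eq_differentiable_at)
    from differentiable_chain_at[OF d\<phi> this] obtain D where D: "((\<lambda>y. G (\<phi> y)) has_derivative D) (at x)"
      by (auto simp: o_def differentiable_def)
    have "\<forall>\<^sub>F y in at x. \<phi> y \<in> U"
      using differentiable_imp_continuous_within[OF d\<phi>] U(1,2) by (auto simp: continuous_within tendsto_def)
    moreover have "\<forall>\<^sub>F y in at x. y \<noteq> 0"
      using eventually_at_in_open'[of "- {0}" x] x by (simp add: open_Compl)
    ultimately have "\<forall>\<^sub>F y in at x. G (\<phi> y) = F (\<phi> y)"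
      by eventually_elim (simp add: U(4) \<phi>Xi)
    then have "((\<lambda>y. F (\<phi> y)) has_derivative D) (at x)"
      using has_derivative_transform_eventually[OF D] U(4)[OF U(2) \<phi>Xi[OF x]] by simp
    then have "(\<lambda>y. h (jj (sgn y))) differentiable (at x)"
      by (auto simp: h act_def \<phi>_def differentiable_def)
    then have "(\<lambda>y. c * h (jj (sgn y)) + f (jj (sgn y))) differentiable (at x)"
      using step(2) by (intro differentiable_add differentiable_mult differentiable_const)
    then show ?case by (simp add: fscale_apply)
  qed
next
  fix g R assume "g \<in> (\<lambda>w x. w (jj (sgn x))) ` W" and R: "rotation3 R"
  then obtain w where g: "g = (\<lambda>x. w (jj (sgn x)))" and w: "w \<in> W" by blast
  obtain A B where AB: "rotation3 A" "rotation3 B" "\<And>x. join (A *v rx (jj x)) (B *v ry (jj x)) = jj (R *v x)"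
    using slot_rot[OF R] by blast
  have "act A B w \<in> W"
    using w unfolding W_def
  proof (induction rule: fn.span_induct_alt)
    case base
    have "act A B 0 = 0" by (auto simp: act_def)
    then show ?case by (simp only: fn.span_zero)
  next
    case (step c h f)
    then obtain A' B' where h: "h = act A' B' F" and AB': "rotation3 A'" "rotation3 B'" by blast
    have "act A B (fscale c h + f) = fscale c (act (A' ** A) (B' ** B) F) + act A B f"
      by (auto simp: act_def fscale_def h matrix_vector_mul_assoc)
    moreover have "act (A' ** A) (B' ** B) F \<in> {act A B F | A B. rotation3 A \<and> rotation3 B}"
      using AB AB' rotation3_mult by blast
    ultimately show ?case using step(2) by (simp only: fn.span_add fn.span_scale fn.span_base)
  qed
  moreover have "(\<lambda>x. g (R *v x)) = (\<lambda>x. act A B w (jj (sgn x)))"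
    unfolding g by (simp add: act_def AB(3) sgn_rotation[OF R])
  ultimately show "(\<lambda>x. g (R *v x)) \<in> (\<lambda>w x. w (jj (sgn x))) ` W" by blast
qed

lemma rotation_transitive:
  assumes "norm (y :: real ^ 3) = 1"
  obtains B where "rotation3 B" "B *v axis 3 1 = y"
proof -
  let ?s = "arccos (y $ 3)" and ?t = "Arg (Complex (y $ 1) (y $ 2))"
  have n: "(cmod (Complex (y $ 1) (y $ 2)))\<^sup>2 = 1 - (y $ 3)\<^sup>2"
    using norm_3[of y] assms by (simp add: cmod_def)
  then have "(y $ 3)\<^sup>2 \<le> 1" using zero_le_power2[of "cmod (Complex (y $ 1) (y $ 2))"] by linarith
  then have y3: "- 1 \<le> y $ 3" "y $ 3 \<le> 1" by (simp_all add: abs_square_le_1 abs_le_iff)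
  have "sin ?s = sqrt (1 - (y $ 3)\<^sup>2)" using y3 by (simp add: sin_arccos)
  then have s: "sin ?s = cmod (Complex (y $ 1) (y $ 2))" using n by (metis norm_ge_zero real_sqrt_unique)
  have "rcis (cmod (Complex (y $ 1) (y $ 2))) ?t = Complex (y $ 1) (y $ 2)" by (rule rcis_cmod_Arg)
  then have "sin ?s * cos ?t = y $ 1" "sin ?s * sin ?t = y $ 2"
    unfolding s by (simp_all add: complex_eq_iff)
  then have "rm3 ?t *v (rm2 ?s *v axis 3 1) = y"
    using y3 by (simp add: rm_mult vec_eq_iff forall_3 axis_def mult.commute)
  then show ?thesis
    using that[OF rotation3_mult[OF rotation3_rm(3) rotation3_rm(2)], of ?t ?s] by (simp add: matrix_vector_mul_assoc)
qed

definition hh :: "nat \<times> nat \<times> nat \<times> nat \<Rightarrow> (real ^ 3) \<times> (real ^ 3) \<Rightarrow> complex" where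
  "hh t p = rs (\<lambda>x. he (fst t) (fst (snd t)) (cv x)) (fst p) * rs (\<lambda>x. he (fst (snd (snd t))) (snd (snd (snd t))) (cv x)) (snd p)"

lemma ST_prod:
  assumes "f \<in> ST" "g \<in> ST"
  shows "(\<lambda>p. f (fst p) * g (snd p)) \<in> fn.span (range hh)"
proof -
  obtain T c where T: "finite T" "\<And>x. f x = (\<Sum>t\<in>T. c t * (case t of (l, j) \<Rightarrow> rs (\<lambda>x. he l j (cv x))) x)"
    using fn_span_range_expansion[OF assms(1)[unfolded ST_def]] by blast
  obtain T' c' where T': "finite T'" "\<And>x. g x = (\<Sum>t\<in>T'. c' t * (case t of (l, j) \<Rightarrow> rs (\<lambda>x. he l j (cv x))) x)"
    using fn_span_range_expansion[OF assms(2)[unfolded ST_def]] by blast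
  show ?thesis
  proof (rule fn_span_sum_apply[of "T \<times> T'" "\<lambda>(s, t). hh (fst s, snd s, fst t, snd t)" _ _ "\<lambda>(s, t). c s * c' t"])
    show "f (fst p) * g (snd p) = (\<Sum>i\<in>T \<times> T'. (case i of (s, t) \<Rightarrow> c s * c' t) * (case i of (s, t) \<Rightarrow> hh (fst s, snd s, fst t, snd t)) p)" for p
      unfolding T(2) T'(2) sum_product sum.cartesian_product
      by (rule sum.cong) (auto simp: hh_def mult_ac)
  qed (auto simp: T(1) T'(1) intro: fn.span_base)
qed

text \<open>Both Laplacians of the zero function vanish, and each multiplies every term by its
  eigenvalue; the difference reweights the relation by the eigenvalue differences. This stands in
  for the orthogonality of spherical harmonics of different degrees.\<close>

lemma harmonic_sum_lam:
  assumes T: "finite T"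
    and z: "\<And>x y. norm x = 1 \<Longrightarrow> norm y = 1 \<Longrightarrow> (\<Sum>t\<in>T. c t * hh t (x, y)) = 0"
    and x: "norm x = 1" and y: "norm y = 1"
  shows "(\<Sum>t\<in>T. c t * (lam (fst (snd (snd t))) - lam (fst t)) * hh t (x, y)) = 0"
proof -
  have zero: "laplacian_S2 (\<lambda>_. 0) u = 0" if "norm u = 1" for u
    using laplacian_S2_harmonic[of "{}" "\<lambda>_. 0" undefined undefined undefined u] that by simp
  have hh: "hh t (u, v) = he (fst t) (fst (snd t)) (cv u) * he (fst (snd (snd t))) (snd (snd (snd t))) (cv v)"
    if "norm u = 1" "norm v = 1" for t u v
    using that by (simp add: hh_def rs_def)
  have "laplacian_S2 (\<lambda>_. 0) x = (\<Sum>t\<in>T. - lam (fst t) * (c t * he (fst (snd (snd t))) (snd (snd (snd t))) (cv y)) * he (fst t) (fst (snd t)) (cv x))"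
    by (rule laplacian_S2_harmonic[OF T _ x]) (use z y in \<open>simp add: hh mult_ac\<close>)
  moreover have "laplacian_S2 (\<lambda>_. 0) y = (\<Sum>t\<in>T. - lam (fst (snd (snd t))) * (c t * he (fst t) (fst (snd t)) (cv x)) * he (fst (snd (snd t))) (snd (snd (snd t))) (cv y))"
    by (rule laplacian_S2_harmonic[OF T _ y]) (use z x in \<open>simp add: hh mult_ac\<close>)
  moreover have "c t * (lam (fst (snd (snd t))) - lam (fst t)) * hh t (x, y)
      = - lam (fst t) * (c t * he (fst (snd (snd t))) (snd (snd (snd t))) (cv y)) * he (fst t) (fst (snd t)) (cv x)
      - - lam (fst (snd (snd t))) * (c t * he (fst t) (fst (snd t)) (cv x)) * he (fst (snd (snd t))) (snd (snd (snd t))) (cv y)" for t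
    unfolding hh[OF x y] by (simp add: algebra_simps)
  ultimately show ?thesis
    unfolding sum_subtractf by (simp only: zero[OF x] zero[OF y] sum_subtractf) simp
qed

text \<open>A spectral projector: evaluated at the difference of two Laplacians, \<open>q\<close>
  keeps the terms with eigenvalue 0 and removes the others.\<close>

lemma interpolating_poly:
  assumes "finite D"
  obtains q :: "complex poly" where "poly q 0 = 1" "\<And>d. d \<in> D \<Longrightarrow> d \<noteq> 0 \<Longrightarrow> poly q d = 0"
proof (rule that[of "\<Prod>d\<in>D - {0}. [:1, - 1 / d:]"])
  show "poly (\<Prod>d\<in>D - {0}. [:1, - 1 / d:]) 0 = 1" by (simp add: poly_prod)
  fix d assume "d \<in> D" "d \<noteq> 0"
  then show "poly (\<Prod>d\<in>D - {0}. [:1, - 1 / d:]) d = 0"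
    using assms by (auto simp: poly_prod intro!: prod_zero bexI[of _ d])
qed

lemma lam_inj: "lam a = lam b \<Longrightarrow> a = b"
proof -
  assume "lam a = lam b"
  then have "of_nat (a * (a + 1)) = (of_nat (b * (b + 1)) :: complex)"
    by (simp only: of_nat_mult of_nat_add of_nat_1)
  then have "a * (a + 1) = b * (b + 1)" by (simp only: of_nat_eq_iff)
  then show "a = b"
    using mult_strict_mono[of a b "a + 1" "b + 1"] mult_strict_mono[of b a "b + 1" "a + 1"]
    by (cases a b rule: linorder_cases) auto
qed

text \<open>All slices of \<open>F\<close> in x lie in one finite-dimensional space, so its
  interpolation points separate the variables, and each factor is a sum of spherical harmonics by
  \<open>sphere_ST\<close>. The Laplace equation then permits discarding every product whose two
  degrees differ.\<close>

lemma V33_HC_sub_U: "V33_HC \<subseteq> Xr.U"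
proof
  fix F assume "F \<in> V33_HC"
  then obtain S where F: "F \<in> V33" and S: "finite S" "{act A B F | A B. rotation3 A \<and> rotation3 B} \<subseteq> fn.span S"
    unfolding V33_HC_def orbit_eq by blast
  have sm: "smooth_on_Xi F" and out: "\<And>\<xi>. \<xi> \<notin> Xi \<Longrightarrow> F \<xi> = 0"
    and hom: "\<And>a \<xi>. a > 0 \<Longrightarrow> \<xi> \<in> Xi \<Longrightarrow> F (a *\<^sub>R \<xi>) = of_real (1 / a) * F \<xi>"
    and lap: "\<And>x y. norm x = 1 \<Longrightarrow> norm y = 1 \<Longrightarrow> laplacian_S2 (\<lambda>x. F (join x y)) x - laplacian_S2 (\<lambda>y. F (join x y)) y = 0"
    using F unfolding V33_def by blast+
  define W where "W = fn.span {act A B F | A B. rotation3 A \<and> rotation3 B}"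
  define e3 :: "real ^ 3" where "e3 = axis 3 1"
  define s1 where "s1 x = join x e3" for x
  define s2 where "s2 y = join e3 y" for y
  have join_lin: "linear (\<lambda>x. join x 0)" "linear (\<lambda>y. join 0 y)"
    by (auto intro!: linearI simp: join_def vec_eq_iff all_plus)
  have s_eq: "s1 = (\<lambda>x. join x 0 + join 0 e3)" "s2 = (\<lambda>y. join 0 y + join e3 0)"
    by (auto simp: s1_def s2_def join_def vec_eq_iff all_plus fun_eq_iff)
  have sd: "s1 differentiable (at x)" "s2 differentiable (at x)" for x
    unfolding s_eq by (rule differentiable_add[OF linear_imp_differentiable[OF join_lin(1)] differentiable_const],
      rule differentiable_add[OF linear_imp_differentiable[OF join_lin(2)] differentiable_const])
  interpret A1: sphere_space "(\<lambda>w x. w (s1 (sgn x))) ` W" "(\<lambda>w x. w (s1 (sgn x))) ` S"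
    unfolding W_def
  proof (rule V33_slot_sphere_space[OF sm S])
    show "\<exists>A B. rotation3 A \<and> rotation3 B \<and> (\<forall>x. join (A *v rx (s1 x)) (B *v ry (s1 x)) = s1 (R *v x))" if "rotation3 R" for R
      using that rotation3_one by (intro exI[of _ R] exI[of _ "mat 1"]) (simp add: s1_def)
    show "s1 x \<in> Xi" if "norm x = 1" for x using that by (auto simp: s1_def e3_def Xi_iff)
  qed (rule sd)
  interpret A2: sphere_space "(\<lambda>w x. w (s2 (sgn x))) ` W" "(\<lambda>w x. w (s2 (sgn x))) ` S"
    unfolding W_def
  proof (rule V33_slot_sphere_space[OF sm S])
    show "\<exists>A B. rotation3 A \<and> rotation3 B \<and> (\<forall>x. join (A *v rx (s2 x)) (B *v ry (s2 x)) = s2 (R *v x))" if "rotation3 R" for R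
      using that rotation3_one by (intro exI[of _ "mat 1"] exI[of _ R]) (simp add: s2_def)
    show "s2 x \<in> Xi" if "norm x = 1" for x using that by (auto simp: s2_def e3_def Xi_iff)
  qed (rule sd)
  have actW: "act A B F \<in> W" if "rotation3 A" "rotation3 B" for A B
    unfolding W_def using that by (intro fn.span_base) blast
  have m1: "(\<lambda>x. F (join (sgn x) y)) \<in> (\<lambda>w x. w (s1 (sgn x))) ` W" if y: "norm y = 1" for y
  proof -
    obtain B where B: "rotation3 B" "B *v e3 = y" using rotation_transitive[OF y] unfolding e3_def by blast
    have "(\<lambda>x. F (join (sgn x) y)) = (\<lambda>x. act (mat 1) B F (s1 (sgn x)))"
      by (simp add: act_def s1_def B(2))
    with actW[OF rotation3_one B(1)] show ?thesis by blast
  qed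
  have m2: "(\<lambda>y. F (join x (sgn y))) \<in> (\<lambda>w x. w (s2 (sgn x))) ` W" if x: "norm x = 1" for x
  proof -
    obtain B where B: "rotation3 B" "B *v e3 = x" using rotation_transitive[OF x] unfolding e3_def by blast
    have "(\<lambda>y. F (join x (sgn y))) = (\<lambda>y. act B (mat 1) F (s2 (sgn y)))"
      by (simp add: act_def s2_def B(2))
    with actW[OF B(1) rotation3_one] show ?thesis by blast
  qed
  obtain I w where Iw: "finite I \<and> (\<forall>i\<in>I. w i \<in> (\<lambda>w x. w (s1 (sgn x))) ` W) \<and>
      (\<forall>f\<in>(\<lambda>w x. w (s1 (sgn x))) ` W. \<forall>x. f x = (\<Sum>i\<in>I. f i * w i x))"
    using A1.dual_points by (elim exE)
  have sgn1: "sgn x = x" if "norm x = 1" for x :: "real ^ 3" using that by (simp add: sgn_div_norm)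
  have split: "F (join x y) = (\<Sum>i\<in>I. rs (w i) x * rs (\<lambda>y. F (join (sgn i) (sgn y))) y)" if x: "norm x = 1" and y: "norm y = 1" for x y
  proof -
    have "F (join (sgn x) y) = (\<Sum>i\<in>I. F (join (sgn i) y) * w i x)"
      using spec[OF bspec[OF conjunct2[OF conjunct2[OF Iw]] m1[OF y]], of x] .
    then show ?thesis using x y by (simp add: sgn1 rs_def mult.commute)
  qed
  \<comment> \<open>The interpolation points \<open>i\<close> are arbitrary vectors;
    \<open>sgn\<close> normalizes them, except that i = 0 leads outside \<open>Xi\<close>, where
    \<open>F\<close> is zero.\<close>
  have g: "rs (\<lambda>y. F (join (sgn i) (sgn y))) \<in> ST" for i
  proof (cases "i = 0")
    case True
    then have "rs (\<lambda>y. F (join (sgn i) (sgn y))) = 0" using out by (auto simp: rs_def Xi_iff)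
    then show ?thesis using fn.subspace_0[OF subspace_ST] by (simp only:)
  next
    case False
    then show ?thesis by (intro A2.sphere_ST m2) (simp add: norm_sgn)
  qed
  define Fp where "Fp p = (if norm (fst p) = 1 \<and> norm (snd p) = 1 then F (join (fst p) (snd p)) else 0)" for p
  have "Fp \<in> fn.span (range hh)"
  proof (rule fn_span_sum_apply[of I "\<lambda>i p. rs (w i) (fst p) * rs (\<lambda>y. F (join (sgn i) (sgn y))) (snd p)" _ _ "\<lambda>_. 1"])
    show "finite I" using Iw by blast
    show "(\<lambda>p. rs (w i) (fst p) * rs (\<lambda>y. F (join (sgn i) (sgn y))) (snd p)) \<in> fn.span (range hh)" if "i \<in> I" for i
      using Iw that by (intro ST_prod A1.sphere_ST g) blast
    show "Fp p = (\<Sum>i\<in>I. 1 * (rs (w i) (fst p) * rs (\<lambda>y. F (join (sgn i) (sgn y))) (snd p)))" for p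
      unfolding Fp_def using split[of "fst p" "snd p"] by (auto simp: rs_def)
  qed
  then obtain T c where T: "finite T" "\<And>p. Fp p = (\<Sum>t\<in>T. c t * hh t p)"
    using fn_span_range_expansion by blast
  define \<delta> where "\<delta> t = lam (fst (snd (snd t))) - lam (fst t)" for t :: "nat \<times> nat \<times> nat \<times> nat"
  have Feq: "F (join x y) = (\<Sum>t\<in>T. c t * hh t (x, y))" if "norm x = 1" "norm y = 1" for x y
    using T(2)[of "(x, y)"] that by (simp add: Fp_def)
  have hh_eq: "hh t (u, v) = he (fst t) (fst (snd t)) (cv u) * he (fst (snd (snd t))) (snd (snd (snd t))) (cv v)"
    if "norm u = 1" "norm v = 1" for t u v
    using that by (simp add: hh_def rs_def)
  have step1: "(\<Sum>t\<in>T. c t * \<delta> t * hh t (x, y)) = 0" if x: "norm x = 1" and y: "norm y = 1" for x y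
  proof -
    have "laplacian_S2 (\<lambda>x. F (join x y)) x = (\<Sum>t\<in>T. - lam (fst t) * (c t * he (fst (snd (snd t))) (snd (snd (snd t))) (cv y)) * he (fst t) (fst (snd t)) (cv x))"
      by (rule laplacian_S2_harmonic[OF T(1) _ x]) (simp add: Feq y hh_eq mult_ac)
    moreover have "laplacian_S2 (\<lambda>y. F (join x y)) y = (\<Sum>t\<in>T. - lam (fst (snd (snd t))) * (c t * he (fst t) (fst (snd t)) (cv x)) * he (fst (snd (snd t))) (snd (snd (snd t))) (cv y))"
      by (rule laplacian_S2_harmonic[OF T(1) _ y]) (simp add: Feq x hh_eq mult_ac)
    moreover have "c t * \<delta> t * hh t (x, y)
      = - lam (fst t) * (c t * he (fst (snd (snd t))) (snd (snd (snd t))) (cv y)) * he (fst t) (fst (snd t)) (cv x)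
      - - lam (fst (snd (snd t))) * (c t * he (fst t) (fst (snd t)) (cv x)) * he (fst (snd (snd t))) (snd (snd (snd t))) (cv y)" for t
      unfolding hh_eq[OF x y] \<delta>_def by (simp add: algebra_simps)
    ultimately show ?thesis using lap[OF x y] by (simp only: sum_subtractf)
  qed
  \<comment> \<open>The exponents start at 1: the sum with exponent 0 is \<open>F\<close>
    itself.\<close>
  have powers: "(\<Sum>t\<in>T. c t * \<delta> t ^ Suc n * hh t (x, y)) = 0" if "norm x = 1" "norm y = 1" for n x y
    using that
  proof (induction n arbitrary: x y)
    case 0
    then show ?case using step1 by simp
  next
    case (Suc n)
    then show ?case
      using harmonic_sum_lam[OF T(1), of "\<lambda>t. c t * \<delta> t ^ Suc n" x y] by (simp add: \<delta>_def mult_ac)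
  qed
  obtain q where q: "poly q 0 = 1" "\<And>d. d \<in> \<delta> ` T \<Longrightarrow> d \<noteq> 0 \<Longrightarrow> poly q d = 0"
    using interpolating_poly[of "\<delta> ` T"] T(1) by blast
  define T0 where "T0 = {t \<in> T. \<delta> t = 0}"
  \<comment> \<open>The constant term q(0) = 1 reproduces \<open>F\<close>, and the higher powers of
    \<delta> contribute zero by \<open>powers\<close>; on the other hand q(\<delta>) removes every
    term with \<delta> \<noteq> 0.\<close>
  have F0: "F (join x y) = (\<Sum>t\<in>T0. c t * hh t (x, y))" if xy: "norm x = 1" "norm y = 1" for x y
  proof -
    have "(\<Sum>t\<in>T. c t * poly q (\<delta> t) * hh t (x, y)) = (\<Sum>n\<le>degree q. coeff q n * (\<Sum>t\<in>T. c t * \<delta> t ^ n * hh t (x, y)))"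
      unfolding poly_altdef sum_distrib_left sum_distrib_right
      by (subst sum.swap) (simp add: mult_ac)
    also have "\<dots> = (\<Sum>n\<le>degree q. if n = 0 then coeff q 0 * F (join x y) else 0)"
    proof (rule sum.cong[OF refl])
      fix n show "coeff q n * (\<Sum>t\<in>T. c t * \<delta> t ^ n * hh t (x, y)) = (if n = 0 then coeff q 0 * F (join x y) else 0)"
        using powers[OF xy, of "n - 1"] Feq[OF xy] by (cases n) simp_all
    qed
    also have "\<dots> = F (join x y)" using q(1) by (simp add: poly_0_coeff_0)
    also have "(\<Sum>t\<in>T. c t * poly q (\<delta> t) * hh t (x, y)) = (\<Sum>t\<in>T0. c t * hh t (x, y))"
      unfolding T0_def using T(1) q by (intro sum.mono_neutral_cong_right) auto
    finally show ?thesis by simp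
  qed
  have T0: "fst (snd (snd t)) = fst t" if "t \<in> T0" for t
    using that lam_inj[of "fst (snd (snd t))" "fst t"] by (simp add: T0_def \<delta>_def)
  show "F \<in> Xr.U"
  proof (rule fn_subspace_sum_apply[OF Xr.subspace_U, of T0 "\<lambda>t. Xr.b (fst t) (fst (snd t)) (snd (snd (snd t)))" _ c])
    show "finite T0" using T(1) by (simp add: T0_def)
    fix \<xi>
    show "F \<xi> = (\<Sum>t\<in>T0. c t * Xr.b (fst t) (fst (snd t)) (snd (snd (snd t))) \<xi>)"
    proof (cases "\<xi> \<in> Xi")
      case False
      then show ?thesis by (simp add: out Xr.b_outside)
    next
      case True
      define r where "r = norm (rx \<xi>)"
      have r: "r > 0" "norm (ry \<xi>) = r" using Xi_norm[OF True] by (simp_all add: r_def)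
      define x y where "x = rx \<xi> /\<^sub>R r" and "y = ry \<xi> /\<^sub>R r"
      have n: "norm x = 1" "norm y = 1" using r by (simp_all add: x_def y_def r_def[symmetric])
      have xi: "\<xi> = r *\<^sub>R join x y"
        using r join_rx_ry[of \<xi>] by (simp add: x_def y_def join_def vec_eq_iff all_plus rx_def ry_def)
      have J: "join x y \<in> Xi" using n by (auto simp: Xi_iff)
      have "Xr.b l j k \<xi> = of_real (1 / r) * (he l j (cv x) * he l k (cv y))" for l j k
        using evX_homogeneous[OF homog_bx r(1) J, of l j k] Xr_b_unit[OF n, of l j k]
        unfolding xi Xr.b_def Xr_evx by simp
      then have "(\<Sum>t\<in>T0. c t * Xr.b (fst t) (fst (snd t)) (snd (snd (snd t))) \<xi>) = of_real (1 / r) * (\<Sum>t\<in>T0. c t * hh t (x, y))"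
        unfolding sum_distrib_left using T0 by (intro sum.cong) (simp_all add: hh_eq[OF n])
      then show ?thesis using hom[OF r(1) J] F0[OF n] xi by simp
    qed
  qed (rule Xr.b_in_U)
qed

theorem V33_HC_eq_U: "V33_HC = Xr.U"
  using V33_HC_sub_U U_sub_V33_HC by blast

section \<open>Pluecker coordinates and the action on Minkowski space\<close>

definition minor2 :: "complex ^ 2 \<Rightarrow> complex ^ 2 \<Rightarrow> complex" where
  "minor2 u v = u $ 1 * v $ 2 - u $ 2 * v $ 1"

text \<open>The factors i and 1/2 are chosen so that for \<open>mink (t, x)\<close> the x-part is
  exactly \<open>cv x\<close> and the third y-coordinate is t; see \<open>vx_mink\<close> and
  \<open>vy_mink\<close>.\<close>

definition pcoord :: "complex \<Rightarrow> complex \<Rightarrow> complex \<Rightarrow> complex \<Rightarrow> complex \<Rightarrow> complex \<Rightarrow> complex ^ (3 + 3)" where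
  "pcoord p12 p13 p14 p23 p24 p34 = (\<chi> i. case i of
      Inl a \<Rightarrow> (vector [\<i> * (p24 - p13) / 2, (p24 + p13) / 2, \<i> * (p14 + p23) / 2] :: complex ^ 3) $ a
    | Inr a \<Rightarrow> (vector [(p12 + p34) / 2, \<i> * (p12 - p34) / 2, \<i> * (p14 - p23) / 2] :: complex ^ 3) $ a)"

text \<open>The Pluecker coordinates of the column space of the matrix with the blocks \<open>V\<close> and \<open>W\<close>, in a
  basis in which the Pluecker relation is \<open>x \<cdot> x = y \<cdot> y\<close>.\<close>

definition plk :: "complex ^ 2 ^ 2 \<Rightarrow> complex ^ 2 ^ 2 \<Rightarrow> complex ^ (3 + 3)" where
  "plk V W = pcoord (minor2 (V $ 1) (V $ 2)) (minor2 (V $ 1) (W $ 1)) (minor2 (V $ 1) (W $ 2))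
     (minor2 (V $ 2) (W $ 1)) (minor2 (V $ 2) (W $ 2)) (minor2 (W $ 1) (W $ 2))"

definition dplk :: "complex ^ 2 ^ 2 \<Rightarrow> complex ^ 2 ^ 2 \<Rightarrow> complex ^ 2 ^ 2 \<Rightarrow> complex ^ 2 ^ 2 \<Rightarrow> complex ^ (3 + 3)" where
  "dplk V W V' W' = pcoord
     (minor2 (V $ 1) (V' $ 2) + minor2 (V' $ 1) (V $ 2)) (minor2 (V $ 1) (W' $ 1) + minor2 (V' $ 1) (W $ 1))
     (minor2 (V $ 1) (W' $ 2) + minor2 (V' $ 1) (W $ 2)) (minor2 (V $ 2) (W' $ 1) + minor2 (V' $ 2) (W $ 1))
     (minor2 (V $ 2) (W' $ 2) + minor2 (V' $ 2) (W $ 2)) (minor2 (W $ 1) (W' $ 2) + minor2 (W' $ 1) (W $ 2))"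

text \<open>The derivative of \<open>SL(4, \<complex>) \<rightarrow> SO(6, \<complex>)\<close> in the coordinates of \<open>plk\<close>.\<close>

definition sigma :: "complex ^ (2 + 2) ^ (2 + 2) \<Rightarrow> complex ^ (3 + 3) ^ (3 + 3)" where
  "sigma X = (\<chi> i j. case i of
      Inl a \<Rightarrow> (case j of
        Inl b \<Rightarrow> (vector [vector [(trace X) / 2, (- \<i> * X $ Inl 1 $ Inl 1 + \<i> * X $ Inl 2 $ Inl 2 - \<i> * X $ Inr 1 $ Inr 1 + \<i> * X $ Inr 2 $ Inr 2) / 2, (- X $ Inl 1 $ Inl 2 + X $ Inl 2 $ Inl 1 - X $ Inr 1 $ Inr 2 + X $ Inr 2 $ Inr 1) / 2],
      vector [(\<i> * X $ Inl 1 $ Inl 1 - \<i> * X $ Inl 2 $ Inl 2 + \<i> * X $ Inr 1 $ Inr 1 - \<i> * X $ Inr 2 $ Inr 2) / 2, (trace X) / 2, (- \<i> * X $ Inl 1 $ Inl 2 - \<i> * X $ Inl 2 $ Inl 1 - \<i> * X $ Inr 1 $ Inr 2 - \<i> * X $ Inr 2 $ Inr 1) / 2],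
      vector [(X $ Inl 1 $ Inl 2 - X $ Inl 2 $ Inl 1 + X $ Inr 1 $ Inr 2 - X $ Inr 2 $ Inr 1) / 2, (\<i> * X $ Inl 1 $ Inl 2 + \<i> * X $ Inl 2 $ Inl 1 + \<i> * X $ Inr 1 $ Inr 2 + \<i> * X $ Inr 2 $ Inr 1) / 2, (trace X) / 2]] :: complex ^ 3 ^ 3) $ a $ b
      | Inr b \<Rightarrow> (vector [vector [(\<i> * X $ Inl 1 $ Inr 2 + \<i> * X $ Inl 2 $ Inr 1 - \<i> * X $ Inr 1 $ Inl 2 - \<i> * X $ Inr 2 $ Inl 1) / 2, (- X $ Inl 1 $ Inr 2 - X $ Inl 2 $ Inr 1 - X $ Inr 1 $ Inl 2 - X $ Inr 2 $ Inl 1) / 2, (X $ Inl 1 $ Inl 2 + X $ Inl 2 $ Inl 1 - X $ Inr 1 $ Inr 2 - X $ Inr 2 $ Inr 1) / 2],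
      vector [(- X $ Inl 1 $ Inr 2 + X $ Inl 2 $ Inr 1 + X $ Inr 1 $ Inl 2 - X $ Inr 2 $ Inl 1) / 2, (- \<i> * X $ Inl 1 $ Inr 2 + \<i> * X $ Inl 2 $ Inr 1 - \<i> * X $ Inr 1 $ Inl 2 + \<i> * X $ Inr 2 $ Inl 1) / 2, (\<i> * X $ Inl 1 $ Inl 2 - \<i> * X $ Inl 2 $ Inl 1 - \<i> * X $ Inr 1 $ Inr 2 + \<i> * X $ Inr 2 $ Inr 1) / 2],
      vector [(\<i> * X $ Inl 1 $ Inr 1 - \<i> * X $ Inl 2 $ Inr 2 - \<i> * X $ Inr 1 $ Inl 1 + \<i> * X $ Inr 2 $ Inl 2) / 2, (- X $ Inl 1 $ Inr 1 + X $ Inl 2 $ Inr 2 - X $ Inr 1 $ Inl 1 + X $ Inr 2 $ Inl 2) / 2, (X $ Inl 1 $ Inl 1 - X $ Inl 2 $ Inl 2 - X $ Inr 1 $ Inr 1 + X $ Inr 2 $ Inr 2) / 2]] :: complex ^ 3 ^ 3) $ a $ b)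
    | Inr a \<Rightarrow> (case j of
        Inl b \<Rightarrow> (vector [vector [(\<i> * X $ Inl 1 $ Inr 2 + \<i> * X $ Inl 2 $ Inr 1 - \<i> * X $ Inr 1 $ Inl 2 - \<i> * X $ Inr 2 $ Inl 1) / 2, (- X $ Inl 1 $ Inr 2 - X $ Inl 2 $ Inr 1 - X $ Inr 1 $ Inl 2 - X $ Inr 2 $ Inl 1) / 2, (X $ Inl 1 $ Inl 2 + X $ Inl 2 $ Inl 1 - X $ Inr 1 $ Inr 2 - X $ Inr 2 $ Inr 1) / 2],
      vector [(- X $ Inl 1 $ Inr 2 + X $ Inl 2 $ Inr 1 + X $ Inr 1 $ Inl 2 - X $ Inr 2 $ Inl 1) / 2, (- \<i> * X $ Inl 1 $ Inr 2 + \<i> * X $ Inl 2 $ Inr 1 - \<i> * X $ Inr 1 $ Inl 2 + \<i> * X $ Inr 2 $ Inl 1) / 2, (\<i> * X $ Inl 1 $ Inl 2 - \<i> * X $ Inl 2 $ Inl 1 - \<i> * X $ Inr 1 $ Inr 2 + \<i> * X $ Inr 2 $ Inr 1) / 2],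
      vector [(\<i> * X $ Inl 1 $ Inr 1 - \<i> * X $ Inl 2 $ Inr 2 - \<i> * X $ Inr 1 $ Inl 1 + \<i> * X $ Inr 2 $ Inl 2) / 2, (- X $ Inl 1 $ Inr 1 + X $ Inl 2 $ Inr 2 - X $ Inr 1 $ Inl 1 + X $ Inr 2 $ Inl 2) / 2, (X $ Inl 1 $ Inl 1 - X $ Inl 2 $ Inl 2 - X $ Inr 1 $ Inr 1 + X $ Inr 2 $ Inr 2) / 2]] :: complex ^ 3 ^ 3) $ b $ a
      | Inr b \<Rightarrow> (vector [vector [(trace X) / 2, (- \<i> * X $ Inl 1 $ Inl 1 - \<i> * X $ Inl 2 $ Inl 2 + \<i> * X $ Inr 1 $ Inr 1 + \<i> * X $ Inr 2 $ Inr 2) / 2, (- \<i> * X $ Inl 1 $ Inr 1 - \<i> * X $ Inl 2 $ Inr 2 - \<i> * X $ Inr 1 $ Inl 1 - \<i> * X $ Inr 2 $ Inl 2) / 2],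
      vector [(\<i> * X $ Inl 1 $ Inl 1 + \<i> * X $ Inl 2 $ Inl 2 - \<i> * X $ Inr 1 $ Inr 1 - \<i> * X $ Inr 2 $ Inr 2) / 2, (trace X) / 2, (X $ Inl 1 $ Inr 1 + X $ Inl 2 $ Inr 2 - X $ Inr 1 $ Inl 1 - X $ Inr 2 $ Inl 2) / 2],
      vector [(\<i> * X $ Inl 1 $ Inr 1 + \<i> * X $ Inl 2 $ Inr 2 + \<i> * X $ Inr 1 $ Inl 1 + \<i> * X $ Inr 2 $ Inl 2) / 2, (- X $ Inl 1 $ Inr 1 - X $ Inl 2 $ Inr 2 + X $ Inr 1 $ Inl 1 + X $ Inr 2 $ Inl 2) / 2, (trace X) / 2]] :: complex ^ 3 ^ 3) $ a $ b))"

definition sigma_inv :: "complex ^ (3 + 3) ^ (3 + 3) \<Rightarrow> complex ^ (2 + 2) ^ (2 + 2)" where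
  "sigma_inv S = (\<chi> i j. case i of
      Inl a \<Rightarrow> (case j of
        Inl b \<Rightarrow> (vector [vector [(\<i> * S $ Inl 1 $ Inl 2 + \<i> * S $ Inr 1 $ Inr 2 + S $ Inl 3 $ Inr 3) / 2,
            (- S $ Inl 1 $ Inl 3 + \<i> * S $ Inl 2 $ Inl 3 + S $ Inl 1 $ Inr 3 - \<i> * S $ Inl 2 $ Inr 3) / 2],
          vector [(S $ Inl 1 $ Inl 3 + \<i> * S $ Inl 2 $ Inl 3 + S $ Inl 1 $ Inr 3 + \<i> * S $ Inl 2 $ Inr 3) / 2,
            (- \<i> * S $ Inl 1 $ Inl 2 + \<i> * S $ Inr 1 $ Inr 2 - S $ Inl 3 $ Inr 3) / 2]] :: complex ^ 2 ^ 2) $ a $ b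
      | Inr b \<Rightarrow> (vector [vector [(- \<i> * S $ Inl 3 $ Inr 1 - S $ Inl 3 $ Inr 2 + \<i> * S $ Inr 1 $ Inr 3 + S $ Inr 2 $ Inr 3) / 2,
            (- \<i> * S $ Inl 1 $ Inr 1 - S $ Inl 1 $ Inr 2 - S $ Inl 2 $ Inr 1 + \<i> * S $ Inl 2 $ Inr 2) / 2],
          vector [(- \<i> * S $ Inl 1 $ Inr 1 - S $ Inl 1 $ Inr 2 + S $ Inl 2 $ Inr 1 - \<i> * S $ Inl 2 $ Inr 2) / 2,
            (\<i> * S $ Inl 3 $ Inr 1 + S $ Inl 3 $ Inr 2 + \<i> * S $ Inr 1 $ Inr 3 + S $ Inr 2 $ Inr 3) / 2]] :: complex ^ 2 ^ 2) $ a $ b)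
    | Inr a \<Rightarrow> (case j of
        Inl b \<Rightarrow> (vector [vector [(\<i> * S $ Inl 3 $ Inr 1 - S $ Inl 3 $ Inr 2 + \<i> * S $ Inr 1 $ Inr 3 - S $ Inr 2 $ Inr 3) / 2,
            (\<i> * S $ Inl 1 $ Inr 1 - S $ Inl 1 $ Inr 2 + S $ Inl 2 $ Inr 1 + \<i> * S $ Inl 2 $ Inr 2) / 2],
          vector [(\<i> * S $ Inl 1 $ Inr 1 - S $ Inl 1 $ Inr 2 - S $ Inl 2 $ Inr 1 - \<i> * S $ Inl 2 $ Inr 2) / 2,
            (- \<i> * S $ Inl 3 $ Inr 1 + S $ Inl 3 $ Inr 2 + \<i> * S $ Inr 1 $ Inr 3 - S $ Inr 2 $ Inr 3) / 2]] :: complex ^ 2 ^ 2) $ a $ b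
      | Inr b \<Rightarrow> (vector [vector [(\<i> * S $ Inl 1 $ Inl 2 - \<i> * S $ Inr 1 $ Inr 2 - S $ Inl 3 $ Inr 3) / 2,
            (- S $ Inl 1 $ Inl 3 + \<i> * S $ Inl 2 $ Inl 3 - S $ Inl 1 $ Inr 3 + \<i> * S $ Inl 2 $ Inr 3) / 2],
          vector [(S $ Inl 1 $ Inl 3 + \<i> * S $ Inl 2 $ Inl 3 - S $ Inl 1 $ Inr 3 - \<i> * S $ Inl 2 $ Inr 3) / 2,
            (- \<i> * S $ Inl 1 $ Inl 2 - \<i> * S $ Inr 1 $ Inr 2 + S $ Inl 3 $ Inr 3) / 2]] :: complex ^ 2 ^ 2) $ a $ b))"

lemma trace_4: "trace (X :: complex ^ (2 + 2) ^ (2 + 2)) = X $ Inl 1 $ Inl 1 + X $ Inl 2 $ Inl 2 + X $ Inr 1 $ Inr 1 + X $ Inr 2 $ Inr 2"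
  by (simp add: trace_def sum_UNIV_plus sum_2)

lemma sigma_add: "sigma (X + Y) = sigma X + sigma Y"
  by (simp add: vec_eq_iff all_plus forall_3 sigma_def trace_4 algebra_simps add_divide_distrib diff_divide_distrib)

lemma sigma_scale: "sigma (mscale c X) = mscale c (sigma X)"
  by (simp add: vec_eq_iff all_plus forall_3 sigma_def trace_4 mscale_def algebra_simps add_divide_distrib diff_divide_distrib)

lemma sigma_so33C: "X \<in> sl4 \<Longrightarrow> sigma X \<in> so33C"
  unfolding so33C_iff sl4_def
  by (simp add: all_plus forall_3 sigma_def algebra_simps add_divide_distrib diff_divide_distrib)

lemma sigma_inv_sl4: "sigma_inv S \<in> sl4"
  by (simp add: sl4_def trace_4 sigma_inv_def algebra_simps add_divide_distrib diff_divide_distrib)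

lemma sigma_inv_sigma: "X \<in> sl4 \<Longrightarrow> sigma_inv (sigma X) = X"
proof -
  assume "X \<in> sl4"
  then have t: "X $ Inr 2 $ Inr 2 = - X $ Inl 1 $ Inl 1 - X $ Inl 2 $ Inl 2 - X $ Inr 1 $ Inr 1"
    unfolding sl4_def trace_4 mem_Collect_eq by (simp add: eq_neg_iff_add_eq_0 algebra_simps)
  show "sigma_inv (sigma X) = X"
    by (simp add: vec_eq_iff all_plus forall_2 sigma_def sigma_inv_def t)
       (simp add: field_simps)
qed

lemma so33C_entries:
  assumes "S \<in> so33C"
  shows "S $ Inl a $ Inl b = - S $ Inl b $ Inl a" "S $ Inr a $ Inr b = - S $ Inr b $ Inr a"
    "S $ Inr a $ Inl b = S $ Inl b $ Inr a" "S $ Inl a $ Inl a = 0" "S $ Inr a $ Inr a = 0"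
proof -
  obtain w w' B where S: "S = gX w w' B" using so33C_gX[OF assms] .
  have c: "crs w (axis b 1) $ a = - crs w (axis a 1) $ b" for w :: "complex ^ 3" and a b
    using exhaust_3[of a] exhaust_3[of b] by (auto simp: crs_entries axis_def)
  have d: "crs w (axis a 1) $ a = 0" for w :: "complex ^ 3" and a
    using exhaust_3[of a] by (auto simp: crs_entries axis_def)
  show "S $ Inl a $ Inl b = - S $ Inl b $ Inl a" "S $ Inr a $ Inr b = - S $ Inr b $ Inr a"
    "S $ Inr a $ Inl b = S $ Inl b $ Inr a" "S $ Inl a $ Inl a = 0" "S $ Inr a $ Inr a = 0"
    using c[of w a b] c[of w' a b] d by (simp_all add: S gX_def)
qed

lemma sigma_sigma_inv:
  assumes "S \<in> so33C"
  shows "sigma (sigma_inv S) = S"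
proof -
  note s = so33C_entries[OF assms]
  have tr: "trace (sigma_inv S) = 0" using sigma_inv_sl4[of S] by (simp add: sl4_def)
  show ?thesis
    by (simp add: vec_eq_iff all_plus forall_3 sigma_def tr s(3-5))
       (simp add: sigma_inv_def s(1)[of 2 1] s(1)[of 3 1] s(1)[of 3 2] s(2)[of 2 1] s(2)[of 3 1] s(2)[of 3 2] field_simps)
qed

text \<open>\<open>sigma X\<close> is the action of X on the second exterior power: by the product
  rule it moves the minors as X moves the two columns. The diagonal entries trace X / 2 belong to
  this action on all of gl(4) and vanish on \<open>sl4\<close>, where \<open>sigma\<close> lands in
  \<open>so33C\<close>.\<close>

lemma sigma_mult_plk:
  "sigma X *v plk V W = dplk V W (blkA X ** V + blkB X ** W) (blkC X ** V + blkD X ** W)"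
  by (simp add: vec_eq_iff all_plus forall_3 sigma_def plk_def dplk_def pcoord_def minor2_def trace_4
      matrix_vector_mult_def matrix_matrix_mult_def sum_UNIV_plus sum_3 sum_2 blkA_def blkB_def blkC_def blkD_def)
    (simp add: field_simps)

text \<open>Both sides lie in \<open>so33C\<close>, so 15 entries determine them: three below the
  diagonal in each diagonal block and the nine of one mixed block.\<close>

lemma sigma_bracket:
  assumes "X \<in> sl4" "Y \<in> sl4"
  shows "sigma (bracket X Y) = bracket (sigma X) (sigma Y)"
proof -
  have "bracket X Y \<in> sl4"
    using trace_mul_sym[of X Y] by (simp add: sl4_def bracket_def trace_sub)
  from so33C_entries[OF sigma_so33C[OF this]]
  have s: "sigma (bracket X Y) $ Inl a $ Inl b = - sigma (bracket X Y) $ Inl b $ Inl a"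
    "sigma (bracket X Y) $ Inr a $ Inr b = - sigma (bracket X Y) $ Inr b $ Inr a"
    "sigma (bracket X Y) $ Inr a $ Inl b = sigma (bracket X Y) $ Inl b $ Inr a"
    "sigma (bracket X Y) $ Inl a $ Inl a = 0" "sigma (bracket X Y) $ Inr a $ Inr a = 0" for a b by blast+
  from so33C_entries[OF so33C_bracket[OF sigma_so33C[OF assms(1)] sigma_so33C[OF assms(2)]]]
  have t: "bracket (sigma X) (sigma Y) $ Inl a $ Inl b = - bracket (sigma X) (sigma Y) $ Inl b $ Inl a"
    "bracket (sigma X) (sigma Y) $ Inr a $ Inr b = - bracket (sigma X) (sigma Y) $ Inr b $ Inr a"
    "bracket (sigma X) (sigma Y) $ Inr a $ Inl b = bracket (sigma X) (sigma Y) $ Inl b $ Inr a"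
    "bracket (sigma X) (sigma Y) $ Inl a $ Inl a = 0" "bracket (sigma X) (sigma Y) $ Inr a $ Inr a = 0" for a b by blast+
  have e: "bracket (sigma X) (sigma Y) $ i $ j = (\<Sum>k\<in>UNIV. sigma X $ i $ k * sigma Y $ k $ j - sigma Y $ i $ k * sigma X $ k $ j)" for i j
    by (simp add: bracket_def matrix_matrix_mult_def sum_subtractf)
  have f: "bracket X Y $ i $ j = (\<Sum>k\<in>UNIV. X $ i $ k * Y $ k $ j - Y $ i $ k * X $ k $ j)" for i j
    by (simp add: bracket_def matrix_matrix_mult_def sum_subtractf)
  have tr: "trace X = 0" "trace Y = 0" using assms by (simp_all add: sl4_def)
  note d = sigma_def f sum_UNIV_plus sum_3 sum_2 tr
  have 1: "sigma (bracket X Y) $ Inl 2 $ Inl 1 = bracket (sigma X) (sigma Y) $ Inl 2 $ Inl 1"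
    unfolding e sum_UNIV_plus sum_3 by (simp add: d field_simps)
  have 2: "sigma (bracket X Y) $ Inl 3 $ Inl 1 = bracket (sigma X) (sigma Y) $ Inl 3 $ Inl 1"
    unfolding e sum_UNIV_plus sum_3 by (simp add: d field_simps)
  have 3: "sigma (bracket X Y) $ Inl 3 $ Inl 2 = bracket (sigma X) (sigma Y) $ Inl 3 $ Inl 2"
    unfolding e sum_UNIV_plus sum_3 by (simp add: d field_simps)
  have 4: "sigma (bracket X Y) $ Inr 2 $ Inr 1 = bracket (sigma X) (sigma Y) $ Inr 2 $ Inr 1"
    unfolding e sum_UNIV_plus sum_3 by (simp add: d field_simps)
  have 5: "sigma (bracket X Y) $ Inr 3 $ Inr 1 = bracket (sigma X) (sigma Y) $ Inr 3 $ Inr 1"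
    unfolding e sum_UNIV_plus sum_3 by (simp add: d field_simps)
  have 6: "sigma (bracket X Y) $ Inr 3 $ Inr 2 = bracket (sigma X) (sigma Y) $ Inr 3 $ Inr 2"
    unfolding e sum_UNIV_plus sum_3 by (simp add: d field_simps)
  have 7: "sigma (bracket X Y) $ Inl 1 $ Inr 1 = bracket (sigma X) (sigma Y) $ Inl 1 $ Inr 1"
    unfolding e sum_UNIV_plus sum_3 by (simp add: d field_simps)
  have 8: "sigma (bracket X Y) $ Inl 1 $ Inr 2 = bracket (sigma X) (sigma Y) $ Inl 1 $ Inr 2"
    unfolding e sum_UNIV_plus sum_3 by (simp add: d field_simps)
  have 9: "sigma (bracket X Y) $ Inl 1 $ Inr 3 = bracket (sigma X) (sigma Y) $ Inl 1 $ Inr 3"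
    unfolding e sum_UNIV_plus sum_3 by (simp add: d field_simps)
  have 10: "sigma (bracket X Y) $ Inl 2 $ Inr 1 = bracket (sigma X) (sigma Y) $ Inl 2 $ Inr 1"
    unfolding e sum_UNIV_plus sum_3 by (simp add: d field_simps)
  have 11: "sigma (bracket X Y) $ Inl 2 $ Inr 2 = bracket (sigma X) (sigma Y) $ Inl 2 $ Inr 2"
    unfolding e sum_UNIV_plus sum_3 by (simp add: d field_simps)
  have 12: "sigma (bracket X Y) $ Inl 2 $ Inr 3 = bracket (sigma X) (sigma Y) $ Inl 2 $ Inr 3"
    unfolding e sum_UNIV_plus sum_3 by (simp add: d field_simps)
  have 13: "sigma (bracket X Y) $ Inl 3 $ Inr 1 = bracket (sigma X) (sigma Y) $ Inl 3 $ Inr 1"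
    unfolding e sum_UNIV_plus sum_3 by (simp add: d field_simps)
  have 14: "sigma (bracket X Y) $ Inl 3 $ Inr 2 = bracket (sigma X) (sigma Y) $ Inl 3 $ Inr 2"
    unfolding e sum_UNIV_plus sum_3 by (simp add: d field_simps)
  have 15: "sigma (bracket X Y) $ Inl 3 $ Inr 3 = bracket (sigma X) (sigma Y) $ Inl 3 $ Inr 3"
    unfolding e sum_UNIV_plus sum_3 by (simp add: d field_simps)
  show ?thesis
    unfolding vec_eq_iff all_plus forall_3
    using 1 2 3 4 5 6 7 8 9 10 11 12 13 14 15
    by (simp only: s(3-5) t(3-5) s(1)[of 1 2] s(1)[of 1 3] s(1)[of 2 3] t(1)[of 1 2] t(1)[of 1 3] t(1)[of 2 3]
        s(2)[of 1 2] s(2)[of 1 3] s(2)[of 2 3] t(2)[of 1 2] t(2)[of 1 3] t(2)[of 2 3] simp_thms)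
qed

lemma lie_iso_sigma: "lie_iso sl4 so33C sigma"
  unfolding lie_iso_def
proof (intro conjI ballI allI sigma_add sigma_scale sigma_bracket)
  show "bij_betw sigma sl4 so33C"
    by (rule bij_betw_byWitness[where f' = sigma_inv]) (auto simp: sigma_inv_sigma sigma_sigma_inv sigma_so33C sigma_inv_sl4)
qed

subsection \<open>The real form\<close>

text \<open>Block matrices over \<open>HR\<close> commute with complex conjugation followed by the
  exchange of the coordinates 1, 2 and 3, 4. Real matrices in \<open>so33\<close> come through
  \<open>sigma\<close> from the conjugation that pairs e1 with e4 and e2 with - e3.
  \<open>gamma\<close> is the signed permutation that carries the first pairing to the
  second.\<close>

definition gamma :: "complex ^ (2 + 2) ^ (2 + 2)" where
  "gamma = (\<chi> i j. if i = Inl 1 \<and> j = Inl 1 \<or> i = Inr 2 \<and> j = Inl 2 \<or> i = Inl 2 \<and> j = Inr 1 then 1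
     else if i = Inr 1 \<and> j = Inr 2 then - 1 else 0)"

lemma gamma_transpose: "gamma ** transpose gamma = mat 1" "transpose gamma ** gamma = mat 1"
  by (simp_all add: vec_eq_iff all_plus forall_2 matrix_matrix_mult_def sum_UNIV_plus sum_2 gamma_def transpose_def mat_def)

lemma gamma_conj:
  "(gamma ** X ** transpose gamma) $ Inl 1 $ Inl 1 = X $ Inl 1 $ Inl 1"
  "(gamma ** X ** transpose gamma) $ Inl 1 $ Inl 2 = X $ Inl 1 $ Inr 1"
  "(gamma ** X ** transpose gamma) $ Inl 1 $ Inr 1 = - X $ Inl 1 $ Inr 2"
  "(gamma ** X ** transpose gamma) $ Inl 1 $ Inr 2 = X $ Inl 1 $ Inl 2"
  "(gamma ** X ** transpose gamma) $ Inl 2 $ Inl 1 = X $ Inr 1 $ Inl 1"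
  "(gamma ** X ** transpose gamma) $ Inl 2 $ Inl 2 = X $ Inr 1 $ Inr 1"
  "(gamma ** X ** transpose gamma) $ Inl 2 $ Inr 1 = - X $ Inr 1 $ Inr 2"
  "(gamma ** X ** transpose gamma) $ Inl 2 $ Inr 2 = X $ Inr 1 $ Inl 2"
  "(gamma ** X ** transpose gamma) $ Inr 1 $ Inl 1 = - X $ Inr 2 $ Inl 1"
  "(gamma ** X ** transpose gamma) $ Inr 1 $ Inl 2 = - X $ Inr 2 $ Inr 1"
  "(gamma ** X ** transpose gamma) $ Inr 1 $ Inr 1 = X $ Inr 2 $ Inr 2"
  "(gamma ** X ** transpose gamma) $ Inr 1 $ Inr 2 = - X $ Inr 2 $ Inl 2"
  "(gamma ** X ** transpose gamma) $ Inr 2 $ Inl 1 = X $ Inl 2 $ Inl 1"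
  "(gamma ** X ** transpose gamma) $ Inr 2 $ Inl 2 = X $ Inl 2 $ Inr 1"
  "(gamma ** X ** transpose gamma) $ Inr 2 $ Inr 1 = - X $ Inl 2 $ Inr 2"
  "(gamma ** X ** transpose gamma) $ Inr 2 $ Inr 2 = X $ Inl 2 $ Inl 2"
  by (simp_all add: matrix_matrix_mult_def sum_UNIV_plus sum_2 gamma_def transpose_def)

lemma sl2_HR_image: "(\<lambda>X. sigma (gamma ** X ** matrix_inv gamma)) ` sl2_HR = cmat ` so33"
proof -
  have gi: "matrix_inv gamma = transpose gamma" by (rule matrix_inv_eqI[OF gamma_transpose(2)])
  have sl: "gamma ** X ** transpose gamma \<in> sl4 \<longleftrightarrow> X \<in> sl4" for X
    unfolding sl4_def mem_Collect_eq trace_4 by (simp add: gamma_conj add_ac)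
  have HR: "X \<in> sl2_HR \<longleftrightarrow> X \<in> sl4 \<and> X $ Inl 2 $ Inl 2 = cnj (X $ Inl 1 $ Inl 1) \<and> X $ Inl 2 $ Inl 1 = cnj (X $ Inl 1 $ Inl 2)
     \<and> X $ Inl 2 $ Inr 2 = cnj (X $ Inl 1 $ Inr 1) \<and> X $ Inl 2 $ Inr 1 = cnj (X $ Inl 1 $ Inr 2)
     \<and> X $ Inr 2 $ Inl 2 = cnj (X $ Inr 1 $ Inl 1) \<and> X $ Inr 2 $ Inl 1 = cnj (X $ Inr 1 $ Inl 2)
     \<and> X $ Inr 2 $ Inr 2 = cnj (X $ Inr 1 $ Inr 1) \<and> X $ Inr 2 $ Inr 1 = cnj (X $ Inr 1 $ Inr 2)" for X
    by (auto simp: sl2_HR_def HR_def blkA_def blkB_def blkC_def blkD_def)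
  show ?thesis
    unfolding gi
  proof (intro equalityI subsetI; elim imageE)
    fix S X assume S: "S = sigma (gamma ** X ** transpose gamma)" and X: "X \<in> sl2_HR"
    have S4: "S \<in> so33C" using X by (simp add: S sigma_so33C sl HR)
    have "Im (S $ i $ j) = 0" for i j
    proof -
      have "\<forall>i j. Im (S $ i $ j) = 0"
        using X unfolding HR S all_plus forall_3 sigma_def
        by (simp add: trace_4 gamma_conj)
      then show ?thesis by blast
    qed
    then have "S = cmat (Re_mat S)" by (simp add: vec_eq_iff cmat_def Re_mat_def complex_eq_iff)
    then show "S \<in> cmat ` so33" using so33C_Re_Im(1)[OF S4] by blast
  next
    fix S R assume S: "S = cmat R" and R: "R \<in> so33"
    have s: "(sgn33 i :: complex) = of_real (sgn33 i)" for i by (cases i) auto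
    have S4: "S \<in> so33C"
      using R unfolding so33C_iff so33_iff S s cmat_def by (simp flip: of_real_mult of_real_add)
    define X where "X = transpose gamma ** sigma_inv S ** gamma"
    have gX: "gamma ** X ** transpose gamma = sigma_inv S"
    proof -
      have "gamma ** X ** transpose gamma = (gamma ** transpose gamma) ** sigma_inv S ** (gamma ** transpose gamma)"
        unfolding X_def by (simp only: matrix_mul_assoc)
      then show ?thesis by (simp add: gamma_transpose)
    qed
    have g: "(gamma ** X ** transpose gamma) $ i $ j = sigma_inv S $ i $ j" for i j by (simp add: gX)
    have "X \<in> sl2_HR"
    proof -
      have "X \<in> sl4" using sl[of X] sigma_inv_sl4[of S] by (simp add: gX)
      moreover have e:
        "X $ Inl 1 $ Inl 1 = sigma_inv S $ Inl 1 $ Inl 1"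
        "X $ Inl 1 $ Inl 2 = sigma_inv S $ Inl 1 $ Inr 2"
        "X $ Inl 1 $ Inr 1 = sigma_inv S $ Inl 1 $ Inl 2"
        "X $ Inl 1 $ Inr 2 = - sigma_inv S $ Inl 1 $ Inr 1"
        "X $ Inl 2 $ Inl 1 = sigma_inv S $ Inr 2 $ Inl 1"
        "X $ Inl 2 $ Inl 2 = sigma_inv S $ Inr 2 $ Inr 2"
        "X $ Inl 2 $ Inr 1 = sigma_inv S $ Inr 2 $ Inl 2"
        "X $ Inl 2 $ Inr 2 = - sigma_inv S $ Inr 2 $ Inr 1"
        "X $ Inr 1 $ Inl 1 = sigma_inv S $ Inl 2 $ Inl 1"
        "X $ Inr 1 $ Inl 2 = sigma_inv S $ Inl 2 $ Inr 2"
        "X $ Inr 1 $ Inr 1 = sigma_inv S $ Inl 2 $ Inl 2"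
        "X $ Inr 1 $ Inr 2 = - sigma_inv S $ Inl 2 $ Inr 1"
        "X $ Inr 2 $ Inl 1 = - sigma_inv S $ Inr 1 $ Inl 1"
        "X $ Inr 2 $ Inl 2 = - sigma_inv S $ Inr 1 $ Inr 2"
        "X $ Inr 2 $ Inr 1 = - sigma_inv S $ Inr 1 $ Inl 2"
        "X $ Inr 2 $ Inr 2 = sigma_inv S $ Inr 1 $ Inr 1"
        by (simp_all add: gamma_conj flip: g)
      moreover
      have "X $ Inl 2 $ Inl 2 = cnj (X $ Inl 1 $ Inl 1) \<and> X $ Inl 2 $ Inl 1 = cnj (X $ Inl 1 $ Inl 2)
     \<and> X $ Inl 2 $ Inr 2 = cnj (X $ Inl 1 $ Inr 1) \<and> X $ Inl 2 $ Inr 1 = cnj (X $ Inl 1 $ Inr 2)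
     \<and> X $ Inr 2 $ Inl 2 = cnj (X $ Inr 1 $ Inl 1) \<and> X $ Inr 2 $ Inl 1 = cnj (X $ Inr 1 $ Inl 2)
     \<and> X $ Inr 2 $ Inr 2 = cnj (X $ Inr 1 $ Inr 1) \<and> X $ Inr 2 $ Inr 1 = cnj (X $ Inr 1 $ Inr 2)"
        unfolding e by (simp add: sigma_inv_def S cmat_def) (simp add: field_simps)
      ultimately show ?thesis unfolding HR by blast
    qed
    moreover have "S = sigma (gamma ** X ** transpose gamma)" by (simp only: gX sigma_sigma_inv[OF S4])
    ultimately show "S \<in> (\<lambda>X. sigma (gamma ** X ** transpose gamma)) ` sl2_HR" by blast
  qed
qed

section \<open>Differentiation of Pluecker coordinates\<close>

lemma has_derivative_vec:
  fixes f :: "'b::real_normed_vector \<Rightarrow> 'a::real_normed_vector ^ 'n"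
  assumes "\<And>i. ((\<lambda>s. f s $ i) has_derivative (\<lambda>h. f' h $ i)) F"
  shows "(f has_derivative f') F"
proof -
  have b: "bounded_linear (\<lambda>h. f' h $ i)" for i using assms[of i] by (rule has_derivative_bounded_linear)
  have "bounded_linear f'"
  proof (rule bounded_linear_intro)
    show "f' (x + y) = f' x + f' y" for x y
      by (simp add: vec_eq_iff linear_add[OF bounded_linear.linear[OF b]])
    show "f' (r *\<^sub>R x) = r *\<^sub>R f' x" for r x
      by (simp add: vec_eq_iff linear_scale[OF bounded_linear.linear[OF b]])
    show "norm (f' x) \<le> norm x * (\<Sum>i\<in>UNIV. onorm (\<lambda>h. f' h $ i))" for x
    proof -
      have "norm (f' x) \<le> (\<Sum>i\<in>UNIV. norm (f' x $ i))"
        by (simp add: norm_vec_def L2_set_le_sum)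
      also have "\<dots> \<le> (\<Sum>i\<in>UNIV. onorm (\<lambda>h. f' h $ i) * norm x)"
        by (intro sum_mono onorm[OF b])
      finally show ?thesis by (simp add: sum_distrib_left sum_distrib_right mult.commute)
    qed
  qed
  with assms show ?thesis
    unfolding has_derivative_def by (auto intro!: vec_tendstoI)
qed

lemma pcoord_nth:
  "pcoord a b c d e f $ Inl 1 = \<i> * (e - b) / 2" "pcoord a b c d e f $ Inl 2 = (e + b) / 2"
  "pcoord a b c d e f $ Inl 3 = \<i> * (c + d) / 2" "pcoord a b c d e f $ Inr 1 = (a + f) / 2"
  "pcoord a b c d e f $ Inr 2 = \<i> * (a - f) / 2" "pcoord a b c d e f $ Inr 3 = \<i> * (c - d) / 2"
  by (simp_all add: pcoord_def)

lemma pcoord_has_derivative: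
  assumes "(a has_derivative a') (at x within S)" "(b has_derivative b') (at x within S)" "(c has_derivative c') (at x within S)"
    "(d has_derivative d') (at x within S)" "(e has_derivative e') (at x within S)" "(f has_derivative f') (at x within S)"
  shows "((\<lambda>x. pcoord (a x) (b x) (c x) (d x) (e x) (f x)) has_derivative
    (\<lambda>h. pcoord (a' h) (b' h) (c' h) (d' h) (e' h) (f' h))) (at x within S)"
proof (rule has_derivative_vec)
  fix i
  have nth: "pcoord a b c d e f $ Inl 1 = \<i> / 2 * (e - b)" "pcoord a b c d e f $ Inl 2 = 1 / 2 * (e + b)"
    "pcoord a b c d e f $ Inl 3 = \<i> / 2 * (c + d)" "pcoord a b c d e f $ Inr 1 = 1 / 2 * (a + f)"
    "pcoord a b c d e f $ Inr 2 = \<i> / 2 * (a - f)" "pcoord a b c d e f $ Inr 3 = \<i> / 2 * (c - d)" for a b c d e f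
    by (simp_all add: pcoord_nth)
  have "\<forall>i. ((\<lambda>x. pcoord (a x) (b x) (c x) (d x) (e x) (f x) $ i) has_derivative
    (\<lambda>h. pcoord (a' h) (b' h) (c' h) (d' h) (e' h) (f' h) $ i)) (at x within S)"
    unfolding all_plus forall_3 nth
    by (intro conjI has_derivative_mult_right has_derivative_add has_derivative_diff assms)
  then show "((\<lambda>x. pcoord (a x) (b x) (c x) (d x) (e x) (f x) $ i) has_derivative
    (\<lambda>h. pcoord (a' h) (b' h) (c' h) (d' h) (e' h) (f' h) $ i)) (at x within S)" by blast
qed

lemma minor2_has_derivative:
  assumes "(u has_derivative u') (at x within S)" "(v has_derivative v') (at x within S)"
  shows "((\<lambda>x. minor2 (u x) (v x)) has_derivative (\<lambda>h. minor2 (u x) (v' h) + minor2 (u' h) (v x))) (at x within S)"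
proof -
  note u = bounded_linear.has_derivative[OF bounded_linear_vec_nth assms(1)]
    and v = bounded_linear.has_derivative[OF bounded_linear_vec_nth assms(2)]
  show ?thesis
    unfolding minor2_def
    by (rule has_derivative_eq_rhs[OF has_derivative_diff[OF has_derivative_mult[OF u[of 1] v[of 2]] has_derivative_mult[OF u[of 2] v[of 1]]]])
       (simp add: fun_eq_iff algebra_simps)
qed

lemma plk_has_derivative:
  assumes "(V has_derivative V') (at x within S)" "(W has_derivative W') (at x within S)"
  shows "((\<lambda>x. plk (V x) (W x)) has_derivative (\<lambda>h. dplk (V x) (W x) (V' h) (W' h))) (at x within S)"
  unfolding plk_def dplk_def
  by (intro pcoord_has_derivative minor2_has_derivative
      bounded_linear.has_derivative[OF bounded_linear_vec_nth] assms)

lemma dplk_scaleR: "dplk V W (r *\<^sub>R V') (r *\<^sub>R W') = r *\<^sub>R dplk V W V' W'"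
  by (simp add: vec_eq_iff all_plus forall_3 dplk_def pcoord_nth minor2_def scaleR_conv_of_real[where 'a = complex])
     (simp add: field_simps)

lemma plk_has_vector_derivative:
  assumes "(V has_vector_derivative V') (at s)" "(W has_vector_derivative W') (at s)"
  shows "((\<lambda>s. plk (V s) (W s)) has_vector_derivative dplk (V s) (W s) V' W') (at s)"
  using plk_has_derivative[OF assms[unfolded has_vector_derivative_def]]
  unfolding has_vector_derivative_def dplk_scaleR .

lemma plk_relation: "bl (vx (plk V W)) (vx (plk V W)) = bl (vy (plk V W)) (vy (plk V W))"
  unfolding bl_3 vx_def vy_def plk_def vec_lambda_beta pcoord_nth minor2_def
  by (simp add: field_simps)

lemma plk_mult: "plk (V ** A) (W ** A) = det A *s plk V W"
  by (simp add: vec_eq_iff all_plus forall_3 plk_def pcoord_nth minor2_def matrix_matrix_mult_def sum_2 det_2)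
     (simp add: field_simps)

definition adj2 :: "complex ^ 2 ^ 2 \<Rightarrow> complex ^ 2 ^ 2" where
  "adj2 A = vector [vector [A $ 2 $ 2, - A $ 1 $ 2], vector [- A $ 2 $ 1, A $ 1 $ 1]]"

lemma adj2_mult: "adj2 A ** A = mscale (det A) (mat 1)"
  by (simp add: vec_eq_iff forall_2 adj2_def mscale_def mat_def matrix_matrix_mult_def sum_2 det_2 algebra_simps)

lemma mscale_mult: "mscale c A ** B = mscale c (A ** B)" "A ** mscale c B = mscale (c :: complex) (A ** B)"
  by (simp_all add: vec_eq_iff mscale_def matrix_matrix_mult_def sum_distrib_left mult_ac)

lemma mscale_mscale: "mscale c (mscale d A) = mscale (c * d :: complex) A"
  by (simp add: vec_eq_iff mscale_def)

lemma mscale_1: "mscale (1 :: complex) A = A"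
  by (simp add: vec_eq_iff mscale_def)

lemma matrix_inv_2: "det A \<noteq> 0 \<Longrightarrow> matrix_inv A = mscale (1 / det A) (adj2 A)"
  by (rule matrix_inv_eqI) (simp add: mscale_mult adj2_mult mscale_mscale mscale_1)

section \<open>Minkowski space as a part of the complex cone\<close>

definition plk1 :: "complex ^ 2 ^ 2 \<Rightarrow> complex ^ (3 + 3)" where
  "plk1 Z = plk Z (mat 1)"

text \<open>On Minkowski space x . x = r^2, which is positive on \<open>mink_plus\<close>; so the
  principal branch gives r there and is holomorphic on the neighbourhood
  \<open>rho_dom\<close>.\<close>

definition rho :: "complex ^ 2 ^ 2 \<Rightarrow> complex" where
  "rho Z = csqrt (bl (vx (plk1 Z)) (vx (plk1 Z)))"

definition tauM :: "complex ^ 2 ^ 2 \<Rightarrow> (complex ^ (3 + 3)) \<times> complex" where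
  "tauM Z = (plk1 Z, rho Z)"

lemma rho_square: "(rho Z)\<^sup>2 = bl (vx (plk1 Z)) (vx (plk1 Z))"
  by (simp add: rho_def)

lemma plk1_nth:
  "plk1 Z $ Inl 1 = \<i> * (Z $ 2 $ 1 + Z $ 1 $ 2) / 2" "plk1 Z $ Inl 2 = (Z $ 2 $ 1 - Z $ 1 $ 2) / 2"
  "plk1 Z $ Inl 3 = \<i> * (Z $ 1 $ 1 - Z $ 2 $ 2) / 2" "plk1 Z $ Inr 1 = (det Z + 1) / 2"
  "plk1 Z $ Inr 2 = \<i> * (det Z - 1) / 2" "plk1 Z $ Inr 3 = \<i> * (Z $ 1 $ 1 + Z $ 2 $ 2) / 2"
  by (simp_all add: plk1_def plk_def pcoord_nth minor2_def mat_def det_2)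

lemma mink_entries:
  "mink (t, x) $ 1 $ 1 = - \<i> * of_real t - \<i> * of_real (x $ 3)" "mink (t, x) $ 1 $ 2 = - \<i> * of_real (x $ 1) - of_real (x $ 2)"
  "mink (t, x) $ 2 $ 1 = - \<i> * of_real (x $ 1) + of_real (x $ 2)" "mink (t, x) $ 2 $ 2 = - \<i> * of_real t + \<i> * of_real (x $ 3)"
  by (simp_all add: mink_def Let_def)

lemma det_mink: "det (mink (t, x)) = of_real ((norm x)\<^sup>2 - t\<^sup>2)"
  by (simp add: det_2 mink_entries norm_3) (simp add: algebra_simps power2_eq_square)

lemma vx_mink: "vx (plk1 (mink (t, x))) = cv x"
  by (simp add: vec_eq_iff forall_3 vx_def cv_def plk1_nth mink_entries)

lemma vy_mink: "vy (plk1 (mink (t, x))) = vector [(of_real ((norm x)\<^sup>2 - t\<^sup>2) + 1) / 2, \<i> * (of_real ((norm x)\<^sup>2 - t\<^sup>2) - 1) / 2, of_real t]"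
  by (simp add: vec_eq_iff forall_3 vy_def plk1_nth mink_entries det_mink)

lemma rho_mink: "rho (mink (t, x)) = of_real (norm x)"
proof -
  have "rho (mink (t, x)) = csqrt (of_real ((norm x)\<^sup>2))" unfolding rho_def vx_mink bl_cv ..
  then show ?thesis by (subst (asm) csqrt_of_real_nonneg) auto
qed

lemma mink_plus_iff: "mink (t, x) \<in> mink_plus \<longleftrightarrow> t\<^sup>2 < (norm x)\<^sup>2"
  by (simp add: mink_plus_def minkowski_def det_mink)

lemma mink_plusE:
  assumes "Y \<in> mink_plus"
  obtains t x where "Y = mink (t, x)" "t\<^sup>2 < (norm x)\<^sup>2" "x \<noteq> 0"
proof -
  obtain t x where Y: "Y = mink (t, x)" using assms unfolding mink_plus_def minkowski_def by auto
  with assms have "t\<^sup>2 < (norm x)\<^sup>2" by (simp add: mink_plus_iff)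
  moreover from this have "x \<noteq> 0" by auto
  ultimately show ?thesis using that Y by blast
qed

lemma mink_decomp: "\<exists>q q'. V = mink q + mscale \<i> (mink q')"
proof -
  \<comment> \<open>On Minkowski space these entries of \<open>plk1\<close> are t and x. They are
    linear in the matrix, so for general V their real and imaginary parts give the two Minkowski
    points.\<close>
  let ?c = "plk1 V"
  let ?q = "\<lambda>f. (f (?c $ Inr 3), (\<chi> a. f (?c $ Inl a)) :: real ^ 3)"
  have r: "of_real (Re z) = z - \<i> * of_real (Im z)" for z using complex_eq[of z] by (simp add: algebra_simps)
  have "V = mink (?q Re) + mscale \<i> (mink (?q Im))"
    by (simp add: vec_eq_iff forall_2 mink_entries mscale_def r)
       (simp add: plk1_nth field_simps)
  then show ?thesis by blast
qed

lemma linear_mink: "linear mink"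
proof (rule linearI)
  show "mink (p + q) = mink p + mink q" for p q
    by (cases p; cases q) (simp add: vec_eq_iff forall_2 mink_entries algebra_simps)
  show "mink (r *\<^sub>R p) = r *\<^sub>R mink p" for r p
    by (cases p) (simp add: vec_eq_iff forall_2 mink_entries scaleR_conv_of_real[where 'a = complex] algebra_simps)
qed

text \<open>The derivatives of two holomorphic extensions agree because \<open>minkowski\<close> spans \<open>M\<^sub>2(\<complex>)\<close> over \<open>\<complex>\<close>.\<close>

lemma holomorphic_derivative_unique:
  assumes Y: "Y \<in> mink_plus" and agree: "\<And>Z. Z \<in> mink_plus \<Longrightarrow> \<psi> Z = \<psi>' Z"
    and D: "(\<psi> has_derivative D) (at Y)" "\<And>c V. D (mscale c V) = c * D V"
    and D': "(\<psi>' has_derivative D') (at Y)" "\<And>c V. D' (mscale c V) = c * D' V"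
  shows "D = D'"
proof
  fix V
  obtain p where p: "Y = mink p" using Y unfolding mink_plus_def minkowski_def by auto
  have m: "D (mink q) = D' (mink q)" for q
  proof -
    let ?l = "\<lambda>s::real. mink (p + s *\<^sub>R q)"
    have l: "?l = (\<lambda>s. Y + s *\<^sub>R mink q)" by (simp add: p linear_add[OF linear_mink] linear_scale[OF linear_mink])
    have "(?l has_derivative (\<lambda>h. h *\<^sub>R mink q)) (at 0)" unfolding l by (auto intro!: derivative_eq_intros)
    then have dl: "(?l has_derivative (\<lambda>h. h *\<^sub>R mink q)) (at 0)" .
    have l0: "?l 0 = Y" by (simp add: p)
    have dd: "((\<lambda>s. f (?l s)) has_vector_derivative E (mink q)) (at 0)" if E: "(f has_derivative E) (at Y)" for f :: "_ \<Rightarrow> complex" and E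
    proof -
      have "((\<lambda>s. f (?l s)) has_derivative (\<lambda>h. E (h *\<^sub>R mink q))) (at 0)"
        by (rule has_derivative_compose[OF dl]) (unfold l0, rule E)
      then show ?thesis
        unfolding has_vector_derivative_def
          linear_scale[OF bounded_linear.linear[OF has_derivative_bounded_linear[OF E]]] .
    qed
    note d = dd[OF D(1)] dd[OF D'(1)]
    have continuous_on_mink: "continuous_on UNIV ?l" unfolding l by (intro continuous_intros)
    have c: "continuous_on UNIV (\<lambda>s. Re (det (?l s)))"
      unfolding det_2 by (intro continuous_intros continuous_on_mink)
    let ?S = "{s. 0 < Re (det (?l s))}"
    have S: "open ?S" using open_Collect_less[OF continuous_on_const c] by simp
    have S0: "0 \<in> ?S" using Y unfolding mem_Collect_eq l0 mink_plus_def by simp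
    have eq: "\<psi> (?l s) = \<psi>' (?l s)" if "s \<in> ?S" for s
      using that by (intro agree) (simp add: mink_plus_def minkowski_def)
    have "((\<lambda>s. \<psi>' (?l s)) has_vector_derivative D (mink q)) (at 0)"
      by (rule has_vector_derivative_transform_within_open[OF d(1) S S0 eq])
    from vector_derivative_unique_at[OF this d(2)] show ?thesis .
  qed
  obtain q q' where V: "V = mink q + mscale \<i> (mink q')" using mink_decomp by blast
  have a: "D (v + w) = D v + D w" "D' (v + w) = D' v + D' w" for v w
    by (rule linear_add[OF bounded_linear.linear[OF has_derivative_bounded_linear]], rule D D')+
  show "D V = D' V" unfolding V a D(2) D'(2) m ..
qed

definition rho_dom :: "(complex ^ 2 ^ 2) set" where
  "rho_dom = {Z. 0 < Re (bl (vx (plk1 Z)) (vx (plk1 Z)))}"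

lemma mink_plus_rho_dom: "mink_plus \<subseteq> rho_dom"
proof
  fix Y assume "Y \<in> mink_plus"
  then obtain t x where "Y = mink (t, x)" "x \<noteq> 0" by (auto elim: mink_plusE)
  then show "Y \<in> rho_dom" by (simp add: rho_dom_def vx_mink bl_cv)
qed

lemma plk1_has_derivative:
  assumes "(Z has_derivative Z') (at x within S)"
  shows "((\<lambda>x. plk1 (Z x)) has_derivative (\<lambda>h. dplk (Z x) (mat 1) (Z' h) 0)) (at x within S)"
  unfolding plk1_def by (rule plk_has_derivative[OF assms has_derivative_const])

lemma bl_has_derivative:
  assumes "(\<xi> has_derivative \<xi>') (at x within S)"
  shows "((\<lambda>x. bl (vx (\<xi> x)) (vx (\<xi> x))) has_derivative (\<lambda>h. 2 * bl (vx (\<xi> x)) (vx (\<xi>' h)))) (at x within S)"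
proof -
  note u = bounded_linear.has_derivative[OF bounded_linear_vec_nth assms]
  show ?thesis
    unfolding bl_3 vx_def vec_lambda_beta
    by (rule has_derivative_eq_rhs[OF has_derivative_add[OF has_derivative_add[OF
          has_derivative_mult[OF u u] has_derivative_mult[OF u u]] has_derivative_mult[OF u u]]])
       (simp add: fun_eq_iff algebra_simps)
qed

lemma open_rho_dom: "open rho_dom"
proof -
  have "continuous_on UNIV (\<lambda>Z. bl (vx (plk1 Z)) (vx (plk1 Z)))"
    by (rule continuous_at_imp_continuous_on, rule ballI, rule has_derivative_continuous,
        rule bl_has_derivative[OF plk1_has_derivative[OF has_derivative_ident]])
  then have "continuous_on UNIV (\<lambda>Z. Re (bl (vx (plk1 Z)) (vx (plk1 Z))))" by (intro continuous_intros)
  from open_Collect_less[OF continuous_on_const this] show ?thesis by (simp add: rho_dom_def)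
qed

lemma rho_dom_nonzero: "Z \<in> rho_dom \<Longrightarrow> rho Z \<noteq> 0"
  by (auto simp: rho_dom_def rho_def)

lemma rho_has_derivative:
  assumes "(Z has_derivative Z') (at x within S)" "Z x \<in> rho_dom"
  shows "((\<lambda>x. rho (Z x)) has_derivative
    (\<lambda>h. bl (vx (plk1 (Z x))) (vx (dplk (Z x) (mat 1) (Z' h) 0)) / rho (Z x))) (at x within S)"
proof -
  let ?q = "\<lambda>Z. bl (vx (plk1 Z)) (vx (plk1 Z))"
  have np: "?q (Z x) \<notin> \<real>\<^sub>\<le>\<^sub>0" using assms(2) by (auto simp: rho_dom_def complex_nonpos_Reals_iff)
  have q: "((\<lambda>x. ?q (Z x)) has_derivative (\<lambda>h. 2 * bl (vx (plk1 (Z x))) (vx (dplk (Z x) (mat 1) (Z' h) 0)))) (at x within S)"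
    by (rule bl_has_derivative[OF plk1_has_derivative[OF assms(1)]])
  have c: "(csqrt has_derivative (\<lambda>h. h * (inverse (2 * csqrt (?q (Z x)))))) (at (?q (Z x)))"
    using has_field_derivative_csqrt[OF np] unfolding has_field_derivative_def
    by (rule has_derivative_eq_rhs) (simp add: fun_eq_iff)
  have "((\<lambda>x. csqrt (?q (Z x))) has_derivative
     (\<lambda>h. 2 * bl (vx (plk1 (Z x))) (vx (dplk (Z x) (mat 1) (Z' h) 0)) * inverse (2 * csqrt (?q (Z x))))) (at x within S)"
    using has_derivative_compose[OF q c] .
  moreover have "2 * a * inverse (2 * b) = a / b" for a b :: complex by (cases "b = 0") (simp_all add: field_simps)
  ultimately show ?thesis unfolding rho_def by (simp only:)
qed

lemma dplk_mscale: "dplk V W (mscale c V') 0 = c *s dplk V W V' 0"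
  by (simp add: vec_eq_iff all_plus forall_3 dplk_def pcoord_nth minor2_def mscale_def field_simps)

lemma ev_holo_on: "holo_on rho_dom (\<lambda>Z. ev e (plk1 Z) (rho Z))"
  unfolding holo_on_def
proof (intro conjI ballI open_rho_dom)
  fix Z assume Z: "Z \<in> rho_dom"
  let ?D = "\<lambda>V. dv e (plk1 Z) (rho Z) (dplk Z (mat 1) V 0) (bl (vx (plk1 Z)) (vx (dplk Z (mat 1) V 0)) / rho Z)"
  have "((\<lambda>Z. ev e (plk1 Z) (rho Z)) has_derivative ?D) (at Z)"
    by (rule ev_has_derivative[OF plk1_has_derivative[OF has_derivative_ident] rho_has_derivative[OF has_derivative_ident]])
       (use Z rho_dom_nonzero in auto)
  moreover have "?D (mscale c V) = c * ?D V" for c V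
  proof -
    have "bl (vx (plk1 Z)) (vx (c *s v)) / rho Z = c * (bl (vx (plk1 Z)) (vx v) / rho Z)" for v
      by (simp add: bl_3 vx_def field_simps)
    then show ?thesis unfolding dplk_mscale by (simp only: dv_scale)
  qed
  ultimately show "\<exists>D. ((\<lambda>Z. ev e (plk1 Z) (rho Z)) has_derivative D) (at Z) \<and> (\<forall>c V. D (mscale c V) = c * D V)"
    by (intro exI[of _ ?D] conjI allI)
qed

section \<open>The infinitesimal action on Minkowski space\<close>

definition evM :: "ex \<Rightarrow> complex ^ 2 ^ 2 \<Rightarrow> complex" where
  "evM e Y = (if Y \<in> mink_plus then ev e (plk1 Y) (rho Y) else 0)"

lemma blk_has_vector_derivative:
  assumes "(k has_vector_derivative k') (at s)"
  shows "((\<lambda>s. blkA (k s)) has_vector_derivative blkA k') (at s)" "((\<lambda>s. blkB (k s)) has_vector_derivative blkB k') (at s)"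
    "((\<lambda>s. blkC (k s)) has_vector_derivative blkC k') (at s)" "((\<lambda>s. blkD (k s)) has_vector_derivative blkD k') (at s)"
  unfolding blkA_def blkB_def blkC_def blkD_def
  by (intro has_vector_derivative_vec; simp; intro has_vector_derivative_vec_nth assms)+

lemma det_has_vector_derivative:
  assumes "(V has_vector_derivative V') (at s)"
  shows "\<exists>d. ((\<lambda>s. det (V s :: complex ^ 2 ^ 2)) has_vector_derivative d) (at s)"
proof -
  note v = has_vector_derivative_vec_nth[OF has_vector_derivative_vec_nth[OF assms]]
  show ?thesis unfolding det_2
    by (rule exI, rule has_vector_derivative_diff[OF has_vector_derivative_mult[OF v v] has_vector_derivative_mult[OF v v]])
qed

lemma inverse_has_vector_derivative:
  fixes f :: "real \<Rightarrow> complex"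
  assumes "(f has_vector_derivative d) (at s)" "f s \<noteq> 0"
  shows "((\<lambda>s. 1 / f s) has_vector_derivative d * - (inverse (f s) ^ Suc (Suc 0))) (at s)"
  using field_vector_diff_chain_at[OF assms(1) DERIV_inverse[OF assms(2)]] by (simp add: o_def inverse_eq_divide)

text \<open>Existence of the derivative is enough: the derivative of the action is later computed in
  homogeneous coordinates.\<close>

lemma moebius_has_vector_derivative:
  fixes V W :: "real \<Rightarrow> complex ^ 2 ^ 2"
  assumes "(V has_vector_derivative V') (at s)" "(W has_vector_derivative W') (at s)" "det (W s) \<noteq> 0"
  shows "\<exists>z. ((\<lambda>s. mscale (1 / det (W s)) (V s ** adj2 (W s))) has_vector_derivative z) (at s)"
proof -
  note w = has_vector_derivative_vec_nth[OF has_vector_derivative_vec_nth[OF assms(2)]]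
  have m: "((\<lambda>s. - W s $ i $ j) has_vector_derivative - W' $ i $ j) (at s)" for i j
    using has_vector_derivative_minus[OF w[of i j]] by simp
  obtain d where d: "((\<lambda>s. det (W s)) has_vector_derivative d) (at s)" using det_has_vector_derivative[OF assms(2)] by blast
  have "\<exists>a. ((\<lambda>s. adj2 (W s)) has_vector_derivative a) (at s)"
  proof
    show "((\<lambda>s. adj2 (W s)) has_vector_derivative adj2 W') (at s)"
    proof (intro has_vector_derivative_vec)
      fix i j :: 2
      show "((\<lambda>s. adj2 (W s) $ i $ j) has_vector_derivative adj2 W' $ i $ j) (at s)"
        using exhaust_2[of i] exhaust_2[of j] w m by (auto simp: adj2_def)
    qed
  qed
  then obtain a where a: "((\<lambda>s. adj2 (W s)) has_vector_derivative a) (at s)" by blast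
  obtain c where c: "((\<lambda>s. V s ** adj2 (W s)) has_vector_derivative c) (at s)"
    using has_vector_derivative_matrix_mult[OF assms(1) a] by blast
  obtain r where r: "((\<lambda>s. 1 / det (W s)) has_vector_derivative r) (at s)"
    using inverse_has_vector_derivative[OF d assms(3)] by blast
  have "((\<lambda>s. mscale (1 / det (W s)) (V s ** adj2 (W s))) has_vector_derivative
    (mscale (1 / det (W s)) c + mscale r (V s ** adj2 (W s)))) (at s)"
  proof (rule has_vector_derivative_vec, rule has_vector_derivative_vec)
    fix i j
    show "((\<lambda>s. mscale (1 / det (W s)) (V s ** adj2 (W s)) $ i $ j) has_vector_derivative
      (mscale (1 / det (W s)) c + mscale r (V s ** adj2 (W s))) $ i $ j) (at s)"
      unfolding mscale_def vec_lambda_beta vector_add_component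
      by (rule has_vector_derivative_mult[OF r has_vector_derivative_vec_nth[OF has_vector_derivative_vec_nth[OF c]]])
  qed
  then show ?thesis by blast
qed

text \<open>For a singular denominator both sides are 0 because 1 / 0 = 0, so the adjugate formula
  holds for all s.\<close>

lemma pi_l_mexp:
  "pi_l (mexp (s *\<^sub>R X)) \<psi> Z =
    (let k = mexp (s *\<^sub>R (- X)); V = blkA k ** Z + blkB k; W = blkC k ** Z + blkD k
     in 1 / det W * \<psi> (mscale (1 / det W) (V ** adj2 W)))"
proof (cases "det (blkC (mexp (s *\<^sub>R (- X))) ** Z + blkD (mexp (s *\<^sub>R (- X)))) = 0")
  case False
  then show ?thesis unfolding pi_l_def matrix_inv_mexp Let_def by (simp only: matrix_inv_2[OF False] mscale_mult)
qed (simp add: pi_l_def matrix_inv_mexp Let_def)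

text \<open>(V, W) and (V W^(-1), 1) have the same column space, so their Pluecker vectors differ by
  the factor det W, which is the N(cZ + d) of the action.\<close>

lemma plk1_moebius:
  assumes "det W \<noteq> 0"
  shows "det W *s plk1 (mscale (1 / det W) (V ** adj2 W)) = plk V W"
proof -
  have "V ** adj2 W ** W = mscale (det W) V" by (simp add: matrix_mul_assoc[symmetric] adj2_mult mscale_mult)
  then have "mscale (1 / det W) (V ** adj2 W) ** W = V" using assms by (simp add: mscale_mult mscale_mscale mscale_1)
  then show ?thesis
    using plk_mult[of "mscale (1 / det W) (V ** adj2 W)" W "mat 1"] by (simp add: plk1_def)
qed

text \<open>The extension inside \<open>dpi_l\<close> is an arbitrary choice, but at s = 0 only its
  value and derivative at Y enter, and these agree with those of the explicit extension. For the
  latter the curve is read in homogeneous coordinates, where its velocity is - sigma X applied to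
  the cone point.\<close>

lemma dpi_l_evM:
  assumes e: "homog (- 1) e"
  shows "dpi_l X (evM e) = evM (der (sigma X) e)"
proof
  fix Y
  show "dpi_l X (evM e) Y = evM (der (sigma X) e) Y"
  proof (cases "Y \<in> mink_plus")
    case False
    then show ?thesis by (simp add: dpi_l_def evM_def)
  next
    case Y: True
    let ?e = "\<lambda>Z. ev e (plk1 Z) (rho Z)"
    let ?\<psi> = "holo_ext (evM e)"
    have "\<exists>\<psi> U. mink_plus \<subseteq> U \<and> holo_on U \<psi> \<and> (\<forall>Y\<in>mink_plus. \<psi> Y = evM e Y)"
      by (rule exI[of _ ?e], rule exI[of _ rho_dom])
         (use mink_plus_rho_dom ev_holo_on in \<open>auto simp: evM_def\<close>)
    then have "\<exists>U. mink_plus \<subseteq> U \<and> holo_on U ?\<psi> \<and> (\<forall>Y\<in>mink_plus. ?\<psi> Y = evM e Y)"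
      unfolding holo_ext_def by (rule someI_ex)
    then obtain U where U: "mink_plus \<subseteq> U" "holo_on U ?\<psi>" and ag: "\<And>Y. Y \<in> mink_plus \<Longrightarrow> ?\<psi> Y = evM e Y" by blast
    have "\<exists>D. (?\<psi> has_derivative D) (at Y) \<and> (\<forall>c V. D (mscale c V) = c * D V)"
      using U Y unfolding holo_on_def by blast
    then obtain D where D: "(?\<psi> has_derivative D) (at Y)" "\<And>c V. D (mscale c V) = c * D V" by (elim exE conjE) auto
    have YR: "Y \<in> rho_dom" using Y mink_plus_rho_dom by blast
    have "\<exists>D. (?e has_derivative D) (at Y) \<and> (\<forall>c V. D (mscale c V) = c * D V)"
      using ev_holo_on[of e] YR unfolding holo_on_def by blast
    then obtain D' where D': "(?e has_derivative D') (at Y)" "\<And>c V. D' (mscale c V) = c * D' V" by (elim exE conjE) auto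
    have DD: "D = D'"
      by (rule holomorphic_derivative_unique[OF Y _ D D']) (simp add: ag evM_def)
    define k where "k s = mexp (s *\<^sub>R (- X))" for s :: real
    define V where "V s = blkA (k s) ** Y + blkB (k s)" for s
    define W where "W s = blkC (k s) ** Y + blkD (k s)" for s
    define Z where "Z s = mscale (1 / det (W s)) (V s ** adj2 (W s))" for s
    have k0: "k 0 = mat 1" by (simp add: k_def)
    have dk: "(k has_vector_derivative - X) (at 0)"
      using has_vector_derivative_mexp(1)[of "- X" 0] by (simp add: k_def[abs_def])
    have b0: "blkA (mat 1 :: complex ^ (2 + 2) ^ (2 + 2)) = mat 1" "blkB (mat 1 :: complex ^ (2 + 2) ^ (2 + 2)) = 0"
      "blkC (mat 1 :: complex ^ (2 + 2) ^ (2 + 2)) = 0" "blkD (mat 1 :: complex ^ (2 + 2) ^ (2 + 2)) = mat 1"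
      by (simp_all add: vec_eq_iff blkA_def blkB_def blkC_def blkD_def mat_def)
    have V0: "V 0 = Y" and W0: "W 0 = mat 1" by (simp_all add: V_def W_def k0 b0)
    have aff: "((\<lambda>s. f s ** Y + g s) has_vector_derivative f' ** Y + g') (at 0)"
      if "(f has_vector_derivative f') (at 0)" "(g has_vector_derivative g') (at 0)" for f g f' g'
      using has_vector_derivative_add[OF has_vector_derivative_matrix_mult[OF that(1) has_vector_derivative_const[of Y]] that(2)]
      by simp
    note b = blk_has_vector_derivative[OF dk]
    have dV: "(V has_vector_derivative blkA (- X) ** Y + blkB (- X)) (at 0)" unfolding V_def[abs_def] by (rule aff[OF b(1,2)])
    have dW: "(W has_vector_derivative blkC (- X) ** Y + blkD (- X)) (at 0)" unfolding W_def[abs_def] by (rule aff[OF b(3,4)])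
    have W1: "det (W 0) \<noteq> 0" by (simp add: W0)
    obtain d where d: "((\<lambda>s. det (W s)) has_vector_derivative d) (at 0)" using det_has_vector_derivative[OF dW] by blast
    obtain z where z: "(Z has_vector_derivative z) (at 0)"
      using moebius_has_vector_derivative[OF dV dW W1] unfolding Z_def[abs_def] by blast
    have Z0: "Z 0 = Y"
      by (simp add: Z_def V0 W0 mscale_1) (simp add: vec_eq_iff forall_2 adj2_def mat_def matrix_matrix_mult_def sum_2)
    obtain r where r: "((\<lambda>s. 1 / det (W s)) has_vector_derivative r) (at 0)"
      using inverse_has_vector_derivative[OF d W1] by blast
    have F: "((\<lambda>s. 1 / det (W s) * f (Z s)) has_vector_derivative 1 / det (W 0) * E z + r * f (Z 0)) (at 0)"
      if "(f has_derivative E) (at Y)" for f E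
    proof -
      have "((\<lambda>s. f (Z s)) has_derivative (\<lambda>h. E (h *\<^sub>R z))) (at 0)"
        by (rule has_derivative_compose[OF z[unfolded has_vector_derivative_def]]) (simp add: Z0 that)
      then have "((\<lambda>s. f (Z s)) has_vector_derivative E z) (at 0)"
        unfolding has_vector_derivative_def
        by (simp add: linear_scale[OF bounded_linear.linear[OF has_derivative_bounded_linear[OF that]]])
      from has_vector_derivative_mult[OF r this] show ?thesis .
    qed
    have F1: "((\<lambda>s. 1 / det (W s) * ?\<psi> (Z s)) has_vector_derivative 1 / det (W 0) * D z + r * ?e Y) (at 0)"
      using F[OF D(1)] Y by (simp add: Z0 ag evM_def)
    have F2: "((\<lambda>s. 1 / det (W s) * ?e (Z s)) has_vector_derivative 1 / det (W 0) * D z + r * ?e Y) (at 0)"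
      using F[OF D'(1)] by (simp add: Z0 DD)
    text \<open>In homogeneous coordinates the cocycle factor disappears.\<close>
    define \<rho> where "\<rho> s = det (W s) * rho (Z s)" for s
    let ?\<xi> = "\<lambda>s. plk (V s) (W s)"
    let ?q = "\<lambda>\<xi>. bl (vx \<xi>) (vx \<xi>)"
    have F3: "1 / det (W s) * ?e (Z s) = ev e (?\<xi> s) (\<rho> s)" if "det (W s) \<noteq> 0" for s
      using ev_homog[OF e that, of "plk1 (Z s)" "rho (Z s)"] plk1_moebius[OF that, of "V s"]
      by (simp add: \<rho>_def Z_def power_int_minus inverse_eq_divide)
    have F4: "\<rho> s * \<rho> s = ?q (?\<xi> s)" if "det (W s) \<noteq> 0" for s
    proof -
      have "?q (c *s \<xi>) = c * c * ?q \<xi>" for c \<xi> by (simp add: bl_3 vx_def algebra_simps)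
      then show ?thesis
        using rho_square[of "Z s"] unfolding plk1_moebius[OF that, of "V s", symmetric] \<rho>_def Z_def
        by (simp add: power2_eq_square mult_ac)
    qed
    have ev0: "\<forall>\<^sub>F s in at 0. det (W s) \<noteq> 0"
    proof -
      have "isCont (\<lambda>s. det (W s)) 0" using d has_vector_derivative_continuous by blast
      then have "((\<lambda>s. det (W s)) \<longlongrightarrow> det (W 0)) (at 0)" by (simp add: isCont_def)
      from tendsto_imp_eventually_ne[OF this W1] show ?thesis .
    qed
    \<comment> \<open>Identities that require det (W s) \<noteq> 0 are available near s = 0, which
      is all that a derivative at 0 sees.\<close>
    have tr: "(g has_vector_derivative g') (at 0)"
      if "(f has_vector_derivative g') (at 0)" "\<And>s. det (W s) \<noteq> 0 \<Longrightarrow> f s = g s" for f g :: "real \<Rightarrow> complex" and g'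
      unfolding has_vector_derivative_def
      by (rule has_derivative_transform_eventually[OF that(1)[unfolded has_vector_derivative_def]])
         (use ev0 that(2) W1 in \<open>auto elim: eventually_mono\<close>)
    let ?\<xi>' = "- (sigma X *v plk1 Y)"
    have \<xi>0: "?\<xi> 0 = plk1 Y" by (simp add: V0 W0 plk1_def)
    have d\<xi>: "(?\<xi> has_vector_derivative ?\<xi>') (at 0)"
    proof -
      have n: "blkA (- X) ** Y + blkB (- X) = - (blkA X ** Y + blkB X ** mat 1)" "blkC (- X) ** Y + blkD (- X) = - (blkC X ** Y + blkD X ** mat 1)"
        by (simp_all add: vec_eq_iff blkA_def blkB_def blkC_def blkD_def matrix_matrix_mult_def sum_negf mat_def
            if_distrib[of "\<lambda>x. _ * x"] cong: if_cong)
      have m: "dplk V W (- V') (- W') = - dplk V W V' W'" for V W V' W'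
        using dplk_scaleR[of V W "- 1" V' W'] by simp
      show ?thesis
        using plk_has_vector_derivative[OF dV dW] unfolding n m V0 W0 plk1_def sigma_mult_plk .
    qed
    have \<rho>0: "\<rho> 0 = rho Y" by (simp add: \<rho>_def W0 Z0)
    have "((\<lambda>s. rho (Z s)) has_vector_derivative bl (vx (plk1 Y)) (vx (dplk Y (mat 1) z 0)) / rho Y) (at 0)"
    proof -
      have "(rho has_derivative (\<lambda>h. bl (vx (plk1 Y)) (vx (dplk Y (mat 1) h 0)) / rho Y)) (at Y)"
        using rho_has_derivative[OF has_derivative_ident YR] by simp
      from has_derivative_compose[OF z[unfolded has_vector_derivative_def], of rho, unfolded Z0, OF this]
      show ?thesis
        unfolding has_vector_derivative_def
        by (rule has_derivative_eq_rhs)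
           (use dplk_scaleR[of Y "mat 1" _ z 0] in \<open>simp add: fun_eq_iff bl_3 vx_def scaleR_conv_of_real[where 'a = complex] field_simps\<close>)
    qed
    from has_vector_derivative_mult[OF d this]
    obtain \<rho>' where d\<rho>: "(\<rho> has_vector_derivative \<rho>') (at 0)" unfolding \<rho>_def[abs_def] by blast
    have nz: "rho Y \<noteq> 0" by (rule rho_dom_nonzero[OF YR])
    \<comment> \<open>The square of \<rho> is a polynomial in the cone coordinates, so
      differentiating it yields \<rho>' without following the branch of the square root.\<close>
    have "((\<lambda>s. \<rho> s * \<rho> s) has_vector_derivative 2 * bl (vx (plk1 Y)) (vx ?\<xi>')) (at 0)"
    proof (rule tr)
      have "((\<lambda>s. ?q (?\<xi> s)) has_derivative (\<lambda>h. 2 * bl (vx (plk1 Y)) (vx (h *\<^sub>R ?\<xi>')))) (at 0)"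
        using bl_has_derivative[OF d\<xi>[unfolded has_vector_derivative_def]] unfolding \<xi>0 .
      then show "((\<lambda>s. ?q (?\<xi> s)) has_vector_derivative 2 * bl (vx (plk1 Y)) (vx ?\<xi>')) (at 0)"
        unfolding has_vector_derivative_def
        by (rule has_derivative_eq_rhs)
           (simp add: fun_eq_iff bl_3 vx_def scaleR_conv_of_real[where 'a = complex] algebra_simps)
    qed (simp add: F4)
    moreover have "((\<lambda>s. \<rho> s * \<rho> s) has_vector_derivative 2 * (rho Y * \<rho>')) (at 0)"
      using has_vector_derivative_mult[OF d\<rho> d\<rho>] unfolding \<rho>0 by (simp add: mult.commute)
    ultimately have "2 * (rho Y * \<rho>') = 2 * bl (vx (plk1 Y)) (vx ?\<xi>')" by (rule vector_derivative_unique_at[rotated])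
    moreover have "bl (vx (plk1 Y)) (vx ?\<xi>') = - bl (vx (plk1 Y)) (vx (sigma X *v plk1 Y))" by (simp add: bl_3 vx_def)
    ultimately have "\<rho>' * rho Y = - bl (vx (plk1 Y)) (vx (sigma X *v plk1 Y))" by (simp only: mult_left_cancel mult.commute) simp
    then have \<rho>': "\<rho>' = - bl (vx (plk1 Y)) (vx (sigma X *v plk1 Y)) / rho Y"
      by (simp only: nonzero_eq_divide_eq[OF nz])
    have "((\<lambda>s. ev e (?\<xi> s) (\<rho> s)) has_vector_derivative ev (der (sigma X) e) (plk1 Y) (rho Y)) (at 0)"
      using ev_has_vector_derivative[OF d\<xi> d\<rho>, of e] nz unfolding \<xi>0 \<rho>0 ev_der[OF nz] \<rho>' by simp
    then have "((\<lambda>s. 1 / det (W s) * ?e (Z s)) has_vector_derivative ev (der (sigma X) e) (plk1 Y) (rho Y)) (at 0)"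
      by (rule tr) (rule F3[symmetric])
    from vector_derivative_unique_at[OF F2 this] F1
    have "((\<lambda>s. 1 / det (W s) * ?\<psi> (Z s)) has_vector_derivative ev (der (sigma X) e) (plk1 Y) (rho Y)) (at 0)" by simp
    moreover have "pi_l (mexp (s *\<^sub>R X)) ?\<psi> Y = 1 / det (W s) * ?\<psi> (Z s)" for s
      unfolding pi_l_mexp Let_def Z_def V_def W_def k_def ..
    ultimately show ?thesis
      using Y by (simp add: dpi_l_def evM_def vector_derivative_at)
  qed
qed

section \<open>The functions spanning \<open>D0M\<close>\<close>

text \<open>\<open>he\<close> with its three coefficients as independent variables over any field:
  the same algebra then serves the real Legendre functions and the complex harmonics.\<close>

definition ec :: "nat \<Rightarrow> nat \<Rightarrow> 'a::field \<Rightarrow> 'a \<Rightarrow> 'a \<Rightarrow> 'a" where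
  "ec l j p z m = coeff ([:p, 2 * z, - m:] ^ l) j"

lemma ec_0: "ec 0 j p z m = (if j = 0 then 1 else 0)"
  by (simp add: ec_def)

lemma ec_Suc: "ec (Suc l) j p z m = p * ec l j p z m + (if 1 \<le> j then 2 * z * ec l (j - 1) p z m else 0)
    + (if 2 \<le> j then - m * ec l (j - 2) p z m else 0)"
  by (simp only: ec_def power_Suc coeff_pCons3_mult)

lemma he_ec: "he l j x = ec l j (x $ 1 + \<i> * x $ 2) (x $ 3) (x $ 1 - \<i> * x $ 2)"
  by (simp add: he_def ec_def sq_def)

lemma ec_eq_0: "2 * l < j \<Longrightarrow> ec l j p z m = 0"
  by (induction l arbitrary: j) (auto simp: ec_0 ec_Suc)

lemma ec_of_real: "ec l j (of_real p) (of_real z) (of_real m) = (of_real (ec l j p z m) :: complex)"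
  by (induction l arbitrary: j) (auto simp: ec_0 ec_Suc)

lemma ec_scale: "ec l j (c * p) (c * z) (c * m) = c ^ l * ec l j p z m"
proof (induction l arbitrary: j)
  case (Suc l)
  show ?case unfolding ec_Suc Suc.IH by (simp add: algebra_simps)
qed (simp add: ec_0)

lemma ec_weight: "ec l j p (c * z) (c\<^sup>2 * m) = c ^ j * ec l j p z m"
proof (induction l arbitrary: j)
  case (Suc l)
  show ?case
  proof (cases "2 \<le> j")
    case True
    then obtain i where "j = 2 + i" using le_Suc_ex by blast
    then show ?thesis unfolding ec_Suc Suc.IH by (simp add: algebra_simps power2_eq_square)
  next
    case False
    then have "j = 0 \<or> j = 1" by auto
    then show ?thesis unfolding ec_Suc Suc.IH by (auto simp: algebra_simps)
  qed
qed (simp add: ec_0)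

text \<open>Reversing the coefficients of the quadratic, u^2 q(1/u), exchanges p with - m.\<close>

lemma ec_reflect: "i + j = 2 * l \<Longrightarrow> ec l i p z m = ec l j (- m) z (- p)"
proof (induction l arbitrary: i j)
  case (Suc l)
  have 1: "p * ec l i p z m = (if 2 \<le> j then - (- p) * ec l (j - 2) (- m) z (- p) else 0)"
  proof (cases "2 \<le> j")
    case True
    then have "i + (j - 2) = 2 * l" using Suc.prems by simp
    with True show ?thesis by (simp add: Suc.IH)
  next
    case False
    then have "2 * l < i" using Suc.prems by simp
    with False show ?thesis by (simp add: ec_eq_0)
  qed
  have 2: "(if 1 \<le> i then 2 * z * ec l (i - 1) p z m else 0) = (if 1 \<le> j then 2 * z * ec l (j - 1) (- m) z (- p) else 0)"
  proof (cases "1 \<le> i \<and> 1 \<le> j")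
    case True
    then have "(i - 1) + (j - 1) = 2 * l" using Suc.prems by simp
    from Suc.IH[OF this] True show ?thesis by simp
  next
    case False
    then have "i = 0 \<and> 2 * l < j - 1 \<or> j = 0 \<and> 2 * l < i - 1" using Suc.prems by auto
    then show ?thesis by (auto simp: ec_eq_0)
  qed
  have 3: "(if 2 \<le> i then - m * ec l (i - 2) p z m else 0) = - m * ec l j (- m) z (- p)"
  proof (cases "2 \<le> i")
    case True
    then have "(i - 2) + j = 2 * l" using Suc.prems by simp
    from Suc.IH[OF this] True show ?thesis by simp
  next
    case False
    then have "2 * l < j" using Suc.prems by simp
    with False show ?thesis by (simp add: ec_eq_0)
  qed
  show ?case unfolding ec_Suc 1 2 3 by (simp add: algebra_simps)
qed (simp add: ec_0)

text \<open>The new quadratic at u is c times the old one at u / c.\<close>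

lemma ec_boost:
  assumes "c \<noteq> 0"
  shows "ec l j (c * p) z (m / c) = c powi (int l - int j) * ec l j p z m"
proof -
  have "ec l j (c * p) z (m / c) = ec l j (c * p) ((1 / c) * (c * z)) ((1 / c)\<^sup>2 * (c * m))"
    using assms by (simp add: power2_eq_square)
  also have "\<dots> = (1 / c) ^ j * (c ^ l * ec l j p z m)" by (simp only: ec_weight ec_scale)
  finally show ?thesis using assms by (simp add: power_int_diff power_one_over)
qed

section \<open>Legendre functions as coefficients of powers of a quadratic\<close>

lemma coeff_higher_pderiv_0: "coeff ((pderiv ^^ k) P) 0 = fact k * coeff (P :: real poly) k"
proof (induction k arbitrary: P)
  case (Suc k)
  have "coeff ((pderiv ^^ Suc k) P) 0 = coeff ((pderiv ^^ k) (pderiv P)) 0" by (simp only: funpow_Suc_right o_apply)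
  then show ?case unfolding Suc.IH by (simp add: coeff_pderiv algebra_simps)
qed simp

lemma pderiv_shift: "pderiv (pcompose P [:x, 1:]) = pcompose (pderiv P) [:x, 1 :: real:]"
  by (induction P) (auto simp: pcompose_pCons pderiv_add pderiv_mult pderiv_pCons pderiv_smult pcompose_add algebra_simps)

lemma higher_pderiv_shift: "(pderiv ^^ k) (pcompose P [:x, 1:]) = pcompose ((pderiv ^^ k) P) [:x, 1 :: real:]"
  by (induction k) (simp_all add: pderiv_shift)

lemma higher_deriv_poly: "(deriv ^^ k) (poly P) = poly ((pderiv ^^ k) (P :: real poly))"
proof (induction k)
  case (Suc k)
  have "deriv (poly Q) = poly (pderiv Q)" for Q :: "real poly"
    by (rule ext) (rule DERIV_imp_deriv[OF poly_DERIV])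
  with Suc show ?case by simp
qed simp

lemma pcompose_power_real: "pcompose (P ^ n) Q = pcompose P Q ^ n" for P Q :: "real poly"
  by (induction n) (simp_all add: pcompose_mult pcompose_1)

text \<open>The k-th derivative at x is k! times a Taylor coefficient, and 1 - (x + v)^2 = (1 - x^2)
  - 2 x v - v^2 is a quadratic in v. So Rodrigues' formula makes Legendre functions the same kind of
  object as \<open>he\<close>.\<close>

lemma higher_deriv_legendre: "(deriv ^^ k) (\<lambda>u. (1 - u\<^sup>2) ^ l) x = fact k * ec l k (1 - x\<^sup>2) (- x) (1 :: real)"
proof -
  let ?P = "[:1, 0, - 1:] ^ l :: real poly"
  have "(\<lambda>u. (1 - u\<^sup>2) ^ l) = poly ?P" by (auto simp: power2_eq_square)
  then have "(deriv ^^ k) (\<lambda>u. (1 - u\<^sup>2) ^ l) x = poly ((pderiv ^^ k) ?P) x" by (simp only: higher_deriv_poly)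
  also have "\<dots> = coeff (pcompose ((pderiv ^^ k) ?P) [:x, 1:]) 0"
    by (simp add: poly_0_coeff_0[symmetric] poly_pcompose)
  also have "\<dots> = fact k * coeff (pcompose ?P [:x, 1:]) k" by (simp only: higher_pderiv_shift[symmetric] coeff_higher_pderiv_0)
  also have "pcompose ?P [:x, 1:] = [:1 - x\<^sup>2, 2 * (- x), - 1:] ^ l"
    by (simp add: pcompose_power_real pcompose_pCons power2_eq_square)
  finally show ?thesis by (simp add: ec_def)
qed

lemma ec_cone:
  assumes "r \<noteq> 0" "j \<le> 2 * l"
  shows "ec l j (1 - (t / r)\<^sup>2) (- (t / r)) 1 = (r :: real) powi (int j - 2 * int l) * ec l j (r\<^sup>2 - t\<^sup>2) (- t) 1"
proof -
  have "r ^ j * ec l j (r\<^sup>2 - t\<^sup>2) (- t) 1 = ec l j (r\<^sup>2 - t\<^sup>2) (r * (- t)) (r\<^sup>2 * 1)" by (simp only: ec_weight)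
  also have "\<dots> = ec l j (r\<^sup>2 * (1 - (t / r)\<^sup>2)) (r\<^sup>2 * - (t / r)) (r\<^sup>2 * 1)"
  proof -
    have "r\<^sup>2 * (1 - (t / r)\<^sup>2) = r\<^sup>2 - t\<^sup>2" using assms(1) by (simp add: power_divide right_diff_distrib)
    moreover have "r\<^sup>2 * - (t / r) = r * (- t)" using assms(1) by (simp add: power2_eq_square)
    ultimately show ?thesis by simp
  qed
  also have "\<dots> = r ^ (2 * l) * ec l j (1 - (t / r)\<^sup>2) (- (t / r)) 1" by (simp only: ec_scale power_mult)
  finally have *: "r ^ j * ec l j (r\<^sup>2 - t\<^sup>2) (- t) 1 = r ^ (2 * l) * ec l j (1 - (t / r)\<^sup>2) (- (t / r)) 1" .
  have "r powi (int j - 2 * int l) = r ^ j / r ^ (2 * l)"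
  proof -
    have "int j - 2 * int l = int j - int (2 * l)" by simp
    then show ?thesis using power_int_diff[of r "int j" "int (2 * l)"] assms(1) by (simp only: power_int_of_nat simp_thms)
  qed
  moreover have "ec l j (1 - (t / r)\<^sup>2) (- (t / r)) 1 = r ^ j * ec l j (r\<^sup>2 - t\<^sup>2) (- t) 1 / r ^ (2 * l)"
    unfolding * using assms(1) by simp
  ultimately show ?thesis by (simp only: times_divide_eq_left)
qed

lemma legendreP_ec:
  assumes "r \<noteq> 0" "- int l \<le> m" "m \<le> int l"
  shows "legendreP l m (t / r) = (- 1) ^ nat (int l + m) / (2 ^ l * fact l) * fact (nat (int l + m)) *
     sqrt (1 - (t / r)\<^sup>2) powi m * r powi (m - int l) * ec l (nat (int l + m)) (r\<^sup>2 - t\<^sup>2) (- t) 1"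
proof -
  have j: "nat (int l + m) \<le> 2 * l" "int (nat (int l + m)) - 2 * int l = m - int l" using assms by auto
  show ?thesis unfolding legendreP_def higher_deriv_legendre ec_cone[OF assms(1) j(1)] j(2) by simp
qed

text \<open>The index k of the factor \<open>he l k\<close> in y: the sign s selects the half of the
  level above or below its middle k = l, which both signs give for n = 0.\<close>

definition rad_index :: "real \<Rightarrow> nat \<Rightarrow> nat \<Rightarrow> nat" where
  "rad_index s l n = (if s = 1 then l + n else l - n)"

text \<open>With N = r^2 - t^2, the factor (1 - (t/r)^2)^(n/2) contributes N^(n/2) / r^n. For s = -1
  the power of N in front cancels it, for s = 1 it completes it to N^n; and N^n is, up to sign, what
  turns coefficient l - n into coefficient l + n.\<close>

lemma radial_part:
  assumes "0 < r" "t\<^sup>2 < r\<^sup>2" "n \<le> l" "s = 1 \<or> s = - 1"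
  shows "(r\<^sup>2 - t\<^sup>2) powr (s * real n / 2) * legendreP l (int n) (t / r)
     = ((- 1) ^ (l + n) / (2 ^ l * fact l) * fact (l + n) * (if s = 1 then (- 1) ^ (l + n) else (- 1) ^ l)) *
       (1 / r ^ l * ec l (rad_index s l n) 1 t (r\<^sup>2 - t\<^sup>2))"
proof -
  let ?N = "r\<^sup>2 - t\<^sup>2"
  have N: "0 < ?N" and r: "r \<noteq> 0" using assms by auto
  have nat: "nat (int l + int n) = l + n" by simp
  have "1 - (t / r)\<^sup>2 = ?N / r\<^sup>2" using r by (simp add: power_divide diff_divide_distrib)
  then have sq: "sqrt (1 - (t / r)\<^sup>2) = sqrt ?N / r" using assms(1) by (simp add: real_sqrt_divide)
  have r1: "ec l (l + n) ?N (- t) 1 = (- 1) ^ l * ec l (l - n) 1 t ?N"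
  proof -
    have "ec l (l + n) ?N (- t) 1 = ec l (l - n) (- 1) (- t) (- ?N)" by (rule ec_reflect) (use assms(3) in auto)
    also have "\<dots> = ec l (l - n) (- 1 * 1) (- 1 * t) (- 1 * ?N)" by simp
    finally show ?thesis by (simp only: ec_scale)
  qed
  have r2: "ec l (l + n) 1 t ?N = (- ?N) ^ n * ec l (l - n) 1 t ?N"
  proof -
    have "ec l (l + n) 1 t ?N = ec l (l - n) (- ?N) t (- 1)" by (rule ec_reflect) (use assms(3) in auto)
    also have "\<dots> = ec l (l - n) (- ?N * 1) t (?N / (- ?N))"
    proof -
      have "?N \<noteq> 0" using N by simp
      then have "?N / ?N = 1" by (rule divide_self)
      then have "?N / (- ?N) = - 1" by (simp only: divide_minus_right)
      then show ?thesis by (simp only: mult_1_right)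
    qed
    also have "\<dots> = (- ?N) powi (int l - int (l - n)) * ec l (l - n) 1 t ?N" by (rule ec_boost) (use N in auto)
    also have "int l - int (l - n) = int n" using assms(3) by simp
    finally show ?thesis by simp
  qed
  have p: "?N powr (s * real n / 2) * sqrt ?N ^ n = (if s = 1 then ?N ^ n else 1)"
  proof -
    have sn: "sqrt ?N ^ n = ?N powr (real n / 2)"
      using N by (simp add: powr_half_sqrt[symmetric] powr_realpow[symmetric] powr_powr)
    have "?N powr (s * real n / 2) * sqrt ?N ^ n = ?N powr (s * real n / 2 + real n / 2)"
      unfolding sn by (simp add: powr_add)
    then show ?thesis using assms(4) N by (auto simp: powr_realpow)
  qed
  have rr: "1 / r ^ n * r powi (int n - int l) = 1 / r ^ l"
    using r by (simp add: power_int_diff)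
  have "?N powr (s * real n / 2) * legendreP l (int n) (t / r)
      = (- 1) ^ (l + n) / (2 ^ l * fact l) * fact (l + n) * (?N powr (s * real n / 2) * sqrt ?N ^ n) * (1 / r ^ n * r powi (int n - int l))
         * ((- 1) ^ l * ec l (l - n) 1 t ?N)"
    using legendreP_ec[OF r, of l "int n" t] assms(3) unfolding nat sq r1
    by (simp add: power_divide)
  also have "\<dots> = (- 1) ^ (l + n) / (2 ^ l * fact l) * fact (l + n) * (1 / r ^ l) *
      ((- 1) ^ l * ((if s = 1 then ?N ^ n else 1) * ec l (l - n) 1 t ?N))"
    unfolding p rr by simp
  also have "(if s = 1 then ?N ^ n else 1) * ec l (l - n) 1 t ?N = (if s = 1 then (- 1) ^ n else 1) * ec l (rad_index s l n) 1 t ?N"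
  proof (cases "s = 1")
    case True
    have pm: "(- ?N) ^ n = (- 1) ^ n * ?N ^ n" by (rule power_minus)
    have "(- 1) ^ n * (- 1) ^ n = (1 :: real)" by (simp flip: power_mult_distrib)
    then show ?thesis
      by (simp only: True if_True simp_thms rad_index_def r2 pm mult.assoc[symmetric] mult_1_left)
  qed (simp add: rad_index_def)
  finally show ?thesis by (simp add: power_add)
qed

lemma ec_diagonal: "ec l l 0 z m = (2 * z) ^ l"
proof -
  have "[:0, 2 * z, - m:] = monom 1 1 * [:2 * z, - m:]" by (simp add: monom_altdef)
  then have "ec l l 0 z m = coeff (monom 1 l * [:2 * z, - m:] ^ l) l"
    by (simp only: ec_def power_mult_distrib monom_power) simp
  also have "\<dots> = coeff ([:2 * z, - m:] ^ l) 0" by (simp add: coeff_monom_mult)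
  finally show ?thesis by (simp add: coeff_0_power)
qed

lemma ec_off_diagonal: "j \<noteq> l \<Longrightarrow> ec l j 0 z 0 = 0"
proof -
  assume "j \<noteq> l"
  have "[:0, 2 * z:] = monom (2 * z) 1" by (simp add: monom_altdef)
  then show ?thesis using \<open>j \<noteq> l\<close> by (simp add: ec_def monom_power)
qed

text \<open>The boost by - cnj p carries (p, x3, cnj p) to (- |p|^2, x3, -1), the arguments produced
  by the Legendre function up to an overall sign. The power of cnj p that this costs is matched by
  |p|^m times the phase on the left-hand side.\<close>

lemma spherical_part:
  fixes x :: "real ^ 3"
  assumes "x \<noteq> 0" "- int l \<le> m" "m \<le> int l"
  shows "of_real (legendreP l m (x $ 3 / norm x)) * exp (- \<i> * of_int m * of_real (Arg (Complex (x $ 1) (x $ 2))))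
    = of_real (fact (nat (int l + m)) / (2 ^ l * fact l)) * (1 / of_real (norm x) ^ l * he l (nat (int l + m)) (cv x))"
proof -
  define r p j where "r = norm x" and "p = Complex (x $ 1) (x $ 2)" and "j = nat (int l + m)"
  have r: "r \<noteq> 0" "0 < r" using assms by (auto simp: r_def)
  have j: "int j = int l + m" using assms by (simp add: j_def)
  have hx: "he l j (cv x) = ec l j p (of_real (x $ 3)) (cnj p)"
  proof -
    have p: "p = of_real (x $ 1) + \<i> * of_real (x $ 2)" by (simp only: p_def Complex_eq)
    then have "cnj p = of_real (x $ 1) - \<i> * of_real (x $ 2)" by simp
    with p show ?thesis by (simp only: he_ec cv_def vec_lambda_beta)
  qed
  have rp: "r\<^sup>2 - (x $ 3)\<^sup>2 = (cmod p)\<^sup>2" by (simp add: r_def norm_3 p_def cmod_def)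
  have "1 - (x $ 3 / r)\<^sup>2 = (cmod p)\<^sup>2 / r\<^sup>2" using r rp by (simp add: power_divide diff_divide_distrib flip: rp)
  then have sq: "sqrt (1 - (x $ 3 / r)\<^sup>2) = cmod p / r" using r by (simp add: real_sqrt_divide)
  have L: "legendreP l m (x $ 3 / r) = (- 1) ^ j * (fact j / (2 ^ l * fact l)) *
     ((cmod p / r) powi m * r powi (m - int l) * ec l j ((cmod p)\<^sup>2) (- (x $ 3)) 1)"
    using legendreP_ec[OF r(1) assms(2,3), of "x $ 3"] unfolding sq rp j_def[symmetric] by simp
  have E: "of_real (ec l j ((cmod p)\<^sup>2) (- (x $ 3)) 1) = (- 1) ^ l * ec l j (- (p * cnj p)) (of_real (x $ 3)) (- 1 :: complex)"
  proof -
    have "(of_real (ec l j ((cmod p)\<^sup>2) (- (x $ 3)) 1) :: complex) = ec l j (p * cnj p) (- of_real (x $ 3)) 1"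
      unfolding ec_of_real[symmetric] complex_norm_square by simp
    also have "\<dots> = ec l j (- 1 * - (p * cnj p)) (- 1 * of_real (x $ 3)) (- 1 * (- 1))" by simp
    finally show ?thesis by (simp only: ec_scale)
  qed
  have main: "of_real ((cmod p / r) powi m * r powi (m - int l)) * exp (- \<i> * of_int m * of_real (Arg p))
      * ((- 1) ^ l * ec l j (- (p * cnj p)) (of_real (x $ 3)) (- 1)) = (- 1) ^ j * (1 / of_real r ^ l * he l j (cv x))"
  proof (cases "p = 0")
    \<comment> \<open>On the axis a nonzero m makes both sides 0: \<open>0 powi m\<close> is 0, also
      for negative m, and the off-diagonal coefficient vanishes.\<close>
    case True
    show ?thesis
    proof (cases "m = 0")
      case m: True
      then have jl: "j = l" using j by simp
      with m True hx[unfolded jl] show ?thesis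
        using ec_diagonal[of l "of_real (x $ 3) :: complex" "- 1"] ec_diagonal[of l "of_real (x $ 3) :: complex" 0]
        by (simp add: power_int_minus inverse_eq_divide)
    next
      case False
      then have "j \<noteq> l" using j by simp
      with True False show ?thesis using ec_off_diagonal[of j l "of_real (x $ 3) :: complex"] by (simp add: hx)
    qed
  next
    case False
    then have c: "- cnj p \<noteq> 0" by simp
    have "ec l j (- (p * cnj p)) (of_real (x $ 3)) (- 1) = ec l j (- cnj p * p) (of_real (x $ 3)) (cnj p / (- cnj p))"
      using False by (simp add: mult.commute)
    also have "\<dots> = (- cnj p) powi (int l - int j) * he l j (cv x)" unfolding hx by (rule ec_boost[OF c])
    also have "int l - int j = - m" using j by simp
    finally have e: "ec l j (- (p * cnj p)) (of_real (x $ 3)) (- 1) = (- cnj p) powi (- m) * he l j (cv x)" .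
    have rr: "(cmod p / r) powi m * r powi (m - int l) = cmod p powi m / r ^ l"
      using r by (simp add: power_int_divide_distrib power_int_diff)
    have ex: "exp (- \<i> * of_int m * of_real (Arg p)) = exp (- \<i> * of_real (Arg p)) powi m"
      by (simp add: exp_power_int mult_ac)
    have "cnj p = of_real (cmod p) * exp (- \<i> * of_real (Arg p))"
    proof -
      have "cnj p = cnj (of_real (cmod p) * exp (\<i> * of_real (Arg p)))" using Arg_eq[OF False] by simp
      then show ?thesis by (simp add: exp_cnj)
    qed
    then have "of_real (cmod p powi m) * exp (- \<i> * of_int m * of_real (Arg p)) = cnj p powi m"
      unfolding ex by (simp add: power_int_mult_distrib)
    then have "of_real (cmod p powi m / r ^ l) * exp (- \<i> * of_int m * of_real (Arg p)) = cnj p powi m / of_real r ^ l"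
      by (simp add: field_simps)
    note P = this
    have Q: "cnj p powi m * (- cnj p) powi (- m) = (- 1) powi m"
    proof -
      have 1: "(- cnj p) powi (- m) = (- 1) powi m * inverse (cnj p powi m)"
        using power_int_mult_distrib[of "- 1" "cnj p" "- m"]
        by (simp only: power_int_minus_one_minus power_int_minus[of "cnj p"] mult_minus1)
      have "a * (b * inverse a) = b" if "a \<noteq> 0" for a b :: complex using that by simp
      from this[of "cnj p powi m"] show ?thesis unfolding 1 using c by simp
    qed
    have gen: "A * (u * (q * h)) = u * s / R * h" if "A = P / R" "P * q = s" for A P R q s u h :: complex
      unfolding that(1) that(2)[symmetric] by simp
    have "of_real ((cmod p / r) powi m * r powi (m - int l)) * exp (- \<i> * of_int m * of_real (Arg p))
      * ((- 1) ^ l * ec l j (- (p * cnj p)) (of_real (x $ 3)) (- 1)) = (- 1) ^ l * (- 1) powi m / of_real r ^ l * he l j (cv x)"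
      unfolding rr e by (rule gen[OF P Q])
    moreover have "(- 1) ^ l * (- 1) powi m = (- 1 :: complex) ^ j"
      using power_int_add[of "- 1 :: complex" "int l" m] by (simp flip: j)
    ultimately show ?thesis by simp
  qed
  have s: "((- 1) ^ j * (- 1) ^ j :: complex) = 1" by (simp flip: power_mult_distrib)
  have "of_real (legendreP l m (x $ 3 / r)) * exp (- \<i> * of_int m * of_real (Arg p))
      = of_real (fact j / (2 ^ l * fact l)) * ((- 1) ^ j * (of_real ((cmod p / r) powi m * r powi (m - int l)) * exp (- \<i> * of_int m * of_real (Arg p))
      * of_real (ec l j ((cmod p)\<^sup>2) (- (x $ 3)) 1)))"
    unfolding L by (simp add: mult_ac)
  also have "\<dots> = of_real (fact j / (2 ^ l * fact l)) * ((- 1) ^ j * ((- 1) ^ j * (1 / of_real r ^ l * he l j (cv x))))"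
    unfolding E main ..
  also have "\<dots> = of_real (fact j / (2 ^ l * fact l)) * (1 / of_real r ^ l * he l j (cv x))"
    by (simp only: mult.assoc[symmetric] s) (simp add: s mult.assoc[symmetric])
  finally show ?thesis by (simp only: r_def p_def j_def)
qed

section \<open>The two realizations\<close>

text \<open>The action is reindexed by \<open>so33C\<close>, the Lie algebra shared with the
  realization on \<open>Xi\<close>.\<close>

interpretation M: cone_realization mink_plus tauM "\<lambda>X. dpi_l (sigma_inv X)"
proof
  have "mink (0, axis 1 1) \<in> mink_plus" by (simp add: mink_plus_iff)
  then show "mink_plus \<noteq> {}" by blast
next
  fix Y assume Y: "Y \<in> mink_plus"
  then have "rho Y \<noteq> 0" using rho_dom_nonzero mink_plus_rho_dom by blast
  then show "snd (tauM Y) \<noteq> 0 \<and> bl (vx (fst (tauM Y))) (vx (fst (tauM Y))) = (snd (tauM Y))\<^sup>2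
      \<and> bl (vy (fst (tauM Y))) (vy (fst (tauM Y))) = (snd (tauM Y))\<^sup>2"
    by (simp add: tauM_def rho_square) (simp add: plk1_def plk_relation)
next
  fix X e assume "X \<in> so33C" "homog (- 1) e"
  then show "dpi_l (sigma_inv X) (\<lambda>p. if p \<in> mink_plus then ev e (fst (tauM p)) (snd (tauM p)) else 0)
      = (\<lambda>p. if p \<in> mink_plus then ev (der X e) (fst (tauM p)) (snd (tauM p)) else 0)"
    unfolding tauM_def fst_conv snd_conv
    using dpi_l_evM[of e "sigma_inv X"] by (simp only: sigma_sigma_inv evM_def[abs_def])
qed

lemma inj_mink: "inj mink"
proof (rule injI)
  fix p q assume "mink p = mink q"
  moreover obtain t x t' x' where pq: "p = (t, x)" "q = (t', x')" by fastforce
  ultimately have e: "mink (t, x) = mink (t', x')" by simp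
  have "cv x = cv x'" using vx_mink[of t x] vx_mink[of t' x'] e by simp
  then have "x = x'" by (simp add: vec_eq_iff cv_def)
  moreover have "t = t'"
    using arg_cong[OF e, of "\<lambda>Y. vy (plk1 Y) $ 3"] unfolding vy_mink by simp
  ultimately show "p = q" using pq by simp
qed

lemma mink_fn_b:
  assumes "s = 1 \<or> s = - 1" "- int l \<le> m" "m \<le> int l" "n \<le> l"
  shows "\<exists>K. K \<noteq> 0 \<and> mink_fn s l m n = fscale K (M.b l (nat (int l + m)) (rad_index s l n))"
proof -
  define k1 where "k1 = sqrt ((2 * real l + 1) * fact (l - n) / fact (l + n))"
  define k2 where "k2 = (- 1) ^ (l + n) / (2 ^ l * fact l) * fact (l + n) * (if s = 1 then (- 1) ^ (l + n) else (- 1) ^ l :: real)"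
  define k3 where "k3 = (- \<i>) powi m * of_real (sqrt (fact (nat (int l - m)) / fact (nat (int l + m))))"
  define k4 :: real where "k4 = fact (nat (int l + m)) / (2 ^ l * fact l)"
  define K where "K = of_real k1 * of_real k2 * k3 * of_real k4"
  have "K \<noteq> 0" by (simp add: K_def k1_def k2_def k3_def k4_def)
  moreover have "mink_fn s l m n Y = fscale K (M.b l (nat (int l + m)) (rad_index s l n)) Y" for Y
  proof (cases "Y \<in> mink_plus")
    case False
    then show ?thesis by (simp add: mink_fn_def fscale_apply M.b_outside)
  next
    case True
    then obtain t x where Y: "Y = mink (t, x)" and tx: "t\<^sup>2 < (norm x)\<^sup>2" "x \<noteq> 0" by (rule mink_plusE)
    define r where "r = norm x"
    have r: "0 < r" using tx by (simp add: r_def)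
    have iv: "inv mink Y = (t, x)" unfolding Y by (rule inv_f_f[OF inj_mink])
    have "\<bar>x $ 3 / r\<bar> \<le> 1" using component_le_norm_cart[of x 3] r by (simp add: r_def)
    then have ca: "cos (arccos (x $ 3 / r)) = x $ 3 / r" by (intro cos_arccos_abs)
    have R: "(r\<^sup>2 - t\<^sup>2) powr (s * real n / 2) * legendreP l (int n) (t / r)
        = k2 * (1 / r ^ l * ec l (rad_index s l n) 1 t (r\<^sup>2 - t\<^sup>2))"
      unfolding k2_def by (rule radial_part[OF r _ assms(4,1)]) (use tx in \<open>simp add: r_def\<close>)
    have S: "of_real (legendreP l m (x $ 3 / r)) * exp (- \<i> * of_int m * of_real (Arg (Complex (x $ 1) (x $ 2))))
        = of_real k4 * (1 / of_real r ^ l * he l (nat (int l + m)) (cv x))"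
      unfolding k4_def r_def by (rule spherical_part[OF tx(2) assms(2,3)])
    have hv: "he l k (vy (plk1 Y)) = of_real (ec l k 1 t (r\<^sup>2 - t\<^sup>2))" for k
    proof -
      let ?y = "vy (plk1 Y)"
      have "?y $ 1 + \<i> * ?y $ 2 = of_real 1" "?y $ 3 = of_real t" "?y $ 1 - \<i> * ?y $ 2 = of_real (r\<^sup>2 - t\<^sup>2)"
        unfolding Y vy_mink r_def by (simp_all add: field_simps)
      then show ?thesis by (simp only: he_ec ec_of_real)
    qed
    have "mink_fn s l m n Y = of_real (k1 * (1 / r) * ((r\<^sup>2 - t\<^sup>2) powr (s * real n / 2) * legendreP l (int n) (t / r)))
        * (k3 * (of_real (legendreP l m (x $ 3 / r)) * exp (- \<i> * of_int m * of_real (Arg (Complex (x $ 1) (x $ 2))))))"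
      using True by (simp add: mink_fn_def iv Let_def sph_harm_def ca r_def[symmetric] k1_def k3_def mult_ac)
    also have "\<dots> = of_real (k1 * (1 / r) * (k2 * (1 / r ^ l * ec l (rad_index s l n) 1 t (r\<^sup>2 - t\<^sup>2))))
        * (k3 * (of_real k4 * (1 / of_real r ^ l * he l (nat (int l + m)) (cv x))))"
      unfolding R S ..
    also have "\<dots> = K * (he l (nat (int l + m)) (cv x) * of_real (ec l (rad_index s l n) 1 t (r\<^sup>2 - t\<^sup>2)) / of_real r ^ (2 * l + 1))"
      using r by (simp only: K_def mult_2 power_add of_real_mult of_real_divide of_real_1 of_real_power) (simp add: mult_ac)
    also have "\<dots> = K * M.b l (nat (int l + m)) (rad_index s l n) Y"
      unfolding M.b_apply[OF True] by (simp add: tauM_def hv) (simp add: Y vx_mink rho_mink r_def)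
    finally show ?thesis by (simp only: fscale_apply)
  qed
  ultimately show ?thesis by blast
qed

text \<open>Up to nonzero factors the spanning families coincide: j = l + m, and the signs -1 and 1
  cover the indices k \<le> l and k \<ge> l. Functions \<open>b l j k\<close> with j or k above 2 l
  are zero.\<close>

lemma D0M_eq_U: "D0M = M.U"
proof
  show "D0M \<subseteq> M.U"
    unfolding D0M_def
  proof (rule fn.span_minimal[OF subsetI M.subspace_U])
    fix f assume "f \<in> {mink_fn s l m n | s l m n. (s = 1 \<or> s = - 1) \<and> - int l \<le> m \<and> m \<le> int l \<and> n \<le> l}"
    then obtain s l m n where f: "f = mink_fn s l m n" "s = 1 \<or> s = - 1" "- int l \<le> m" "m \<le> int l" "n \<le> l" by blast
    from mink_fn_b[OF f(2-5)] f(1) obtain K where "f = fscale K (M.b l (nat (int l + m)) (rad_index s l n))" by blast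
    then show "f \<in> M.U" by (simp only: fn.subspace_scale[OF M.subspace_U M.b_in_U])
  qed
  show "M.U \<subseteq> D0M"
    unfolding M.U_def
  proof (rule fn.span_minimal)
    show "fn.subspace D0M" by (simp add: D0M_def)
    show "range (\<lambda>(l, j, k). M.b l j k) \<subseteq> D0M"
    proof (rule image_subsetI, clarify)
      fix l j k
      show "M.b l j k \<in> D0M"
      proof (cases "2 * l < j \<or> 2 * l < k")
        case True
        show ?thesis unfolding M.b_eq_0[OF True] D0M_def by (rule fn.span_zero)
      next
        case False
        define s n where "s = (if k \<le> l then - 1 else 1 :: real)" and "n = (if k \<le> l then l - k else k - l)"
        have c: "s = 1 \<or> s = - 1" "- int l \<le> int j - int l" "int j - int l \<le> int l" "n \<le> l"
          using False by (auto simp: s_def n_def)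
        have "rad_index s l n = k" using False by (auto simp: rad_index_def s_def n_def)
        with mink_fn_b[OF c] obtain K where K: "K \<noteq> 0" "mink_fn s l (int j - int l) n = fscale K (M.b l j k)" by auto
        have "M.b l j k = fscale (1 / K) (mink_fn s l (int j - int l) n)"
          unfolding K(2) M.fscale_fscale using K(1) by (simp add: fscale_def)
        moreover have "mink_fn s l (int j - int l) n \<in> D0M"
          unfolding D0M_def by (rule fn.span_base) (use c in blast)
        ultimately show ?thesis by (simp only: D0M_def fn.span_scale)
      qed
    qed
  qed
qed

section \<open>Any two realizations are isomorphic\<close>

lemma span_linear_image:
  assumes "\<And>f g. R (f + g) = R f + R g" "\<And>c f. R (fscale c f) = fscale c (R f)"
  shows "R ` fn.span B = fn.span (R ` B)"
proof
  have R0: "R 0 = 0" using assms(2)[of 0 0] by (simp only: fn.scale_zero_left)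
  show "R ` fn.span B \<subseteq> fn.span (R ` B)"
  proof (rule image_subsetI)
    fix f assume "f \<in> fn.span B"
    then show "R f \<in> fn.span (R ` B)"
    proof (induction rule: fn.span_induct_alt)
      case base
      show ?case unfolding R0 by (rule fn.span_zero)
    next
      case (step c f g)
      show ?case unfolding assms
        by (rule fn.span_add[OF fn.span_scale[OF fn.span_base[OF imageI[OF step(1)]]] step(2)])
    qed
  qed
  show "fn.span (R ` B) \<subseteq> R ` fn.span B"
  proof (rule fn.span_minimal)
    show "R ` B \<subseteq> R ` fn.span B" by (intro image_mono fn.span_superset)
    show "fn.subspace (R ` fn.span B)"
    proof (rule fn.subspaceI)
      show "0 \<in> R ` fn.span B" using fn.span_zero R0 by (metis imageI)
      show "x + y \<in> R ` fn.span B" if x: "x \<in> R ` fn.span B" and y: "y \<in> R ` fn.span B" for x y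
      proof -
        obtain f g where fg: "f \<in> fn.span B" "x = R f" "g \<in> fn.span B" "y = R g" using x y by blast
        show ?thesis unfolding fg assms(1)[symmetric] by (rule imageI[OF fn.span_add[OF fg(1,3)]])
      qed
      show "fscale c x \<in> R ` fn.span B" if "x \<in> R ` fn.span B" for c x
      proof -
        have "\<exists>f. f \<in> fn.span B \<and> x = R f" using that by blast
        then obtain f where f: "f \<in> fn.span B" "x = R f" by (elim exE conjE)
        show ?thesis unfolding f(2) assms(2)[symmetric] by (rule imageI[OF fn.span_scale[OF f(1)]])
      qed
    qed
  qed
qed

text \<open>A realization maps to a second one by restriction along an injection of index sets that is
  compatible with the operators; by irreducibility this is an isomorphism.\<close>

lemma restriction_iso:
  assumes A: "cone_realization D tau opr" and B: "cone_realization D' tau' opr'"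
    and \<iota>: "\<And>p. \<iota> p \<in> D' \<longleftrightarrow> p \<in> D" "\<And>p. tau' (\<iota> p) = tau p"
    and op: "\<And>X f. opr' X f \<circ> \<iota> = opr X (f \<circ> \<iota>)"
  shows "bij_betw (\<lambda>f. f \<circ> \<iota>) (cone_realization.U D' tau') (cone_realization.U D tau)"
proof -
  interpret A: cone_realization D tau opr by (rule A)
  interpret B: cone_realization D' tau' opr' by (rule B)
  let ?R = "\<lambda>f. f \<circ> \<iota>"
  have R: "?R (f + g) = ?R f + ?R g" "?R (fscale c f) = fscale c (?R f)" for f g c
    by (auto simp: fscale_def)
  have Rb: "?R (B.b l j k) = A.b l j k" for l j k
    by (rule ext) (simp add: B.b_def A.b_def B.evx_def A.evx_def \<iota>)
  have surj: "?R ` B.U = A.U"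
    unfolding B.U_def A.U_def span_linear_image[of ?R, OF R] image_image
    by (simp add: Rb split_beta)
  have R0: "?R 0 = 0" by (auto simp: fun_eq_iff)
  let ?K = "{f \<in> B.U. ?R f = 0}"
  have "fn.subspace ?K"
  proof (rule fn.subspaceI)
    show "0 \<in> ?K" using fn.subspace_0[OF B.subspace_U] R0 by simp
    show "f + g \<in> ?K" if "f \<in> ?K" "g \<in> ?K" for f g
    proof -
      have "f + g \<in> B.U" using that by (intro fn.subspace_add[OF B.subspace_U]) simp_all
      moreover have "?R (f + g) = 0" unfolding R using that by simp
      ultimately show ?thesis by blast
    qed
    show "fscale c f \<in> ?K" if "f \<in> ?K" for c f
    proof -
      have "fscale c f \<in> B.U" using that by (intro fn.subspace_scale[OF B.subspace_U]) simp
      moreover have "?R f = 0" using that by blast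
      then have "?R (fscale c f) = 0" by (simp only: R A.fscale_0)
      ultimately show ?thesis by blast
    qed
  qed
  moreover have "?K \<subseteq> B.U" by blast
  moreover have "opr' X f \<in> ?K" if "X \<in> so33C" "f \<in> ?K" for X f
  proof -
    have f: "f \<in> B.U" "?R f = 0" using that(2) by simp_all
    have "opr X 0 = 0" using A.opr_scale[OF that(1) fn.subspace_0[OF A.subspace_U], of 0] by (simp only: A.fscale_0)
    then have "?R (opr' X f) = 0" unfolding op f(2) .
    with B.opr_in_U[OF that(1) f(1)] show ?thesis by blast
  qed
  ultimately have "?K = {0} \<or> ?K = B.U"
    using B.irreducible_U unfolding irreducible_module_def by blast
  \<comment> \<open>The lowest function \<open>b 0 0 0\<close> is 1/\<rho>, whose restriction
    vanishes nowhere on \<open>D\<close>.\<close>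
  moreover have "?K \<noteq> B.U"
  proof
    assume "?K = B.U"
    then have "?R (B.b 0 0 0) = 0" using B.b_in_U[of 0 0 0] by blast
    then have z: "A.b 0 0 0 p = 0" for p unfolding Rb by (simp add: fun_eq_iff)
    obtain p where "p \<in> D" using A.D_ne by blast
    with z[of p] A.cone[OF this] show False by (simp add: A.b_apply he_0)
  qed
  ultimately have K: "?K = {0}" by blast
  have "inj_on ?R B.U"
  proof (rule inj_onI)
    fix f g assume fg: "f \<in> B.U" "g \<in> B.U" "?R f = ?R g"
    have "f - g \<in> B.U" using fg by (intro fn.subspace_diff[OF B.subspace_U])
    moreover have "?R (f - g) = 0" using fg(3) by (simp add: fun_eq_iff)
    ultimately have "f - g = 0" using K by blast
    then show "f = g" by simp
  qed
  with surj show ?thesis by (simp add: bij_betw_def)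
qed

lemma realizations_isomorphic:
  assumes A: "cone_realization D1 tau1 op1" and B: "cone_realization D2 tau2 op2"
  shows "\<exists>\<Phi>. bij_betw \<Phi> (cone_realization.U D1 tau1) (cone_realization.U D2 tau2) \<and>
     (\<forall>u\<in>cone_realization.U D1 tau1. \<forall>v\<in>cone_realization.U D1 tau1. \<Phi> (u + v) = \<Phi> u + \<Phi> v) \<and>
     (\<forall>c. \<forall>v\<in>cone_realization.U D1 tau1. \<Phi> (fscale c v) = fscale c (\<Phi> v)) \<and>
     (\<forall>X\<in>so33C. \<forall>v\<in>cone_realization.U D1 tau1. \<Phi> (op1 X v) = op2 X (\<Phi> v))"
proof -
  interpret A: cone_realization D1 tau1 op1 by (rule A)
  interpret B: cone_realization D2 tau2 op2 by (rule B)
  \<comment> \<open>The operator treats the two parts of the sum type separately, so both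
    restrictions intertwine by construction; the content lies in their injectivity.\<close>
  let ?op = "\<lambda>X f. case_sum (op1 X (f \<circ> Inl)) (op2 X (f \<circ> Inr))"
  have S: "cone_realization (Inl ` D1 \<union> Inr ` D2) (case_sum tau1 tau2) ?op"
  proof
    show "Inl ` D1 \<union> Inr ` D2 \<noteq> {}" using A.D_ne by blast
  next
    fix p assume "p \<in> Inl ` D1 \<union> Inr ` D2"
    then show "snd (case_sum tau1 tau2 p) \<noteq> 0
        \<and> bl (vx (fst (case_sum tau1 tau2 p))) (vx (fst (case_sum tau1 tau2 p))) = (snd (case_sum tau1 tau2 p))\<^sup>2
        \<and> bl (vy (fst (case_sum tau1 tau2 p))) (vy (fst (case_sum tau1 tau2 p))) = (snd (case_sum tau1 tau2 p))\<^sup>2"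
      using A.cone B.cone by fastforce
  next
    fix X e assume X: "X \<in> so33C" "homog (- 1) e"
    let ?f = "\<lambda>e p. if p \<in> Inl ` D1 \<union> Inr ` D2 then ev e (fst (case_sum tau1 tau2 p)) (snd (case_sum tau1 tau2 p)) else 0"
    have f: "?f e \<circ> Inl = A.evx e" "?f e \<circ> Inr = B.evx e" for e
      by (auto simp: A.evx_def B.evx_def)
    show "?op X (?f e) = ?f (der X e)"
    proof
      fix p show "?op X (?f e) p = ?f (der X e) p"
        unfolding f A.opr_evx[OF X] B.opr_evx[OF X]
        by (cases p) (auto simp: A.evx_def B.evx_def)
    qed
  qed
  interpret S: cone_realization "Inl ` D1 \<union> Inr ` D2" "case_sum tau1 tau2" ?op by (rule S)
  have L: "bij_betw (\<lambda>f. f \<circ> Inl) S.U A.U"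
    by (rule restriction_iso[OF A S]) auto
  have R: "bij_betw (\<lambda>f. f \<circ> Inr) S.U B.U"
    by (rule restriction_iso[OF B S]) auto
  define g where "g = inv_into S.U (\<lambda>f. f \<circ> Inl)"
  have g: "bij_betw g A.U S.U" unfolding g_def by (rule bij_betw_inv_into[OF L])
  have gU: "g u \<in> S.U" and gI: "g u \<circ> Inl = u" if "u \<in> A.U" for u
    using that bij_betwE[OF g] bij_betw_inv_into_right[OF L] by (auto simp: g_def)
  have gE: "g (f \<circ> Inl) = f" if "f \<in> S.U" for f
    unfolding g_def using bij_betw_inv_into_left[OF L that] by simp
  have g_add: "g (u + v) = g u + g v" if "u \<in> A.U" "v \<in> A.U" for u v
  proof -
    have "(g u + g v) \<circ> Inl = u + v" using gI[OF that(1)] gI[OF that(2)] by (auto simp: fun_eq_iff)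
    then show ?thesis using gE[OF fn.subspace_add[OF S.subspace_U gU[OF that(1)] gU[OF that(2)]]] by simp
  qed
  have g_scale: "g (fscale c u) = fscale c (g u)" if "u \<in> A.U" for c u
  proof -
    have "fscale c (g u) \<circ> Inl = fscale c u" using gI[OF that] by (auto simp: fun_eq_iff fscale_def)
    then show ?thesis using gE[OF fn.subspace_scale[OF S.subspace_U gU[OF that], of c]] by simp
  qed
  have g_op: "g (op1 X u) = ?op X (g u)" if "X \<in> so33C" "u \<in> A.U" for X u
  proof -
    have "?op X (g u) \<circ> Inl = op1 X u" unfolding gI[OF that(2)] by (auto simp: fun_eq_iff)
    then show ?thesis using gE[OF S.opr_in_U[OF that(1) gU[OF that(2)]]] by simp
  qed
  let ?\<Phi> = "\<lambda>u. g u \<circ> Inr"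
  have "bij_betw ?\<Phi> A.U B.U" using bij_betw_trans[OF g R] by (simp add: o_def)
  moreover have "?\<Phi> (u + v) = ?\<Phi> u + ?\<Phi> v" if "u \<in> A.U" "v \<in> A.U" for u v
    unfolding g_add[OF that] by (auto simp: fun_eq_iff)
  moreover have "?\<Phi> (fscale c u) = fscale c (?\<Phi> u)" if "u \<in> A.U" for c u
    unfolding g_scale[OF that] by (auto simp: fun_eq_iff fscale_def)
  moreover have "?\<Phi> (op1 X u) = op2 X (?\<Phi> u)" if "X \<in> so33C" "u \<in> A.U" for X u
    unfolding g_op[OF that] by (auto simp: fun_eq_iff)
  ultimately show ?thesis by (intro exI[of _ ?\<Phi>] conjI ballI allI)
qed

section \<open>Transport along the isomorphism of Lie algebras\<close>

lemma lie_module_pullback: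
  assumes iso: "lie_iso g h \<sigma>" and M: "lie_module h V \<rho>'"
    and \<rho>: "\<And>X v. X \<in> g \<Longrightarrow> v \<in> V \<Longrightarrow> \<rho> X v = \<rho>' (\<sigma> X) v"
    and g: "\<And>X Y. X \<in> g \<Longrightarrow> Y \<in> g \<Longrightarrow> X + Y \<in> g" "\<And>c X. X \<in> g \<Longrightarrow> mscale c X \<in> g"
      "\<And>X Y. X \<in> g \<Longrightarrow> Y \<in> g \<Longrightarrow> bracket X Y \<in> g"
  shows "lie_module g V \<rho>"
proof -
  have s: "\<sigma> X \<in> h" if "X \<in> g" for X using iso that unfolding lie_iso_def by (auto dest: bij_betwE)
  have i: "\<sigma> (X + Y) = \<sigma> X + \<sigma> Y" "\<sigma> (mscale c X) = mscale c (\<sigma> X)" "\<sigma> (bracket X Y) = bracket (\<sigma> X) (\<sigma> Y)"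
    if "X \<in> g" "Y \<in> g" for X Y c using iso that unfolding lie_iso_def by blast+
  have sub: "fn.subspace V" and mem: "\<And>X v. X \<in> h \<Longrightarrow> v \<in> V \<Longrightarrow> \<rho>' X v \<in> V"
    and add: "\<And>X u v. X \<in> h \<Longrightarrow> u \<in> V \<Longrightarrow> v \<in> V \<Longrightarrow> \<rho>' X (u + v) = \<rho>' X u + \<rho>' X v"
    and scl: "\<And>X c v. X \<in> h \<Longrightarrow> v \<in> V \<Longrightarrow> \<rho>' X (fscale c v) = fscale c (\<rho>' X v)"
    and addX: "\<And>X Y v. X \<in> h \<Longrightarrow> Y \<in> h \<Longrightarrow> v \<in> V \<Longrightarrow> \<rho>' (X + Y) v = \<rho>' X v + \<rho>' Y v"
    and sclX: "\<And>X c v. X \<in> h \<Longrightarrow> v \<in> V \<Longrightarrow> \<rho>' (mscale c X) v = fscale c (\<rho>' X v)"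
    and brX: "\<And>X Y v. X \<in> h \<Longrightarrow> Y \<in> h \<Longrightarrow> v \<in> V \<Longrightarrow> \<rho>' (bracket X Y) v = \<rho>' X (\<rho>' Y v) - \<rho>' Y (\<rho>' X v)"
    using M unfolding lie_module_def by simp_all
  show ?thesis
    unfolding lie_module_def
    by (intro conjI ballI allI sub)
       (simp_all add: \<rho> g i s mem add scl addX sclX brX fn.subspace_add[OF sub] fn.subspace_scale[OF sub])
qed

lemma irreducible_module_pullback:
  assumes iso: "lie_iso g h \<sigma>" and M: "irreducible_module h V \<rho>'"
    and \<rho>: "\<And>X v. X \<in> g \<Longrightarrow> v \<in> V \<Longrightarrow> \<rho> X v = \<rho>' (\<sigma> X) v"
  shows "irreducible_module g V \<rho>"
  unfolding irreducible_module_def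
proof (intro conjI allI impI)
  show "V \<noteq> {0}" using M by (simp add: irreducible_module_def)
  fix W assume W: "fn.subspace W \<and> W \<subseteq> V \<and> (\<forall>X\<in>g. \<forall>w\<in>W. \<rho> X w \<in> W)"
  have im: "\<sigma> ` g = h" using iso by (simp add: lie_iso_def bij_betw_def)
  have "\<rho>' X w \<in> W" if X: "X \<in> h" and w: "w \<in> W" for X w
  proof -
    obtain X' where X': "X' \<in> g" "X = \<sigma> X'" using X im by blast
    have "w \<in> V" using W w by blast
    have "\<rho> X' w \<in> W" using W X'(1) w by blast
    then show ?thesis unfolding X'(2) \<rho>[OF X'(1) \<open>w \<in> V\<close>] .
  qed
  with M W show "W = {0} \<or> W = V" unfolding irreducible_module_def by blast
qed

theorem theorem73:
  shows "lie_module sl4 D0M dpi_l \<and>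
         lie_module so33C V33_HC do33C \<and>
         (\<exists>\<gamma> \<sigma> \<Phi>.
            invertible \<gamma> \<and>
            lie_iso sl4 so33C \<sigma> \<and>
            (\<lambda>X. \<sigma> (\<gamma> ** X ** matrix_inv \<gamma>)) ` sl2_HR = cmat ` so33 \<and>
            module_iso sl4 \<sigma> D0M dpi_l V33_HC do33C \<Phi>) \<and>
         irreducible_module sl4 D0M dpi_l"
proof (intro conjI)
  \<comment> \<open>Rewrites the operators of \<open>sl4\<close> as those of the realization
    \<open>M\<close>, which are indexed by \<open>so33C\<close>.\<close>
  have \<rho>: "dpi_l X v = dpi_l (sigma_inv (sigma X)) v" if "X \<in> sl4" for X v
    by (simp only: sigma_inv_sigma[OF that])
  show "lie_module sl4 D0M dpi_l"
    unfolding D0M_eq_U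
  proof (rule lie_module_pullback[OF lie_iso_sigma M.lie_module_U \<rho>])
    show "X + Y \<in> sl4" "mscale c X \<in> sl4" "bracket X Y \<in> sl4" if "X \<in> sl4" "Y \<in> sl4" for X Y c
      using that trace_mul_sym[of X Y]
      by (simp_all add: sl4_def trace_add bracket_def trace_sub, simp add: trace_def mscale_def flip: sum_distrib_left)
  qed
  show "lie_module so33C V33_HC do33C"
    unfolding V33_HC_eq_U by (rule Xr.lie_module_U)
  show "irreducible_module sl4 D0M dpi_l"
    unfolding D0M_eq_U by (rule irreducible_module_pullback[OF lie_iso_sigma M.irreducible_U \<rho>])
  obtain \<Phi> where \<Phi>: "bij_betw \<Phi> M.U Xr.U"
     "\<forall>u\<in>M.U. \<forall>v\<in>M.U. \<Phi> (u + v) = \<Phi> u + \<Phi> v" "\<forall>c. \<forall>v\<in>M.U. \<Phi> (fscale c v) = fscale c (\<Phi> v)"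
     "\<forall>X\<in>so33C. \<forall>v\<in>M.U. \<Phi> (dpi_l (sigma_inv X) v) = do33C X (\<Phi> v)"
    using realizations_isomorphic[OF M.cone_realization_axioms Xr.cone_realization_axioms] by (elim exE conjE) blast
  have "module_iso sl4 sigma D0M dpi_l V33_HC do33C \<Phi>"
    unfolding module_iso_def D0M_eq_U V33_HC_eq_U
  proof (intro conjI \<Phi>(1-3) ballI)
    fix X v assume X: "X \<in> sl4" and v: "v \<in> M.U"
    show "\<Phi> (dpi_l X v) = do33C (sigma X) (\<Phi> v)"
      using \<Phi>(4) sigma_so33C[OF X] v by (simp only: \<rho>[OF X])
  qed
  moreover have "invertible gamma" using gamma_transpose unfolding invertible_def by blast
  ultimately show "\<exists>\<gamma> \<sigma> \<Phi>. invertible \<gamma> \<and> lie_iso sl4 so33C \<sigma> \<and>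
            (\<lambda>X. \<sigma> (\<gamma> ** X ** matrix_inv \<gamma>)) ` sl2_HR = cmat ` so33 \<and>
            module_iso sl4 \<sigma> D0M dpi_l V33_HC do33C \<Phi>"
    using lie_iso_sigma sl2_HR_image by (intro exI[of _ gamma] exI[of _ sigma] exI[of _ \<Phi>] conjI)
qed

end
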